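(* Let $A$ and $B$ be finite-dimensional algebras over a field $k$ with $\mathrm{gl.dim}\, B<\infty$, and let $\Lambda=A\otimes_k B$. Then $$\mathrm{mon}(B,\ {}^{\perp}A)=\mathrm{mon}(B,A)\cap {}^{\perp}\Lambda .$$ Moreover, if $\mathrm{inj.dim}\,A_A<\infty$, then ${}^{\perp}\Lambda=\mathrm{mon}(B,\ {}^{\perp}A)$.
   Context: All modules are finitely generated, and are left modules unless otherwise stated; $A_A$ is $A$ regarded as a right module. For an algebra $R$ and a left $R$-module $N$, ${}^{\perp}N$ is the full subcategory of left $R$-modules $X$ with $\mathrm{Ext}^i_R(X,N)=0$ for all $i\ge 1$; in particular ${}^{\perp}A$ and ${}^{\perp}\Lambda$ are taken with respect to the left regular modules ${}_AA$ and ${}_\Lambda\Lambda$. Monic modules over $\Lambda=A\otimes_k B$: a left $\Lambda$-module $X$ is monic if $\mathrm{Tor}^{\Lambda}_i(A\otimes_k V,X)=0$ for all $i\ge 1$ and all right $B$-modules $V$ (here $A\otimes_k V$ is regarded as an $A$-$\Lambda$-bimodule). $\mathrm{mon}(B,A)$ is the full subcategory of $\Lambda$-mod of monic modules. For an additive full subcategory $\mathscr C$ of $A$-mod, $\mathrm{mon}(B,\mathscr C)$ is the full subcategory of those $X\in\mathrm{mon}(B,A)$ such that $(A\otimes_k V)\otimes_\Lambda X\in\mathscr C$ for all right $B$-modules $V$. *)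

theory Defs
  imports
    "HOL-Algebra.Module"
    "HOL-Algebra.AbelCoset"
    "HOL-Algebra.Free_Abelian_Groups"
    "HOL-Algebra.Elementary_Groups"
    "HOL-Library.Extended_Nat"
begin

text \<open>
  An algebra over k is a record of type \<open>('k, 'r) module\<close>: its \<open>mult\<close> and \<open>one\<close> fields are the ring
  structure and \<open>smult\<close> is the scalar multiplication by k. A module over a ring on type \<open>'r\<close> is a
  record of type \<open>('r, 'm) module\<close>, whose \<open>mult\<close> and \<open>one\<close> fields carry no meaning.
  The library locale of modules requires a commutative base ring, hence \<open>left_module\<close> below.
\<close>

section \<open>Modules over a not necessarily commutative ring\<close>

locale left_module = R?: ring R + M?: abelian_group M
  for R (structure) and M (structure) +
  assumes smult_closed:
      "\<lbrakk>r \<in> carrier R; x \<in> carrier M\<rbrakk> \<Longrightarrow> r \<odot>\<^bsub>M\<^esub> x \<in> carrier M"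
    and smult_l_distr:
      "\<lbrakk>r \<in> carrier R; s \<in> carrier R; x \<in> carrier M\<rbrakk> \<Longrightarrow>
        (r \<oplus> s) \<odot>\<^bsub>M\<^esub> x = r \<odot>\<^bsub>M\<^esub> x \<oplus>\<^bsub>M\<^esub> s \<odot>\<^bsub>M\<^esub> x"
    and smult_r_distr:
      "\<lbrakk>r \<in> carrier R; x \<in> carrier M; y \<in> carrier M\<rbrakk> \<Longrightarrow>
        r \<odot>\<^bsub>M\<^esub> (x \<oplus>\<^bsub>M\<^esub> y) = r \<odot>\<^bsub>M\<^esub> x \<oplus>\<^bsub>M\<^esub> r \<odot>\<^bsub>M\<^esub> y"
    and smult_assoc:
      "\<lbrakk>r \<in> carrier R; s \<in> carrier R; x \<in> carrier M\<rbrakk> \<Longrightarrow>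
        (r \<otimes> s) \<odot>\<^bsub>M\<^esub> x = r \<odot>\<^bsub>M\<^esub> (s \<odot>\<^bsub>M\<^esub> x)"
    and smult_one: "x \<in> carrier M \<Longrightarrow> \<one> \<odot>\<^bsub>M\<^esub> x = x"

definition fin_gen :: "('r, 'c) ring_scheme \<Rightarrow> ('r, 'm, 'd) module_scheme \<Rightarrow> bool" where
  "fin_gen R M \<longleftrightarrow> (\<exists>S. finite S \<and> S \<subseteq> carrier M \<and>
     (\<forall>x \<in> carrier M. \<exists>c \<in> S \<rightarrow> carrier R. x = (\<Oplus>\<^bsub>M\<^esub>s\<in>S. c s \<odot>\<^bsub>M\<^esub> s)))"

definition fg_left_module :: "('r, 'c) ring_scheme \<Rightarrow> ('r, 'm, 'd) module_scheme \<Rightarrow> bool" where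
  "fg_left_module R M \<longleftrightarrow> left_module R M \<and> fin_gen R M"

definition opp :: "('r, 'c) ring_scheme \<Rightarrow> ('r, 'c) ring_scheme" where
  "opp R = R\<lparr>mult := \<lambda>x y. y \<otimes>\<^bsub>R\<^esub> x\<rparr>"

text \<open>In a right module, \<open>r \<odot> x\<close> stands for the product of x by r on the right.\<close>

abbreviation fg_right_module :: "('r, 'c) ring_scheme \<Rightarrow> ('r, 'm, 'd) module_scheme \<Rightarrow> bool" where
  "fg_right_module R M \<equiv> fg_left_module (opp R) M"

text \<open>\<open>regular R\<close> is the left regular module; the right regular module is \<open>regular (opp R)\<close>.\<close>

definition regular :: "('r, 'c) ring_scheme \<Rightarrow> ('r, 'r) module" where
  "regular R = \<lparr>carrier = carrier R, mult = mult R, one = \<one>\<^bsub>R\<^esub>,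
     ring.zero = \<zero>\<^bsub>R\<^esub>, add = add R, smult = mult R\<rparr>"

definition lmod_hom ::
  "('r, 'c) ring_scheme \<Rightarrow> ('r, 'm, 'd) module_scheme \<Rightarrow> ('r, 'n, 'e) module_scheme \<Rightarrow> ('m \<Rightarrow> 'n) set"
  where "lmod_hom R M N = {f \<in> carrier M \<rightarrow> carrier N.
     (\<forall>x \<in> carrier M. \<forall>y \<in> carrier M. f (x \<oplus>\<^bsub>M\<^esub> y) = f x \<oplus>\<^bsub>N\<^esub> f y) \<and>
     (\<forall>r \<in> carrier R. \<forall>x \<in> carrier M. f (r \<odot>\<^bsub>M\<^esub> x) = r \<odot>\<^bsub>N\<^esub> f x)}"

locale fd_algebra = field k + ring A + Module.module k A for k and A (structure) +
  assumes scalar_mult_left: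
      "\<lbrakk>c \<in> carrier k; x \<in> carrier A; y \<in> carrier A\<rbrakk> \<Longrightarrow> (c \<odot> x) \<otimes> y = c \<odot> (x \<otimes> y)"
    and scalar_mult_right:
      "\<lbrakk>c \<in> carrier k; x \<in> carrier A; y \<in> carrier A\<rbrakk> \<Longrightarrow> x \<otimes> (c \<odot> y) = c \<odot> (x \<otimes> y)"
    and finite_dimensional: "fin_gen k A"

section \<open>Projective and injective modules, resolutions, dimensions\<close>

text \<open>
  A finitely generated module over a finite-dimensional k-algebra is finite-dimensional over k, so it
  is isomorphic to a module whose carrier is a set of functions \<open>nat \<Rightarrow> 'k\<close> (a copy of some power of k).
  Quantification over all finitely generated modules is therefore quantification over modules with
  carrier in the type \<open>'k univ\<close>.
\<close>

type_synonym 'k univ = "nat \<Rightarrow> 'k"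

definition projective :: "('k, 'r) module \<Rightarrow> ('r, 'm) module \<Rightarrow> bool" where
  "projective R P \<longleftrightarrow> fg_left_module R P \<and>
     (\<forall>(M :: ('r, 'k univ) module) (N :: ('r, 'k univ) module) g f.
        fg_left_module R M \<and> fg_left_module R N \<and>
        g \<in> lmod_hom R M N \<and> g ` carrier M = carrier N \<and> f \<in> lmod_hom R P N \<longrightarrow>
        (\<exists>h \<in> lmod_hom R P M. \<forall>x \<in> carrier P. g (h x) = f x))"

definition injective :: "('k, 'r) module \<Rightarrow> ('r, 'm) module \<Rightarrow> bool" where
  "injective R I \<longleftrightarrow> fg_left_module R I \<and>
     (\<forall>(M :: ('r, 'k univ) module) (N :: ('r, 'k univ) module) g f.
        fg_left_module R M \<and> fg_left_module R N \<and>
        g \<in> lmod_hom R M N \<and> inj_on g (carrier M) \<and> f \<in> lmod_hom R M I \<longrightarrow>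
        (\<exists>h \<in> lmod_hom R N I. \<forall>x \<in> carrier M. h (g x) = f x))"

text \<open>The differentials of a resolution P go from \<open>P (Suc i)\<close> to \<open>P i\<close>, those of a coresolution J
  from \<open>J i\<close> to \<open>J (Suc i)\<close>; e is the augmentation.\<close>

definition projective_resolution ::
  "('k, 'r) module \<Rightarrow> ('r, 'x) module \<Rightarrow> (nat \<Rightarrow> ('r, 'k univ) module) \<Rightarrow>
   (nat \<Rightarrow> 'k univ \<Rightarrow> 'k univ) \<Rightarrow> ('k univ \<Rightarrow> 'x) \<Rightarrow> bool" where
  "projective_resolution R X P d e \<longleftrightarrow>
     (\<forall>i. projective R (P i)) \<and>
     (\<forall>i. d i \<in> lmod_hom R (P (Suc i)) (P i)) \<and>
     e \<in> lmod_hom R (P 0) X \<and>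
     e ` carrier (P 0) = carrier X \<and>
     d 0 ` carrier (P 1) = a_kernel (P 0) X e \<and>
     (\<forall>i. d (Suc i) ` carrier (P (Suc (Suc i))) = a_kernel (P (Suc i)) (P i) (d i))"

definition injective_coresolution ::
  "('k, 'r) module \<Rightarrow> ('r, 'x) module \<Rightarrow> (nat \<Rightarrow> ('r, 'k univ) module) \<Rightarrow>
   (nat \<Rightarrow> 'k univ \<Rightarrow> 'k univ) \<Rightarrow> ('x \<Rightarrow> 'k univ) \<Rightarrow> bool" where
  "injective_coresolution R X J d e \<longleftrightarrow>
     (\<forall>i. injective R (J i)) \<and>
     (\<forall>i. d i \<in> lmod_hom R (J i) (J (Suc i))) \<and>
     e \<in> lmod_hom R X (J 0) \<and>
     inj_on e (carrier X) \<and>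
     e ` carrier X = a_kernel (J 0) (J 1) (d 0) \<and>
     (\<forall>i. d i ` carrier (J i) = a_kernel (J (Suc i)) (J (Suc (Suc i))) (d (Suc i)))"

definition proj_dim :: "('k, 'r) module \<Rightarrow> ('r, 'x) module \<Rightarrow> enat" where
  "proj_dim R X = Inf {enat n |n. \<exists>P d e. projective_resolution R X P d e \<and>
     (\<forall>i>n. carrier (P i) = {\<zero>\<^bsub>P i\<^esub>})}"

definition inj_dim :: "('k, 'r) module \<Rightarrow> ('r, 'x) module \<Rightarrow> enat" where
  "inj_dim R X = Inf {enat n |n. \<exists>J d e. injective_coresolution R X J d e \<and>
     (\<forall>i>n. carrier (J i) = {\<zero>\<^bsub>J i\<^esub>})}"

definition gl_dim :: "('k, 'r) module \<Rightarrow> enat" where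
  "gl_dim R = Sup {proj_dim R X |X :: ('r, 'k univ) module. fg_left_module R X}"

text \<open>Ext and Tor are computed from a fixed choice of projective resolution.\<close>

definition chosen_resolution :: "('k, 'r) module \<Rightarrow> ('r, 'x) module \<Rightarrow>
    (nat \<Rightarrow> ('r, 'k univ) module) \<times> (nat \<Rightarrow> 'k univ \<Rightarrow> 'k univ)" where
  "chosen_resolution R X = (SOME (P, d). \<exists>e. projective_resolution R X P d e)"

section \<open>Ext\<close>

definition Hom_group ::
  "('r, 'c) ring_scheme \<Rightarrow> ('r, 'm, 'd) module_scheme \<Rightarrow> ('r, 'n, 'e) module_scheme \<Rightarrow> ('m \<Rightarrow> 'n) ring"
  where "Hom_group R M N = \<lparr>carrier = lmod_hom R M N \<inter> extensional (carrier M),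
     mult = undefined, one = undefined,
     ring.zero = (\<lambda>x\<in>carrier M. \<zero>\<^bsub>N\<^esub>),
     add = (\<lambda>f g. \<lambda>x\<in>carrier M. f x \<oplus>\<^bsub>N\<^esub> g x)\<rparr>"

definition Ext :: "('k, 'r) module \<Rightarrow> ('r, 'x) module \<Rightarrow> ('r, 'n) module \<Rightarrow> nat
    \<Rightarrow> ('k univ \<Rightarrow> 'n) set monoid" where
  "Ext R X N i = (case chosen_resolution R X of (P, d) \<Rightarrow>
     let H = (\<lambda>j. Hom_group R (P j) N);
         \<delta> = (\<lambda>j f. compose (carrier (P (Suc j))) f (d j));
         Z = a_kernel (H i) (H (Suc i)) (\<delta> i);
         D = (case i of 0 \<Rightarrow> {\<zero>\<^bsub>H 0\<^esub>} | Suc j \<Rightarrow> \<delta> j ` carrier (H j))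
     in (H i)\<lparr>carrier := Z\<rparr> A_Mod D)"

definition perp :: "('k, 'r) module \<Rightarrow> ('r, 'n) module \<Rightarrow> ('r, 'x) module set" where
  "perp R N = {X. fg_left_module R X \<and> (\<forall>i\<ge>1. trivial_group (Ext R X N i))}"

section \<open>Tensor products\<close>

text \<open>For a right R-module M and a left R-module N, \<open>tensor R M N\<close> is the free abelian group on
  \<open>M \<times> N\<close> modulo the subgroup generated by the usual relations, written additively.\<close>

definition tensor_relations ::
  "('r, 'c) ring_scheme \<Rightarrow> ('r, 'm, 'd) module_scheme \<Rightarrow> ('r, 'n, 'e) module_scheme
    \<Rightarrow> ('m \<times> 'n \<Rightarrow>\<^sub>0 int) set" where
  "tensor_relations R M N = generate (free_Abelian_group (carrier M \<times> carrier N))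
     ({frag_of (x \<oplus>\<^bsub>M\<^esub> x', y) - frag_of (x, y) - frag_of (x', y) |x x' y.
         x \<in> carrier M \<and> x' \<in> carrier M \<and> y \<in> carrier N} \<union>
      {frag_of (x, y \<oplus>\<^bsub>N\<^esub> y') - frag_of (x, y) - frag_of (x, y') |x y y'.
         x \<in> carrier M \<and> y \<in> carrier N \<and> y' \<in> carrier N} \<union>
      {frag_of (r \<odot>\<^bsub>M\<^esub> x, y) - frag_of (x, r \<odot>\<^bsub>N\<^esub> y) |r x y.
         r \<in> carrier R \<and> x \<in> carrier M \<and> y \<in> carrier N})"

definition tensor ::
  "('r, 'c) ring_scheme \<Rightarrow> ('r, 'm, 'd) module_scheme \<Rightarrow> ('r, 'n, 'e) module_scheme
    \<Rightarrow> ('m \<times> 'n \<Rightarrow>\<^sub>0 int) set ring" where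
  "tensor R M N =
     (let T = free_Abelian_group (carrier M \<times> carrier N) Mod tensor_relations R M N
      in \<lparr>carrier = carrier T, mult = undefined, one = undefined, ring.zero = \<one>\<^bsub>T\<^esub>, add = mult T\<rparr>)"

definition pure ::
  "('r, 'c) ring_scheme \<Rightarrow> ('r, 'm, 'd) module_scheme \<Rightarrow> ('r, 'n, 'e) module_scheme
    \<Rightarrow> 'm \<Rightarrow> 'n \<Rightarrow> ('m \<times> 'n \<Rightarrow>\<^sub>0 int) set" where
  "pure R M N x y =
     tensor_relations R M N #>\<^bsub>free_Abelian_group (carrier M \<times> carrier N)\<^esub> frag_of (x, y)"

text \<open>The additive map from a tensor product to H induced by a balanced map \<open>\<beta>\<close>, evaluated at the
  coset C.\<close>

definition tensor_lift ::
  "('h, 'c) ring_scheme \<Rightarrow> ('m \<times> 'n \<Rightarrow> 'h) \<Rightarrow> ('m \<times> 'n \<Rightarrow>\<^sub>0 int) set \<Rightarrow> 'h" where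
  "tensor_lift H \<beta> C = (THE h. \<forall>c \<in> C.
     h = (\<Oplus>\<^bsub>H\<^esub>p \<in> Poly_Mapping.keys c. [Poly_Mapping.lookup c p] \<cdot>\<^bsub>H\<^esub> \<beta> p))"

definition tensor_algebra :: "'k ring \<Rightarrow> ('k, 'a) module \<Rightarrow> ('k, 'b) module
    \<Rightarrow> ('k, ('a \<times> 'b \<Rightarrow>\<^sub>0 int) set) module" where
  "tensor_algebra k A B = (let T = tensor k A B in
     \<lparr>carrier = carrier T,
      mult = (\<lambda>s t. tensor_lift T (\<lambda>(a, b).
                tensor_lift T (\<lambda>(a', b'). pure k A B (a \<otimes>\<^bsub>A\<^esub> a') (b \<otimes>\<^bsub>B\<^esub> b')) t) s),
      one = pure k A B \<one>\<^bsub>A\<^esub> \<one>\<^bsub>B\<^esub>,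
      ring.zero = \<zero>\<^bsub>T\<^esub>,
      add = add T,
      smult = (\<lambda>c. tensor_lift T (\<lambda>(a, b). pure k A B (c \<odot>\<^bsub>A\<^esub> a) b))\<rparr>)"

text \<open>The underlying k-space of a module over a k-algebra.\<close>

definition base_space :: "('k, 'r) module \<Rightarrow> ('r, 'm) module \<Rightarrow> ('k, 'm) module" where
  "base_space R M = \<lparr>carrier = carrier M, mult = mult M, one = \<one>\<^bsub>M\<^esub>,
     ring.zero = \<zero>\<^bsub>M\<^esub>, add = add M, smult = (\<lambda>c. smult M (c \<odot>\<^bsub>R\<^esub> \<one>\<^bsub>R\<^esub>))\<rparr>"

text \<open>In a bimodule, \<open>smult\<close> is the right action and \<open>lsmult\<close> is the left action.\<close>

record ('s, 'r, 'm) bimodule = "('r, 'm) module" +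
  lsmult :: "'s \<Rightarrow> 'm \<Rightarrow> 'm"

text \<open>\<open>A \<otimes>\<^sub>k V\<close> as a bimodule over A and \<open>A \<otimes>\<^sub>k B\<close>, for a right B-module V.\<close>

definition tensor_bimodule :: "'k ring \<Rightarrow> ('k, 'a) module \<Rightarrow> ('k, 'b) module \<Rightarrow> ('b, 'v) module
    \<Rightarrow> ('a, ('a \<times> 'b \<Rightarrow>\<^sub>0 int) set, ('a \<times> 'v \<Rightarrow>\<^sub>0 int) set) bimodule" where
  "tensor_bimodule k A B V =
     (let V' = base_space B V; T = tensor k A V' in
     \<lparr>carrier = carrier T, mult = undefined, one = undefined, ring.zero = \<zero>\<^bsub>T\<^esub>, add = add T,
      smult = (\<lambda>l w. tensor_lift T (\<lambda>(a, b).
                tensor_lift T (\<lambda>(a', v). pure k A V' (a' \<otimes>\<^bsub>A\<^esub> a) (b \<odot>\<^bsub>V\<^esub> v)) w) l),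
      lsmult = (\<lambda>a. tensor_lift T (\<lambda>(a', v). pure k A V' (a \<otimes>\<^bsub>A\<^esub> a') v))\<rparr>)"

text \<open>The left module \<open>W \<otimes>\<^sub>R X\<close> for a bimodule W with right action of R and a left R-module X.\<close>

definition bimodule_tensor :: "('r, 'c) ring_scheme \<Rightarrow> ('s, 'r, 'w) bimodule \<Rightarrow> ('r, 'x) module
    \<Rightarrow> ('s, ('w \<times> 'x \<Rightarrow>\<^sub>0 int) set) module" where
  "bimodule_tensor R W X = (let T = tensor R W X in
     \<lparr>carrier = carrier T, mult = undefined, one = undefined, ring.zero = \<zero>\<^bsub>T\<^esub>, add = add T,
      smult = (\<lambda>s. tensor_lift T (\<lambda>(w, x). pure R W X (lsmult W s w) x))\<rparr>)"

section \<open>Tor\<close>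

definition Tor :: "('k, 'r) module \<Rightarrow> ('r, 'w, 'd) module_scheme \<Rightarrow> ('r, 'x) module \<Rightarrow> nat
    \<Rightarrow> ('w \<times> 'k univ \<Rightarrow>\<^sub>0 int) set set monoid" where
  "Tor R W X i = (case chosen_resolution R X of (P, d) \<Rightarrow>
     let T = (\<lambda>j. tensor R W (P j));
         \<delta> = (\<lambda>j. tensor_lift (T j) (\<lambda>(w, p). pure R W (P j) w (d j p)));
         Z = (case i of 0 \<Rightarrow> carrier (T 0) | Suc j \<Rightarrow> a_kernel (T (Suc j)) (T j) (\<delta> j));
         D = \<delta> i ` carrier (T (Suc i))
     in (T i)\<lparr>carrier := Z\<rparr> A_Mod D)"

section \<open>Monic modules\<close>

definition mon :: "'k ring \<Rightarrow> ('k, 'b) module \<Rightarrow> ('k, 'a) module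
    \<Rightarrow> (('a \<times> 'b \<Rightarrow>\<^sub>0 int) set, 'x) module set" where
  "mon k B A = {X. fg_left_module (tensor_algebra k A B) X \<and>
     (\<forall>V :: ('b, 'k univ) module. fg_right_module B V \<longrightarrow>
        (\<forall>i\<ge>1. trivial_group (Tor (tensor_algebra k A B) (tensor_bimodule k A B V) X i)))}"

text \<open>A full subcategory C of A-modules enters through its members on the carrier type
  of \<open>(A \<otimes>\<^sub>k V) \<otimes>\<^sub>\<Lambda> X\<close>.\<close>

definition mon_in :: "'k ring \<Rightarrow> ('k, 'b) module \<Rightarrow> ('k, 'a) module
    \<Rightarrow> ('a, (('a \<times> 'k univ \<Rightarrow>\<^sub>0 int) set \<times> 'x \<Rightarrow>\<^sub>0 int) set) module set
    \<Rightarrow> (('a \<times> 'b \<Rightarrow>\<^sub>0 int) set, 'x) module set" where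
  "mon_in k B A C = {X \<in> mon k B A.
     \<forall>V :: ('b, 'k univ) module. fg_right_module B V \<longrightarrow>
       bimodule_tensor (tensor_algebra k A B) (tensor_bimodule k A B V) X \<in> C}"

end

theory Submission
  imports Defs
begin

text \<open>
  Let P be the chosen projective resolution of X over L, the tensor product of A and B. For a right
  B-module V with dual left module W there is a natural isomorphism
  Hom_A((A \<otimes> V) \<otimes> P, A) = Hom_L(P, A \<otimes> W). If X is monic then (A \<otimes> V) \<otimes> P is a projective
  resolution of (A \<otimes> V) \<otimes> X, so Ext_A((A \<otimes> V) \<otimes> X, A) = Ext_L(X, A \<otimes> W). Taking for V the dual of B,
  so that A \<otimes> W = L, gives one inclusion; for the other, W has a finite projective resolution, which
  A \<otimes> - turns into a resolution by summands of free L-modules, and dimension shifting gives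
  Ext_L(X, A \<otimes> W) = 0 for all W.

  For the second claim, X in the left perpendicular category of L makes the complex of right modules
  Hom_A((A \<otimes> V) \<otimes> P, A) exact in positive degrees. Dimension shifting along a finite injective
  coresolution of the right regular module shows that dualizing once more preserves exactness, and the
  double dual is (A \<otimes> V) \<otimes> P itself.
\<close>

section \<open>Additive maps and finite sums\<close>

text \<open>The definitions test projectivity and injectivity only against modules carried by
  \<open>'k univ\<close>, whereas A \<otimes> W and (A \<otimes> V) \<otimes> P live on types of
  cosets of formal sums. The bridge is finite-dimensionality: coordinates over k move any finitely
  generated module to \<open>'k univ\<close>, where the lifting property yields a finite dual basis,
  a notion that makes sense on every type and is preserved by all functors in use. Ext and Tor are
  attached to one chosen resolution, and (A \<otimes> V) \<otimes> P is not the one chosen for (A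
  \<otimes> V) \<otimes> X; hence the comparison of two resolutions up to homotopy.

  No long exact sequence is formed. Vanishing of Ext is expressed by elements, as the existence of
  bounding cochains, and each dimension shift is one diagram chase. The natural isomorphism of Hom
  groups rests on contracting W against V, which is why V and W enter through a pairing rather than
  as a module and its dual: in one use W is B and V has to be found, in the other V is
  given.\<close>

lemma abelian_group_cong:
  assumes "abelian_group G" "carrier H = carrier G" "add H = add G" "\<zero>\<^bsub>H\<^esub> = \<zero>\<^bsub>G\<^esub>"
  shows "abelian_group H"
proof -
  interpret G: abelian_group G by fact
  show ?thesis
    by (rule abelian_groupI) (auto simp: assms G.a_ac intro: G.a_inv_closed G.l_neg)
qed

text \<open>Most maps into or out of tensor products are additive before they are linear over
  anything, such as r |-> r x or x |-> x \<otimes> y; the two sides need not be modules over one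
  ring.\<close>

definition add_hom :: "('g, 'c) ring_scheme \<Rightarrow> ('h, 'd) ring_scheme \<Rightarrow> ('g \<Rightarrow> 'h) set" where
  "add_hom G H = {f \<in> carrier G \<rightarrow> carrier H.
     \<forall>x\<in>carrier G. \<forall>y\<in>carrier G. f (x \<oplus>\<^bsub>G\<^esub> y) = f x \<oplus>\<^bsub>H\<^esub> f y}"

lemma add_homI:
  "\<lbrakk>\<And>x. x \<in> carrier G \<Longrightarrow> f x \<in> carrier H;
    \<And>x y. \<lbrakk>x \<in> carrier G; y \<in> carrier G\<rbrakk> \<Longrightarrow> f (x \<oplus>\<^bsub>G\<^esub> y) = f x \<oplus>\<^bsub>H\<^esub> f y\<rbrakk> \<Longrightarrow> f \<in> add_hom G H"
  by (auto simp: add_hom_def)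

lemma add_hom_closed: "\<lbrakk>f \<in> add_hom G H; x \<in> carrier G\<rbrakk> \<Longrightarrow> f x \<in> carrier H"
  by (auto simp: add_hom_def)

lemma add_hom_add:
  "\<lbrakk>f \<in> add_hom G H; x \<in> carrier G; y \<in> carrier G\<rbrakk> \<Longrightarrow> f (x \<oplus>\<^bsub>G\<^esub> y) = f x \<oplus>\<^bsub>H\<^esub> f y"
  by (auto simp: add_hom_def)

lemma add_hom_zero:
  assumes "abelian_group G" "abelian_group H" "f \<in> add_hom G H"
  shows "f \<zero>\<^bsub>G\<^esub> = \<zero>\<^bsub>H\<^esub>"
proof -
  interpret G: abelian_group G by fact
  interpret H: abelian_group H by fact
  have "f \<zero>\<^bsub>G\<^esub> \<in> carrier H" "f \<zero>\<^bsub>G\<^esub> \<oplus>\<^bsub>H\<^esub> f \<zero>\<^bsub>G\<^esub> = f \<zero>\<^bsub>G\<^esub>"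
    using assms(3) add_hom_closed add_hom_add[OF assms(3), of "\<zero>\<^bsub>G\<^esub>" "\<zero>\<^bsub>G\<^esub>"] by fastforce+
  then show ?thesis by (metis H.add.l_cancel_one')
qed

lemma add_hom_minus:
  assumes "abelian_group G" "abelian_group H" "f \<in> add_hom G H" "x \<in> carrier G"
  shows "f (\<ominus>\<^bsub>G\<^esub> x) = \<ominus>\<^bsub>H\<^esub> f x"
proof -
  interpret G: abelian_group G by fact
  interpret H: abelian_group H by fact
  have "f (\<ominus>\<^bsub>G\<^esub> x) \<oplus>\<^bsub>H\<^esub> f x = \<zero>\<^bsub>H\<^esub>"
    using add_hom_add[OF assms(3), of "\<ominus>\<^bsub>G\<^esub> x" x] add_hom_zero[OF assms(1-3)] assms(4)
    by (simp add: G.l_neg)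
  then show ?thesis
    using add_hom_closed[OF assms(3)] assms(4) by (metis G.a_inv_closed H.minus_equality)
qed

lemma add_hom_diff:
  assumes "abelian_group G" "abelian_group H" "f \<in> add_hom G H" "x \<in> carrier G" "y \<in> carrier G"
  shows "f (x \<ominus>\<^bsub>G\<^esub> y) = f x \<ominus>\<^bsub>H\<^esub> f y"
proof -
  interpret G: abelian_group G by fact
  show ?thesis using assms by (simp add: a_minus_def add_hom_add add_hom_minus)
qed

text \<open>Unlike \<open>finsum\<close>, this sum unfolds without membership conditions.\<close>

primrec msum :: "('g, 'c) ring_scheme \<Rightarrow> (nat \<Rightarrow> 'g) \<Rightarrow> nat \<Rightarrow> 'g" where
  "msum G f 0 = \<zero>\<^bsub>G\<^esub>"
| "msum G f (Suc n) = msum G f n \<oplus>\<^bsub>G\<^esub> f n"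

lemma msum_cong: "(\<And>i. i < n \<Longrightarrow> f i = g i) \<Longrightarrow> msum G f n = msum G g n"
  by (induction n) auto

text \<open>Lets sums move between a module, its underlying k-space and the records of its
  submodules: only \<open>add\<close> and \<open>zero\<close> are read, and no carrier is
  consulted.\<close>

lemma msum_same_ops: "\<lbrakk>add H = add G; \<zero>\<^bsub>H\<^esub> = \<zero>\<^bsub>G\<^esub>\<rbrakk> \<Longrightarrow> msum H f n = msum G f n"
  by (induction n) auto

context abelian_group
begin

lemma msum_closed: "(\<And>i. i < n \<Longrightarrow> f i \<in> carrier G) \<Longrightarrow> msum G f n \<in> carrier G"
  by (induction n) auto

lemma msum_zero: "(\<And>i. i < n \<Longrightarrow> f i = \<zero>) \<Longrightarrow> msum G f n = \<zero>"
  by (induction n) auto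

lemma msum_add:
  "\<lbrakk>\<And>i. i < n \<Longrightarrow> f i \<in> carrier G; \<And>i. i < n \<Longrightarrow> g i \<in> carrier G\<rbrakk> \<Longrightarrow>
    msum G (\<lambda>i. f i \<oplus> g i) n = msum G f n \<oplus> msum G g n"
  by (induction n) (auto simp: a_ac msum_closed)

lemma msum_append:
  "(\<And>i. i < m + n \<Longrightarrow> f i \<in> carrier G) \<Longrightarrow>
    msum G f (m + n) = msum G f m \<oplus> msum G (\<lambda>i. f (m + i)) n"
  by (induction n) (auto simp: a_ac msum_closed)

text \<open>The pair (i, j) is stored as l = i * n + j. A dual basis indexed by pairs is brought to
  the single index of \<open>dual_basis\<close> in this way.\<close>

lemma msum_double:
  "(\<And>i j. \<lbrakk>i < m; j < n\<rbrakk> \<Longrightarrow> f i j \<in> carrier G) \<Longrightarrow>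
    msum G (\<lambda>i. msum G (f i) n) m = msum G (\<lambda>l. f (l div n) (l mod n)) (m * n)"
proof (induction m)
  case (Suc m)
  have lt: "l div n < Suc m \<and> l mod n < n" if "l < m * n + n" for l
    using that by (cases "n = 0") (auto simp: div_less_iff_less_mult)
  have "msum G (\<lambda>l. f (l div n) (l mod n)) (m * n + n) =
     msum G (\<lambda>l. f (l div n) (l mod n)) (m * n) \<oplus> msum G (\<lambda>l. f ((m * n + l) div n) ((m * n + l) mod n)) n"
    by (rule msum_append) (use lt Suc.prems in auto)
  moreover have "msum G (\<lambda>l. f ((m * n + l) div n) ((m * n + l) mod n)) n = msum G (f m) n"
    by (rule msum_cong) auto
  ultimately show ?case using Suc by (simp add: add.commute)
qed simp

end

lemma add_hom_of_msum:
  assumes "abelian_group G" "abelian_group H" "f \<in> add_hom G H" "\<And>i. i < n \<Longrightarrow> x i \<in> carrier G"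
  shows "f (msum G x n) = msum H (\<lambda>i. f (x i)) n"
  using assms(4)
proof (induction n)
  case 0
  then show ?case using add_hom_zero[OF assms(1-3)] by simp
next
  case (Suc n)
  interpret G: abelian_group G by fact
  have "msum G x n \<in> carrier G" using Suc.prems by (intro G.msum_closed) auto
  then show ?case using Suc add_hom_add[OF assms(3)] by simp
qed

section \<open>Modules and homomorphisms\<close>

lemma left_moduleI:
  assumes "ring R" "abelian_group M"
    "\<And>r x. \<lbrakk>r \<in> carrier R; x \<in> carrier M\<rbrakk> \<Longrightarrow> r \<odot>\<^bsub>M\<^esub> x \<in> carrier M"
    "\<And>r s x. \<lbrakk>r \<in> carrier R; s \<in> carrier R; x \<in> carrier M\<rbrakk> \<Longrightarrow>
      (r \<oplus>\<^bsub>R\<^esub> s) \<odot>\<^bsub>M\<^esub> x = r \<odot>\<^bsub>M\<^esub> x \<oplus>\<^bsub>M\<^esub> s \<odot>\<^bsub>M\<^esub> x"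
    "\<And>r x y. \<lbrakk>r \<in> carrier R; x \<in> carrier M; y \<in> carrier M\<rbrakk> \<Longrightarrow>
      r \<odot>\<^bsub>M\<^esub> (x \<oplus>\<^bsub>M\<^esub> y) = r \<odot>\<^bsub>M\<^esub> x \<oplus>\<^bsub>M\<^esub> r \<odot>\<^bsub>M\<^esub> y"
    "\<And>r s x. \<lbrakk>r \<in> carrier R; s \<in> carrier R; x \<in> carrier M\<rbrakk> \<Longrightarrow>
      (r \<otimes>\<^bsub>R\<^esub> s) \<odot>\<^bsub>M\<^esub> x = r \<odot>\<^bsub>M\<^esub> (s \<odot>\<^bsub>M\<^esub> x)"
    "\<And>x. x \<in> carrier M \<Longrightarrow> \<one>\<^bsub>R\<^esub> \<odot>\<^bsub>M\<^esub> x = x"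
  shows "left_module R M"
  using assms by (auto simp: left_module_def left_module_axioms_def)

lemma left_module_ring: "left_module R M \<Longrightarrow> ring R"
  and left_module_abelian_group: "left_module R M \<Longrightarrow> abelian_group M"
  by (auto simp: left_module_def)

lemma regular_simps [simp]:
  "carrier (regular R) = carrier R" "add (regular R) = add R" "\<zero>\<^bsub>regular R\<^esub> = \<zero>\<^bsub>R\<^esub>"
  "smult (regular R) = mult R"
  by (simp_all add: regular_def)

lemma left_module_regular: "ring R \<Longrightarrow> left_module R (regular R)"
proof -
  assume "ring R"
  then interpret ring R .
  show ?thesis
    by (rule left_moduleI)
      (auto simp: l_distr r_distr m_assoc intro: abelian_group_cong[OF abelian_group_axioms]
        ring_axioms)
qed

lemma lmod_homI:
  "\<lbrakk>\<And>x. x \<in> carrier M \<Longrightarrow> f x \<in> carrier N;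
    \<And>x y. \<lbrakk>x \<in> carrier M; y \<in> carrier M\<rbrakk> \<Longrightarrow> f (x \<oplus>\<^bsub>M\<^esub> y) = f x \<oplus>\<^bsub>N\<^esub> f y;
    \<And>r x. \<lbrakk>r \<in> carrier R; x \<in> carrier M\<rbrakk> \<Longrightarrow> f (r \<odot>\<^bsub>M\<^esub> x) = r \<odot>\<^bsub>N\<^esub> f x\<rbrakk> \<Longrightarrow> f \<in> lmod_hom R M N"
  by (auto simp: lmod_hom_def)

lemma lmod_hom_closed: "\<lbrakk>f \<in> lmod_hom R M N; x \<in> carrier M\<rbrakk> \<Longrightarrow> f x \<in> carrier N"
  and lmod_hom_add:
    "\<lbrakk>f \<in> lmod_hom R M N; x \<in> carrier M; y \<in> carrier M\<rbrakk> \<Longrightarrow> f (x \<oplus>\<^bsub>M\<^esub> y) = f x \<oplus>\<^bsub>N\<^esub> f y"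
  and lmod_hom_smult:
    "\<lbrakk>f \<in> lmod_hom R M N; r \<in> carrier R; x \<in> carrier M\<rbrakk> \<Longrightarrow> f (r \<odot>\<^bsub>M\<^esub> x) = r \<odot>\<^bsub>N\<^esub> f x"
  by (auto simp: lmod_hom_def)

lemma lmod_hom_add_hom: "f \<in> lmod_hom R M N \<Longrightarrow> f \<in> add_hom M N"
  by (auto simp: lmod_hom_def add_hom_def)

lemma lmod_hom_zero:
  "\<lbrakk>left_module R M; left_module R N; f \<in> lmod_hom R M N\<rbrakk> \<Longrightarrow> f \<zero>\<^bsub>M\<^esub> = \<zero>\<^bsub>N\<^esub>"
  by (meson add_hom_zero left_module_abelian_group lmod_hom_add_hom)

lemma lmod_hom_diff:
  "\<lbrakk>left_module R M; left_module R N; f \<in> lmod_hom R M N; x \<in> carrier M; y \<in> carrier M\<rbrakk> \<Longrightarrow>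
    f (x \<ominus>\<^bsub>M\<^esub> y) = f x \<ominus>\<^bsub>N\<^esub> f y"
  by (meson add_hom_diff left_module_abelian_group lmod_hom_add_hom)

lemma lmod_hom_of_msum:
  "\<lbrakk>left_module R M; left_module R N; f \<in> lmod_hom R M N; \<And>i. i < n \<Longrightarrow> x i \<in> carrier M\<rbrakk> \<Longrightarrow>
    f (msum M x n) = msum N (\<lambda>i. f (x i)) n"
  by (rule add_hom_of_msum)
    (auto intro: left_module_abelian_group lmod_hom_add_hom)

lemma lmod_hom_comp:
  "\<lbrakk>f \<in> lmod_hom R M N; g \<in> lmod_hom R N Q\<rbrakk> \<Longrightarrow> (\<lambda>x. g (f x)) \<in> lmod_hom R M Q"
  by (auto simp: lmod_hom_def Pi_iff)

lemma lmod_hom_id: "(\<lambda>x. x) \<in> lmod_hom R M M"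
  by (auto simp: lmod_hom_def)

lemma lmod_hom_cong:
  assumes "left_module R M" "f \<in> lmod_hom R M N" "\<And>x. x \<in> carrier M \<Longrightarrow> g x = f x"
  shows "g \<in> lmod_hom R M N"
proof -
  interpret left_module R M by fact
  show ?thesis using assms(2,3) by (auto simp: lmod_hom_def smult_closed)
qed

context left_module
begin

lemma smult_r_null: "r \<in> carrier R \<Longrightarrow> r \<odot>\<^bsub>M\<^esub> \<zero>\<^bsub>M\<^esub> = \<zero>\<^bsub>M\<^esub>"
  by (metis M.add.l_cancel_one' M.l_zero M.zero_closed smult_closed smult_r_distr)

lemma smult_l_null: "x \<in> carrier M \<Longrightarrow> \<zero> \<odot>\<^bsub>M\<^esub> x = \<zero>\<^bsub>M\<^esub>"
  by (metis M.add.l_cancel_one' R.l_zero R.zero_closed smult_closed smult_l_distr)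

lemma smult_add_hom: "r \<in> carrier R \<Longrightarrow> (\<lambda>x. r \<odot>\<^bsub>M\<^esub> x) \<in> add_hom M M"
  by (auto simp: add_hom_def smult_closed smult_r_distr)

lemma smult_minus_one: "x \<in> carrier M \<Longrightarrow> (\<ominus> \<one>) \<odot>\<^bsub>M\<^esub> x = \<ominus>\<^bsub>M\<^esub> x"
  by (metis M.minus_equality R.add.inv_closed R.l_neg R.one_closed smult_closed smult_l_distr
      smult_l_null smult_one)

lemma lmod_hom_plus:
  "\<lbrakk>f \<in> lmod_hom R P M; g \<in> lmod_hom R P M\<rbrakk> \<Longrightarrow> (\<lambda>x. f x \<oplus>\<^bsub>M\<^esub> g x) \<in> lmod_hom R P M"
  by (auto simp: lmod_hom_def Pi_iff M.a_ac smult_r_distr)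

lemma lmod_hom_const_zero: "(\<lambda>x. \<zero>\<^bsub>M\<^esub>) \<in> lmod_hom R P M"
  by (auto simp: lmod_hom_def smult_r_null)

lemma lmod_hom_minus:
  assumes "f \<in> lmod_hom R P M" "g \<in> lmod_hom R P M"
  shows "(\<lambda>x. f x \<ominus>\<^bsub>M\<^esub> g x) \<in> lmod_hom R P M"
  using assms add_hom_minus[OF M.abelian_group_axioms M.abelian_group_axioms smult_add_hom]
  by (auto simp: lmod_hom_def Pi_iff a_minus_def M.a_ac smult_r_distr M.minus_add)

text \<open>A functional times a fixed element is the building block of every homomorphism defined
  through a dual basis.\<close>

lemma lmod_hom_smult_elem:
  "\<lbrakk>\<phi> \<in> lmod_hom R P (regular R); m \<in> carrier M\<rbrakk> \<Longrightarrow> (\<lambda>x. \<phi> x \<odot>\<^bsub>M\<^esub> m) \<in> lmod_hom R P M"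
  by (auto simp: lmod_hom_def Pi_iff smult_closed smult_l_distr smult_assoc)

lemma lmod_hom_msum:
  "(\<And>i. i < n \<Longrightarrow> f i \<in> lmod_hom R P M) \<Longrightarrow> (\<lambda>x. msum M (\<lambda>i. f i x) n) \<in> lmod_hom R P M"
  by (induction n) (auto intro: lmod_hom_const_zero lmod_hom_plus)

end

section \<open>Submodules and finite generation\<close>

text \<open>Closure under negatives comes from the scalar -1, so a submodule is an additive
  subgroup.\<close>

definition submod :: "('r, 'c) ring_scheme \<Rightarrow> ('r, 'm, 'd) module_scheme \<Rightarrow> 'm set \<Rightarrow> bool" where
  "submod R M U \<longleftrightarrow> U \<subseteq> carrier M \<and> \<zero>\<^bsub>M\<^esub> \<in> U \<and> (\<forall>x\<in>U. \<forall>y\<in>U. x \<oplus>\<^bsub>M\<^esub> y \<in> U) \<and>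
     (\<forall>r\<in>carrier R. \<forall>x\<in>U. r \<odot>\<^bsub>M\<^esub> x \<in> U)"

lemma left_module_submod:
  assumes "left_module R M" "submod R M U"
  shows "left_module R (M\<lparr>carrier := U\<rparr>)"
proof -
  interpret left_module R M by fact
  have U: "x \<in> carrier M" if "x \<in> U" for x using assms(2) that by (auto simp: submod_def)
  have neg: "\<ominus>\<^bsub>M\<^esub> x \<in> U" if "x \<in> U" for x
    using assms(2) that smult_minus_one[OF U[OF that]] by (metis R.add.inv_closed R.one_closed submod_def)
  have "abelian_group (M\<lparr>carrier := U\<rparr>)"
    by (rule abelian_groupI)
      (use assms(2) U neg M.l_neg in \<open>auto simp: submod_def M.a_ac intro!: bexI[OF _ neg]\<close>)
  then show ?thesis
    using assms(2) U
    by (intro left_moduleI) (auto simp: submod_def smult_l_distr smult_r_distr smult_assoc smult_one R.ring_axioms)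
qed

lemma submod_kernel:
  assumes "left_module R M" "left_module R N" "f \<in> lmod_hom R M N"
  shows "submod R M (a_kernel M N f)"
proof -
  interpret M: left_module R M by fact
  interpret N: left_module R N by fact
  show ?thesis
    using assms(3) lmod_hom_zero[OF assms]
    by (auto simp: submod_def a_kernel_def' lmod_hom_add lmod_hom_smult M.smult_closed N.smult_r_null)
qed

lemma submod_image:
  assumes "left_module R M" "left_module R N" "f \<in> lmod_hom R M N"
  shows "submod R N (f ` carrier M)"
proof -
  interpret M: left_module R M by fact
  have "f x \<oplus>\<^bsub>N\<^esub> f y \<in> f ` carrier M" if "x \<in> carrier M" "y \<in> carrier M" for x y
    using that by (metis (no_types) M.add.m_closed assms(3) imageI lmod_hom_add)
  moreover have "r \<odot>\<^bsub>N\<^esub> f x \<in> f ` carrier M" if "r \<in> carrier R" "x \<in> carrier M" for r x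
    using that by (metis (no_types) M.smult_closed assms(3) imageI lmod_hom_smult)
  moreover have "\<zero>\<^bsub>N\<^esub> \<in> f ` carrier M"
    by (metis (no_types) M.zero_closed assms imageI lmod_hom_zero)
  ultimately show ?thesis
    using lmod_hom_closed[OF assms(3)] by (auto simp: submod_def)
qed

lemma submod_vimage:
  assumes "left_module R M" "left_module R N" "f \<in> lmod_hom R M N" "submod R N U"
  shows "submod R M {x \<in> carrier M. f x \<in> U}"
proof -
  interpret M: left_module R M by fact
  show ?thesis
    using assms(3,4) lmod_hom_zero[OF assms(1-3)]
    by (auto simp: submod_def lmod_hom_add lmod_hom_smult M.smult_closed)
qed

lemma submod_finsum:
  assumes "left_module R M" "submod R M U" "finite S" "f \<in> S \<rightarrow> U"
  shows "(\<Oplus>\<^bsub>M\<^esub>s\<in>S. f s) \<in> U"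
  using assms(3,4)
proof (induction S)
  case empty
  interpret left_module R M by fact
  show ?case using assms(2) by (simp add: submod_def)
next
  case (insert s S)
  interpret left_module R M by fact
  have "f \<in> S \<rightarrow> carrier M" "f s \<in> carrier M"
    using insert assms(2) by (auto simp: submod_def)
  then show ?case using insert assms(2) by (auto simp: submod_def M.finsum_insert)
qed

lemma submod_msum:
  "\<lbrakk>submod R M U; \<And>i. i < n \<Longrightarrow> f i \<in> U\<rbrakk> \<Longrightarrow> msum M f n \<in> U"
  by (induction n) (auto simp: submod_def)

text \<open>Phrased by submodules instead of linear combinations: generation is then proved by
  exhibiting a submodule, which suits images, the passage from A to k, and tensor products.\<close>

definition generates :: "('r, 'c) ring_scheme \<Rightarrow> ('r, 'm, 'd) module_scheme \<Rightarrow> 'm set \<Rightarrow> bool" where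
  "generates R M S \<longleftrightarrow> finite S \<and> S \<subseteq> carrier M \<and> (\<forall>U. submod R M U \<longrightarrow> S \<subseteq> U \<longrightarrow> carrier M \<subseteq> U)"

lemma generatesD: "\<lbrakk>generates R M S; submod R M U; S \<subseteq> U\<rbrakk> \<Longrightarrow> carrier M \<subseteq> U"
  by (simp add: generates_def)

text \<open>The linear combinations of S form a submodule containing S, and every submodule
  containing S contains all of them.\<close>

lemma fin_gen_iff:
  assumes "left_module R M"
  shows "fin_gen R M \<longleftrightarrow> (\<exists>S. generates R M S)"
proof
  assume "fin_gen R M"
  then obtain S where S: "finite S" "S \<subseteq> carrier M"
    "\<forall>x \<in> carrier M. \<exists>c \<in> S \<rightarrow> carrier R. x = (\<Oplus>\<^bsub>M\<^esub>s\<in>S. c s \<odot>\<^bsub>M\<^esub> s)"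
    by (auto simp: fin_gen_def)
  have "carrier M \<subseteq> U" if U: "submod R M U" "S \<subseteq> U" for U
  proof
    fix x assume "x \<in> carrier M"
    then obtain c where c: "c \<in> S \<rightarrow> carrier R" "x = (\<Oplus>\<^bsub>M\<^esub>s\<in>S. c s \<odot>\<^bsub>M\<^esub> s)"
      using S(3) by blast
    have "(\<lambda>s. c s \<odot>\<^bsub>M\<^esub> s) \<in> S \<rightarrow> U" using c U by (auto simp: submod_def Pi_iff)
    then show "x \<in> U" using submod_finsum[OF assms U(1) S(1)] c(2) by simp
  qed
  then show "\<exists>S. generates R M S"
    using S(1,2) unfolding generates_def by metis
next
  assume "\<exists>S. generates R M S"
  then obtain S where gen: "generates R M S" ..
  then have S: "finite S" "S \<subseteq> carrier M"
    by (simp_all add: generates_def)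
  interpret left_module R M by fact
  define L where "L c = (\<Oplus>\<^bsub>M\<^esub>s\<in>S. c s \<odot>\<^bsub>M\<^esub> s)" for c
  have Sc: "s \<in> carrier M" if "s \<in> S" for s using S(2) that by auto
  have cl: "(\<lambda>s. c s \<odot>\<^bsub>M\<^esub> s) \<in> S \<rightarrow> carrier M" if "c \<in> S \<rightarrow> carrier R" for c
    using that Sc by (auto simp: Pi_iff smult_closed)
  have L_add: "L c \<oplus>\<^bsub>M\<^esub> L d = L (\<lambda>s. c s \<oplus>\<^bsub>R\<^esub> d s)" if "c \<in> S \<rightarrow> carrier R" "d \<in> S \<rightarrow> carrier R" for c d
  proof -
    have "L (\<lambda>s. c s \<oplus>\<^bsub>R\<^esub> d s) = (\<Oplus>\<^bsub>M\<^esub>s\<in>S. c s \<odot>\<^bsub>M\<^esub> s \<oplus>\<^bsub>M\<^esub> d s \<odot>\<^bsub>M\<^esub> s)"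
      unfolding L_def using that Sc
      by (intro M.finsum_cong') (auto simp: Pi_iff smult_l_distr smult_closed)
    also have "\<dots> = L c \<oplus>\<^bsub>M\<^esub> L d" unfolding L_def using that cl by (intro M.finsum_addf) auto
    finally show ?thesis by simp
  qed
  have L_smult: "r \<odot>\<^bsub>M\<^esub> L c = L (\<lambda>s. r \<otimes>\<^bsub>R\<^esub> c s)" if "r \<in> carrier R" "c \<in> S \<rightarrow> carrier R" for r c
  proof -
    have "r \<odot>\<^bsub>M\<^esub> (\<Oplus>\<^bsub>M\<^esub>s\<in>F. c s \<odot>\<^bsub>M\<^esub> s) = (\<Oplus>\<^bsub>M\<^esub>s\<in>F. (r \<otimes>\<^bsub>R\<^esub> c s) \<odot>\<^bsub>M\<^esub> s)" if "finite F" "F \<subseteq> S" for F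
      using that
    proof (induction F)
      case empty
      then show ?case using \<open>r \<in> _\<close> by (simp add: smult_r_null)
    next
      case (insert s F)
      have "(\<lambda>s. c s \<odot>\<^bsub>M\<^esub> s) \<in> F \<rightarrow> carrier M" "(\<lambda>s. (r \<otimes>\<^bsub>R\<^esub> c s) \<odot>\<^bsub>M\<^esub> s) \<in> F \<rightarrow> carrier M"
        "c s \<in> carrier R" "s \<in> carrier M"
        using insert.prems Sc \<open>r \<in> _\<close> \<open>c \<in> _\<close> by (auto simp: Pi_iff intro!: smult_closed)
      moreover from this have "(\<Oplus>\<^bsub>M\<^esub>s\<in>F. c s \<odot>\<^bsub>M\<^esub> s) \<in> carrier M" by (intro M.finsum_closed)
      ultimately show ?case using insert \<open>r \<in> _\<close>
        by (simp add: M.finsum_insert smult_closed smult_r_distr smult_assoc)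
    qed
    then show ?thesis using S(1) by (simp add: L_def)
  qed
  have "submod R M {L c |c. c \<in> S \<rightarrow> carrier R}"
    unfolding submod_def
  proof (intro conjI ballI)
    show "{L c |c. c \<in> S \<rightarrow> carrier R} \<subseteq> carrier M"
      unfolding L_def using cl by (auto intro!: M.finsum_closed)
    have "L (\<lambda>s. \<zero>\<^bsub>R\<^esub>) = \<zero>\<^bsub>M\<^esub>"
    proof -
      have "L (\<lambda>s. \<zero>\<^bsub>R\<^esub>) = (\<Oplus>\<^bsub>M\<^esub>s\<in>S. \<zero>\<^bsub>M\<^esub>)"
        unfolding L_def using Sc by (intro M.finsum_cong') (auto simp: smult_l_null)
      then show ?thesis by (simp add: M.finsum_zero)
    qed
    then show "\<zero>\<^bsub>M\<^esub> \<in> {L c |c. c \<in> S \<rightarrow> carrier R}" by (auto intro!: exI[of _ "\<lambda>s. \<zero>\<^bsub>R\<^esub>"])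
  next
    fix x y assume "x \<in> {L c |c. c \<in> S \<rightarrow> carrier R}" "y \<in> {L c |c. c \<in> S \<rightarrow> carrier R}"
    then obtain c d where cd: "x = L c" "y = L d" "c \<in> S \<rightarrow> carrier R" "d \<in> S \<rightarrow> carrier R" by blast
    have "(\<lambda>s. c s \<oplus>\<^bsub>R\<^esub> d s) \<in> S \<rightarrow> carrier R" using cd by auto
    then show "x \<oplus>\<^bsub>M\<^esub> y \<in> {L c |c. c \<in> S \<rightarrow> carrier R}"
      using L_add[OF cd(3,4)] cd(1,2) by blast
  next
    fix r x assume "r \<in> carrier R" "x \<in> {L c |c. c \<in> S \<rightarrow> carrier R}"
    then obtain c where cd: "x = L c" "c \<in> S \<rightarrow> carrier R" by blast
    have "(\<lambda>s. r \<otimes>\<^bsub>R\<^esub> c s) \<in> S \<rightarrow> carrier R" using cd \<open>r \<in> _\<close> by auto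
    then show "r \<odot>\<^bsub>M\<^esub> x \<in> {L c |c. c \<in> S \<rightarrow> carrier R}"
      using L_smult[OF \<open>r \<in> _\<close> cd(2)] cd(1) by blast
  qed
  moreover have "S \<subseteq> {L c |c. c \<in> S \<rightarrow> carrier R}"
  proof
    fix t assume t: "t \<in> S"
    have "L (\<lambda>s. if t = s then \<one>\<^bsub>R\<^esub> else \<zero>\<^bsub>R\<^esub>) = (\<Oplus>\<^bsub>M\<^esub>s\<in>S. if t = s then s else \<zero>\<^bsub>M\<^esub>)"
      unfolding L_def using Sc by (intro M.finsum_cong') (auto simp: smult_l_null smult_one)
    also have "\<dots> = t" using M.finsum_singleton[OF t S(1), of "\<lambda>s. s"] Sc by auto
    finally show "t \<in> {L c |c. c \<in> S \<rightarrow> carrier R}"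
      by (intro CollectI exI[of _ "\<lambda>s. if t = s then \<one>\<^bsub>R\<^esub> else \<zero>\<^bsub>R\<^esub>"]) auto
  qed
  ultimately have "carrier M \<subseteq> {L c |c. c \<in> S \<rightarrow> carrier R}" by (rule generatesD[OF gen])
  then show "fin_gen R M" unfolding fin_gen_def L_def using S(1,2) by blast
qed

text \<open>The preimage of a submodule that contains the image of S is a submodule that contains S,
  hence is everything.\<close>

lemma fin_gen_image:
  assumes "left_module R M" "left_module R N" "f \<in> lmod_hom R M N" "f ` carrier M = carrier N" "fin_gen R M"
  shows "fin_gen R N"
proof -
  obtain S where gen: "generates R M S"
    using assms(5) fin_gen_iff[OF assms(1)] by auto
  then have S: "finite S" "S \<subseteq> carrier M"
    by (simp_all add: generates_def)
  have "carrier N \<subseteq> U" if "submod R N U" "f ` S \<subseteq> U" for U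
  proof -
    have "carrier M \<subseteq> {x \<in> carrier M. f x \<in> U}"
      by (rule generatesD[OF gen submod_vimage[OF assms(1-3) that(1)]]) (use that(2) S(2) in auto)
    then show ?thesis unfolding assms(4)[symmetric] by auto
  qed
  then show ?thesis
    unfolding fin_gen_iff[OF assms(2)] generates_def using S lmod_hom_closed[OF assms(3)]
    by (intro exI[of _ "f ` S"]) auto
qed

section \<open>Dual bases\<close>

text \<open>
  Finitely generated projective modules are handled through finite dual bases, since the lifting
  property obtained from a dual basis holds against modules on arbitrary types.
\<close>

definition dual_basis :: "('r, 'c) ring_scheme \<Rightarrow> ('r, 'm, 'd) module_scheme \<Rightarrow> nat \<Rightarrow> (nat \<Rightarrow> 'm) \<Rightarrow>
    (nat \<Rightarrow> 'm \<Rightarrow> 'r) \<Rightarrow> bool" where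
  "dual_basis R P n p \<phi> \<longleftrightarrow> (\<forall>i<n. p i \<in> carrier P \<and> \<phi> i \<in> lmod_hom R P (regular R)) \<and>
     (\<forall>x\<in>carrier P. x = msum P (\<lambda>i. \<phi> i x \<odot>\<^bsub>P\<^esub> p i) n)"

definition has_dual_basis :: "('r, 'c) ring_scheme \<Rightarrow> ('r, 'm, 'd) module_scheme \<Rightarrow> bool" where
  "has_dual_basis R P \<longleftrightarrow> (\<exists>n p \<phi>. dual_basis R P n p \<phi>)"

lemma dual_basisD:
  assumes "dual_basis R P n p \<phi>"
  shows "i < n \<Longrightarrow> p i \<in> carrier P" "i < n \<Longrightarrow> \<phi> i \<in> lmod_hom R P (regular R)"
    "\<lbrakk>i < n; x \<in> carrier P\<rbrakk> \<Longrightarrow> \<phi> i x \<in> carrier R"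
    "x \<in> carrier P \<Longrightarrow> msum P (\<lambda>i. \<phi> i x \<odot>\<^bsub>P\<^esub> p i) n = x"
  using assms lmod_hom_closed[of "\<phi> i" R P "regular R" x] by (auto simp: dual_basis_def)

lemma has_dual_basis_regular:
  assumes "ring R"
  shows "has_dual_basis R (regular R)"
proof -
  interpret ring R by fact
  have "dual_basis R (regular R) 1 (\<lambda>i. \<one>\<^bsub>R\<^esub>) (\<lambda>i x. x)"
    by (auto simp: dual_basis_def lmod_hom_id)
  then show ?thesis by (auto simp: has_dual_basis_def)
qed

lemma has_dual_basis_fin_gen:
  assumes "left_module R P" "has_dual_basis R P"
  shows "fin_gen R P"
proof -
  obtain n p \<phi> where db: "dual_basis R P n p \<phi>" using assms(2) by (auto simp: has_dual_basis_def)
  have "carrier P \<subseteq> U" if U: "submod R P U" "p ` {..<n} \<subseteq> U" for U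
  proof
    fix x assume x: "x \<in> carrier P"
    have "msum P (\<lambda>i. \<phi> i x \<odot>\<^bsub>P\<^esub> p i) n \<in> U"
      by (rule submod_msum[OF U(1)]) (use U x dual_basisD(3)[OF db] in \<open>auto simp: submod_def\<close>)
    then show "x \<in> U" using dual_basisD(4)[OF db x] by simp
  qed
  then show ?thesis unfolding fin_gen_iff[OF assms(1)] generates_def
    using dual_basisD(1)[OF db] by (intro exI[of _ "p ` {..<n}"]) auto
qed

lemma lmod_hom_dual_basis:
  assumes "left_module R P" "left_module R N" "dual_basis R P n p \<phi>" "f \<in> lmod_hom R P N" "x \<in> carrier P"
  shows "f x = msum N (\<lambda>i. \<phi> i x \<odot>\<^bsub>N\<^esub> f (p i)) n"
proof -
  interpret P: left_module R P by fact
  have "f x = f (msum P (\<lambda>i. \<phi> i x \<odot>\<^bsub>P\<^esub> p i) n)" using dual_basisD(4)[OF assms(3,5)] by simp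
  also have "\<dots> = msum N (\<lambda>i. f (\<phi> i x \<odot>\<^bsub>P\<^esub> p i)) n"
    by (rule lmod_hom_of_msum[OF assms(1,2,4)])
      (use dual_basisD[OF assms(3)] assms(5) in \<open>auto intro: P.smult_closed\<close>)
  also have "\<dots> = msum N (\<lambda>i. \<phi> i x \<odot>\<^bsub>N\<^esub> f (p i)) n"
    by (rule msum_cong) (use dual_basisD[OF assms(3)] assms(4,5) in \<open>auto simp: lmod_hom_smult\<close>)
  finally show ?thesis .
qed

text \<open>Only the images of the finitely many p i have to be lifted; the functionals \<phi> i
  then assemble the lifts into a homomorphism. Asking that f land in the image of g, instead of g
  being onto, lets exactness be used directly, without a module structure on the image.\<close>

lemma dual_basis_lift:
  assumes "left_module R P" "has_dual_basis R P" "left_module R M" "left_module R N"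
    "g \<in> lmod_hom R M N" "f \<in> lmod_hom R P N" "f ` carrier P \<subseteq> g ` carrier M"
  shows "\<exists>h\<in>lmod_hom R P M. \<forall>x\<in>carrier P. g (h x) = f x"
proof -
  interpret M: left_module R M by fact
  obtain n p \<phi> where db: "dual_basis R P n p \<phi>" using assms(2) by (auto simp: has_dual_basis_def)
  have "\<exists>m. m \<in> carrier M \<and> g m = f (p i)" if "i < n" for i
  proof -
    have "f (p i) \<in> g ` carrier M" using assms(7) dual_basisD(1)[OF db that] by auto
    then show ?thesis by (auto simp: image_iff)
  qed
  then obtain m where "\<forall>i. i < n \<longrightarrow> m i \<in> carrier M \<and> g (m i) = f (p i)" by metis
  then have m: "\<And>i. i < n \<Longrightarrow> m i \<in> carrier M" "\<And>i. i < n \<Longrightarrow> g (m i) = f (p i)"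
    by auto
  define h where "h x = msum M (\<lambda>i. \<phi> i x \<odot>\<^bsub>M\<^esub> m i) n" for x
  have "h \<in> lmod_hom R P M" unfolding h_def
    by (intro M.lmod_hom_msum M.lmod_hom_smult_elem dual_basisD(2)[OF db] m)
  moreover have "g (h x) = f x" if x: "x \<in> carrier P" for x
  proof -
    have "g (h x) = msum N (\<lambda>i. g (\<phi> i x \<odot>\<^bsub>M\<^esub> m i)) n" unfolding h_def
      by (rule lmod_hom_of_msum[OF assms(3-5)]) (use m x dual_basisD(3)[OF db] in \<open>auto intro: M.smult_closed\<close>)
    also have "\<dots> = msum N (\<lambda>i. \<phi> i x \<odot>\<^bsub>N\<^esub> f (p i)) n"
      by (rule msum_cong) (use m x dual_basisD(3)[OF db] assms(5) in \<open>auto simp: lmod_hom_smult\<close>)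
    also have "\<dots> = f x" using lmod_hom_dual_basis[OF assms(1,4) db assms(6) x] by simp
    finally show ?thesis .
  qed
  ultimately show ?thesis by blast
qed

text \<open>The elements are pushed forward along t and the functionals pulled back along its
  section s.\<close>

lemma has_dual_basis_retract:
  assumes "left_module R P" "left_module R F" "has_dual_basis R F" "s \<in> lmod_hom R P F" "t \<in> lmod_hom R F P"
    "\<And>x. x \<in> carrier P \<Longrightarrow> t (s x) = x"
  shows "has_dual_basis R P"
proof -
  interpret F: left_module R F by fact
  obtain n p \<phi> where db: "dual_basis R F n p \<phi>" using assms(3) by (auto simp: has_dual_basis_def)
  have "dual_basis R P n (\<lambda>i. t (p i)) (\<lambda>i x. \<phi> i (s x))"
    unfolding dual_basis_def
  proof (intro conjI allI impI ballI)
    fix x assume x: "x \<in> carrier P"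
    have sx: "s x \<in> carrier F" using lmod_hom_closed[OF assms(4) x] .
    show "x = msum P (\<lambda>i. \<phi> i (s x) \<odot>\<^bsub>P\<^esub> t (p i)) n"
      using lmod_hom_dual_basis[OF assms(2,1) db assms(5) sx] assms(6)[OF x] by simp
  next
    fix i assume i: "i < n"
    show "t (p i) \<in> carrier P" using dual_basisD(1)[OF db i] lmod_hom_closed[OF assms(5)] by auto
    show "(\<lambda>x. \<phi> i (s x)) \<in> lmod_hom R P (regular R)"
      by (rule lmod_hom_comp[OF assms(4) dual_basisD(2)[OF db i]])
  qed
  then show ?thesis by (auto simp: has_dual_basis_def)
qed

lemma (in abelian_group) minus_eq_zero_iff:
  assumes "x \<in> carrier G" "y \<in> carrier G"
  shows "x \<ominus> y = \<zero> \<longleftrightarrow> x = y"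
proof
  assume "x \<ominus> y = \<zero>"
  then have "(x \<ominus> y) \<oplus> y = y" using assms by simp
  then show "x = y" using assms by (simp add: a_minus_def a_assoc l_neg)
qed (use assms in \<open>simp add: a_minus_def r_neg\<close>)

section \<open>Finite-dimensional spaces\<close>

text \<open>A vector s with \<tau>(s) = 1 splits V into the kernel of \<tau> and the line through s.
  The functionals on the kernel are extended by the projection x - \<tau>(x) s, and the pair (s,
  \<tau>) is added at index m.\<close>

lemma has_dual_basis_extend:
  assumes "left_module k V" "\<tau> \<in> lmod_hom k V (regular k)" "s \<in> carrier V" "\<tau> s = \<one>\<^bsub>k\<^esub>"
    "has_dual_basis k (V\<lparr>carrier := a_kernel V (regular k) \<tau>\<rparr>)"
  shows "has_dual_basis k V"
proof -
  interpret V: left_module k V by fact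
  let ?K = "V\<lparr>carrier := a_kernel V (regular k) \<tau>\<rparr>"
  define \<pi> where "\<pi> x = x \<ominus>\<^bsub>V\<^esub> \<tau> x \<odot>\<^bsub>V\<^esub> s" for x
  obtain m p \<phi> where db: "dual_basis k ?K m p \<phi>" using assms(5) by (auto simp: has_dual_basis_def)
  have reg: "left_module k (regular k)" by (rule left_module_regular[OF V.R.ring_axioms])
  have \<tau>c: "\<tau> x \<in> carrier k" if "x \<in> carrier V" for x using lmod_hom_closed[OF assms(2) that] by simp
  have \<pi>V: "\<pi> \<in> lmod_hom k V V" unfolding \<pi>_def
    by (intro V.lmod_hom_minus V.lmod_hom_smult_elem lmod_hom_id assms)
  have \<tau>\<pi>: "\<tau> (\<pi> x) = \<zero>\<^bsub>k\<^esub>" if x: "x \<in> carrier V" for x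
  proof -
    have "\<tau> (\<pi> x) = \<tau> x \<ominus>\<^bsub>regular k\<^esub> \<tau> (\<tau> x \<odot>\<^bsub>V\<^esub> s)" unfolding \<pi>_def
      by (rule lmod_hom_diff[OF assms(1) reg assms(2)]) (use x \<tau>c assms(3) in \<open>auto intro: V.smult_closed\<close>)
    also have "\<tau> (\<tau> x \<odot>\<^bsub>V\<^esub> s) = \<tau> x"
      using lmod_hom_smult[OF assms(2) \<tau>c[OF x] assms(3)] assms(4) \<tau>c[OF x] by simp
    finally show ?thesis
      using \<tau>c[OF x] left_module.axioms(2)[OF reg] abelian_group.r_neg[of "regular k" "\<tau> x"]
      by (simp add: a_minus_def)
  qed
  have \<pi>K: "\<pi> \<in> lmod_hom k V ?K"
    using \<pi>V \<tau>\<pi> by (auto simp: lmod_hom_def a_kernel_def')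
  let ?p = "\<lambda>i. if i < m then p i else s"
  let ?\<phi> = "\<lambda>i. if i < m then (\<lambda>x. \<phi> i (\<pi> x)) else \<tau>"
  have "dual_basis k V (Suc m) ?p ?\<phi>" unfolding dual_basis_def
  proof (intro conjI allI impI ballI)
    fix i assume "i < Suc m"
    show "?p i \<in> carrier V" using dual_basisD(1)[OF db, of i] assms(3) by (auto simp: a_kernel_def')
    show "?\<phi> i \<in> lmod_hom k V (regular k)"
      using lmod_hom_comp[OF \<pi>K dual_basisD(2)[OF db]] assms(2) by auto
  next
    fix x assume x: "x \<in> carrier V"
    have \<pi>x: "\<pi> x \<in> carrier ?K" using lmod_hom_closed[OF \<pi>K x] .
    have "msum V (\<lambda>i. ?\<phi> i x \<odot>\<^bsub>V\<^esub> ?p i) m = msum ?K (\<lambda>i. \<phi> i (\<pi> x) \<odot>\<^bsub>?K\<^esub> p i) m"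
      by (subst msum_same_ops[of V ?K]) (auto intro: msum_cong)
    also have "\<dots> = \<pi> x" using dual_basisD(4)[OF db \<pi>x] .
    finally have "msum V (\<lambda>i. ?\<phi> i x \<odot>\<^bsub>V\<^esub> ?p i) (Suc m) = \<pi> x \<oplus>\<^bsub>V\<^esub> \<tau> x \<odot>\<^bsub>V\<^esub> s"
      by simp
    also have "\<dots> = x" unfolding \<pi>_def
      using x \<tau>c[OF x] assms(3) by (simp add: a_minus_def V.smult_closed V.M.a_assoc V.M.l_neg)
    finally show "x = msum V (\<lambda>i. ?\<phi> i x \<odot>\<^bsub>V\<^esub> ?p i) (Suc m)" by simp
  qed
  then show ?thesis by (auto simp: has_dual_basis_def)
qed

lemma has_dual_basis_zero: "carrier V \<subseteq> {\<zero>\<^bsub>V\<^esub>} \<Longrightarrow> has_dual_basis R V"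
  unfolding has_dual_basis_def dual_basis_def by (intro exI[of _ 0]) auto

lemma lmod_hom_restrict_submod:
  "\<lbrakk>f \<in> lmod_hom R M N; U \<subseteq> carrier M\<rbrakk> \<Longrightarrow> f \<in> lmod_hom R (M\<lparr>carrier := U\<rparr>) N"
  by (rule lmod_homI) (auto simp: subset_iff lmod_hom_closed lmod_hom_add lmod_hom_smult)

text \<open>Induction on the number of functionals. The last one is dropped if it vanishes
  identically; otherwise a line is split off, and the remaining functionals still separate the
  points of its kernel.\<close>

lemma separated_has_dual_basis:
  fixes n :: nat
  assumes "field k" "left_module k U" "\<And>i. i < n \<Longrightarrow> c i \<in> lmod_hom k U (regular k)"
    "\<And>x. \<lbrakk>x \<in> carrier U; \<And>i. i < n \<Longrightarrow> c i x = \<zero>\<^bsub>k\<^esub>\<rbrakk> \<Longrightarrow> x = \<zero>\<^bsub>U\<^esub>"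
  shows "has_dual_basis k U"
  using assms(2-4)
proof (induction n arbitrary: U)
  case 0
  then show ?case by (intro has_dual_basis_zero) auto
next
  case (Suc n)
  interpret field k by fact
  interpret U: left_module k U by fact
  show ?case
  proof (cases "\<forall>x\<in>carrier U. c n x = \<zero>\<^bsub>k\<^esub>")
    case True
    show ?thesis
    proof (rule Suc.IH[OF Suc.prems(1)])
      show "c i \<in> lmod_hom k U (regular k)" if "i < n" for i using Suc.prems(2) that by simp
      show "x = \<zero>\<^bsub>U\<^esub>" if "x \<in> carrier U" "\<And>i. i < n \<Longrightarrow> c i x = \<zero>\<^bsub>k\<^esub>" for x
        by (rule Suc.prems(3)[OF that(1)]) (use that True in \<open>auto simp: less_Suc_eq\<close>)
    qed
  next
    case False
    then obtain u where u: "u \<in> carrier U" "c n u \<noteq> \<zero>\<^bsub>k\<^esub>" by auto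
    have cn: "c n \<in> lmod_hom k U (regular k)" using Suc.prems(2) by simp
    have cu: "c n u \<in> Units k" using lmod_hom_closed[OF cn u(1)] u(2) by (simp add: field_Units)
    define s where "s = inv\<^bsub>k\<^esub> (c n u) \<odot>\<^bsub>U\<^esub> u"
    have s: "s \<in> carrier U" using u cu by (simp add: s_def U.smult_closed)
    have "c n s = \<one>\<^bsub>k\<^esub>" unfolding s_def using lmod_hom_smult[OF cn _ u(1)] cu by simp
    moreover have sub: "submod k U (a_kernel U (regular k) (c n))"
      by (rule submod_kernel[OF Suc.prems(1) left_module_regular[OF ring_axioms] cn])
    have "has_dual_basis k (U\<lparr>carrier := a_kernel U (regular k) (c n)\<rparr>)"
    proof (rule Suc.IH[OF left_module_submod[OF Suc.prems(1) sub]])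
      show "c i \<in> lmod_hom k (U\<lparr>carrier := a_kernel U (regular k) (c n)\<rparr>) (regular k)" if "i < n" for i
        by (rule lmod_hom_restrict_submod) (use Suc.prems(2) that in \<open>auto simp: a_kernel_def'\<close>)
      show "x = \<zero>\<^bsub>U\<lparr>carrier := a_kernel U (regular k) (c n)\<rparr>\<^esub>"
        if x: "x \<in> carrier (U\<lparr>carrier := a_kernel U (regular k) (c n)\<rparr>)" "\<And>i. i < n \<Longrightarrow> c i x = \<zero>\<^bsub>k\<^esub>" for x
        using Suc.prems(3)[of x] x by (auto simp: a_kernel_def' less_Suc_eq)
    qed
    ultimately show ?thesis by (intro has_dual_basis_extend[OF Suc.prems(1) cn s])
  qed
qed

text \<open>The vectors of a dual basis of V need not lie in U, but its functionals restrict to U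
  and still separate points.\<close>

lemma has_dual_basis_submod:
  assumes "field k" "left_module k V" "has_dual_basis k V" "submod k V U"
  shows "has_dual_basis k (V\<lparr>carrier := U\<rparr>)"
proof -
  interpret V: left_module k V by fact
  obtain n p \<phi> where db: "dual_basis k V n p \<phi>" using assms(3) by (auto simp: has_dual_basis_def)
  have UV: "U \<subseteq> carrier V" using assms(4) by (simp add: submod_def)
  show ?thesis
  proof (rule separated_has_dual_basis[OF assms(1) left_module_submod[OF assms(2,4)]])
    show "\<phi> i \<in> lmod_hom k (V\<lparr>carrier := U\<rparr>) (regular k)" if "i < n" for i
      by (rule lmod_hom_restrict_submod[OF dual_basisD(2)[OF db that] UV])
    show "x = \<zero>\<^bsub>V\<lparr>carrier := U\<rparr>\<^esub>" if x: "x \<in> carrier (V\<lparr>carrier := U\<rparr>)" "\<And>i. i < n \<Longrightarrow> \<phi> i x = \<zero>\<^bsub>k\<^esub>" for x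
    proof -
      have "x = msum V (\<lambda>i. \<phi> i x \<odot>\<^bsub>V\<^esub> p i) n" using dual_basisD(4)[OF db] x UV by auto
      also have "\<dots> = \<zero>\<^bsub>V\<^esub>"
        by (rule V.M.msum_zero) (use x dual_basisD(1)[OF db] in \<open>simp add: V.smult_l_null\<close>)
      finally show ?thesis by simp
    qed
  qed
qed

text \<open>Generators are adjoined one at a time. One outside the subspace U reached so far
  contributes a line, and the coordinate along it is a functional with kernel U, so
  \<open>has_dual_basis_extend\<close> applies.\<close>

lemma fin_gen_has_dual_basis:
  assumes "field k" "left_module k V" "fin_gen k V"
  shows "has_dual_basis k V"
proof -
  interpret field k by fact
  interpret V: left_module k V by fact
  obtain S where gen: "generates k V S" using assms(3) fin_gen_iff[OF assms(2)] by auto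
  then have S: "finite S" "S \<subseteq> carrier V" by (simp_all add: generates_def)
  have "\<exists>U. submod k V U \<and> S \<subseteq> U \<and> has_dual_basis k (V\<lparr>carrier := U\<rparr>)"
    using S
  proof (induction S)
    case empty
    have "submod k V {\<zero>\<^bsub>V\<^esub>}" by (auto simp: submod_def V.smult_r_null)
    moreover have "has_dual_basis k (V\<lparr>carrier := {\<zero>\<^bsub>V\<^esub>}\<rparr>)" by (rule has_dual_basis_zero) auto
    ultimately show ?case by blast
  next
    case (insert s S)
    then obtain U where U: "submod k V U" "S \<subseteq> U" "has_dual_basis k (V\<lparr>carrier := U\<rparr>)" by auto
    have s: "s \<in> carrier V" using insert by simp
    have Uc: "u \<in> carrier V" if "u \<in> U" for u using U(1) that by (auto simp: submod_def)
    have Uneg: "\<ominus>\<^bsub>V\<^esub> u \<in> U" if "u \<in> U" for u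
    proof -
      have "(\<ominus>\<^bsub>k\<^esub> \<one>\<^bsub>k\<^esub>) \<odot>\<^bsub>V\<^esub> u \<in> U" using U(1) that by (simp add: submod_def)
      then show ?thesis using V.smult_minus_one[OF Uc[OF that]] by simp
    qed
    show ?case
    proof (cases "s \<in> U")
      case True
      then show ?thesis using U by auto
    next
      case False
      define U' where "U' = {u \<oplus>\<^bsub>V\<^esub> r \<odot>\<^bsub>V\<^esub> s |u r. u \<in> U \<and> r \<in> carrier k}"
      \<comment> \<open>Two different coefficients would put (r - r') s into U, and dividing by r -
        r' would put s there.\<close>
      have uniq: "r = r' \<and> u = u'"
        if eq: "u \<oplus>\<^bsub>V\<^esub> r \<odot>\<^bsub>V\<^esub> s = u' \<oplus>\<^bsub>V\<^esub> r' \<odot>\<^bsub>V\<^esub> s"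
          and ur: "u \<in> U" "u' \<in> U" "r \<in> carrier k" "r' \<in> carrier k" for u u' r r'
      proof -
        have rs: "r \<odot>\<^bsub>V\<^esub> s \<in> carrier V" "r' \<odot>\<^bsub>V\<^esub> s \<in> carrier V" using ur s by (auto intro: V.smult_closed)
        have "(r \<ominus>\<^bsub>k\<^esub> r') \<odot>\<^bsub>V\<^esub> s = r \<odot>\<^bsub>V\<^esub> s \<ominus>\<^bsub>V\<^esub> r' \<odot>\<^bsub>V\<^esub> s"
          using ur s add_hom_diff[OF abelian_group_axioms V.M.abelian_group_axioms, of "\<lambda>r. r \<odot>\<^bsub>V\<^esub> s" r r']
          by (auto simp: add_hom_def V.smult_closed V.smult_l_distr)
        also have "\<dots> = (\<ominus>\<^bsub>V\<^esub> u \<oplus>\<^bsub>V\<^esub> (u \<oplus>\<^bsub>V\<^esub> r \<odot>\<^bsub>V\<^esub> s)) \<ominus>\<^bsub>V\<^esub> r' \<odot>\<^bsub>V\<^esub> s"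
          using Uc[OF ur(1)] rs by (simp add: V.M.r_neg2 V.M.r_neg1)
        also have "\<dots> = \<ominus>\<^bsub>V\<^esub> u \<oplus>\<^bsub>V\<^esub> u'"
          unfolding eq using Uc[OF ur(1)] Uc[OF ur(2)] rs by (simp add: a_minus_def V.M.a_assoc V.M.r_neg)
        also have "\<dots> \<in> U" using U(1) Uneg ur by (simp add: submod_def)
        finally have in_U: "(r \<ominus>\<^bsub>k\<^esub> r') \<odot>\<^bsub>V\<^esub> s \<in> U" .
        have "r \<ominus>\<^bsub>k\<^esub> r' = \<zero>\<^bsub>k\<^esub>"
        proof (rule ccontr)
          assume "r \<ominus>\<^bsub>k\<^esub> r' \<noteq> \<zero>\<^bsub>k\<^esub>"
          then have un: "r \<ominus>\<^bsub>k\<^esub> r' \<in> Units k" using ur by (simp add: field_Units)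
          have "inv\<^bsub>k\<^esub> (r \<ominus>\<^bsub>k\<^esub> r') \<odot>\<^bsub>V\<^esub> ((r \<ominus>\<^bsub>k\<^esub> r') \<odot>\<^bsub>V\<^esub> s) \<in> U"
            using in_U U(1) un by (auto simp: submod_def)
          moreover have "inv\<^bsub>k\<^esub> (r \<ominus>\<^bsub>k\<^esub> r') \<odot>\<^bsub>V\<^esub> ((r \<ominus>\<^bsub>k\<^esub> r') \<odot>\<^bsub>V\<^esub> s) = s"
            using un s V.smult_assoc[of "inv\<^bsub>k\<^esub> (r \<ominus>\<^bsub>k\<^esub> r')" "r \<ominus>\<^bsub>k\<^esub> r'" s]
            by (simp add: V.smult_one Units_closed)
          ultimately show False using False by simp
        qed
        then have rr: "r = r'" using ur minus_eq_zero_iff[of r r'] by simp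
        have "u = u'" using eq unfolding rr using Uc ur rs by (simp add: V.M.add.right_cancel)
        with rr show ?thesis by simp
      qed
      have U'I: "u \<oplus>\<^bsub>V\<^esub> r \<odot>\<^bsub>V\<^esub> s \<in> U'" if "u \<in> U" "r \<in> carrier k" for u r
        using that by (auto simp: U'_def)
      have add: "(u \<oplus>\<^bsub>V\<^esub> r \<odot>\<^bsub>V\<^esub> s) \<oplus>\<^bsub>V\<^esub> (u' \<oplus>\<^bsub>V\<^esub> r' \<odot>\<^bsub>V\<^esub> s) = (u \<oplus>\<^bsub>V\<^esub> u') \<oplus>\<^bsub>V\<^esub> (r \<oplus>\<^bsub>k\<^esub> r') \<odot>\<^bsub>V\<^esub> s"
        if "u \<in> U" "u' \<in> U" "r \<in> carrier k" "r' \<in> carrier k" for u u' r r'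
        using that Uc s by (simp add: V.smult_l_distr V.smult_closed V.M.a_ac)
      have mul: "t \<odot>\<^bsub>V\<^esub> (u \<oplus>\<^bsub>V\<^esub> r \<odot>\<^bsub>V\<^esub> s) = t \<odot>\<^bsub>V\<^esub> u \<oplus>\<^bsub>V\<^esub> (t \<otimes>\<^bsub>k\<^esub> r) \<odot>\<^bsub>V\<^esub> s"
        if "u \<in> U" "r \<in> carrier k" "t \<in> carrier k" for u r t
        using that Uc s by (simp add: V.smult_r_distr V.smult_closed V.smult_assoc)
      have UA: "u \<oplus>\<^bsub>V\<^esub> u' \<in> U" if "u \<in> U" "u' \<in> U" for u u' using U(1) that by (simp add: submod_def)
      have UM: "t \<odot>\<^bsub>V\<^esub> u \<in> U" if "u \<in> U" "t \<in> carrier k" for t u using U(1) that by (simp add: submod_def)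
      have U0: "\<zero>\<^bsub>V\<^esub> \<in> U" using U(1) by (simp add: submod_def)
      have sU': "s \<in> U'" using U'I[OF U0 one_closed] s by (simp add: V.smult_one)
      have UU': "U \<subseteq> U'" using U'I[of _ "\<zero>\<^bsub>k\<^esub>"] Uc s by (auto simp: V.smult_l_null)
      have sub': "submod k V U'" unfolding submod_def
      proof (intro conjI ballI)
        show "U' \<subseteq> carrier V" using Uc s by (auto simp: U'_def V.smult_closed)
        show "\<zero>\<^bsub>V\<^esub> \<in> U'" using UU' U0 by auto
        show "x \<oplus>\<^bsub>V\<^esub> y \<in> U'" if "x \<in> U'" "y \<in> U'" for x y
        proof -
          obtain u r u' r' where "x = u \<oplus>\<^bsub>V\<^esub> r \<odot>\<^bsub>V\<^esub> s" "y = u' \<oplus>\<^bsub>V\<^esub> r' \<odot>\<^bsub>V\<^esub> s"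
            "u \<in> U" "u' \<in> U" "r \<in> carrier k" "r' \<in> carrier k" using \<open>x \<in> U'\<close> \<open>y \<in> U'\<close> by (auto simp: U'_def)
          then show ?thesis using U'I[OF UA a_closed] add by simp
        qed
        show "t \<odot>\<^bsub>V\<^esub> x \<in> U'" if t: "t \<in> carrier k" and x: "x \<in> U'" for t x
        proof -
          obtain u r where "x = u \<oplus>\<^bsub>V\<^esub> r \<odot>\<^bsub>V\<^esub> s" "u \<in> U" "r \<in> carrier k" using x by (auto simp: U'_def)
          then show ?thesis using U'I[OF UM m_closed] mul t by simp
        qed
      qed
      \<comment> \<open>The coordinate along s; the description is met because of
        \<open>uniq\<close>.\<close>
      define \<tau> where "\<tau> x = (THE r. r \<in> carrier k \<and> (\<exists>u\<in>U. x = u \<oplus>\<^bsub>V\<^esub> r \<odot>\<^bsub>V\<^esub> s))" for x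
      have \<tau>: "\<tau> (u \<oplus>\<^bsub>V\<^esub> r \<odot>\<^bsub>V\<^esub> s) = r" if ur: "u \<in> U" "r \<in> carrier k" for u r
        unfolding \<tau>_def
      proof (rule the_equality)
        show "r \<in> carrier k \<and> (\<exists>u'\<in>U. u \<oplus>\<^bsub>V\<^esub> r \<odot>\<^bsub>V\<^esub> s = u' \<oplus>\<^bsub>V\<^esub> r \<odot>\<^bsub>V\<^esub> s)" using ur by auto
        show "r' = r" if "r' \<in> carrier k \<and> (\<exists>u'\<in>U. u \<oplus>\<^bsub>V\<^esub> r \<odot>\<^bsub>V\<^esub> s = u' \<oplus>\<^bsub>V\<^esub> r' \<odot>\<^bsub>V\<^esub> s)" for r'
          using that uniq ur by metis
      qed
      let ?U' = "V\<lparr>carrier := U'\<rparr>"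
      have \<tau>h: "\<tau> \<in> lmod_hom k ?U' (regular k)"
      proof (rule lmod_homI)
        show "\<tau> x \<in> carrier (regular k)" if "x \<in> carrier ?U'" for x
          using that \<tau> by (auto simp: U'_def)
        show "\<tau> (x \<oplus>\<^bsub>?U'\<^esub> y) = \<tau> x \<oplus>\<^bsub>regular k\<^esub> \<tau> y" if xy: "x \<in> carrier ?U'" "y \<in> carrier ?U'" for x y
        proof -
          obtain u r u' r' where "x = u \<oplus>\<^bsub>V\<^esub> r \<odot>\<^bsub>V\<^esub> s" "y = u' \<oplus>\<^bsub>V\<^esub> r' \<odot>\<^bsub>V\<^esub> s"
            "u \<in> U" "u' \<in> U" "r \<in> carrier k" "r' \<in> carrier k" using xy by (auto simp: U'_def)
          then show ?thesis using add \<tau> UA by simp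
        qed
        show "\<tau> (t \<odot>\<^bsub>?U'\<^esub> x) = t \<odot>\<^bsub>regular k\<^esub> \<tau> x" if t: "t \<in> carrier k" and x: "x \<in> carrier ?U'" for t x
        proof -
          obtain u r where "x = u \<oplus>\<^bsub>V\<^esub> r \<odot>\<^bsub>V\<^esub> s" "u \<in> U" "r \<in> carrier k" using x by (auto simp: U'_def)
          then show ?thesis using mul \<tau> UM t by simp
        qed
      qed
      have "\<zero>\<^bsub>V\<^esub> \<oplus>\<^bsub>V\<^esub> \<one>\<^bsub>k\<^esub> \<odot>\<^bsub>V\<^esub> s = s" using s by (simp add: V.smult_one)
      then have \<tau>s: "\<tau> s = \<one>\<^bsub>k\<^esub>" using \<tau>[OF U0 one_closed] by simp
      have "a_kernel ?U' (regular k) \<tau> = U"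
      proof
        show "U \<subseteq> a_kernel ?U' (regular k) \<tau>"
          using UU' \<tau>[of _ "\<zero>\<^bsub>k\<^esub>"] Uc s by (auto simp: a_kernel_def' V.smult_l_null)
        show "a_kernel ?U' (regular k) \<tau> \<subseteq> U"
          using \<tau> Uc s by (auto simp: a_kernel_def' U'_def V.smult_l_null)
      qed
      then have "has_dual_basis k ?U'"
        using U(3) has_dual_basis_extend[OF left_module_submod[OF assms(2) sub'] \<tau>h _ \<tau>s] sU' by simp
      then show ?thesis using sub' sU' UU' U(2) by auto
    qed
  qed
  then obtain U where U: "submod k V U" "S \<subseteq> U" "has_dual_basis k (V\<lparr>carrier := U\<rparr>)" by auto
  have "carrier V = U" using generatesD[OF gen U(1,2)] U(1) by (auto simp: submod_def)
  then show ?thesis using U(3) by auto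
qed

section \<open>Modules over a finite-dimensional algebra\<close>

lemma left_module_of_module: "Module.module k M \<Longrightarrow> left_module k M"
proof -
  assume "Module.module k M"
  then interpret Module.module k M .
  show ?thesis
    by (rule left_moduleI)
      (auto simp: smult_l_distr smult_r_distr smult_assoc1 R.ring_axioms M.abelian_group_axioms)
qed

lemma base_space_simps [simp]:
  "carrier (base_space R M) = carrier M" "add (base_space R M) = add M"
  "\<zero>\<^bsub>base_space R M\<^esub> = \<zero>\<^bsub>M\<^esub>" "smult (base_space R M) c = smult M (c \<odot>\<^bsub>R\<^esub> \<one>\<^bsub>R\<^esub>)"
  by (simp_all add: base_space_def)

text \<open>\<open>fd_algebra\<close> with k and A fixed to plain records, the types on which
  \<open>base_space\<close>, \<open>tensor_algebra\<close> and \<open>mon\<close> are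
  defined.\<close>

locale algebra = fd_algebra k A for k :: "'k ring" and A :: "('k, 'a) module" (structure)

context algebra
begin

lemma field_k: "field k" ..

lemma ring_A: "ring A" ..

lemma left_module_k_A: "left_module k A"
  by (rule left_module_of_module) (rule module_axioms)

text \<open>The field acts through the central elements c 1. This is how \<open>base_space\<close>
  recovers the action of k on an A-module, and why left and right modules can share that
  construction.\<close>

lemma scalar_one:
  assumes "c \<in> carrier k" "x \<in> carrier A"
  shows "(c \<odot> \<one>) \<otimes> x = c \<odot> x" "x \<otimes> (c \<odot> \<one>) = c \<odot> x"
  using assms scalar_mult_left[of c \<one> x] scalar_mult_right[of c x \<one>] by auto

lemma left_module_base_space:
  assumes "left_module A M"
  shows "left_module k (base_space A M)"
proof -
  interpret M: left_module A M by fact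
  interpret kA: left_module k A by (rule left_module_k_A)
  have [simp]: "c \<odot> \<one> \<in> carrier A" if "c \<in> carrier k" for c using that by (simp add: kA.smult_closed)
  show ?thesis
  proof (rule left_moduleI)
    show "ring k" ..
    show "abelian_group (base_space A M)"
      by (rule abelian_group_cong[OF M.M.abelian_group_axioms]) auto
    fix r s x assume "r \<in> carrier k" "s \<in> carrier k" "x \<in> carrier (base_space A M)"
    then show "(r \<otimes>\<^bsub>k\<^esub> s) \<odot>\<^bsub>base_space A M\<^esub> x = r \<odot>\<^bsub>base_space A M\<^esub> (s \<odot>\<^bsub>base_space A M\<^esub> x)"
      using scalar_one(1)[of r "s \<odot> \<one>"] M.smult_assoc[of "r \<odot> \<one>" "s \<odot> \<one>" x]
      by (simp add: kA.smult_assoc)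
  qed (auto simp: M.smult_closed M.smult_r_distr kA.smult_l_distr M.smult_l_distr smult_one
      kA.smult_one M.smult_one)
qed

lemma lmod_hom_base_space:
  "f \<in> lmod_hom A M N \<Longrightarrow> f \<in> lmod_hom k (base_space A M) (base_space A N)"
  using left_module.smult_closed[OF left_module_k_A _ one_closed] by (auto simp: lmod_hom_def)

lemma submod_base_space: "submod A M U \<Longrightarrow> submod k (base_space A M) U"
  using left_module.smult_closed[OF left_module_k_A _ one_closed] by (auto simp: submod_def)

text \<open>The products of k-generators of A with A-generators of M generate M over k, and over a
  field finite generation gives a dual basis.\<close>

lemma fg_has_dual_basis:
  assumes "fg_left_module A M"
  shows "has_dual_basis k (base_space A M)"
proof -
  interpret M: left_module A M using assms by (simp add: fg_left_module_def)
  interpret kM: left_module k "base_space A M" by (rule left_module_base_space) unfold_locales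
  interpret kA: left_module k A by (rule left_module_k_A)
  obtain T where T: "generates A M T"
    using assms fin_gen_iff[OF M.left_module_axioms] by (auto simp: fg_left_module_def)
  obtain S where S: "generates k A S"
    using finite_dimensional fin_gen_iff[OF left_module_k_A] by auto
  have ST: "finite S" "finite T" "S \<subseteq> carrier A" "T \<subseteq> carrier M"
    using S T by (auto simp: generates_def)
  have "generates k (base_space A M) ((\<lambda>(s, t). s \<odot>\<^bsub>M\<^esub> t) ` (S \<times> T))"
    unfolding generates_def
  proof (intro conjI allI impI)
    show "finite ((\<lambda>(s, t). s \<odot>\<^bsub>M\<^esub> t) ` (S \<times> T))" using ST by simp
    show "(\<lambda>(s, t). s \<odot>\<^bsub>M\<^esub> t) ` (S \<times> T) \<subseteq> carrier (base_space A M)"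
      using ST by (auto intro!: M.smult_closed)
    fix U assume U: "submod k (base_space A M) U" "(\<lambda>(s, t). s \<odot>\<^bsub>M\<^esub> t) ` (S \<times> T) \<subseteq> U"
    have AT: "r \<odot>\<^bsub>M\<^esub> t \<in> U" if rt: "r \<in> carrier A" "t \<in> T" for r t
    proof -
      have t: "t \<in> carrier M" using ST rt by auto
      have hom: "(\<lambda>r. r \<odot>\<^bsub>M\<^esub> t) \<in> lmod_hom k A (base_space A M)"
      proof (rule lmod_homI)
        fix c r assume cr: "c \<in> carrier k" "r \<in> carrier A"
        show "(c \<odot> r) \<odot>\<^bsub>M\<^esub> t = c \<odot>\<^bsub>base_space A M\<^esub> (r \<odot>\<^bsub>M\<^esub> t)"
          using cr t M.smult_assoc[of "c \<odot> \<one>" r t] scalar_one(1)[of c r] by simp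
      qed (use t in \<open>auto simp: M.smult_closed M.smult_l_distr\<close>)
      have "carrier A \<subseteq> {r \<in> carrier A. r \<odot>\<^bsub>M\<^esub> t \<in> U}"
        by (rule generatesD[OF S submod_vimage[OF left_module_k_A kM.left_module_axioms hom U(1)]])
          (use U(2) ST rt in auto)
      then show ?thesis using rt by auto
    qed
    \<comment> \<open>U is only a k-subspace. The elements x with A x inside U form an A-submodule,
      it contains T, and it lies in U since A has a unit.\<close>
    have "submod A M {x \<in> carrier M. \<forall>r\<in>carrier A. r \<odot>\<^bsub>M\<^esub> x \<in> U}"
      unfolding submod_def
      using U(1) by (auto simp: submod_def M.smult_r_distr M.smult_r_null M.smult_closed
          M.smult_assoc[symmetric])
    then have "carrier M \<subseteq> {x \<in> carrier M. \<forall>r\<in>carrier A. r \<odot>\<^bsub>M\<^esub> x \<in> U}"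
      by (rule generatesD[OF T]) (use AT ST in auto)
    then show "carrier (base_space A M) \<subseteq> U" using M.smult_one by force
  qed
  then have "fin_gen k (base_space A M)" using fin_gen_iff[OF kM.left_module_axioms] by auto
  then show ?thesis by (rule fin_gen_has_dual_basis[OF field_k kM.left_module_axioms])
qed

text \<open>Every A-submodule is a k-subspace, so a finite set generating over k also generates over
  A.\<close>

lemma fin_gen_of_base_space:
  assumes "left_module A M" "fin_gen k (base_space A M)"
  shows "fin_gen A M"
proof -
  obtain S where S: "generates k (base_space A M) S"
    using assms fin_gen_iff[OF left_module_base_space[OF assms(1)]] by auto
  then have "generates A M S" unfolding generates_def using submod_base_space[of M] by auto
  then show ?thesis using fin_gen_iff[OF assms(1)] by auto
qed

lemma fg_of_dual_basis_base_space:
  assumes "left_module A M" "has_dual_basis k (base_space A M)"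
  shows "fg_left_module A M"
  using fin_gen_of_base_space[OF assms(1)] assms
    has_dual_basis_fin_gen[OF left_module_base_space[OF assms(1)]]
  by (simp add: fg_left_module_def)

text \<open>Finite generation can be tested over k, where subspaces inherit dual bases. This is the
  only form in which A being noetherian is used.\<close>

lemma fg_submod:
  fixes M :: "('a, 'm) module"
  assumes "fg_left_module A M" "submod A M U"
  shows "fg_left_module A (M\<lparr>carrier := U\<rparr>)"
proof -
  have M: "left_module A M" using assms by (simp add: fg_left_module_def)
  have eq: "base_space A (M\<lparr>carrier := U\<rparr>) = (base_space A M)\<lparr>carrier := U\<rparr>"
    by (simp add: base_space_def)
  have "has_dual_basis k ((base_space A M)\<lparr>carrier := U\<rparr>)"
    by (rule has_dual_basis_submod[OF field_k left_module_base_space[OF M] fg_has_dual_basis[OF assms(1)]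
          submod_base_space[OF assms(2)]])
  then show ?thesis
    by (intro fg_of_dual_basis_base_space left_module_submod[OF M assms(2)]) (simp add: eq)
qed

end

section \<open>Transport of structure\<close>

text \<open>The module structure on the image of \<iota> for which an injective \<iota> becomes an
  isomorphism; it serves to move modules to the type \<open>'k univ\<close>.\<close>

definition transport :: "('r, 'm, 'd) module_scheme \<Rightarrow> ('m \<Rightarrow> 'n) \<Rightarrow> ('r, 'n) module" where
  "transport M \<iota> = (let \<kappa> = inv_into (carrier M) \<iota> in
     \<lparr>carrier = \<iota> ` carrier M, mult = undefined, one = undefined, ring.zero = \<iota> \<zero>\<^bsub>M\<^esub>,
      add = (\<lambda>x y. \<iota> (\<kappa> x \<oplus>\<^bsub>M\<^esub> \<kappa> y)), smult = (\<lambda>r x. \<iota> (r \<odot>\<^bsub>M\<^esub> \<kappa> x))\<rparr>)"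

lemma transport_simps:
  "carrier (transport M \<iota>) = \<iota> ` carrier M" "\<zero>\<^bsub>transport M \<iota>\<^esub> = \<iota> \<zero>\<^bsub>M\<^esub>"
  by (simp_all add: transport_def Let_def)

lemma transport_ops:
  assumes "inj_on \<iota> (carrier M)"
  shows "\<lbrakk>x \<in> carrier M; y \<in> carrier M\<rbrakk> \<Longrightarrow> \<iota> x \<oplus>\<^bsub>transport M \<iota>\<^esub> \<iota> y = \<iota> (x \<oplus>\<^bsub>M\<^esub> y)"
    and "x \<in> carrier M \<Longrightarrow> r \<odot>\<^bsub>transport M \<iota>\<^esub> \<iota> x = \<iota> (r \<odot>\<^bsub>M\<^esub> x)"
  using inv_into_f_f[OF assms] by (simp_all add: transport_def Let_def)

lemma left_module_transport:
  assumes "left_module R M" "inj_on \<iota> (carrier M)"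
  shows "left_module R (transport M \<iota>)"
proof -
  interpret M: left_module R M by fact
  note ops = transport_simps transport_ops[OF assms(2)]
  have "abelian_group (transport M \<iota>)"
  proof (rule abelian_groupI)
    show "\<exists>y\<in>carrier (transport M \<iota>). y \<oplus>\<^bsub>transport M \<iota>\<^esub> x = \<zero>\<^bsub>transport M \<iota>\<^esub>"
      if x: "x \<in> carrier (transport M \<iota>)" for x
    proof -
      obtain z where z: "z \<in> carrier M" "x = \<iota> z" using x by (auto simp: ops)
      then show ?thesis by (intro bexI[of _ "\<iota> (\<ominus>\<^bsub>M\<^esub> z)"]) (auto simp: ops M.M.l_neg)
    qed
  qed (auto simp: ops M.M.a_ac)
  then show ?thesis
    by (intro left_moduleI) (auto simp: ops M.smult_l_distr M.smult_r_distr M.smult_assoc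
        M.smult_one M.smult_closed M.R.ring_axioms)
qed

lemma transport_homs:
  assumes "left_module R M" "inj_on \<iota> (carrier M)"
  shows "\<iota> \<in> lmod_hom R M (transport M \<iota>)" "inv_into (carrier M) \<iota> \<in> lmod_hom R (transport M \<iota>) M"
proof -
  interpret M: left_module R M by fact
  note ops = transport_simps transport_ops[OF assms(2)]
  show "\<iota> \<in> lmod_hom R M (transport M \<iota>)" by (rule lmod_homI) (auto simp: ops)
  show "inv_into (carrier M) \<iota> \<in> lmod_hom R (transport M \<iota>) M"
    by (rule lmod_homI) (auto simp: ops inv_into_f_f[OF assms(2)] M.smult_closed)
qed

definition module_iso :: "('r, 'c) ring_scheme \<Rightarrow> ('r, 'm, 'd) module_scheme \<Rightarrow> ('r, 'n, 'e) module_scheme \<Rightarrow>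
    ('m \<Rightarrow> 'n) \<Rightarrow> ('n \<Rightarrow> 'm) \<Rightarrow> bool" where
  "module_iso R M N \<iota> \<kappa> \<longleftrightarrow> \<iota> \<in> lmod_hom R M N \<and> \<kappa> \<in> lmod_hom R N M \<and>
     (\<forall>x\<in>carrier M. \<kappa> (\<iota> x) = x) \<and> (\<forall>y\<in>carrier N. \<iota> (\<kappa> y) = y)"

lemma module_iso_image: "module_iso R M N \<iota> \<kappa> \<Longrightarrow> \<iota> ` carrier M = carrier N"
  by (auto simp: module_iso_def image_iff intro: lmod_hom_closed) (metis lmod_hom_closed)

lemma module_iso_sym: "module_iso R M N \<iota> \<kappa> \<Longrightarrow> module_iso R N M \<kappa> \<iota>"
  by (simp add: module_iso_def)

lemma module_iso_transport:
  assumes "left_module R M" "inj_on \<iota> (carrier M)"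
  shows "module_iso R M (transport M \<iota>) \<iota> (inv_into (carrier M) \<iota>)"
  using transport_homs[OF assms] inv_into_f_f[OF assms(2)]
  by (auto simp: module_iso_def transport_simps)

text \<open>The k-coordinates embed M into functions on the naturals. Entries from n on are the
  constant \<open>undefined\<close>, so injectivity depends on the n coordinates alone.\<close>

lemma (in algebra) fg_univ_copy:
  fixes M :: "('a, 'm) module"
  assumes "fg_left_module A M"
  shows "\<exists>(N :: ('a, 'k univ) module) \<iota> \<kappa>. fg_left_module A N \<and> module_iso A M N \<iota> \<kappa>"
proof -
  have M: "left_module A M" using assms by (simp add: fg_left_module_def)
  interpret kM: left_module k "base_space A M" by (rule left_module_base_space[OF M])
  obtain n p \<phi> where db: "dual_basis k (base_space A M) n p \<phi>"
    using fg_has_dual_basis[OF assms] by (auto simp: has_dual_basis_def)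
  define \<iota> :: "_ \<Rightarrow> 'k univ" where "\<iota> x = (\<lambda>i. if i < n then \<phi> i x else undefined)" for x
  have inj: "inj_on \<iota> (carrier M)"
  proof (rule inj_onI)
    fix x y assume xy: "x \<in> carrier M" "y \<in> carrier M" "\<iota> x = \<iota> y"
    have "\<phi> i x = \<phi> i y" if "i < n" for i using fun_cong[OF xy(3), of i] that by (simp add: \<iota>_def)
    then have "msum (base_space A M) (\<lambda>i. \<phi> i x \<odot>\<^bsub>base_space A M\<^esub> p i) n
      = msum (base_space A M) (\<lambda>i. \<phi> i y \<odot>\<^bsub>base_space A M\<^esub> p i) n" by (intro msum_cong) simp
    then show "x = y" using dual_basisD(4)[OF db] xy by simp
  qed
  let ?N = "transport M \<iota>"
  have "fg_left_module A ?N"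
    using fin_gen_image[OF M left_module_transport[OF M inj] transport_homs(1)[OF M inj]] assms
      left_module_transport[OF M inj]
    by (simp add: fg_left_module_def transport_simps)
  then show ?thesis using module_iso_transport[OF M inj] by blast
qed

section \<open>Free modules and projective modules\<close>

definition free_module :: "('r, 'c) ring_scheme \<Rightarrow> nat \<Rightarrow> ('r, nat \<Rightarrow> 'r) module" where
  "free_module R n = \<lparr>carrier = {..<n} \<rightarrow>\<^sub>E carrier R, mult = undefined, one = undefined,
     ring.zero = (\<lambda>i\<in>{..<n}. \<zero>\<^bsub>R\<^esub>), add = (\<lambda>f g. \<lambda>i\<in>{..<n}. f i \<oplus>\<^bsub>R\<^esub> g i),
     smult = (\<lambda>r f. \<lambda>i\<in>{..<n}. r \<otimes>\<^bsub>R\<^esub> f i)\<rparr>"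

lemma free_module_simps:
  "carrier (free_module R n) = {..<n} \<rightarrow>\<^sub>E carrier R"
  "\<zero>\<^bsub>free_module R n\<^esub> = (\<lambda>i\<in>{..<n}. \<zero>\<^bsub>R\<^esub>)"
  "f \<oplus>\<^bsub>free_module R n\<^esub> g = (\<lambda>i\<in>{..<n}. f i \<oplus>\<^bsub>R\<^esub> g i)"
  "r \<odot>\<^bsub>free_module R n\<^esub> f = (\<lambda>i\<in>{..<n}. r \<otimes>\<^bsub>R\<^esub> f i)"
  by (simp_all add: free_module_def)

context ring
begin

lemma left_module_free: "left_module R (free_module R n)"
proof -
  have "abelian_group (free_module R n)"
  proof (rule abelian_groupI)
    fix x assume x: "x \<in> carrier (free_module R n)"
    then have "(\<lambda>i\<in>{..<n}. \<ominus> x i) \<oplus>\<^bsub>free_module R n\<^esub> x = \<zero>\<^bsub>free_module R n\<^esub>"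
      by (auto simp: free_module_simps fun_eq_iff PiE_iff l_neg)
    moreover have "(\<lambda>i\<in>{..<n}. \<ominus> x i) \<in> carrier (free_module R n)"
      using x by (auto simp: free_module_simps PiE_iff)
    ultimately show "\<exists>y\<in>carrier (free_module R n). y \<oplus>\<^bsub>free_module R n\<^esub> x = \<zero>\<^bsub>free_module R n\<^esub>" by blast
  next
    fix x assume "x \<in> carrier (free_module R n)"
    then show "\<zero>\<^bsub>free_module R n\<^esub> \<oplus>\<^bsub>free_module R n\<^esub> x = x"
      by (auto simp: free_module_simps fun_eq_iff PiE_iff extensional_def)
  qed (auto simp: free_module_simps fun_eq_iff PiE_iff a_ac)
  then show ?thesis
  proof (intro left_moduleI)
    show "\<one> \<odot>\<^bsub>free_module R n\<^esub> x = x" if "x \<in> carrier (free_module R n)" for x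
      using that by (auto simp: free_module_simps fun_eq_iff PiE_iff extensional_def)
  qed (auto simp: free_module_simps fun_eq_iff PiE_iff l_distr r_distr m_assoc ring_axioms)
qed

lemma msum_delta: "x j \<in> carrier R \<Longrightarrow> msum R (\<lambda>i. if i = j then x i else \<zero>) n = (if j < n then x j else \<zero>)"
  by (induction n) (auto simp: less_Suc_eq)

lemma msum_free:
  "\<lbrakk>\<And>i. i < m \<Longrightarrow> g i \<in> carrier (free_module R n); j < n\<rbrakk> \<Longrightarrow>
    msum (free_module R n) g m j = msum R (\<lambda>i. g i j) m"
  by (induction m) (auto simp: free_module_simps)

lemma has_dual_basis_free: "has_dual_basis R (free_module R n)"
proof -
  interpret F: left_module R "free_module R n" by (rule left_module_free)
  define p where "p i = (\<lambda>j\<in>{..<n}. if i = j then \<one> else \<zero>)" for i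
  have p: "p i \<in> carrier (free_module R n)" for i by (auto simp: p_def free_module_simps)
  have "dual_basis R (free_module R n) n p (\<lambda>i f. f i)"
    unfolding dual_basis_def
  proof (intro conjI allI impI ballI p)
    show "(\<lambda>f. f i) \<in> lmod_hom R (free_module R n) (regular R)" if "i < n" for i
      using that by (auto simp: lmod_hom_def free_module_simps PiE_iff)
    fix x assume x: "x \<in> carrier (free_module R n)"
    have sc: "x i \<odot>\<^bsub>free_module R n\<^esub> p i \<in> carrier (free_module R n)" if "i < n" for i
      using that x by (intro F.smult_closed p) (auto simp: free_module_simps PiE_iff)
    let ?s = "msum (free_module R n) (\<lambda>i. x i \<odot>\<^bsub>free_module R n\<^esub> p i) n"
    have "?s \<in> carrier (free_module R n)" by (rule F.M.msum_closed[OF sc])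
    moreover have "?s j = x j" if j: "j < n" for j
    proof -
      have xj: "x i \<in> carrier R" if "i < n" for i using x that by (auto simp: free_module_simps PiE_iff)
      have "?s j = msum R (\<lambda>i. (x i \<odot>\<^bsub>free_module R n\<^esub> p i) j) n" by (rule msum_free[OF sc j])
      also have "\<dots> = msum R (\<lambda>i. if i = j then x i else \<zero>) n"
        by (rule msum_cong) (use j xj in \<open>auto simp: free_module_simps p_def\<close>)
      also have "\<dots> = x j" using msum_delta[of x j n, OF xj[OF j]] j by simp
      finally show ?thesis .
    qed
    ultimately show "x = ?s"
      using x PiE_ext[of x "{..<n}" "\<lambda>_. carrier R" ?s]
      by (simp only: free_module_simps(1)) auto
  qed
  then show ?thesis by (auto simp: has_dual_basis_def)
qed

lemma free_module_hom:
  assumes "left_module R M" "\<And>i. i < n \<Longrightarrow> m i \<in> carrier M"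
  shows "(\<lambda>f. msum M (\<lambda>i. f i \<odot>\<^bsub>M\<^esub> m i) n) \<in> lmod_hom R (free_module R n) M"
proof -
  interpret M: left_module R M by fact
  show ?thesis
    by (intro M.lmod_hom_msum M.lmod_hom_smult_elem assms(2))
      (auto simp: lmod_hom_def free_module_simps PiE_iff)
qed

lemma ex_free_cover:
  assumes "fg_left_module R M"
  shows "\<exists>n. \<exists>f\<in>lmod_hom R (free_module R n) M. f ` carrier (free_module R n) = carrier M"
proof -
  interpret M: left_module R M using assms by (simp add: fg_left_module_def)
  obtain S where S: "generates R M S"
    using assms fin_gen_iff[OF M.left_module_axioms] by (auto simp: fg_left_module_def)
  then have "finite S" "S \<subseteq> carrier M" by (auto simp: generates_def)
  then obtain n m where m: "S = m ` {..<n::nat}"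
    using finite_imp_nat_seg_image_inj_on[of S] by (auto simp: lessThan_def)
  have mc: "m i \<in> carrier M" if "i < n" for i using that m \<open>S \<subseteq> carrier M\<close> by auto
  let ?f = "\<lambda>f. msum M (\<lambda>i. f i \<odot>\<^bsub>M\<^esub> m i) n"
  have f: "?f \<in> lmod_hom R (free_module R n) M"
    by (rule free_module_hom[OF M.left_module_axioms mc])
  have sub: "submod R M (?f ` carrier (free_module R n))"
    by (rule submod_image[OF left_module_free M.left_module_axioms f])
  have "S \<subseteq> ?f ` carrier (free_module R n)"
  proof
    fix s assume "s \<in> S"
    then obtain j where j: "j < n" "s = m j" using m by auto
    have "?f (\<lambda>i\<in>{..<n}. if i = j then \<one> else \<zero>) = msum M (\<lambda>i. if i = j then m i else \<zero>\<^bsub>M\<^esub>) n"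
      by (rule msum_cong) (use mc in \<open>auto simp: M.smult_one M.smult_l_null\<close>)
    also have "\<dots> = m j"
    proof -
      have "msum M (\<lambda>i. if i = j then m i else \<zero>\<^bsub>M\<^esub>) l = (if j < l then m j else \<zero>\<^bsub>M\<^esub>)" for l
        using mc[OF j(1)] by (induction l) (auto simp: less_Suc_eq)
      then show ?thesis using j by simp
    qed
    finally show "s \<in> ?f ` carrier (free_module R n)"
      using j by (intro image_eqI[of _ _ "\<lambda>i\<in>{..<n}. if i = j then \<one> else \<zero>"]) (auto simp: free_module_simps)
  qed
  then have "carrier M \<subseteq> ?f ` carrier (free_module R n)" by (rule generatesD[OF S sub])
  then have "?f ` carrier (free_module R n) = carrier M" using sub unfolding submod_def by blast
  then show ?thesis using f by blast
qed

end

lemma dual_basis_projective: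
  fixes R :: "('k, 'r) module"
  assumes "left_module R P" "has_dual_basis R P"
  shows "projective R P"
  unfolding projective_def
proof (intro conjI allI impI)
  show "fg_left_module R P" using assms has_dual_basis_fin_gen by (auto simp: fg_left_module_def)
  fix M N :: "('r, 'k univ) module" and g f
  assume *: "fg_left_module R M \<and> fg_left_module R N \<and> g \<in> lmod_hom R M N \<and>
    g ` carrier M = carrier N \<and> f \<in> lmod_hom R P N"
  then show "\<exists>h\<in>lmod_hom R P M. \<forall>x\<in>carrier P. g (h x) = f x"
    using dual_basis_lift[OF assms, of M N g f] lmod_hom_closed[of f R P N]
    by (auto simp: fg_left_module_def)
qed

context algebra
begin

text \<open>A free cover, moved to \<open>'k univ\<close> because the terms of a resolution are
  required to live there.\<close>

lemma ex_univ_cover: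
  assumes "fg_left_module A M"
  shows "\<exists>(F :: ('a, 'k univ) module) f. left_module A F \<and> has_dual_basis A F \<and> f \<in> lmod_hom A F M \<and>
    f ` carrier F = carrier M"
proof -
  obtain n f where f: "f \<in> lmod_hom A (free_module A n) M" "f ` carrier (free_module A n) = carrier M"
    using ex_free_cover[OF assms] by auto
  have "fg_left_module A (free_module A n)"
    using left_module_free has_dual_basis_free has_dual_basis_fin_gen by (auto simp: fg_left_module_def)
  then obtain F :: "('a, 'k univ) module" and \<iota> \<kappa>
    where F: "fg_left_module A F" "module_iso A (free_module A n) F \<iota> \<kappa>"
    using fg_univ_copy by blast
  have FL: "left_module A F" using F by (simp add: fg_left_module_def)
  have iso: "\<iota> \<in> lmod_hom A (free_module A n) F" "\<kappa> \<in> lmod_hom A F (free_module A n)"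
    "\<And>y. y \<in> carrier F \<Longrightarrow> \<iota> (\<kappa> y) = y" using F(2) by (auto simp: module_iso_def)
  have "has_dual_basis A F"
    by (rule has_dual_basis_retract[OF FL left_module_free has_dual_basis_free iso(2,1)]) (rule iso(3))
  moreover have "(\<lambda>x. f (\<kappa> x)) \<in> lmod_hom A F M" by (rule lmod_hom_comp[OF iso(2) f(1)])
  moreover have "(\<lambda>x. f (\<kappa> x)) ` carrier F = carrier M"
    using module_iso_image[OF module_iso_sym[OF F(2)]] f(2) by (simp add: image_image[symmetric])
  ultimately show ?thesis using FL by blast
qed

text \<open>The lifting property speaks only about modules on \<open>'k univ\<close>, so the
  identity of P is lifted along a free cover on that type. P is thereby a retract of a module with a
  dual basis.\<close>

lemma projective_has_dual_basis:
  fixes P :: "('a, 'k univ) module"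
  assumes "projective A P"
  shows "left_module A P" "has_dual_basis A P"
proof -
  have fg: "fg_left_module A P" using assms by (simp add: projective_def)
  then show P: "left_module A P" by (simp add: fg_left_module_def)
  obtain F :: "('a, 'k univ) module" and f where F: "left_module A F" "has_dual_basis A F"
    "f \<in> lmod_hom A F P" "f ` carrier F = carrier P" using ex_univ_cover[OF fg] by blast
  have fgF: "fg_left_module A F" using F has_dual_basis_fin_gen by (auto simp: fg_left_module_def)
  have "\<exists>h\<in>lmod_hom A P F. \<forall>x\<in>carrier P. f (h x) = x"
    using assms fg fgF F(3,4) lmod_hom_id[of A P] unfolding projective_def by blast
  then obtain h where "h \<in> lmod_hom A P F" "\<And>x. x \<in> carrier P \<Longrightarrow> f (h x) = x" by blast
  then show "has_dual_basis A P" using has_dual_basis_retract[OF P F(1,2) _ F(3)] by blast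
qed

text \<open>Kernels of covers are finitely generated by \<open>fg_submod\<close>, so each of them
  can be covered again.\<close>

lemma ex_projective_resolution:
  assumes "fg_left_module A X"
  shows "\<exists>P d e. projective_resolution A X P d e"
proof -
  define cover where "cover K = (SOME Ff :: ('a, 'k univ) module \<times> ('k univ \<Rightarrow> 'k univ).
    left_module A (fst Ff) \<and> has_dual_basis A (fst Ff) \<and> snd Ff \<in> lmod_hom A (fst Ff) K \<and>
    snd Ff ` carrier (fst Ff) = carrier K)" for K :: "('a, 'k univ) module"
  define F f where "F K = fst (cover K)" and "f K = snd (cover K)" for K
  have cover: "left_module A (F K)" "has_dual_basis A (F K)" "f K \<in> lmod_hom A (F K) K"
      "f K ` carrier (F K) = carrier K" if K: "fg_left_module A K" for K
  proof -
    have "\<exists>Ff :: ('a, 'k univ) module \<times> ('k univ \<Rightarrow> 'k univ).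
      left_module A (fst Ff) \<and> has_dual_basis A (fst Ff) \<and> snd Ff \<in> lmod_hom A (fst Ff) K \<and>
      snd Ff ` carrier (fst Ff) = carrier K" using ex_univ_cover[OF K] by auto
    from someI_ex[OF this] show "left_module A (F K)" "has_dual_basis A (F K)"
      "f K \<in> lmod_hom A (F K) K" "f K ` carrier (F K) = carrier K"
      by (simp_all add: F_def f_def cover_def)
  qed
  have fgF: "fg_left_module A F'" if "left_module A F'" "has_dual_basis A F'"
    for F' :: "('a, 'k univ) module"
    using that has_dual_basis_fin_gen by (auto simp: fg_left_module_def)
  obtain F0 :: "('a, 'k univ) module" and e where F0: "left_module A F0" "has_dual_basis A F0"
    "e \<in> lmod_hom A F0 X" "e ` carrier F0 = carrier X" using ex_univ_cover[OF assms] by blast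
  have X: "left_module A X" using assms by (simp add: fg_left_module_def)
  \<comment> \<open>The syzygies: \<open>K 0\<close> is the kernel of the augmentation and
    \<open>K (Suc n)\<close> the kernel of the cover of \<open>K n\<close>. Hence
    \<open>P (Suc n)\<close> covers \<open>K n\<close>, a submodule of \<open>P n\<close>.\<close>
  define K where "K = rec_nat (F0\<lparr>carrier := a_kernel F0 X e\<rparr>)
    (\<lambda>_ K'. (F K')\<lparr>carrier := a_kernel (F K') K' (f K')\<rparr>)"
  have K0: "K 0 = F0\<lparr>carrier := a_kernel F0 X e\<rparr>" by (simp add: K_def)
  have KS: "K (Suc n) = (F (K n))\<lparr>carrier := a_kernel (F (K n)) (K n) (f (K n))\<rparr>" for n
    by (simp add: K_def)
  have fgK: "fg_left_module A (K n)" for n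
  proof (induction n)
    case 0
    show ?case unfolding K0 by (rule fg_submod[OF fgF[OF F0(1,2)] submod_kernel[OF F0(1) X F0(3)]])
  next
    case (Suc n)
    then have "left_module A (K n)" by (simp add: fg_left_module_def)
    then show ?case unfolding KS
      by (intro fg_submod[OF fgF] submod_kernel cover Suc)
  qed
  define P where "P n = (case n of 0 \<Rightarrow> F0 | Suc m \<Rightarrow> F (K m))" for n
  define d where "d n = f (K n)" for n
  have dP: "d n ` carrier (P (Suc n)) = carrier (K n)" for n
    using cover(4)[OF fgK] by (simp add: d_def P_def)
  have d: "d n \<in> lmod_hom A (P (Suc n)) (K n)" for n
    using cover(3)[OF fgK] by (simp add: d_def P_def)
  \<comment> \<open>\<open>K n\<close> is the record of \<open>P n\<close> with a smaller carrier,
    so the cover of \<open>K n\<close> is also a map into \<open>P n\<close>.\<close>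
  have KP: "add (K n) = add (P n)" "smult (K n) = smult (P n)" "carrier (K n) \<subseteq> carrier (P n)" for n
    by (cases n; auto simp: K0 KS P_def a_kernel_def')+
  have dh: "d n \<in> lmod_hom A (P (Suc n)) (P n)" for n
    using d[of n] KP(3)[of n] unfolding lmod_hom_def KP(1,2) by (auto simp: subset_iff Pi_iff)
  have zero: "\<zero>\<^bsub>K n\<^esub> = \<zero>\<^bsub>P n\<^esub>" for n by (cases n) (auto simp: K0 KS P_def)
  have proj: "projective A (P n)" for n
    using F0 cover(1,2)[OF fgK] by (cases n) (auto simp: P_def intro: dual_basis_projective)
  have "projective_resolution A X P d e"
    unfolding projective_resolution_def
  proof (intro conjI allI proj dh)
    show "e \<in> lmod_hom A (P 0) X" "e ` carrier (P 0) = carrier X" using F0 by (auto simp: P_def)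
    show "d 0 ` carrier (P 1) = a_kernel (P 0) X e" using dP[of 0] by (simp add: K0 P_def)
    show "d (Suc i) ` carrier (P (Suc (Suc i))) = a_kernel (P (Suc i)) (P i) (d i)" for i
      using dP[of "Suc i"] zero[of i] by (simp add: KS P_def d_def a_kernel_def')
  qed
  then show ?thesis by blast
qed

end

section \<open>Resolutions and cohomology\<close>

text \<open>Exactness of Hom_R(P, N) in all positive degrees. Cochains are judged on the carriers
  only, which keeps extensionality and factor groups out of the diagram chases.\<close>

definition cohom_van :: "('r, 'c) ring_scheme \<Rightarrow> (nat \<Rightarrow> ('r, 'm, 'd) module_scheme) \<Rightarrow> (nat \<Rightarrow> 'm \<Rightarrow> 'm) \<Rightarrow>
    ('r, 'n, 'e) module_scheme \<Rightarrow> bool" where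
  "cohom_van R P d N \<longleftrightarrow> (\<forall>j. \<forall>f\<in>lmod_hom R (P (Suc j)) N.
     (\<forall>x\<in>carrier (P (Suc (Suc j))). f (d (Suc j) x) = \<zero>\<^bsub>N\<^esub>) \<longrightarrow>
     (\<exists>g\<in>lmod_hom R (P j) N. \<forall>x\<in>carrier (P (Suc j)). g (d j x) = f x))"

lemma cohom_vanD:
  "\<lbrakk>cohom_van R P d N; f \<in> lmod_hom R (P (Suc j)) N;
    \<And>x. x \<in> carrier (P (Suc (Suc j))) \<Longrightarrow> f (d (Suc j) x) = \<zero>\<^bsub>N\<^esub>\<rbrakk> \<Longrightarrow>
    \<exists>g\<in>lmod_hom R (P j) N. \<forall>x\<in>carrier (P (Suc j)). g (d j x) = f x"
  unfolding cohom_van_def by simp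

text \<open>Counterpart of \<open>projective_resolution\<close> on arbitrary types, with dual bases
  in the place of the lifting property, so that (A \<otimes> V) \<otimes> P can qualify.\<close>

definition resolution :: "('r, 'c) ring_scheme \<Rightarrow> ('r, 't, 'd) module_scheme \<Rightarrow>
    (nat \<Rightarrow> ('r, 'm, 'e) module_scheme) \<Rightarrow> (nat \<Rightarrow> 'm \<Rightarrow> 'm) \<Rightarrow> ('m \<Rightarrow> 't) \<Rightarrow> bool" where
  "resolution R T P d e \<longleftrightarrow> left_module R T \<and>
     (\<forall>i. left_module R (P i)) \<and> (\<forall>i. has_dual_basis R (P i)) \<and>
     (\<forall>i. d i \<in> lmod_hom R (P (Suc i)) (P i)) \<and> e \<in> lmod_hom R (P 0) T \<and>
     e ` carrier (P 0) = carrier T \<and> d 0 ` carrier (P (Suc 0)) = a_kernel (P 0) T e \<and>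
     (\<forall>i. d (Suc i) ` carrier (P (Suc (Suc i))) = a_kernel (P (Suc i)) (P i) (d i))"

lemma resolutionD:
  assumes "resolution R T P d e"
  shows "left_module R T" "left_module R (P i)" "has_dual_basis R (P i)"
    "d i \<in> lmod_hom R (P (Suc i)) (P i)" "e \<in> lmod_hom R (P 0) T"
    "e ` carrier (P 0) = carrier T" "d 0 ` carrier (P (Suc 0)) = a_kernel (P 0) T e"
    "d (Suc i) ` carrier (P (Suc (Suc i))) = a_kernel (P (Suc i)) (P i) (d i)"
    "x \<in> carrier (P (Suc i)) \<Longrightarrow> d i x \<in> carrier (P i)"
    "y \<in> carrier (P (Suc (Suc i))) \<Longrightarrow> d i (d (Suc i) y) = \<zero>\<^bsub>P i\<^esub>"
    "z \<in> carrier (P (Suc 0)) \<Longrightarrow> e (d 0 z) = \<zero>\<^bsub>T\<^esub>"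
proof -
  show ker: "d 0 ` carrier (P (Suc 0)) = a_kernel (P 0) T e"
    "d (Suc i) ` carrier (P (Suc (Suc i))) = a_kernel (P (Suc i)) (P i) (d i)"
    using assms by (auto simp: resolution_def)
  show "y \<in> carrier (P (Suc (Suc i))) \<Longrightarrow> d i (d (Suc i) y) = \<zero>\<^bsub>P i\<^esub>"
    using ker(2) by (auto simp: a_kernel_def' set_eq_iff image_iff)
  show "z \<in> carrier (P (Suc 0)) \<Longrightarrow> e (d 0 z) = \<zero>\<^bsub>T\<^esub>"
    using ker(1) by (auto simp: a_kernel_def' set_eq_iff image_iff)
  have d: "d i \<in> lmod_hom R (P (Suc i)) (P i)" using assms by (auto simp: resolution_def)
  then show "x \<in> carrier (P (Suc i)) \<Longrightarrow> d i x \<in> carrier (P i)" by (rule lmod_hom_closed)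
qed (use assms in \<open>auto simp: resolution_def\<close>)

text \<open>The comparison theorem; the two resolutions may live on different types, which is how a
  chosen resolution is compared with one built by a tensor functor.\<close>

lemma chain_map_lift:
  assumes Q: "resolution R T Q d' e'" and P: "resolution R T P d e"
  shows "\<exists>f. (\<forall>i. f i \<in> lmod_hom R (Q i) (P i)) \<and> (\<forall>x\<in>carrier (Q 0). e (f 0 x) = e' x) \<and>
    (\<forall>i. \<forall>x\<in>carrier (Q (Suc i)). d i (f (Suc i) x) = f i (d' i x))"
proof -
  note QD = resolutionD[OF Q] and PD = resolutionD[OF P]
  have "\<exists>f0\<in>lmod_hom R (Q 0) (P 0). \<forall>x\<in>carrier (Q 0). e (f0 x) = e' x"
    by (rule dual_basis_lift[OF QD(2,3) PD(2,1) PD(5) QD(5)]) (simp add: QD(6) PD(6))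
  then obtain f0 where f0: "f0 \<in> lmod_hom R (Q 0) (P 0)" "\<And>x. x \<in> carrier (Q 0) \<Longrightarrow> e (f0 x) = e' x"
    by blast
  \<comment> \<open>The last clause says that f after the differential lands in the image of the
    next differential of P, exactly what lifting in the next degree requires.\<close>
  let ?I = "\<lambda>n f. f \<in> lmod_hom R (Q n) (P n) \<and> (n = 0 \<longrightarrow> (\<forall>x\<in>carrier (Q 0). e (f x) = e' x)) \<and>
    (\<forall>x\<in>carrier (Q (Suc n)). f (d' n x) \<in> d n ` carrier (P (Suc n)))"
  have "\<exists>f. \<forall>n. ?I n (f n) \<and> (\<forall>x\<in>carrier (Q (Suc n)). d n (f (Suc n) x) = f n (d' n x))"
  proof (rule dependent_nat_choice[where P = ?I and
        Q = "\<lambda>n f g. \<forall>x\<in>carrier (Q (Suc n)). d n (g x) = f (d' n x)"])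
    have "f0 (d' 0 x) \<in> d 0 ` carrier (P (Suc 0))" if "x \<in> carrier (Q (Suc 0))" for x
      unfolding PD(7) using that f0 lmod_hom_closed[OF f0(1)]
      by (simp add: a_kernel_def' QD(9,11))
    then show "\<exists>f. ?I 0 f" using f0 by blast
  next
    fix f n assume f: "?I n f"
    have "(\<lambda>x. f (d' n x)) \<in> lmod_hom R (Q (Suc n)) (P n)"
      using lmod_hom_comp[OF QD(4)] f by blast
    then have "\<exists>g\<in>lmod_hom R (Q (Suc n)) (P (Suc n)). \<forall>x\<in>carrier (Q (Suc n)). d n (g x) = f (d' n x)"
      by (rule dual_basis_lift[OF QD(2,3) PD(2,2) PD(4)]) (use f in auto)
    then obtain g where g: "g \<in> lmod_hom R (Q (Suc n)) (P (Suc n))"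
      "\<And>x. x \<in> carrier (Q (Suc n)) \<Longrightarrow> d n (g x) = f (d' n x)" by blast
    have "g (d' (Suc n) x) \<in> d (Suc n) ` carrier (P (Suc (Suc n)))" if x: "x \<in> carrier (Q (Suc (Suc n)))" for x
    proof -
      have "d n (g (d' (Suc n) x)) = f \<zero>\<^bsub>Q n\<^esub>" using g(2)[OF QD(9)[OF x]] QD(10)[OF x] by simp
      also have "\<dots> = \<zero>\<^bsub>P n\<^esub>" using lmod_hom_zero[OF QD(2) PD(2)] f by blast
      finally show ?thesis unfolding PD(8) using lmod_hom_closed[OF g(1) QD(9)[OF x]]
        by (simp add: a_kernel_def')
    qed
    then show "\<exists>g. ?I (Suc n) g \<and> (\<forall>x\<in>carrier (Q (Suc n)). d n (g x) = f (d' n x))"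
      using g by blast
  qed
  then obtain f where f: "\<forall>n. ?I n (f n) \<and> (\<forall>x\<in>carrier (Q (Suc n)). d n (f (Suc n) x) = f n (d' n x))" ..
  show ?thesis
  proof (intro exI[of _ f] conjI allI)
    show "f i \<in> lmod_hom R (Q i) (P i)" for i using spec[OF f, of i] by (elim conjE)
    show "\<forall>x\<in>carrier (Q 0). e (f 0 x) = e' x" using spec[OF f, of 0] by simp
    show "\<forall>x\<in>carrier (Q (Suc i)). d i (f (Suc i) x) = f i (d' i x)" for i
      using spec[OF f, of i] by (elim conjE)
  qed
qed

text \<open>A chain map over the zero map is null-homotopic. A self-map suffices, since the lemma is
  applied to the difference of g f and the identity.\<close>

lemma chain_map_null_homotopic:
  assumes Q: "resolution R T Q d e" and u: "\<And>i. u i \<in> lmod_hom R (Q i) (Q i)"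
    "\<And>x. x \<in> carrier (Q 0) \<Longrightarrow> e (u 0 x) = \<zero>\<^bsub>T\<^esub>"
    "\<And>i x. x \<in> carrier (Q (Suc i)) \<Longrightarrow> d i (u (Suc i) x) = u i (d i x)"
  shows "\<exists>h. (\<forall>i. h i \<in> lmod_hom R (Q i) (Q (Suc i))) \<and>
    (\<forall>i. \<forall>x\<in>carrier (Q (Suc i)). u (Suc i) x = d (Suc i) (h (Suc i) x) \<oplus>\<^bsub>Q (Suc i)\<^esub> h i (d i x))"
proof -
  note QD = resolutionD[OF Q]
  \<comment> \<open>The invariant makes u - h d a cycle in the next degree: d u (x) = u d (x) = d h
    d (x). It persists because the older summand of the homotopy disappears on boundaries.\<close>
  let ?I = "\<lambda>n h. h \<in> lmod_hom R (Q n) (Q (Suc n)) \<and> (\<forall>x\<in>carrier (Q (Suc n)). u n (d n x) = d n (h (d n x)))"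
  have "\<exists>h. \<forall>n. ?I n (h n) \<and> (\<forall>x\<in>carrier (Q (Suc n)).
      u (Suc n) x = d (Suc n) (h (Suc n) x) \<oplus>\<^bsub>Q (Suc n)\<^esub> h n (d n x))"
  proof (rule dependent_nat_choice[where P = ?I and
        Q = "\<lambda>n h h'. \<forall>x\<in>carrier (Q (Suc n)). u (Suc n) x = d (Suc n) (h' x) \<oplus>\<^bsub>Q (Suc n)\<^esub> h (d n x)"])
    have "\<exists>h\<in>lmod_hom R (Q 0) (Q (Suc 0)). \<forall>x\<in>carrier (Q 0). d 0 (h x) = u 0 x"
      by (rule dual_basis_lift[OF QD(2,3) QD(2,2) QD(4) u(1)])
        (use u(2) lmod_hom_closed[OF u(1)] in \<open>auto simp: QD(7) a_kernel_def'\<close>)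
    then obtain h where h: "h \<in> lmod_hom R (Q 0) (Q (Suc 0))" "\<And>x. x \<in> carrier (Q 0) \<Longrightarrow> d 0 (h x) = u 0 x"
      by blast
    then show "\<exists>h. ?I 0 h" using QD(9) by (intro exI[of _ h]) auto
  next
    fix h n assume h: "?I n h"
    interpret Q: left_module R "Q (Suc n)" by (rule QD(2))
    interpret Qn: left_module R "Q n" by (rule QD(2))
    define v where "v x = u (Suc n) x \<ominus>\<^bsub>Q (Suc n)\<^esub> h (d n x)" for x
    have hd: "(\<lambda>x. h (d n x)) \<in> lmod_hom R (Q (Suc n)) (Q (Suc n))"
      using lmod_hom_comp[OF QD(4)] h by blast
    have v: "v \<in> lmod_hom R (Q (Suc n)) (Q (Suc n))"
      unfolding v_def by (rule Q.lmod_hom_minus[OF u(1) hd])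
    have dv: "d n (v x) = \<zero>\<^bsub>Q n\<^esub>" if x: "x \<in> carrier (Q (Suc n))" for x
    proof -
      have "d n (v x) = d n (u (Suc n) x) \<ominus>\<^bsub>Q n\<^esub> d n (h (d n x))" unfolding v_def
        by (rule lmod_hom_diff[OF QD(2,2,4) lmod_hom_closed[OF u(1) x] lmod_hom_closed[OF hd x]])
      also have "\<dots> = \<zero>\<^bsub>Q n\<^esub>" using u(3)[OF x] h x lmod_hom_closed[OF u(1) QD(9)[OF x]]
        by (simp add: Qn.M.minus_eq_zero_iff)
      finally show ?thesis .
    qed
    have "\<exists>h'\<in>lmod_hom R (Q (Suc n)) (Q (Suc (Suc n))). \<forall>x\<in>carrier (Q (Suc n)). d (Suc n) (h' x) = v x"
      by (rule dual_basis_lift[OF QD(2,3) QD(2,2) QD(4) v])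
        (use dv lmod_hom_closed[OF v] in \<open>auto simp: QD(8) a_kernel_def'\<close>)
    then obtain h' where h': "h' \<in> lmod_hom R (Q (Suc n)) (Q (Suc (Suc n)))"
      "\<And>x. x \<in> carrier (Q (Suc n)) \<Longrightarrow> d (Suc n) (h' x) = v x" by blast
    have uv: "u (Suc n) x = v x \<oplus>\<^bsub>Q (Suc n)\<^esub> h (d n x)" if x: "x \<in> carrier (Q (Suc n))" for x
      unfolding v_def using lmod_hom_closed[OF u(1) x] lmod_hom_closed[OF hd x]
      by (simp add: a_minus_def Q.M.a_assoc Q.M.l_neg)
    have h0: "h \<zero>\<^bsub>Q n\<^esub> = \<zero>\<^bsub>Q (Suc n)\<^esub>" using lmod_hom_zero[OF QD(2,2)] h by blast
    have "u (Suc n) (d (Suc n) x) = d (Suc n) (h' (d (Suc n) x))" if x: "x \<in> carrier (Q (Suc (Suc n)))" for x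
      using uv[OF QD(9)[OF x]] QD(10)[OF x] h0 h'(2)[OF QD(9)[OF x]] lmod_hom_closed[OF v QD(9)[OF x]] by simp
    then show "\<exists>h'. ?I (Suc n) h' \<and> (\<forall>x\<in>carrier (Q (Suc n)).
      u (Suc n) x = d (Suc n) (h' x) \<oplus>\<^bsub>Q (Suc n)\<^esub> h (d n x))"
      using h' uv by (intro exI[of _ h']) auto
  qed
  then obtain h where h: "\<forall>n. ?I n (h n) \<and> (\<forall>x\<in>carrier (Q (Suc n)).
      u (Suc n) x = d (Suc n) (h (Suc n) x) \<oplus>\<^bsub>Q (Suc n)\<^esub> h n (d n x))" ..
  show ?thesis
  proof (intro exI[of _ h] conjI allI)
    show "h i \<in> lmod_hom R (Q i) (Q (Suc i))" for i using spec[OF h, of i] by (elim conjE)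
    show "\<forall>x\<in>carrier (Q (Suc i)). u (Suc i) x = d (Suc i) (h (Suc i) x) \<oplus>\<^bsub>Q (Suc i)\<^esub> h i (d i x)" for i
      using spec[OF h, of i] by (elim conjE)
  qed
qed

text \<open>Makes the vanishing of Ext independent of the chosen resolution. With chain maps f, g
  between the resolutions and a homotopy h from the identity to g f, the cocycle \<phi> g on P has a
  bounding cochain \<psi>.\<close>

lemma cohom_van_resolution:
  assumes P: "resolution R T P d e" and Q: "resolution R T Q d' e'" and N: "left_module R N"
    and van: "cohom_van R P d N"
  shows "cohom_van R Q d' N"
  unfolding cohom_van_def
proof (intro allI ballI impI)
  note PD = resolutionD[OF P] and QD = resolutionD[OF Q]
  fix j \<phi> assume \<phi>: "\<phi> \<in> lmod_hom R (Q (Suc j)) N" "\<forall>x\<in>carrier (Q (Suc (Suc j))). \<phi> (d' (Suc j) x) = \<zero>\<^bsub>N\<^esub>"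
  interpret N: left_module R N by fact
  obtain f where f: "\<And>i. f i \<in> lmod_hom R (Q i) (P i)" "\<And>x. x \<in> carrier (Q 0) \<Longrightarrow> e (f 0 x) = e' x"
    "\<And>i x. x \<in> carrier (Q (Suc i)) \<Longrightarrow> d i (f (Suc i) x) = f i (d' i x)"
    using chain_map_lift[OF Q P] by blast
  obtain g where g: "\<And>i. g i \<in> lmod_hom R (P i) (Q i)" "\<And>x. x \<in> carrier (P 0) \<Longrightarrow> e' (g 0 x) = e x"
    "\<And>i x. x \<in> carrier (P (Suc i)) \<Longrightarrow> d' i (g (Suc i) x) = g i (d i x)"
    using chain_map_lift[OF P Q] by blast
  have gf: "(\<lambda>x. g i (f i x)) \<in> lmod_hom R (Q i) (Q i)" for i by (rule lmod_hom_comp[OF f(1) g(1)])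
  define u where "u i x = g i (f i x) \<ominus>\<^bsub>Q i\<^esub> x" for i x
  have fc: "f i x \<in> carrier (P i)" if "x \<in> carrier (Q i)" for i x by (rule lmod_hom_closed[OF f(1) that])
  have u1: "u i \<in> lmod_hom R (Q i) (Q i)" for i
    unfolding u_def by (rule left_module.lmod_hom_minus[OF QD(2) gf lmod_hom_id])
  have u2: "e' (u 0 x) = \<zero>\<^bsub>T\<^esub>" if x: "x \<in> carrier (Q 0)" for x
  proof -
    interpret T: left_module R T by (rule QD(1))
    have "e' (u 0 x) = e' (g 0 (f 0 x)) \<ominus>\<^bsub>T\<^esub> e' x" unfolding u_def
      by (rule lmod_hom_diff[OF QD(2,1,5) lmod_hom_closed[OF gf x] x])
    then show ?thesis using g(2)[OF fc[OF x]] f(2)[OF x] lmod_hom_closed[OF QD(5) x]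
      by (simp add: T.M.minus_eq_zero_iff)
  qed
  have u3: "d' i (u (Suc i) x) = u i (d' i x)" if x: "x \<in> carrier (Q (Suc i))" for i x
  proof -
    have "d' i (u (Suc i) x) = d' i (g (Suc i) (f (Suc i) x)) \<ominus>\<^bsub>Q i\<^esub> d' i x" unfolding u_def
      by (rule lmod_hom_diff[OF QD(2,2,4) lmod_hom_closed[OF gf x] x])
    then show ?thesis using g(3)[OF fc[OF x]] f(3)[OF x] by (simp add: u_def)
  qed
  obtain h where h: "\<And>i. h i \<in> lmod_hom R (Q i) (Q (Suc i))"
    "\<And>i x. x \<in> carrier (Q (Suc i)) \<Longrightarrow> u (Suc i) x = d' (Suc i) (h (Suc i) x) \<oplus>\<^bsub>Q (Suc i)\<^esub> h i (d' i x)"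
    using chain_map_null_homotopic[OF Q u1 u2 u3] by blast
  have "\<exists>\<psi>\<in>lmod_hom R (P j) N. \<forall>x\<in>carrier (P (Suc j)). \<psi> (d j x) = \<phi> (g (Suc j) x)"
  proof (rule cohom_vanD[OF van])
    show "(\<lambda>x. \<phi> (g (Suc j) x)) \<in> lmod_hom R (P (Suc j)) N" by (rule lmod_hom_comp[OF g(1) \<phi>(1)])
    show "\<phi> (g (Suc j) (d (Suc j) x)) = \<zero>\<^bsub>N\<^esub>" if "x \<in> carrier (P (Suc (Suc j)))" for x
      using \<phi>(2) lmod_hom_closed[OF g(1) that] by (simp add: g(3)[OF that, symmetric])
  qed
  then obtain \<psi> where \<psi>: "\<psi> \<in> lmod_hom R (P j) N" "\<And>x. x \<in> carrier (P (Suc j)) \<Longrightarrow> \<psi> (d j x) = \<phi> (g (Suc j) x)"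
    by blast
  \<comment> \<open>The bounding cochain for \<phi>: \<psi> f bounds \<phi> g f, and \<phi> h
    corrects the difference between \<phi> g f and \<phi>, because \<phi> kills boundaries.\<close>
  have "(\<lambda>y. \<psi> (f j y) \<ominus>\<^bsub>N\<^esub> \<phi> (h j y)) \<in> lmod_hom R (Q j) N"
    by (rule N.lmod_hom_minus[OF lmod_hom_comp[OF f(1) \<psi>(1)] lmod_hom_comp[OF h(1) \<phi>(1)]])
  moreover have "\<psi> (f j (d' j x)) \<ominus>\<^bsub>N\<^esub> \<phi> (h j (d' j x)) = \<phi> x" if x: "x \<in> carrier (Q (Suc j))" for x
  proof -
    have hx: "h (Suc j) x \<in> carrier (Q (Suc (Suc j)))" by (rule lmod_hom_closed[OF h(1) x])
    have hd: "h j (d' j x) \<in> carrier (Q (Suc j))" by (rule lmod_hom_closed[OF h(1) QD(9)[OF x]])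
    have gfx: "g (Suc j) (f (Suc j) x) \<in> carrier (Q (Suc j))" by (rule lmod_hom_closed[OF gf x])
    have "\<phi> (u (Suc j) x) = \<phi> (d' (Suc j) (h (Suc j) x)) \<oplus>\<^bsub>N\<^esub> \<phi> (h j (d' j x))"
      unfolding h(2)[OF x] by (rule lmod_hom_add[OF \<phi>(1) QD(9)[OF hx] hd])
    also have "\<dots> = \<phi> (h j (d' j x))" using \<phi>(2) hx lmod_hom_closed[OF \<phi>(1) hd] by simp
    finally have 1: "\<phi> (h j (d' j x)) = \<phi> (u (Suc j) x)" by simp
    have 2: "\<phi> (u (Suc j) x) = \<phi> (g (Suc j) (f (Suc j) x)) \<ominus>\<^bsub>N\<^esub> \<phi> x"
      unfolding u_def by (rule lmod_hom_diff[OF QD(2) N \<phi>(1) gfx x])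
    have 3: "\<psi> (f j (d' j x)) = \<phi> (g (Suc j) (f (Suc j) x))"
      using \<psi>(2)[OF fc[OF x]] f(3)[OF x] by simp
    show ?thesis unfolding 1 2 3
      using lmod_hom_closed[OF \<phi>(1) gfx] lmod_hom_closed[OF \<phi>(1) x]
      by (simp add: a_minus_def N.M.minus_add N.M.minus_minus N.M.r_neg2)
  qed
  ultimately show "\<exists>g\<in>lmod_hom R (Q j) N. \<forall>x\<in>carrier (Q (Suc j)). g (d' j x) = \<phi> x"
    by (intro bexI[of _ "\<lambda>y. \<psi> (f j y) \<ominus>\<^bsub>N\<^esub> \<phi> (h j y)"] ballI)
qed

section \<open>Ext and subquotients\<close>

lemma trivial_A_Mod_iff:
  assumes "abelian_group G" "\<zero>\<^bsub>G\<^esub> \<in> D" "D \<subseteq> carrier G"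
    "\<And>x y. \<lbrakk>x \<in> D; y \<in> D\<rbrakk> \<Longrightarrow> x \<oplus>\<^bsub>G\<^esub> y \<in> D" "\<And>x. x \<in> D \<Longrightarrow> \<ominus>\<^bsub>G\<^esub> x \<in> D"
  shows "trivial_group (G A_Mod D) \<longleftrightarrow> carrier G \<subseteq> D"
proof -
  interpret G: abelian_group G by fact
  have "additive_subgroup D G"
    by (rule additive_subgroup.intro, rule G.add.subgroupI)
      (use assms in \<open>auto simp: a_inv_def\<close>)
  then interpret D: abelian_subgroup D G
    by (rule abelian_subgroupI3) (rule assms(1))
  have one: "one (G A_Mod D) = D" "carrier (G A_Mod D) = {D +>\<^bsub>G\<^esub> x |x. x \<in> carrier G}"
    by (auto simp: A_FactGroup_def' A_RCOSETS_def')
  have "carrier (G A_Mod D) = {D} \<longleftrightarrow> carrier G \<subseteq> D"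
  proof
    assume *: "carrier (G A_Mod D) = {D}"
    show "carrier G \<subseteq> D"
    proof
      fix x assume x: "x \<in> carrier G"
      then have "D +>\<^bsub>G\<^esub> x = D" using * one by auto
      then show "x \<in> D" using D.a_rcos_self[OF x] by simp
    qed
  next
    assume *: "carrier G \<subseteq> D"
    have "D +>\<^bsub>G\<^esub> x = D" if "x \<in> carrier G" for x
      using D.a_rcos_const * that by auto
    then show "carrier (G A_Mod D) = {D}" unfolding one(2) by auto
  qed
  then show ?thesis
    using D.a_factorgroup_is_group one(1) by (simp add: trivial_group_def)
qed

lemma abelian_group_hom_add_hom:
  assumes "abelian_group G" "abelian_group H" "f \<in> add_hom G H"
  shows "abelian_group_hom G H f"
proof -
  have "f \<in> hom (add_monoid G) (add_monoid H)" using assms(3) by (auto simp: add_hom_def hom_def)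
  then show ?thesis
    by (intro abelian_group_homI assms(1,2) group_hom.intro group_hom_axioms.intro
        abelian_group.a_group[OF assms(1)] abelian_group.a_group[OF assms(2)])
qed

text \<open>Serves Ext and Tor alike, since both definitions form the factor group of a kernel
  record by an image.\<close>

lemma trivial_homology_iff:
  assumes G0: "abelian_group G0" and G1: "abelian_group G1" and G2: "abelian_group G2"
    and \<alpha>: "\<alpha> \<in> add_hom G0 G1" and \<beta>: "\<beta> \<in> add_hom G1 G2"
    and \<beta>\<alpha>: "\<And>x. x \<in> carrier G0 \<Longrightarrow> \<beta> (\<alpha> x) = \<zero>\<^bsub>G2\<^esub>"
  shows "trivial_group ((G1\<lparr>carrier := a_kernel G1 G2 \<beta>\<rparr>) A_Mod (\<alpha> ` carrier G0)) \<longleftrightarrow>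
    a_kernel G1 G2 \<beta> \<subseteq> \<alpha> ` carrier G0"
proof -
  interpret H: abelian_group G1 by fact
  let ?Z = "a_kernel G1 G2 \<beta>"
  let ?D = "\<alpha> ` carrier G0"
  let ?G = "G1\<lparr>carrier := ?Z\<rparr>"
  have Zsub: "additive_subgroup ?Z G1"
    by (rule abelian_group_hom.additive_subgroup_a_kernel[OF abelian_group_hom_add_hom[OF G1 G2 \<beta>]])
  have Dsub: "additive_subgroup ?D G1"
    by (rule additive_subgroup.intro)
      (use group_hom.img_is_subgroup[OF abelian_group_hom.a_group_hom[OF
          abelian_group_hom_add_hom[OF G0 G1 \<alpha>]]] in simp)
  have Gab: "abelian_group ?G"
  proof (rule abelian_groupI)
    fix f assume f: "f \<in> carrier ?G"
    then have fH: "f \<in> carrier G1" by (auto simp: a_kernel_def')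
    have "f \<in> ?Z" using f by simp
    then have "\<ominus>\<^bsub>G1\<^esub> f \<in> ?Z"
      unfolding a_inv_def by (rule subgroup.m_inv_closed[OF additive_subgroup.a_subgroup[OF Zsub]])
    then show "\<exists>y\<in>carrier ?G. y \<oplus>\<^bsub>?G\<^esub> f = \<zero>\<^bsub>?G\<^esub>"
      using H.l_neg[OF fH] by (intro bexI[of _ "\<ominus>\<^bsub>G1\<^esub> f"]) auto
  qed (use additive_subgroup.a_closed[OF Zsub] additive_subgroup.zero_closed[OF Zsub]
        additive_subgroup.a_Hcarr[OF Zsub] H.a_assoc H.a_comm H.l_zero in auto)
  have DZ: "?D \<subseteq> ?Z" using \<beta>\<alpha> add_hom_closed[OF \<alpha>] by (auto simp: a_kernel_def')
  \<comment> \<open>The inverse in the restricted record is defined afresh from that record, so it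
    has to be identified with the inverse in \<open>G1\<close>.\<close>
  have neg: "\<ominus>\<^bsub>?G\<^esub> f \<in> ?D" if f: "f \<in> ?D" for f
  proof -
    have fZ: "f \<in> carrier ?G" using f DZ by auto
    have fH: "f \<in> carrier G1" using f add_hom_closed[OF \<alpha>] by auto
    have nD: "\<ominus>\<^bsub>G1\<^esub> f \<in> ?D"
      unfolding a_inv_def by (rule subgroup.m_inv_closed[OF additive_subgroup.a_subgroup[OF Dsub] f])
    have "\<ominus>\<^bsub>?G\<^esub> f = \<ominus>\<^bsub>G1\<^esub> f"
      by (rule abelian_group.minus_equality[OF Gab]) (use nD DZ fZ H.l_neg[OF fH] in auto)
    then show ?thesis using nD by simp
  qed
  have "trivial_group (?G A_Mod ?D) \<longleftrightarrow> carrier ?G \<subseteq> ?D"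
    by (rule trivial_A_Mod_iff[OF Gab]) (use DZ neg additive_subgroup.a_closed[OF Dsub]
        additive_subgroup.zero_closed[OF Dsub] in auto)
  then show ?thesis by simp
qed

lemma Hom_group_simps [simp]:
  "carrier (Hom_group R M N) = lmod_hom R M N \<inter> extensional (carrier M)"
  "\<zero>\<^bsub>Hom_group R M N\<^esub> = (\<lambda>x\<in>carrier M. \<zero>\<^bsub>N\<^esub>)"
  "f \<oplus>\<^bsub>Hom_group R M N\<^esub> g = (\<lambda>x\<in>carrier M. f x \<oplus>\<^bsub>N\<^esub> g x)"
  by (simp_all add: Hom_group_def)

lemma lmod_hom_restrict: "\<lbrakk>left_module R M; f \<in> lmod_hom R M N\<rbrakk> \<Longrightarrow> restrict f (carrier M) \<in> lmod_hom R M N"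
  by (rule lmod_hom_cong[of R M f N]) auto

lemma abelian_group_Hom_group:
  assumes "left_module R M" "left_module R N"
  shows "abelian_group (Hom_group R M N)"
proof -
  interpret M: left_module R M by fact
  interpret N: left_module R N by fact
  have c: "f x \<in> carrier N" if "f \<in> lmod_hom R M N" "x \<in> carrier M" for f x
    by (rule lmod_hom_closed[OF that])
  show ?thesis
  proof (rule abelian_groupI)
    fix f assume f: "f \<in> carrier (Hom_group R M N)"
    have "(\<lambda>x\<in>carrier M. \<zero>\<^bsub>N\<^esub> \<ominus>\<^bsub>N\<^esub> f x) \<in> carrier (Hom_group R M N)"
      using f lmod_hom_restrict[OF assms(1) N.lmod_hom_minus[OF N.lmod_hom_const_zero]] by auto
    moreover have "(\<lambda>x\<in>carrier M. \<zero>\<^bsub>N\<^esub> \<ominus>\<^bsub>N\<^esub> f x) \<oplus>\<^bsub>Hom_group R M N\<^esub> f = \<zero>\<^bsub>Hom_group R M N\<^esub>"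
      using f c by (auto simp: fun_eq_iff a_minus_def N.M.l_neg)
    ultimately show "\<exists>g\<in>carrier (Hom_group R M N). g \<oplus>\<^bsub>Hom_group R M N\<^esub> f = \<zero>\<^bsub>Hom_group R M N\<^esub>" by blast
  next
    fix f assume "f \<in> carrier (Hom_group R M N)"
    then show "\<zero>\<^bsub>Hom_group R M N\<^esub> \<oplus>\<^bsub>Hom_group R M N\<^esub> f = f"
      using c by (auto simp: fun_eq_iff extensional_def)
  next
    fix f g assume "f \<in> carrier (Hom_group R M N)" "g \<in> carrier (Hom_group R M N)"
    then show "f \<oplus>\<^bsub>Hom_group R M N\<^esub> g \<in> carrier (Hom_group R M N)"
      using lmod_hom_restrict[OF assms(1) N.lmod_hom_plus] by auto
  next
    show "\<zero>\<^bsub>Hom_group R M N\<^esub> \<in> carrier (Hom_group R M N)"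
      using lmod_hom_restrict[OF assms(1) N.lmod_hom_const_zero] by auto
  qed (auto simp: fun_eq_iff c N.M.a_ac)
qed

text \<open>The choice operator returns a projective resolution because one exists; its terms live
  on \<open>'k univ\<close>, so they have dual bases.\<close>

lemma (in algebra) chosen_resolution:
  assumes "fg_left_module A X" "chosen_resolution A X = (P, d)"
  shows "\<exists>e. resolution A X P d e"
proof -
  have "\<exists>Pd. case Pd of (P, d) \<Rightarrow> \<exists>e. projective_resolution A X P d e"
    using ex_projective_resolution[OF assms(1)] by auto
  from someI_ex[OF this] obtain e where e: "projective_resolution A X P d e"
    using assms(2) by (auto simp: chosen_resolution_def)
  have "projective A (P i)" for i using e by (simp add: projective_resolution_def)
  then have "resolution A X P d e"
    using e assms(1) projective_has_dual_basis
    by (auto simp: resolution_def projective_resolution_def fg_left_module_def)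
  then show ?thesis by blast
qed

lemma restrict_comp_lmod_hom:
  assumes "left_module R M" "f \<in> lmod_hom R M' N" "d \<in> lmod_hom R M M'"
  shows "compose (carrier M) f d \<in> lmod_hom R M N \<inter> extensional (carrier M)"
  using lmod_hom_restrict[OF assms(1) lmod_hom_comp[OF assms(3,2)]]
  by (auto simp: compose_def)

text \<open>The definition of Ext uses groups of extensional maps, \<open>cohom_van\<close>
  arbitrary ones. Beyond \<open>trivial_homology_iff\<close> the work is to restrict cochains and to
  read their equality pointwise.\<close>

lemma (in algebra) Ext_trivial_iff:
  assumes "fg_left_module A X" "chosen_resolution A X = (P, d)" "left_module A N"
  shows "(\<forall>i\<ge>1. trivial_group (Ext A X N i)) \<longleftrightarrow> cohom_van A P d N"
proof -
  obtain e where "resolution A X P d e" using chosen_resolution[OF assms(1,2)] ..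
  note PD = resolutionD[OF this]
  interpret N: left_module A N by fact
  let ?H = "\<lambda>j. Hom_group A (P j) N"
  let ?\<delta> = "\<lambda>j f. compose (carrier (P (Suc j))) f (d j)"
  have Hab: "abelian_group (?H j)" for j by (rule abelian_group_Hom_group[OF PD(2) assms(3)])
  have step: "trivial_group (Ext A X N (Suc j)) \<longleftrightarrow>
     (\<forall>f\<in>lmod_hom A (P (Suc j)) N. (\<forall>x\<in>carrier (P (Suc (Suc j))). f (d (Suc j) x) = \<zero>\<^bsub>N\<^esub>) \<longrightarrow>
     (\<exists>g\<in>lmod_hom A (P j) N. \<forall>x\<in>carrier (P (Suc j)). g (d j x) = f x))" for j
  proof -
    let ?Z = "a_kernel (?H (Suc j)) (?H (Suc (Suc j))) (?\<delta> (Suc j))"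
    let ?D = "?\<delta> j ` carrier (?H j)"
    let ?G = "(?H (Suc j))\<lparr>carrier := ?Z\<rparr>"
    have add: "?\<delta> i \<in> add_hom (?H i) (?H (Suc i))" for i
    proof (rule add_homI)
      show "?\<delta> i f \<in> carrier (?H (Suc i))" if "f \<in> carrier (?H i)" for f
        using that restrict_comp_lmod_hom[OF PD(2) _ PD(4)] by auto
      show "?\<delta> i (f \<oplus>\<^bsub>?H i\<^esub> g) = ?\<delta> i f \<oplus>\<^bsub>?H (Suc i)\<^esub> ?\<delta> i g"
        if "f \<in> carrier (?H i)" "g \<in> carrier (?H i)" for f g
        by (auto simp: compose_def fun_eq_iff PD(9))
    qed
    have \<delta>\<delta>: "?\<delta> (Suc j) (?\<delta> j g) = \<zero>\<^bsub>?H (Suc (Suc j))\<^esub>" if "g \<in> carrier (?H j)" for g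
      using that lmod_hom_zero[OF PD(2) assms(3), of g]
      by (auto simp: compose_def fun_eq_iff PD(9,10))
    have "trivial_group (Ext A X N (Suc j)) \<longleftrightarrow> trivial_group (?G A_Mod ?D)"
      by (simp add: Ext_def assms(2) Let_def)
    also have "\<dots> \<longleftrightarrow> carrier ?G \<subseteq> ?D"
      using trivial_homology_iff[OF Hab Hab Hab add[of j] add[of "Suc j"]] \<delta>\<delta> by simp
    also have "\<dots> \<longleftrightarrow> (\<forall>f\<in>lmod_hom A (P (Suc j)) N. (\<forall>x\<in>carrier (P (Suc (Suc j))). f (d (Suc j) x) = \<zero>\<^bsub>N\<^esub>) \<longrightarrow>
     (\<exists>g\<in>lmod_hom A (P j) N. \<forall>x\<in>carrier (P (Suc j)). g (d j x) = f x))" (is "?L \<longleftrightarrow> ?R")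
    proof
      assume L: ?L
      show ?R
      proof (intro ballI impI)
        fix f assume f: "f \<in> lmod_hom A (P (Suc j)) N" "\<forall>x\<in>carrier (P (Suc (Suc j))). f (d (Suc j) x) = \<zero>\<^bsub>N\<^esub>"
        let ?f = "restrict f (carrier (P (Suc j)))"
        have "?f \<in> carrier ?G" using f lmod_hom_restrict[OF PD(2) f(1)]
          by (auto simp: a_kernel_def' compose_def fun_eq_iff PD(9))
        then obtain g where g: "g \<in> lmod_hom A (P j) N" "?f = ?\<delta> j g" using L by auto
        have "g (d j x) = f x" if "x \<in> carrier (P (Suc j))" for x
          using fun_cong[OF g(2), of x] that by (simp add: compose_def)
        then show "\<exists>g\<in>lmod_hom A (P j) N. \<forall>x\<in>carrier (P (Suc j)). g (d j x) = f x" using g by blast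
      qed
    next
      assume R: ?R
      show ?L
      proof
        fix f assume f: "f \<in> carrier ?G"
        then have fh: "f \<in> lmod_hom A (P (Suc j)) N" "f \<in> extensional (carrier (P (Suc j)))"
          by (auto simp: a_kernel_def')
        have "f (d (Suc j) x) = \<zero>\<^bsub>N\<^esub>" if "x \<in> carrier (P (Suc (Suc j)))" for x
        proof -
          have "?\<delta> (Suc j) f = \<zero>\<^bsub>?H (Suc (Suc j))\<^esub>" using f by (simp add: a_kernel_def')
          then have "?\<delta> (Suc j) f x = \<zero>\<^bsub>?H (Suc (Suc j))\<^esub> x" by (rule fun_cong)
          then show ?thesis using that by (simp add: compose_def)
        qed
        then obtain g where g: "g \<in> lmod_hom A (P j) N" "\<And>x. x \<in> carrier (P (Suc j)) \<Longrightarrow> g (d j x) = f x"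
          using R fh(1) by blast
        have "f = ?\<delta> j (restrict g (carrier (P j)))"
          using fh(2) g(2) by (auto simp: compose_def fun_eq_iff extensional_def PD(9))
        then show "f \<in> ?D" using lmod_hom_restrict[OF PD(2) g(1)] by (intro image_eqI) auto
      qed
    qed
    finally show ?thesis .
  qed
  have "(\<forall>i\<ge>1. trivial_group (Ext A X N i)) \<longleftrightarrow> (\<forall>j. trivial_group (Ext A X N (Suc j)))"
    by (metis One_nat_def Suc_le_D le_add1 plus_1_eq_Suc)
  then show ?thesis unfolding step cohom_van_def .
qed

section \<open>Injective modules\<close>

text \<open>\<open>injective\<close> supplies extensions only along injective maps between modules
  on \<open>'k univ\<close>. So E' is copied to that type and f is passed through the image of
  \<delta>, where it is well defined because it kills the kernel of \<delta>.\<close>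

lemma (in algebra) injective_extend:
  fixes E E' :: "('a, 'm) module"
  assumes "injective A I" "left_module A E" "fg_left_module A E'"
    "\<delta> \<in> lmod_hom A E E'" "f \<in> lmod_hom A E I" "\<And>x. \<lbrakk>x \<in> carrier E; \<delta> x = \<zero>\<^bsub>E'\<^esub>\<rbrakk> \<Longrightarrow> f x = \<zero>\<^bsub>I\<^esub>"
  shows "\<exists>g\<in>lmod_hom A E' I. \<forall>x\<in>carrier E. g (\<delta> x) = f x"
proof -
  have E': "left_module A E'" using assms(3) by (simp add: fg_left_module_def)
  obtain N :: "('a, 'k univ) module" and \<iota> \<kappa> where N: "fg_left_module A N" "module_iso A E' N \<iota> \<kappa>"
    using fg_univ_copy[OF assms(3)] by blast
  have NL: "left_module A N" using N by (simp add: fg_left_module_def)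
  have IL: "left_module A I" using assms(1) by (simp add: injective_def fg_left_module_def)
  interpret E: left_module A E by fact
  interpret I: left_module A I by (rule IL)
  have \<iota>: "\<iota> \<in> lmod_hom A E' N" "\<And>x. x \<in> carrier E' \<Longrightarrow> \<kappa> (\<iota> x) = x"
    using N(2) by (auto simp: module_iso_def)
  define a where "a x = \<iota> (\<delta> x)" for x
  have a: "a \<in> lmod_hom A E N" unfolding a_def by (rule lmod_hom_comp[OF assms(4) \<iota>(1)])
  have sub: "submod A N (a ` carrier E)" by (rule submod_image[OF assms(2) NL a])
  let ?M = "N\<lparr>carrier := a ` carrier E\<rparr>"
  \<comment> \<open>The value at an arbitrarily chosen preimage; two preimages differ by an element
    of the kernel of \<delta>.\<close>
  define f' where "f' y = f (SOME x. x \<in> carrier E \<and> a x = y)" for y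
  have f': "f' (a x) = f x" if x: "x \<in> carrier E" for x
  proof -
    have "\<exists>z. z \<in> carrier E \<and> a z = a x" using x by blast
    from someI_ex[OF this] obtain z where z: "z \<in> carrier E" "a z = a x" "f' (a x) = f z"
      by (auto simp: f'_def)
    have \<delta>: "\<delta> z \<in> carrier E'" "\<delta> x \<in> carrier E'" using x z lmod_hom_closed[OF assms(4)] by auto
    have "\<delta> z = \<kappa> (a z)" "\<delta> x = \<kappa> (a x)" unfolding a_def using \<iota>(2) \<delta> by simp_all
    then have "\<delta> z = \<delta> x" unfolding z(2) by simp
    then have "\<delta> (z \<ominus>\<^bsub>E\<^esub> x) = \<zero>\<^bsub>E'\<^esub>"
      using lmod_hom_diff[OF assms(2) E' assms(4) z(1) x] \<delta>
        abelian_group.minus_eq_zero_iff[OF left_module_abelian_group[OF E']] by simp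
    then have "f (z \<ominus>\<^bsub>E\<^esub> x) = \<zero>\<^bsub>I\<^esub>" using assms(6) x z(1) by simp
    then have "f z = f x"
      using lmod_hom_diff[OF assms(2) IL assms(5) z(1) x] x z(1) lmod_hom_closed[OF assms(5)]
      by (simp add: I.M.minus_eq_zero_iff)
    then show ?thesis using z by simp
  qed
  have f'h: "f' \<in> lmod_hom A ?M I"
  proof (rule lmod_homI)
    show "f' y \<in> carrier I" if "y \<in> carrier ?M" for y
      using that f' lmod_hom_closed[OF assms(5)] by auto
    show "f' (y \<oplus>\<^bsub>?M\<^esub> y') = f' y \<oplus>\<^bsub>I\<^esub> f' y'" if yy: "y \<in> carrier ?M" "y' \<in> carrier ?M" for y y'
    proof -
      obtain x x' where x: "y = a x" "y' = a x'" "x \<in> carrier E" "x' \<in> carrier E" using yy by auto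
      then have "y \<oplus>\<^bsub>?M\<^esub> y' = a (x \<oplus>\<^bsub>E\<^esub> x')" using lmod_hom_add[OF a] by simp
      then show ?thesis using x f' lmod_hom_add[OF assms(5)] by simp
    qed
    show "f' (r \<odot>\<^bsub>?M\<^esub> y) = r \<odot>\<^bsub>I\<^esub> f' y" if r: "r \<in> carrier A" and y: "y \<in> carrier ?M" for r y
    proof -
      obtain x where x: "y = a x" "x \<in> carrier E" using y by auto
      then have "r \<odot>\<^bsub>?M\<^esub> y = a (r \<odot>\<^bsub>E\<^esub> x)" using lmod_hom_smult[OF a r] by simp
      then show ?thesis using x r f' lmod_hom_smult[OF assms(5)] E.smult_closed by simp
    qed
  qed
  have inc: "(\<lambda>x. x) \<in> lmod_hom A ?M N" "inj_on (\<lambda>x. x) (carrier ?M)"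
    using sub by (auto simp: lmod_hom_def submod_def)
  have "\<exists>h\<in>lmod_hom A N I. \<forall>x\<in>carrier ?M. h x = f' x"
    using assms(1)[unfolded injective_def, THEN conjunct2, rule_format, of ?M N "\<lambda>x. x" f']
      fg_submod[OF N(1) sub] N(1) inc f'h by simp
  then obtain h where h: "h \<in> lmod_hom A N I" "\<And>x. x \<in> carrier E \<Longrightarrow> h (a x) = f x"
    using f' by auto
  then show ?thesis
    using lmod_hom_comp[OF \<iota>(1) h(1)] by (intro bexI[of _ "\<lambda>x. h (\<iota> x)"]) (auto simp: a_def)
qed

text \<open>The integer multiples are the coefficients in the sums that define
  \<open>tensor_lift\<close>.\<close>

lemma (in abelian_group) add_pow_int:
  fixes i j :: int
  assumes "x \<in> carrier G"
  shows "[i] \<cdot>\<^bsub>G\<^esub> x \<in> carrier G" "[(0 :: int)] \<cdot>\<^bsub>G\<^esub> x = \<zero>" "[(1 :: int)] \<cdot>\<^bsub>G\<^esub> x = x"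
    "[(i + j)] \<cdot>\<^bsub>G\<^esub> x = [i] \<cdot>\<^bsub>G\<^esub> x \<oplus> [j] \<cdot>\<^bsub>G\<^esub> x"
  using assms group.int_pow_closed[OF a_group, of x i] group.int_pow_mult[OF a_group, of x i j]
    group.int_pow_1[OF a_group, of x]
  by (simp_all add: add_pow_def)

section \<open>Tensor products\<close>

text \<open>Two groups with actions under which they are closed are all that the relations of
  \<open>tensor\<close> mention. In this generality the locale also covers the bimodule A \<otimes>
  V, whose \<open>smult\<close> is its right action.\<close>

locale tensor_factors =
  fixes R :: "('r, 'c) ring_scheme" and M :: "('r, 'm, 'd) module_scheme"
    and N :: "('r, 'n, 'e) module_scheme"
  assumes abelian_M: "abelian_group M" and abelian_N: "abelian_group N"
    and smult_M: "\<lbrakk>r \<in> carrier R; x \<in> carrier M\<rbrakk> \<Longrightarrow> r \<odot>\<^bsub>M\<^esub> x \<in> carrier M"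
    and smult_N: "\<lbrakk>r \<in> carrier R; y \<in> carrier N\<rbrakk> \<Longrightarrow> r \<odot>\<^bsub>N\<^esub> y \<in> carrier N"
begin

sublocale M: abelian_group M by (rule abelian_M)
sublocale N: abelian_group N by (rule abelian_N)

abbreviation "F \<equiv> free_Abelian_group (carrier M \<times> carrier N)"
abbreviation "T \<equiv> tensor R M N"
abbreviation "rel \<equiv> tensor_relations R M N"
abbreviation "pur \<equiv> pure R M N"

sublocale F: comm_group F by (rule abelian_free_Abelian_group)

abbreviation "gens \<equiv> {frag_of (x \<oplus>\<^bsub>M\<^esub> x', y) - frag_of (x, y) - frag_of (x', y) |x x' y.
         x \<in> carrier M \<and> x' \<in> carrier M \<and> y \<in> carrier N} \<union>
      {frag_of (x, y \<oplus>\<^bsub>N\<^esub> y') - frag_of (x, y) - frag_of (x, y') |x y y'.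
         x \<in> carrier M \<and> y \<in> carrier N \<and> y' \<in> carrier N} \<union>
      {frag_of (r \<odot>\<^bsub>M\<^esub> x, y) - frag_of (x, r \<odot>\<^bsub>N\<^esub> y) |r x y.
         r \<in> carrier R \<and> x \<in> carrier M \<and> y \<in> carrier N}"

lemma keys_diff_subset: "\<lbrakk>Poly_Mapping.keys a \<subseteq> S; Poly_Mapping.keys b \<subseteq> S\<rbrakk> \<Longrightarrow> Poly_Mapping.keys (a - b) \<subseteq> S"
  using keys_diff[of a b] by blast

lemma gens_subset: "gens \<subseteq> carrier F"
proof
  fix h assume "h \<in> gens"
  then show "h \<in> carrier F"
    by (elim UnE CollectE exE conjE) (simp_all add: keys_diff_subset smult_M smult_N)
qed

lemma subgroup_rel: "subgroup rel F"
  unfolding tensor_relations_def by (rule F.generate_is_subgroup[OF gens_subset])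

lemma normal_rel: "rel \<lhd> F" by (rule F.subgroup_imp_normal[OF subgroup_rel])

abbreviation "coset c \<equiv> rel #>\<^bsub>F\<^esub> c"

lemma T_simps:
  "carrier T = carrier (F Mod rel)" "\<zero>\<^bsub>T\<^esub> = \<one>\<^bsub>F Mod rel\<^esub>" "add T = mult (F Mod rel)"
  by (simp_all add: tensor_def Let_def)

lemma carrier_T: "carrier T = coset ` carrier F"
  by (auto simp: T_simps FactGroup_def RCOSETS_def)

lemma coset_add: "\<lbrakk>Poly_Mapping.keys c \<subseteq> carrier M \<times> carrier N; Poly_Mapping.keys d \<subseteq> carrier M \<times> carrier N\<rbrakk> \<Longrightarrow>
    coset c \<oplus>\<^bsub>T\<^esub> coset d = coset (c + d)"
  using normal.rcos_sum[OF normal_rel, of c d] by (simp add: T_simps FactGroup_def)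

lemma coset_eqI:
  assumes "c - d \<in> rel" "Poly_Mapping.keys c \<subseteq> carrier M \<times> carrier N" "Poly_Mapping.keys d \<subseteq> carrier M \<times> carrier N"
  shows "coset c = coset d"
proof -
  have "c \<in> coset d"
    using subgroup.rcos_module_rev[OF subgroup_rel F.is_group, of d c] assms by simp
  then show ?thesis using F.repr_independence[of c rel d] subgroup_rel assms(3) by simp
qed

lemma abelian_T: "abelian_group T"
proof -
  have "group (F Mod rel)" by (rule normal.factorgroup_is_group[OF normal_rel])
  then interpret Q: group "F Mod rel" .
  show ?thesis
  proof (rule abelian_groupI)
    show "x \<oplus>\<^bsub>T\<^esub> y = y \<oplus>\<^bsub>T\<^esub> x" if "x \<in> carrier T" "y \<in> carrier T" for x y
      using that by (auto simp: carrier_T coset_add add.commute)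
    show "\<exists>y\<in>carrier T. y \<oplus>\<^bsub>T\<^esub> x = \<zero>\<^bsub>T\<^esub>" if "x \<in> carrier T" for x
      using that Q.l_inv_ex by (auto simp: T_simps)
  qed (auto simp: T_simps Q.m_assoc simp del: mult_FactGroup one_FactGroup)
qed

sublocale T: abelian_group T by (rule abelian_T)

lemma coset_zero: "coset 0 = \<zero>\<^bsub>T\<^esub>"
proof -
  have "coset 0 \<oplus>\<^bsub>T\<^esub> coset 0 = coset 0" by (simp add: coset_add)
  moreover have "coset 0 \<in> carrier T" unfolding carrier_T by (rule imageI) simp
  ultimately show ?thesis by (metis T.add.l_cancel_one')
qed

lemma pure_coset: "pur x y = coset (frag_of (x, y))" by (simp add: pure_def)

lemma pure_closed: "\<lbrakk>x \<in> carrier M; y \<in> carrier N\<rbrakk> \<Longrightarrow> pur x y \<in> carrier T"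
  unfolding carrier_T pure_coset by (rule imageI) simp

lemma rel_incl:
  "\<lbrakk>x \<in> carrier M; x' \<in> carrier M; y \<in> carrier N\<rbrakk> \<Longrightarrow>
    frag_of (x \<oplus>\<^bsub>M\<^esub> x', y) - frag_of (x, y) - frag_of (x', y) \<in> rel"
  "\<lbrakk>x \<in> carrier M; y \<in> carrier N; y' \<in> carrier N\<rbrakk> \<Longrightarrow>
    frag_of (x, y \<oplus>\<^bsub>N\<^esub> y') - frag_of (x, y) - frag_of (x, y') \<in> rel"
  "\<lbrakk>r \<in> carrier R; x \<in> carrier M; y \<in> carrier N\<rbrakk> \<Longrightarrow> frag_of (r \<odot>\<^bsub>M\<^esub> x, y) - frag_of (x, r \<odot>\<^bsub>N\<^esub> y) \<in> rel"
  unfolding tensor_relations_def by (rule generate.incl, blast)+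

lemma pure_add_left:
  assumes "x \<in> carrier M" "x' \<in> carrier M" "y \<in> carrier N"
  shows "pur (x \<oplus>\<^bsub>M\<^esub> x') y = pur x y \<oplus>\<^bsub>T\<^esub> pur x' y"
proof -
  have "coset (frag_of (x \<oplus>\<^bsub>M\<^esub> x', y)) = coset (frag_of (x, y) + frag_of (x', y))"
    by (rule coset_eqI) (use assms rel_incl(1)[OF assms] keys_add[of "frag_of (x, y)" "frag_of (x', y)"] in
        \<open>auto simp: diff_diff_eq\<close>)
  then show ?thesis using assms by (simp add: pure_coset coset_add)
qed

lemma pure_add_right:
  assumes "x \<in> carrier M" "y \<in> carrier N" "y' \<in> carrier N"
  shows "pur x (y \<oplus>\<^bsub>N\<^esub> y') = pur x y \<oplus>\<^bsub>T\<^esub> pur x y'"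
proof -
  have "coset (frag_of (x, y \<oplus>\<^bsub>N\<^esub> y')) = coset (frag_of (x, y) + frag_of (x, y'))"
    by (rule coset_eqI) (use assms rel_incl(2)[OF assms] keys_add[of "frag_of (x, y)" "frag_of (x, y')"] in
        \<open>auto simp: diff_diff_eq\<close>)
  then show ?thesis using assms by (simp add: pure_coset coset_add)
qed

lemma pure_balanced:
  assumes "r \<in> carrier R" "x \<in> carrier M" "y \<in> carrier N"
  shows "pur (r \<odot>\<^bsub>M\<^esub> x) y = pur x (r \<odot>\<^bsub>N\<^esub> y)"
  unfolding pure_coset
  by (rule coset_eqI) (use assms rel_incl(3)[OF assms] smult_M smult_N in auto)

lemma pure_add_hom_left: "y \<in> carrier N \<Longrightarrow> (\<lambda>x. pur x y) \<in> add_hom M T"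
  by (auto simp: add_hom_def pure_closed pure_add_left)

lemma pure_add_hom_right: "x \<in> carrier M \<Longrightarrow> pur x \<in> add_hom N T"
  by (auto simp: add_hom_def pure_closed pure_add_right)

lemma pure_zero_left: "y \<in> carrier N \<Longrightarrow> pur \<zero>\<^bsub>M\<^esub> y = \<zero>\<^bsub>T\<^esub>"
  using add_hom_zero[OF abelian_M abelian_T pure_add_hom_left] by simp

lemma pure_zero_right: "x \<in> carrier M \<Longrightarrow> pur x \<zero>\<^bsub>N\<^esub> = \<zero>\<^bsub>T\<^esub>"
  using add_hom_zero[OF abelian_N abelian_T pure_add_hom_right] by simp

text \<open>Every element is a sum of pure tensors without signs, because -(x \<otimes> y) = (-x)
  \<otimes> y.\<close>

lemma tensor_induct [consumes 1, case_names pure add]: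
  assumes "t \<in> carrier T"
    and pure: "\<And>x y. \<lbrakk>x \<in> carrier M; y \<in> carrier N\<rbrakk> \<Longrightarrow> P (pur x y)"
    and add: "\<And>s t. \<lbrakk>s \<in> carrier T; t \<in> carrier T; P s; P t\<rbrakk> \<Longrightarrow> P (s \<oplus>\<^bsub>T\<^esub> t)"
  shows "P t"
proof -
  obtain c where c: "Poly_Mapping.keys c \<subseteq> carrier M \<times> carrier N" "t = coset c" using assms(1) by (auto simp: carrier_T)
  have in_T: "coset d \<in> carrier T" if "Poly_Mapping.keys d \<subseteq> carrier M \<times> carrier N" for d
    unfolding carrier_T by (rule imageI) (use that in simp)
  \<comment> \<open>The induction rule for free abelian groups builds elements by differences, so
    the claim is carried for c and - c together.\<close>
  have "P (coset c) \<and> P (coset (- c))"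
  proof (rule free_Abelian_group_induct[OF c(1), where P = "\<lambda>c. P (coset c) \<and> P (coset (- c))"])
    show "P (coset 0) \<and> P (coset (- 0))"
      using pure[OF M.zero_closed N.zero_closed] pure_zero_right[OF M.zero_closed] coset_zero by simp
  next
    fix x y assume *: "Poly_Mapping.keys x \<subseteq> carrier M \<times> carrier N"
      "Poly_Mapping.keys y \<subseteq> carrier M \<times> carrier N"
      "P (coset x) \<and> P (coset (- x))" "P (coset y) \<and> P (coset (- y))"
    have "coset (x - y) = coset x \<oplus>\<^bsub>T\<^esub> coset (- y)" "coset (- (x - y)) = coset y \<oplus>\<^bsub>T\<^esub> coset (- x)"
      using * by (simp_all add: coset_add keys_minus)
    then show "P (coset (x - y)) \<and> P (coset (- (x - y)))" using * by (simp add: add in_T keys_minus)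
  next
    fix a assume "a \<in> carrier M \<times> carrier N"
    then obtain x y where a: "a = (x, y)" "x \<in> carrier M" "y \<in> carrier N" by auto
    have 1: "coset (- frag_of a) \<oplus>\<^bsub>T\<^esub> pur x y = \<zero>\<^bsub>T\<^esub>"
      using a by (simp add: pure_coset coset_add keys_minus coset_zero)
    have 2: "pur (\<ominus>\<^bsub>M\<^esub> x) y \<oplus>\<^bsub>T\<^esub> pur x y = \<zero>\<^bsub>T\<^esub>"
      using a by (simp add: pure_add_left[symmetric] M.l_neg pure_zero_left)
    have cl: "coset (- frag_of a) \<in> carrier T" "pur x y \<in> carrier T" "pur (\<ominus>\<^bsub>M\<^esub> x) y \<in> carrier T"
      using a by (auto intro!: in_T pure_closed simp: keys_minus)
    have "coset (- frag_of a) = pur (\<ominus>\<^bsub>M\<^esub> x) y"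
      using T.add.right_cancel[OF cl(2,1,3)] 1 2 by simp
    then show "P (coset (frag_of a)) \<and> P (coset (- frag_of a))"
      using a pure[of x y] pure[of "\<ominus>\<^bsub>M\<^esub> x" y] by (simp add: pure_coset)
  qed
  then show ?thesis using c(2) by simp
qed

text \<open>The standard argument for identities on tensor products below: both sides are shown to
  be additive in one variable and then compared at pure tensors.\<close>

lemma add_hom_eq:
  assumes "abelian_group H" "f \<in> add_hom T H" "g \<in> add_hom T H" "t \<in> carrier T"
    "\<And>x y. \<lbrakk>x \<in> carrier M; y \<in> carrier N\<rbrakk> \<Longrightarrow> f (pur x y) = g (pur x y)"
  shows "f t = g t"
  using assms(4) by (induction rule: tensor_induct) (auto simp: assms(5) add_hom_add[OF assms(2)] add_hom_add[OF assms(3)])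

section \<open>The universal property of the tensor product\<close>

definition balanced :: "('h, 'f) ring_scheme \<Rightarrow> ('m \<times> 'n \<Rightarrow> 'h) \<Rightarrow> bool" where
  "balanced H \<beta> \<longleftrightarrow> (\<forall>x\<in>carrier M. \<forall>y\<in>carrier N. \<beta> (x, y) \<in> carrier H) \<and>
     (\<forall>x\<in>carrier M. \<forall>x'\<in>carrier M. \<forall>y\<in>carrier N. \<beta> (x \<oplus>\<^bsub>M\<^esub> x', y) = \<beta> (x, y) \<oplus>\<^bsub>H\<^esub> \<beta> (x', y)) \<and>
     (\<forall>x\<in>carrier M. \<forall>y\<in>carrier N. \<forall>y'\<in>carrier N. \<beta> (x, y \<oplus>\<^bsub>N\<^esub> y') = \<beta> (x, y) \<oplus>\<^bsub>H\<^esub> \<beta> (x, y')) \<and>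
     (\<forall>r\<in>carrier R. \<forall>x\<in>carrier M. \<forall>y\<in>carrier N. \<beta> (r \<odot>\<^bsub>M\<^esub> x, y) = \<beta> (x, r \<odot>\<^bsub>N\<^esub> y))"

lemma balancedI:
  "\<lbrakk>\<And>x y. \<lbrakk>x \<in> carrier M; y \<in> carrier N\<rbrakk> \<Longrightarrow> \<beta> (x, y) \<in> carrier H;
    \<And>x x' y. \<lbrakk>x \<in> carrier M; x' \<in> carrier M; y \<in> carrier N\<rbrakk> \<Longrightarrow> \<beta> (x \<oplus>\<^bsub>M\<^esub> x', y) = \<beta> (x, y) \<oplus>\<^bsub>H\<^esub> \<beta> (x', y);
    \<And>x y y'. \<lbrakk>x \<in> carrier M; y \<in> carrier N; y' \<in> carrier N\<rbrakk> \<Longrightarrow> \<beta> (x, y \<oplus>\<^bsub>N\<^esub> y') = \<beta> (x, y) \<oplus>\<^bsub>H\<^esub> \<beta> (x, y');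
    \<And>r x y. \<lbrakk>r \<in> carrier R; x \<in> carrier M; y \<in> carrier N\<rbrakk> \<Longrightarrow> \<beta> (r \<odot>\<^bsub>M\<^esub> x, y) = \<beta> (x, r \<odot>\<^bsub>N\<^esub> y)\<rbrakk> \<Longrightarrow>
    balanced H \<beta>"
  by (simp add: balanced_def)

lemma balancedD:
  assumes "balanced H \<beta>"
  shows "\<lbrakk>x \<in> carrier M; y \<in> carrier N\<rbrakk> \<Longrightarrow> \<beta> (x, y) \<in> carrier H"
    "\<lbrakk>x \<in> carrier M; x' \<in> carrier M; y \<in> carrier N\<rbrakk> \<Longrightarrow> \<beta> (x \<oplus>\<^bsub>M\<^esub> x', y) = \<beta> (x, y) \<oplus>\<^bsub>H\<^esub> \<beta> (x', y)"
    "\<lbrakk>x \<in> carrier M; y \<in> carrier N; y' \<in> carrier N\<rbrakk> \<Longrightarrow> \<beta> (x, y \<oplus>\<^bsub>N\<^esub> y') = \<beta> (x, y) \<oplus>\<^bsub>H\<^esub> \<beta> (x, y')"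
    "\<lbrakk>r \<in> carrier R; x \<in> carrier M; y \<in> carrier N\<rbrakk> \<Longrightarrow> \<beta> (r \<odot>\<^bsub>M\<^esub> x, y) = \<beta> (x, r \<odot>\<^bsub>N\<^esub> y)"
  using assms by (simp_all add: balanced_def)

context
  fixes H :: "('h, 'f) ring_scheme" and \<beta> :: "'m \<times> 'n \<Rightarrow> 'h"
  assumes H: "abelian_group H" and \<beta>: "balanced H \<beta>"
begin

interpretation H: abelian_group H by (rule H)

definition ext :: "('m \<times> 'n \<Rightarrow>\<^sub>0 int) \<Rightarrow> 'h" where
  "ext c = (\<Oplus>\<^bsub>H\<^esub>p \<in> Poly_Mapping.keys c. [Poly_Mapping.lookup c p] \<cdot>\<^bsub>H\<^esub> \<beta> p)"

lemma \<beta>_closed: "p \<in> carrier M \<times> carrier N \<Longrightarrow> \<beta> p \<in> carrier H"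
  using \<beta> by (auto simp: balanced_def)

text \<open>The sums for c, d and c + d run over different key sets; they can be added after all
  three are written over the union.\<close>

lemma ext_superset:
  assumes "finite K" "Poly_Mapping.keys c \<subseteq> K" "K \<subseteq> carrier M \<times> carrier N"
  shows "ext c = (\<Oplus>\<^bsub>H\<^esub>p \<in> K. [Poly_Mapping.lookup c p] \<cdot>\<^bsub>H\<^esub> \<beta> p)"
  unfolding ext_def
proof (rule H.add.finprod_mono_neutral_cong_left[OF assms(1,2)])
  show "[Poly_Mapping.lookup c i] \<cdot>\<^bsub>H\<^esub> \<beta> i = \<zero>\<^bsub>H\<^esub>" if "i \<in> K - Poly_Mapping.keys c" for i
    using that assms(3) H.add_pow_int(2)[OF \<beta>_closed] by (auto simp: in_keys_iff)
qed (use assms(3) in \<open>auto intro!: H.add_pow_int(1) \<beta>_closed\<close>)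

lemma ext_add_hom:
  assumes "Poly_Mapping.keys c \<subseteq> carrier M \<times> carrier N" "Poly_Mapping.keys d \<subseteq> carrier M \<times> carrier N"
  shows "ext (c + d) = ext c \<oplus>\<^bsub>H\<^esub> ext d" "ext c \<in> carrier H"
proof -
  let ?K = "Poly_Mapping.keys c \<union> Poly_Mapping.keys d"
  have K: "finite ?K" "?K \<subseteq> carrier M \<times> carrier N" using assms by auto
  have cl: "(\<lambda>p. [Poly_Mapping.lookup c' p] \<cdot>\<^bsub>H\<^esub> \<beta> p) \<in> ?K \<rightarrow> carrier H" for c' :: "'m \<times> 'n \<Rightarrow>\<^sub>0 int"
    by (rule Pi_I, rule H.add_pow_int(1), rule \<beta>_closed, erule subsetD[OF K(2)])
  have "ext (c + d) = (\<Oplus>\<^bsub>H\<^esub>p \<in> ?K. [Poly_Mapping.lookup (c + d) p] \<cdot>\<^bsub>H\<^esub> \<beta> p)"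
    by (rule ext_superset[OF K(1) _ K(2)]) (rule keys_add)
  also have "\<dots> = (\<Oplus>\<^bsub>H\<^esub>p \<in> ?K. [Poly_Mapping.lookup c p] \<cdot>\<^bsub>H\<^esub> \<beta> p \<oplus>\<^bsub>H\<^esub> [Poly_Mapping.lookup d p] \<cdot>\<^bsub>H\<^esub> \<beta> p)"
  proof (rule H.finsum_cong')
    show "[Poly_Mapping.lookup (c + d) p] \<cdot>\<^bsub>H\<^esub> \<beta> p =
      [Poly_Mapping.lookup c p] \<cdot>\<^bsub>H\<^esub> \<beta> p \<oplus>\<^bsub>H\<^esub> [Poly_Mapping.lookup d p] \<cdot>\<^bsub>H\<^esub> \<beta> p" if "p \<in> ?K" for p
      using H.add_pow_int(4)[OF \<beta>_closed[of p]] K(2) that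
      by (auto simp: Poly_Mapping.lookup_add)
  qed (use cl in auto)
  also have "\<dots> = ext c \<oplus>\<^bsub>H\<^esub> ext d"
    using H.finsum_addf[OF cl[of c] cl[of d]] ext_superset[OF K(1) _ K(2), of c] ext_superset[OF K(1) _ K(2), of d]
    by simp
  finally show "ext (c + d) = ext c \<oplus>\<^bsub>H\<^esub> ext d" .
  show "ext c \<in> carrier H" using ext_superset[OF K(1) _ K(2), of c] H.finsum_closed[OF cl[of c]] by simp
qed

lemma ext_zero: "ext 0 = \<zero>\<^bsub>H\<^esub>" by (simp add: ext_def)

lemma ext_minus:
  assumes "Poly_Mapping.keys c \<subseteq> carrier M \<times> carrier N"
  shows "ext (- c) = \<ominus>\<^bsub>H\<^esub> ext c"
proof -
  have k: "Poly_Mapping.keys (- c) \<subseteq> carrier M \<times> carrier N" using assms by (simp add: keys_minus)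
  have "ext (- c) \<oplus>\<^bsub>H\<^esub> ext c = \<zero>\<^bsub>H\<^esub>" using ext_add_hom(1)[OF k assms] ext_zero by simp
  then show ?thesis using H.minus_equality ext_add_hom(2)[OF assms assms] ext_add_hom(2)[OF k k] by metis
qed

lemma ext_diff:
  assumes "Poly_Mapping.keys c \<subseteq> carrier M \<times> carrier N" "Poly_Mapping.keys d \<subseteq> carrier M \<times> carrier N"
  shows "ext (c - d) = ext c \<ominus>\<^bsub>H\<^esub> ext d"
  using ext_add_hom(1)[of c "- d"] ext_minus[OF assms(2)] assms by (simp add: keys_minus a_minus_def)

lemma ext_frag_of: "p \<in> carrier M \<times> carrier N \<Longrightarrow> ext (frag_of p) = \<beta> p"
  using \<beta>_closed[of p] H.add_pow_int(3)[of "\<beta> p"]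
  by (simp add: ext_def H.finsum_insert H.r_zero)

lemma ext_gens:
  assumes "h \<in> gens"
  shows "ext h = \<zero>\<^bsub>H\<^esub>"
proof -
  have 3: "(u \<oplus>\<^bsub>H\<^esub> v) \<ominus>\<^bsub>H\<^esub> u \<ominus>\<^bsub>H\<^esub> v = \<zero>\<^bsub>H\<^esub>" if "u \<in> carrier H" "v \<in> carrier H" for u v
  proof -
    have "(u \<oplus>\<^bsub>H\<^esub> v) \<ominus>\<^bsub>H\<^esub> u = v" using that by (simp add: a_minus_def H.a_comm[of u v] H.a_assoc H.r_neg)
    then show ?thesis using that by (simp add: a_minus_def H.r_neg)
  qed
  show ?thesis using assms
  proof (elim UnE CollectE exE conjE)
    fix x x' y assume *: "h = frag_of (x \<oplus>\<^bsub>M\<^esub> x', y) - frag_of (x, y) - frag_of (x', y)"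
      "x \<in> carrier M" "x' \<in> carrier M" "y \<in> carrier N"
    then have "ext h = \<beta> (x \<oplus>\<^bsub>M\<^esub> x', y) \<ominus>\<^bsub>H\<^esub> \<beta> (x, y) \<ominus>\<^bsub>H\<^esub> \<beta> (x', y)"
      by (simp add: ext_diff ext_frag_of keys_diff_subset)
    then show ?thesis using 3[of "\<beta> (x, y)" "\<beta> (x', y)"] balancedD[OF \<beta>] *(2-4) by simp
  next
    fix x y y' assume *: "h = frag_of (x, y \<oplus>\<^bsub>N\<^esub> y') - frag_of (x, y) - frag_of (x, y')"
      "x \<in> carrier M" "y \<in> carrier N" "y' \<in> carrier N"
    then have "ext h = \<beta> (x, y \<oplus>\<^bsub>N\<^esub> y') \<ominus>\<^bsub>H\<^esub> \<beta> (x, y) \<ominus>\<^bsub>H\<^esub> \<beta> (x, y')"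
      by (simp add: ext_diff ext_frag_of keys_diff_subset)
    then show ?thesis using 3[of "\<beta> (x, y)" "\<beta> (x, y')"] balancedD[OF \<beta>] *(2-4) by simp
  next
    fix r x y assume *: "h = frag_of (r \<odot>\<^bsub>M\<^esub> x, y) - frag_of (x, r \<odot>\<^bsub>N\<^esub> y)"
      "r \<in> carrier R" "x \<in> carrier M" "y \<in> carrier N"
    then have "ext h = \<beta> (r \<odot>\<^bsub>M\<^esub> x, y) \<ominus>\<^bsub>H\<^esub> \<beta> (x, r \<odot>\<^bsub>N\<^esub> y)"
      by (simp add: ext_diff ext_frag_of smult_M smult_N)
    then show ?thesis using balancedD[OF \<beta>] *(2-4) smult_N by (simp add: H.minus_eq_zero_iff)
  qed
qed

text \<open>The elements killed by \<open>ext\<close> form a subgroup that contains the generating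
  relations, hence all of \<open>rel\<close>.\<close>

lemma ext_rel:
  assumes "c \<in> rel"
  shows "ext c = \<zero>\<^bsub>H\<^esub>"
proof -
  have "subgroup {c \<in> carrier F. ext c = \<zero>\<^bsub>H\<^esub>} F"
  proof (rule F.subgroupI)
    show "{c \<in> carrier F. ext c = \<zero>\<^bsub>H\<^esub>} \<noteq> {}" using ext_zero by (auto intro!: exI[of _ 0])
  next
    fix a assume "a \<in> {c \<in> carrier F. ext c = \<zero>\<^bsub>H\<^esub>}"
    then show "inv\<^bsub>F\<^esub> a \<in> {c \<in> carrier F. ext c = \<zero>\<^bsub>H\<^esub>}" by (simp add: ext_minus keys_minus)
  next
    fix a b assume "a \<in> {c \<in> carrier F. ext c = \<zero>\<^bsub>H\<^esub>}" "b \<in> {c \<in> carrier F. ext c = \<zero>\<^bsub>H\<^esub>}"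
    moreover from this have "Poly_Mapping.keys (a + b) \<subseteq> carrier M \<times> carrier N" using keys_add[of a b] by auto
    ultimately show "a \<otimes>\<^bsub>F\<^esub> b \<in> {c \<in> carrier F. ext c = \<zero>\<^bsub>H\<^esub>}" by (simp add: ext_add_hom)
  qed auto
  moreover have "gens \<subseteq> {c \<in> carrier F. ext c = \<zero>\<^bsub>H\<^esub>}"
  proof
    fix c assume c: "c \<in> gens"
    then show "c \<in> {c \<in> carrier F. ext c = \<zero>\<^bsub>H\<^esub>}" using ext_gens[OF c] subsetD[OF gens_subset c] by blast
  qed
  ultimately have "generate F gens \<subseteq> {c \<in> carrier F. ext c = \<zero>\<^bsub>H\<^esub>}"
    by (intro F.generate_subgroup_incl)
  then show ?thesis using assms unfolding tensor_relations_def by blast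
qed

text \<open>\<open>ext\<close> is constant on cosets of the relations, so the definite description
  in \<open>tensor_lift\<close> has exactly one solution.\<close>

lemma tensor_lift_coset:
  assumes "Poly_Mapping.keys c \<subseteq> carrier M \<times> carrier N"
  shows "tensor_lift H \<beta> (coset c) = ext c"
proof -
  have ext: "ext c' = ext c" if c': "c' \<in> coset c" for c'
  proof -
    obtain h where h: "h \<in> rel" "c' = h + c" using c' by (auto simp: r_coset_def)
    have "Poly_Mapping.keys h \<subseteq> carrier M \<times> carrier N" using subgroup.mem_carrier[OF subgroup_rel h(1)] by simp
    then show ?thesis using h ext_rel[OF h(1)] ext_add_hom[of h c] assms ext_add_hom(2)[OF assms assms] by simp
  qed
  have "c \<in> coset c" by (rule F.rcos_self[OF _ subgroup_rel]) (use assms in simp)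
  show ?thesis unfolding tensor_lift_def ext_def[symmetric]
  proof (rule the_equality)
    show "\<forall>c'\<in>coset c. ext c = ext c'" by (intro ballI ext[symmetric])
    show "h = ext c" if "\<forall>c'\<in>coset c. h = ext c'" for h using that \<open>c \<in> coset c\<close> by (rule bspec)
  qed
qed

lemma tensor_lift_pure: "\<lbrakk>x \<in> carrier M; y \<in> carrier N\<rbrakk> \<Longrightarrow> tensor_lift H \<beta> (pur x y) = \<beta> (x, y)"
  by (simp add: pure_coset tensor_lift_coset ext_frag_of)

lemma tensor_lift_add_hom: "tensor_lift H \<beta> \<in> add_hom T H"
proof (rule add_homI)
  show "tensor_lift H \<beta> t \<in> carrier H" if "t \<in> carrier T" for t
    using that ext_add_hom(2) by (auto simp: carrier_T tensor_lift_coset)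
  show "tensor_lift H \<beta> (s \<oplus>\<^bsub>T\<^esub> t) = tensor_lift H \<beta> s \<oplus>\<^bsub>H\<^esub> tensor_lift H \<beta> t"
    if st: "s \<in> carrier T" "t \<in> carrier T" for s t
  proof -
    obtain c d where cd: "s = coset c" "t = coset d" "Poly_Mapping.keys c \<subseteq> carrier M \<times> carrier N"
      "Poly_Mapping.keys d \<subseteq> carrier M \<times> carrier N" using st by (auto simp: carrier_T)
    then have "Poly_Mapping.keys (c + d) \<subseteq> carrier M \<times> carrier N" using keys_add[of c d] by blast
    then show ?thesis using cd by (simp add: coset_add tensor_lift_coset ext_add_hom)
  qed
qed

end

end

section \<open>Tensor products over a field\<close>

lemma add_hom_plus:
  assumes "abelian_group H" "f \<in> add_hom G H" "g \<in> add_hom G H"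
  shows "(\<lambda>x. f x \<oplus>\<^bsub>H\<^esub> g x) \<in> add_hom G H"
proof -
  interpret H: abelian_group H by fact
  show ?thesis using assms(2,3) by (auto simp: add_hom_def Pi_iff H.a_ac)
qed

lemma add_hom_comp: "\<lbrakk>f \<in> add_hom G H; g \<in> add_hom H K\<rbrakk> \<Longrightarrow> (\<lambda>x. g (f x)) \<in> add_hom G K"
  by (auto simp: add_hom_def Pi_iff)

definition bilinear :: "('k, 'c) ring_scheme \<Rightarrow> ('k, 'm, 'd) module_scheme \<Rightarrow> ('k, 'n, 'e) module_scheme \<Rightarrow>
    ('k, 'p, 'f) module_scheme \<Rightarrow> ('m \<Rightarrow> 'n \<Rightarrow> 'p) \<Rightarrow> bool" where
  "bilinear k M N P \<alpha> \<longleftrightarrow>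
     (\<forall>x\<in>carrier M. \<forall>y\<in>carrier N. \<alpha> x y \<in> carrier P) \<and>
     (\<forall>x\<in>carrier M. \<forall>x'\<in>carrier M. \<forall>y\<in>carrier N. \<alpha> (x \<oplus>\<^bsub>M\<^esub> x') y = \<alpha> x y \<oplus>\<^bsub>P\<^esub> \<alpha> x' y) \<and>
     (\<forall>x\<in>carrier M. \<forall>y\<in>carrier N. \<forall>y'\<in>carrier N. \<alpha> x (y \<oplus>\<^bsub>N\<^esub> y') = \<alpha> x y \<oplus>\<^bsub>P\<^esub> \<alpha> x y') \<and>
     (\<forall>c\<in>carrier k. \<forall>x\<in>carrier M. \<forall>y\<in>carrier N. \<alpha> (c \<odot>\<^bsub>M\<^esub> x) y = c \<odot>\<^bsub>P\<^esub> \<alpha> x y) \<and>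
     (\<forall>c\<in>carrier k. \<forall>x\<in>carrier M. \<forall>y\<in>carrier N. \<alpha> x (c \<odot>\<^bsub>N\<^esub> y) = c \<odot>\<^bsub>P\<^esub> \<alpha> x y)"

lemma bilinearI:
  "\<lbrakk>\<And>x y. \<lbrakk>x \<in> carrier M; y \<in> carrier N\<rbrakk> \<Longrightarrow> \<alpha> x y \<in> carrier P;
    \<And>x x' y. \<lbrakk>x \<in> carrier M; x' \<in> carrier M; y \<in> carrier N\<rbrakk> \<Longrightarrow> \<alpha> (x \<oplus>\<^bsub>M\<^esub> x') y = \<alpha> x y \<oplus>\<^bsub>P\<^esub> \<alpha> x' y;
    \<And>x y y'. \<lbrakk>x \<in> carrier M; y \<in> carrier N; y' \<in> carrier N\<rbrakk> \<Longrightarrow> \<alpha> x (y \<oplus>\<^bsub>N\<^esub> y') = \<alpha> x y \<oplus>\<^bsub>P\<^esub> \<alpha> x y';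
    \<And>c x y. \<lbrakk>c \<in> carrier k; x \<in> carrier M; y \<in> carrier N\<rbrakk> \<Longrightarrow> \<alpha> (c \<odot>\<^bsub>M\<^esub> x) y = c \<odot>\<^bsub>P\<^esub> \<alpha> x y;
    \<And>c x y. \<lbrakk>c \<in> carrier k; x \<in> carrier M; y \<in> carrier N\<rbrakk> \<Longrightarrow> \<alpha> x (c \<odot>\<^bsub>N\<^esub> y) = c \<odot>\<^bsub>P\<^esub> \<alpha> x y\<rbrakk> \<Longrightarrow>
    bilinear k M N P \<alpha>"
  by (simp add: bilinear_def)

lemma bilinearD:
  assumes "bilinear k M N P \<alpha>"
  shows "\<lbrakk>x \<in> carrier M; y \<in> carrier N\<rbrakk> \<Longrightarrow> \<alpha> x y \<in> carrier P"
    "\<lbrakk>x \<in> carrier M; x' \<in> carrier M; y \<in> carrier N\<rbrakk> \<Longrightarrow> \<alpha> (x \<oplus>\<^bsub>M\<^esub> x') y = \<alpha> x y \<oplus>\<^bsub>P\<^esub> \<alpha> x' y"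
    "\<lbrakk>x \<in> carrier M; y \<in> carrier N; y' \<in> carrier N\<rbrakk> \<Longrightarrow> \<alpha> x (y \<oplus>\<^bsub>N\<^esub> y') = \<alpha> x y \<oplus>\<^bsub>P\<^esub> \<alpha> x y'"
    "\<lbrakk>c \<in> carrier k; x \<in> carrier M; y \<in> carrier N\<rbrakk> \<Longrightarrow> \<alpha> (c \<odot>\<^bsub>M\<^esub> x) y = c \<odot>\<^bsub>P\<^esub> \<alpha> x y"
    "\<lbrakk>c \<in> carrier k; x \<in> carrier M; y \<in> carrier N\<rbrakk> \<Longrightarrow> \<alpha> x (c \<odot>\<^bsub>N\<^esub> y) = c \<odot>\<^bsub>P\<^esub> \<alpha> x y"
  using assms by (simp_all add: bilinear_def)

lemma tensor_factors_modules:
  assumes "left_module R M" "left_module R N"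
  shows "tensor_factors R M N"
proof -
  interpret M: left_module R M by fact
  interpret N: left_module R N by fact
  show ?thesis
    by unfold_locales (auto intro: M.smult_closed N.smult_closed)
qed

section \<open>Maps between tensor products induced by two bilinear actions\<close>

context
  fixes k :: "'k ring" and A :: "('k, 'a, 'a2) module_scheme" and B :: "('k, 'b, 'b2) module_scheme"
    and M :: "('k, 'm, 'm2) module_scheme" and N :: "('k, 'n, 'n2) module_scheme"
    and M' :: "('k, 'p, 'p2) module_scheme" and N' :: "('k, 'q, 'q2) module_scheme"
    and \<alpha> :: "'a \<Rightarrow> 'm \<Rightarrow> 'p" and \<beta> :: "'b \<Rightarrow> 'n \<Rightarrow> 'q"
  assumes mods: "left_module k A" "left_module k B" "left_module k M" "left_module k N"
      "left_module k M'" "left_module k N'"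
    and \<alpha>: "bilinear k A M M' \<alpha>" and \<beta>: "bilinear k B N N' \<beta>"
begin

interpretation AB: tensor_factors k A B by (rule tensor_factors_modules[OF mods(1,2)])
interpretation MN: tensor_factors k M N by (rule tensor_factors_modules[OF mods(3,4)])
interpretation MN': tensor_factors k M' N' by (rule tensor_factors_modules[OF mods(5,6)])

lemmas \<alpha>D = bilinearD[OF \<alpha>] and \<beta>D = bilinearD[OF \<beta>]

definition inner_map :: "'a \<Rightarrow> 'b \<Rightarrow> 'm \<times> 'n \<Rightarrow> ('p \<times> 'q \<Rightarrow>\<^sub>0 int) set" where
  "inner_map a b = (\<lambda>(m, n). pure k M' N' (\<alpha> a m) (\<beta> b n))"

lemma balanced_inner:
  assumes "a \<in> carrier A" "b \<in> carrier B"
  shows "MN.balanced MN'.T (inner_map a b)"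
  using assms \<alpha>D \<beta>D by (intro MN.balancedI)
    (simp_all add: inner_map_def MN'.pure_closed MN'.pure_add_left MN'.pure_add_right MN'.pure_balanced)

lemma inner_add_hom:
  "\<lbrakk>a \<in> carrier A; b \<in> carrier B\<rbrakk> \<Longrightarrow> tensor_lift MN'.T (inner_map a b) \<in> add_hom MN.T MN'.T"
  by (rule MN.tensor_lift_add_hom[OF MN'.abelian_T balanced_inner])

lemma inner_pure:
  "\<lbrakk>a \<in> carrier A; b \<in> carrier B; m \<in> carrier M; n \<in> carrier N\<rbrakk> \<Longrightarrow>
    tensor_lift MN'.T (inner_map a b) (pure k M N m n) = pure k M' N' (\<alpha> a m) (\<beta> b n)"
  using MN.tensor_lift_pure[OF MN'.abelian_T balanced_inner] by (simp add: inner_map_def)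

text \<open>Each condition is an identity between additive maps in s, and at a pure tensor it
  reduces to bilinearity of \<alpha> or \<beta>.\<close>

lemma balanced_outer:
  assumes "s \<in> carrier (tensor k M N)"
  shows "AB.balanced MN'.T (\<lambda>(a, b). tensor_lift MN'.T (inner_map a b) s)"
proof (rule AB.balancedI, goal_cases)
  case (1 a b)
  then show ?case using add_hom_closed[OF inner_add_hom assms] by simp
next
  case (2 a a' b)
  have "tensor_lift MN'.T (inner_map (a \<oplus>\<^bsub>A\<^esub> a') b) s =
    tensor_lift MN'.T (inner_map a b) s \<oplus>\<^bsub>MN'.T\<^esub> tensor_lift MN'.T (inner_map a' b) s"
    by (rule MN.add_hom_eq[OF MN'.abelian_T inner_add_hom
          add_hom_plus[OF MN'.abelian_T inner_add_hom inner_add_hom] assms])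
      (use 2 \<alpha>D \<beta>D in \<open>simp_all add: inner_pure MN'.pure_add_left\<close>)
  then show ?case by simp
next
  case (3 a b b')
  have "tensor_lift MN'.T (inner_map a (b \<oplus>\<^bsub>B\<^esub> b')) s =
    tensor_lift MN'.T (inner_map a b) s \<oplus>\<^bsub>MN'.T\<^esub> tensor_lift MN'.T (inner_map a b') s"
    by (rule MN.add_hom_eq[OF MN'.abelian_T inner_add_hom
          add_hom_plus[OF MN'.abelian_T inner_add_hom inner_add_hom] assms])
      (use 3 \<alpha>D \<beta>D in \<open>simp_all add: inner_pure MN'.pure_add_right\<close>)
  then show ?case by simp
next
  case (4 r a b)
  have "tensor_lift MN'.T (inner_map (r \<odot>\<^bsub>A\<^esub> a) b) s = tensor_lift MN'.T (inner_map a (r \<odot>\<^bsub>B\<^esub> b)) s"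
    by (rule MN.add_hom_eq[OF MN'.abelian_T inner_add_hom inner_add_hom assms])
      (use 4 \<alpha>D \<beta>D AB.smult_M AB.smult_N in \<open>simp_all add: inner_pure MN'.pure_balanced\<close>)
  then show ?case by simp
qed

text \<open>
  The doubly lifted maps of the definitions of the algebra \<open>A \<otimes> B\<close>, of its right action on
  \<open>A \<otimes> V\<close> and of its left action on \<open>A \<otimes> W\<close> are all instances of the following one.
\<close>

definition dlift :: "('a \<times> 'b \<Rightarrow>\<^sub>0 int) set \<Rightarrow> ('m \<times> 'n \<Rightarrow>\<^sub>0 int) set \<Rightarrow> ('p \<times> 'q \<Rightarrow>\<^sub>0 int) set" where
  "dlift t s = tensor_lift (tensor k M' N') (\<lambda>(a, b). tensor_lift (tensor k M' N') (\<lambda>(m, n). pure k M' N' (\<alpha> a m) (\<beta> b n)) s) t"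

lemma dlift_alt: "dlift t s = tensor_lift MN'.T (\<lambda>(a, b). tensor_lift MN'.T (inner_map a b) s) t"
  by (simp add: dlift_def inner_map_def)

lemma dlift_left: "s \<in> carrier (tensor k M N) \<Longrightarrow> (\<lambda>t. dlift t s) \<in> add_hom (tensor k A B) (tensor k M' N')"
  unfolding dlift_alt by (rule AB.tensor_lift_add_hom[OF MN'.abelian_T balanced_outer])

lemma dlift_pure_left:
  "\<lbrakk>a \<in> carrier A; b \<in> carrier B; s \<in> carrier (tensor k M N)\<rbrakk> \<Longrightarrow>
    dlift (pure k A B a b) s = tensor_lift MN'.T (inner_map a b) s"
  unfolding dlift_alt using AB.tensor_lift_pure[OF MN'.abelian_T balanced_outer] by simp

lemma dlift_pure:
  "\<lbrakk>a \<in> carrier A; b \<in> carrier B; m \<in> carrier M; n \<in> carrier N\<rbrakk> \<Longrightarrow>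
    dlift (pure k A B a b) (pure k M N m n) = pure k M' N' (\<alpha> a m) (\<beta> b n)"
  by (simp add: dlift_pure_left MN.pure_closed inner_pure)

text \<open>For pure t this is additivity of the inner lift, and both sides of the identity are
  additive in t.\<close>

lemma dlift_right:
  assumes "t \<in> carrier (tensor k A B)"
  shows "dlift t \<in> add_hom (tensor k M N) (tensor k M' N')"
proof (rule add_homI)
  show "dlift t s \<in> carrier (tensor k M' N')" if "s \<in> carrier (tensor k M N)" for s
    using add_hom_closed[OF dlift_left[OF that] assms] .
  show "dlift t (s \<oplus>\<^bsub>tensor k M N\<^esub> s') = dlift t s \<oplus>\<^bsub>tensor k M' N'\<^esub> dlift t s'"
    if s: "s \<in> carrier (tensor k M N)" "s' \<in> carrier (tensor k M N)" for s s'
  proof (rule AB.add_hom_eq[OF MN'.abelian_T dlift_left add_hom_plus[OF MN'.abelian_T dlift_left dlift_left] assms])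
    show "s \<oplus>\<^bsub>tensor k M N\<^esub> s' \<in> carrier (tensor k M N)" using s by simp
    fix a b assume "a \<in> carrier A" "b \<in> carrier B"
    then show "dlift (pure k A B a b) (s \<oplus>\<^bsub>tensor k M N\<^esub> s') =
      dlift (pure k A B a b) s \<oplus>\<^bsub>tensor k M' N'\<^esub> dlift (pure k A B a b) s'"
      using add_hom_add[OF inner_add_hom, of a b s s'] s by (simp add: dlift_pure_left)
  qed (use s in auto)
qed

end

section \<open>Opposite algebras\<close>

lemma opp_simps [simp]:
  "carrier (opp R) = carrier R" "add (opp R) = add R" "\<zero>\<^bsub>opp R\<^esub> = \<zero>\<^bsub>R\<^esub>" "\<one>\<^bsub>opp R\<^esub> = \<one>\<^bsub>R\<^esub>"
  "x \<otimes>\<^bsub>opp R\<^esub> y = y \<otimes>\<^bsub>R\<^esub> x"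
  by (simp_all add: opp_def)

lemma smult_opp [simp]: "smult (opp A) = smult A"
  by (simp add: opp_def)

lemma ring_opp: "ring R \<Longrightarrow> ring (opp R)"
proof -
  assume "ring R"
  then interpret ring R .
  show ?thesis
    by (intro ringI abelian_group_cong[OF abelian_group_axioms] monoidI)
      (auto simp: m_assoc l_distr r_distr)
qed

lemma opp_opp: "opp (opp R) = R"
  by (simp add: opp_def)

lemma algebra_opp:
  assumes "algebra k A"
  shows "algebra k (opp A)"
proof -
  interpret algebra k A by fact
  have m: "Module.module k (opp A)"
  proof (rule moduleI)
    show "cring k" ..
    show "abelian_group (opp A)" by (rule abelian_group_cong[OF abelian_group_axioms]) auto
  qed (auto simp: smult_l_distr smult_r_distr smult_assoc1)
  have "fin_gen k (opp A)" using finite_dimensional by (simp add: fin_gen_def opp_def finsum_def)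
  then show ?thesis
    by (intro algebra.intro fd_algebra.intro fd_algebra_axioms.intro m ring_opp ring_A field_k)
      (auto simp: scalar_mult_left scalar_mult_right)
qed

lemma base_space_opp: "base_space (opp A) V = base_space A V"
  by (simp add: base_space_def)

section \<open>The tensor product of two algebras\<close>

locale two_algebras = A: algebra k A + B: algebra k B
  for k :: "'k ring" and A :: "('k, 'a) module" and B :: "('k, 'b) module"
begin

abbreviation L where "L \<equiv> tensor_algebra k A B"

lemma modA: "left_module k A" and modB: "left_module k B"
  by (rule A.left_module_k_A, rule B.left_module_k_A)

sublocale AB: tensor_factors k A B by (rule tensor_factors_modules[OF modA modB])
sublocale kA: left_module k A by (rule modA)
sublocale kB: left_module k B by (rule modB)

lemma bilinear_mult_A: "bilinear k A A A (mult A)"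
  by (rule bilinearI) (auto simp: A.l_distr A.r_distr A.scalar_mult_left A.scalar_mult_right)

lemma bilinear_mult_B: "bilinear k B B B (mult B)"
  by (rule bilinearI) (auto simp: B.l_distr B.r_distr B.scalar_mult_left B.scalar_mult_right)

lemma L_simps [simp]:
  "carrier L = carrier (tensor k A B)" "add L = add (tensor k A B)" "\<zero>\<^bsub>L\<^esub> = \<zero>\<^bsub>tensor k A B\<^esub>"
  "\<one>\<^bsub>L\<^esub> = pure k A B \<one>\<^bsub>A\<^esub> \<one>\<^bsub>B\<^esub>"
  by (simp_all add: tensor_algebra_def Let_def)

text \<open>Recognizes the nested lifts in \<open>tensor_algebra\<close> as one
  \<open>dlift\<close>, which brings additivity in both arguments and the formula on pure
  tensors.\<close>

lemma L_mult: "mult L = dlift k A B (mult A) (mult B)"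
  using dlift_def[OF modA modB modA modB modA modB bilinear_mult_A bilinear_mult_B]
  by (simp add: tensor_algebra_def Let_def fun_eq_iff)

lemma L_mult_left: "s \<in> carrier L \<Longrightarrow> (\<lambda>t. t \<otimes>\<^bsub>L\<^esub> s) \<in> add_hom (tensor k A B) (tensor k A B)"
  and L_mult_right: "t \<in> carrier L \<Longrightarrow> (\<lambda>s. t \<otimes>\<^bsub>L\<^esub> s) \<in> add_hom (tensor k A B) (tensor k A B)"
  and L_mult_pure: "\<lbrakk>a \<in> carrier A; b \<in> carrier B; a' \<in> carrier A; b' \<in> carrier B\<rbrakk> \<Longrightarrow>
    pure k A B a b \<otimes>\<^bsub>L\<^esub> pure k A B a' b' = pure k A B (a \<otimes>\<^bsub>A\<^esub> a') (b \<otimes>\<^bsub>B\<^esub> b')"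
  unfolding L_mult
  using dlift_left[OF modA modB modA modB modA modB bilinear_mult_A bilinear_mult_B]
    dlift_right[OF modA modB modA modB modA modB bilinear_mult_A bilinear_mult_B]
    dlift_pure[OF modA modB modA modB modA modB bilinear_mult_A bilinear_mult_B]
  by simp_all

lemma balanced_smult: "c \<in> carrier k \<Longrightarrow> AB.balanced (tensor k A B) (\<lambda>(a, b). pure k A B (c \<odot>\<^bsub>A\<^esub> a) b)"
  by (rule AB.balancedI)
    (auto simp: AB.pure_closed kA.smult_closed kA.smult_r_distr AB.pure_add_left AB.pure_add_right
      AB.pure_balanced[symmetric] kA.smult_assoc[symmetric] A.m_comm)

lemma L_smult_add_hom: "c \<in> carrier k \<Longrightarrow> smult L c \<in> add_hom (tensor k A B) (tensor k A B)"
  using AB.tensor_lift_add_hom[OF AB.abelian_T balanced_smult] by (simp add: tensor_algebra_def Let_def)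

lemma L_smult_pure:
  "\<lbrakk>c \<in> carrier k; a \<in> carrier A; b \<in> carrier B\<rbrakk> \<Longrightarrow> c \<odot>\<^bsub>L\<^esub> pure k A B a b = pure k A B (c \<odot>\<^bsub>A\<^esub> a) b"
  using AB.tensor_lift_pure[OF AB.abelian_T balanced_smult] by (simp add: tensor_algebra_def Let_def)

lemma abelian_L: "abelian_group L"
  by (rule abelian_group_cong[OF AB.abelian_T]) auto

lemma ring_L: "ring L"
proof (rule ringI)
  have cl: "s \<otimes>\<^bsub>L\<^esub> t \<in> carrier L" if "s \<in> carrier L" "t \<in> carrier L" for s t
    using add_hom_closed[OF L_mult_right] that by simp
  show "monoid L"
  proof (rule monoidI)
    show "\<one>\<^bsub>L\<^esub> \<in> carrier L" by (simp add: AB.pure_closed)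
    show "\<one>\<^bsub>L\<^esub> \<otimes>\<^bsub>L\<^esub> x = x" if "x \<in> carrier L" for x
      using that[simplified]
      by (induction rule: AB.tensor_induct)
        (auto simp: L_mult_pure[of "\<one>\<^bsub>A\<^esub>" "\<one>\<^bsub>B\<^esub>", simplified] add_hom_add[OF L_mult_right] AB.pure_closed)
    show "x \<otimes>\<^bsub>L\<^esub> \<one>\<^bsub>L\<^esub> = x" if "x \<in> carrier L" for x
      using that[simplified]
      by (induction rule: AB.tensor_induct)
        (auto simp: L_mult_pure add_hom_add[OF L_mult_left] AB.pure_closed)
    show "(x \<otimes>\<^bsub>L\<^esub> y) \<otimes>\<^bsub>L\<^esub> z = x \<otimes>\<^bsub>L\<^esub> (y \<otimes>\<^bsub>L\<^esub> z)" if xyz: "x \<in> carrier L" "y \<in> carrier L" "z \<in> carrier L" for x y z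
    proof -
      \<comment> \<open>Associativity is additive in each variable. Here two factors are pure, in
        the next fact one, and finally none.\<close>
      have 1: "(pure k A B a b \<otimes>\<^bsub>L\<^esub> pure k A B a' b') \<otimes>\<^bsub>L\<^esub> z = pure k A B a b \<otimes>\<^bsub>L\<^esub> (pure k A B a' b' \<otimes>\<^bsub>L\<^esub> z)"
        if "a \<in> carrier A" "b \<in> carrier B" "a' \<in> carrier A" "b' \<in> carrier B" "z \<in> carrier L" for z a b a' b'
        by (rule AB.add_hom_eq[OF AB.abelian_T L_mult_right add_hom_comp[OF L_mult_right L_mult_right]])
          (use that in \<open>auto simp: L_mult_pure AB.pure_closed A.m_assoc B.m_assoc\<close>)
      have 2: "(pure k A B a b \<otimes>\<^bsub>L\<^esub> y) \<otimes>\<^bsub>L\<^esub> z = pure k A B a b \<otimes>\<^bsub>L\<^esub> (y \<otimes>\<^bsub>L\<^esub> z)"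
        if "a \<in> carrier A" "b \<in> carrier B" "y \<in> carrier L" "z \<in> carrier L" for y z a b
        by (rule AB.add_hom_eq[OF AB.abelian_T add_hom_comp[OF L_mult_right L_mult_left]
              add_hom_comp[OF L_mult_left L_mult_right]])
          (use that 1 in \<open>simp_all add: AB.pure_closed\<close>)
      show ?thesis
        by (rule AB.add_hom_eq[OF AB.abelian_T add_hom_comp[OF L_mult_left L_mult_left] L_mult_left])
          (use xyz cl[OF xyz(2,3)] 2 in simp_all)
    qed
  qed (use cl in auto)
qed (use abelian_L add_hom_add[OF L_mult_left] add_hom_add[OF L_mult_right] in auto)

lemma left_module_k_L: "left_module k L"
proof (rule left_moduleI)
  show "ring k" ..
  show "abelian_group L" by (rule abelian_L)
  show "(r \<oplus>\<^bsub>k\<^esub> s) \<odot>\<^bsub>L\<^esub> x = r \<odot>\<^bsub>L\<^esub> x \<oplus>\<^bsub>L\<^esub> s \<odot>\<^bsub>L\<^esub> x" if "r \<in> carrier k" "s \<in> carrier k" "x \<in> carrier L" for r s x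
    unfolding L_simps
    by (rule AB.add_hom_eq[OF AB.abelian_T L_smult_add_hom
          add_hom_plus[OF AB.abelian_T L_smult_add_hom L_smult_add_hom]])
      (use that in \<open>auto simp: L_smult_pure kA.smult_l_distr AB.pure_add_left kA.smult_closed\<close>)
  show "(r \<otimes>\<^bsub>k\<^esub> s) \<odot>\<^bsub>L\<^esub> x = r \<odot>\<^bsub>L\<^esub> (s \<odot>\<^bsub>L\<^esub> x)" if "r \<in> carrier k" "s \<in> carrier k" "x \<in> carrier L" for r s x
    by (rule AB.add_hom_eq[OF AB.abelian_T L_smult_add_hom
          add_hom_comp[OF L_smult_add_hom L_smult_add_hom]])
      (use that in \<open>auto simp: L_smult_pure kA.smult_assoc kA.smult_closed\<close>)
  show "\<one>\<^bsub>k\<^esub> \<odot>\<^bsub>L\<^esub> x = x" if "x \<in> carrier L" for x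
    by (rule AB.add_hom_eq[OF AB.abelian_T L_smult_add_hom, of "\<one>\<^bsub>k\<^esub>" "\<lambda>x. x"])
      (use that in \<open>auto simp: L_smult_pure kA.smult_one add_hom_def\<close>)
qed (use add_hom_closed[OF L_smult_add_hom] add_hom_add[OF L_smult_add_hom] in auto)

text \<open>For a subspace U containing the tensors of generators, the first argument is extended to
  all of A for each generator of B, and then the second argument to all of B.\<close>

lemma fin_gen_L: "fin_gen k L"
proof -
  obtain S where S: "generates k A S"
    using A.finite_dimensional fin_gen_iff[OF modA] by auto
  obtain T where T: "generates k B T"
    using B.finite_dimensional fin_gen_iff[OF modB] by auto
  have ST: "finite S" "finite T" "S \<subseteq> carrier A" "T \<subseteq> carrier B" using S T by (auto simp: generates_def)
  have hA: "(\<lambda>a. pure k A B a b) \<in> lmod_hom k A L" if "b \<in> carrier B" for b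
    by (rule lmod_homI) (use that in \<open>auto simp: AB.pure_closed AB.pure_add_left L_smult_pure\<close>)
  have hB: "(\<lambda>b. pure k A B a b) \<in> lmod_hom k B L" if "a \<in> carrier A" for a
    by (rule lmod_homI)
      (use that in \<open>auto simp: AB.pure_closed AB.pure_add_right L_smult_pure AB.pure_balanced[symmetric]\<close>)
  have "generates k L ((\<lambda>(a, b). pure k A B a b) ` (S \<times> T))"
    unfolding generates_def
  proof (intro conjI allI impI subsetI)
    fix U x assume U: "submod k L U" "(\<lambda>(a, b). pure k A B a b) ` (S \<times> T) \<subseteq> U" and x: "x \<in> carrier L"
    have AT: "pure k A B a b \<in> U" if ab: "a \<in> carrier A" "b \<in> T" for a b
    proof -
      have b: "b \<in> carrier B" using ab ST by auto
      have "carrier A \<subseteq> {a \<in> carrier A. pure k A B a b \<in> U}"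
        by (rule generatesD[OF S submod_vimage[OF modA left_module_k_L hA[OF b] U(1)]])
          (use U(2) ST ab in auto)
      then show ?thesis using ab by auto
    qed
    have ABU: "pure k A B a b \<in> U" if ab: "a \<in> carrier A" "b \<in> carrier B" for a b
    proof -
      have "carrier B \<subseteq> {b \<in> carrier B. pure k A B a b \<in> U}"
        by (rule generatesD[OF T submod_vimage[OF modB left_module_k_L hB[OF ab(1)] U(1)]])
          (use AT ST ab in auto)
      then show ?thesis using ab by auto
    qed
    show "x \<in> U" using x[simplified] by (induction rule: AB.tensor_induct) (use U(1) ABU in \<open>auto simp: submod_def\<close>)
  next
    show "x \<in> carrier L" if "x \<in> (\<lambda>(a, b). pure k A B a b) ` (S \<times> T)" for x
      using that ST by (auto intro!: AB.pure_closed)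
  qed (use ST in auto)
  then show ?thesis using fin_gen_iff[OF left_module_k_L] by auto
qed

text \<open>All results on finite-dimensional algebras thereby apply to \<open>L\<close>, in
  particular the existence of resolutions and the criterion for Ext.\<close>

lemma algebra_L: "algebra k L"
proof (intro algebra.intro fd_algebra.intro fd_algebra_axioms.intro ring_L A.field_k fin_gen_L)
  interpret L: left_module k L by (rule left_module_k_L)
  show "Module.module k L"
    by (rule moduleI[OF _ abelian_L])
      (use A.field_k in \<open>simp add: field_def domain_def\<close>, auto simp: L.smult_closed L.smult_l_distr L.smult_r_distr L.smult_assoc L.smult_one simp del: L_simps)
  fix c x y assume cxy: "c \<in> carrier k" "x \<in> carrier L" "y \<in> carrier L"
  have 1: "(c \<odot>\<^bsub>L\<^esub> pure k A B a b) \<otimes>\<^bsub>L\<^esub> y = c \<odot>\<^bsub>L\<^esub> (pure k A B a b \<otimes>\<^bsub>L\<^esub> y)"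
    "pure k A B a b \<otimes>\<^bsub>L\<^esub> (c \<odot>\<^bsub>L\<^esub> y) = c \<odot>\<^bsub>L\<^esub> (pure k A B a b \<otimes>\<^bsub>L\<^esub> y)"
    if ab: "a \<in> carrier A" "b \<in> carrier B" for a b
  proof -
    show "(c \<odot>\<^bsub>L\<^esub> pure k A B a b) \<otimes>\<^bsub>L\<^esub> y = c \<odot>\<^bsub>L\<^esub> (pure k A B a b \<otimes>\<^bsub>L\<^esub> y)"
      by (rule AB.add_hom_eq[OF AB.abelian_T L_mult_right add_hom_comp[OF L_mult_right L_smult_add_hom]])
        (use ab cxy in \<open>auto simp: L_smult_pure L_mult_pure AB.pure_closed kA.smult_closed A.scalar_mult_left\<close>)
    show "pure k A B a b \<otimes>\<^bsub>L\<^esub> (c \<odot>\<^bsub>L\<^esub> y) = c \<odot>\<^bsub>L\<^esub> (pure k A B a b \<otimes>\<^bsub>L\<^esub> y)"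
      by (rule AB.add_hom_eq[OF AB.abelian_T add_hom_comp[OF L_smult_add_hom L_mult_right]
            add_hom_comp[OF L_mult_right L_smult_add_hom]])
        (use ab cxy in \<open>auto simp: L_smult_pure L_mult_pure AB.pure_closed kA.smult_closed A.scalar_mult_right\<close>)
  qed
  show "(c \<odot>\<^bsub>L\<^esub> x) \<otimes>\<^bsub>L\<^esub> y = c \<odot>\<^bsub>L\<^esub> (x \<otimes>\<^bsub>L\<^esub> y)"
    by (rule AB.add_hom_eq[OF AB.abelian_T add_hom_comp[OF L_smult_add_hom L_mult_left]
          add_hom_comp[OF L_mult_left L_smult_add_hom]])
      (use cxy 1 in auto)
  show "x \<otimes>\<^bsub>L\<^esub> (c \<odot>\<^bsub>L\<^esub> y) = c \<odot>\<^bsub>L\<^esub> (x \<otimes>\<^bsub>L\<^esub> y)"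
    by (rule AB.add_hom_eq[OF AB.abelian_T L_mult_left add_hom_comp[OF L_mult_left L_smult_add_hom]])
      (use cxy 1 add_hom_closed[OF L_smult_add_hom] in auto)
qed

sublocale L: algebra k L by (rule algebra_L)

end

section \<open>Induced modules\<close>

text \<open>Used to exchange \<open>ind (regular B)\<close> and \<open>regular L\<close> as targets,
  two separately built records with the same operations.\<close>

lemma lmod_hom_cong_target:
  assumes "carrier N' = carrier N" "add N' = add N"
    "\<And>r x. \<lbrakk>r \<in> carrier R; x \<in> carrier N\<rbrakk> \<Longrightarrow> r \<odot>\<^bsub>N'\<^esub> x = r \<odot>\<^bsub>N\<^esub> x"
  shows "lmod_hom R M N' = lmod_hom R M N"
  using assms by (auto simp: lmod_hom_def Pi_iff)

context two_algebras
begin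

text \<open>The left L-module A \<otimes> W, with a \<otimes> b acting by left multiplication on A
  and by b on W. The tensor product is over k, hence the passage to
  \<open>base_space\<close>.\<close>

definition ind :: "('b, 'w) module \<Rightarrow> (('a \<times> 'b \<Rightarrow>\<^sub>0 int) set, ('a \<times> 'w \<Rightarrow>\<^sub>0 int) set) module" where
  "ind W = (let T = tensor k A (base_space B W) in
     \<lparr>carrier = carrier T, mult = undefined, one = undefined, ring.zero = \<zero>\<^bsub>T\<^esub>, add = add T,
      smult = dlift k A (base_space B W) (mult A) (smult W)\<rparr>)"

lemma ind_simps [simp]:
  "carrier (ind W) = carrier (tensor k A (base_space B W))"
  "add (ind W) = add (tensor k A (base_space B W))"
  "\<zero>\<^bsub>ind W\<^esub> = \<zero>\<^bsub>tensor k A (base_space B W)\<^esub>"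
  by (simp_all add: ind_def Let_def)

lemma pure_L_closed: "\<lbrakk>a \<in> carrier A; b \<in> carrier B\<rbrakk> \<Longrightarrow> pure k A B a b \<in> carrier L"
  by (simp add: AB.pure_closed)

abbreviation pW where "pW W \<equiv> pure k A (base_space B W)"

lemma factors_W: "left_module B W \<Longrightarrow> tensor_factors k A (base_space B W)"
  by (rule tensor_factors_modules[OF modA B.left_module_base_space])

text \<open>Scalars of k act through central elements of B, so they can be pulled out of either
  argument.\<close>

lemma bilinear_smult:
  assumes "left_module B W"
  shows "bilinear k B (base_space B W) (base_space B W) (smult W)"
proof -
  interpret W: left_module B W by fact
  have c1: "c \<odot>\<^bsub>B\<^esub> \<one>\<^bsub>B\<^esub> \<in> carrier B" if "c \<in> carrier k" for c using that by (simp add: kB.smult_closed)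
  show ?thesis
  proof (rule bilinearI)
    fix c x y assume "c \<in> carrier k" "x \<in> carrier B" "y \<in> carrier (base_space B W)"
    then show "(c \<odot>\<^bsub>B\<^esub> x) \<odot>\<^bsub>W\<^esub> y = c \<odot>\<^bsub>base_space B W\<^esub> (x \<odot>\<^bsub>W\<^esub> y)"
      "x \<odot>\<^bsub>W\<^esub> (c \<odot>\<^bsub>base_space B W\<^esub> y) = c \<odot>\<^bsub>base_space B W\<^esub> (x \<odot>\<^bsub>W\<^esub> y)"
      using c1[of c] by (simp_all add: W.smult_assoc[symmetric] B.scalar_one)
  qed (auto simp: W.smult_closed W.smult_l_distr W.smult_r_distr)
qed

lemma ind_smult:
  assumes "left_module B W"
  shows "t \<in> carrier (ind W) \<Longrightarrow> (\<lambda>l. l \<odot>\<^bsub>ind W\<^esub> t) \<in> add_hom (tensor k A B) (ind W)"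
    "l \<in> carrier L \<Longrightarrow> smult (ind W) l \<in> add_hom (ind W) (ind W)"
    "\<lbrakk>a \<in> carrier A; b \<in> carrier B; a' \<in> carrier A; w \<in> carrier W\<rbrakk> \<Longrightarrow>
      pure k A B a b \<odot>\<^bsub>ind W\<^esub> pW W a' w = pW W (a \<otimes>\<^bsub>A\<^esub> a') (b \<odot>\<^bsub>W\<^esub> w)"
proof -
  note mW = B.left_module_base_space[OF assms]
  note facts = modA modB modA mW modA mW bilinear_mult_A bilinear_smult[OF assms]
  show "t \<in> carrier (ind W) \<Longrightarrow> (\<lambda>l. l \<odot>\<^bsub>ind W\<^esub> t) \<in> add_hom (tensor k A B) (ind W)"
    using dlift_left[OF facts, of t] by (simp add: add_hom_def ind_def Let_def)
  show "l \<in> carrier L \<Longrightarrow> smult (ind W) l \<in> add_hom (ind W) (ind W)"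
    using dlift_right[OF facts, of l] by (simp add: add_hom_def ind_def Let_def)
  show "\<lbrakk>a \<in> carrier A; b \<in> carrier B; a' \<in> carrier A; w \<in> carrier W\<rbrakk> \<Longrightarrow>
      pure k A B a b \<odot>\<^bsub>ind W\<^esub> pW W a' w = pW W (a \<otimes>\<^bsub>A\<^esub> a') (b \<odot>\<^bsub>W\<^esub> w)"
    using dlift_pure[OF facts] by (simp add: ind_def Let_def)
qed

lemma add_hom_ind: "add_hom (ind W) H = add_hom (tensor k A (base_space B W)) H"
  "add_hom G (ind W) = add_hom G (tensor k A (base_space B W))"
  by (simp_all add: add_hom_def)

lemma left_module_ind:
  assumes "left_module B W"
  shows "left_module L (ind W)"
proof -
  interpret W: left_module B W by fact
  interpret T: tensor_factors k A "base_space B W" by (rule factors_W[OF assms])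
  note sm = ind_smult[OF assms]
  note sm' = sm(1,2)[unfolded add_hom_ind]
  show ?thesis
  proof (rule left_moduleI)
    show "ring L" by (rule ring_L)
    show "abelian_group (ind W)" by (rule abelian_group_cong[OF T.abelian_T]) auto
    show "l \<odot>\<^bsub>ind W\<^esub> x \<in> carrier (ind W)" if "l \<in> carrier L" "x \<in> carrier (ind W)" for l x
      using add_hom_closed[OF sm(2)] that by simp
    show "(r \<oplus>\<^bsub>L\<^esub> s) \<odot>\<^bsub>ind W\<^esub> x = r \<odot>\<^bsub>ind W\<^esub> x \<oplus>\<^bsub>ind W\<^esub> s \<odot>\<^bsub>ind W\<^esub> x"
      if "r \<in> carrier L" "s \<in> carrier L" "x \<in> carrier (ind W)" for r s x
      using add_hom_add[OF sm(1)] that by simp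
    show "r \<odot>\<^bsub>ind W\<^esub> (x \<oplus>\<^bsub>ind W\<^esub> y) = r \<odot>\<^bsub>ind W\<^esub> x \<oplus>\<^bsub>ind W\<^esub> r \<odot>\<^bsub>ind W\<^esub> y"
      if "r \<in> carrier L" "x \<in> carrier (ind W)" "y \<in> carrier (ind W)" for r x y
      using add_hom_add[OF sm(2)] that by simp
    show "\<one>\<^bsub>L\<^esub> \<odot>\<^bsub>ind W\<^esub> x = x" if "x \<in> carrier (ind W)" for x
      by (rule T.add_hom_eq[OF T.abelian_T, of "smult (ind W) \<one>\<^bsub>L\<^esub>" "\<lambda>x. x"])
        (use that sm'(2)[of "\<one>\<^bsub>L\<^esub>"] pure_L_closed in \<open>simp_all add: sm(3) W.smult_one add_hom_def AB.pure_closed\<close>)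
    have 1: "(pure k A B a b \<otimes>\<^bsub>L\<^esub> pure k A B a' b') \<odot>\<^bsub>ind W\<^esub> x = pure k A B a b \<odot>\<^bsub>ind W\<^esub> (pure k A B a' b' \<odot>\<^bsub>ind W\<^esub> x)"
      if "a \<in> carrier A" "b \<in> carrier B" "a' \<in> carrier A" "b' \<in> carrier B" "x \<in> carrier (ind W)" for a b a' b' x
      by (rule T.add_hom_eq[OF T.abelian_T sm'(2) add_hom_comp[OF sm'(2) sm'(2)]])
        (use that in \<open>simp_all add: L_mult_pure sm(3) AB.pure_closed A.m_assoc W.smult_assoc W.smult_closed\<close>)
    have 2: "(pure k A B a b \<otimes>\<^bsub>L\<^esub> s) \<odot>\<^bsub>ind W\<^esub> x = pure k A B a b \<odot>\<^bsub>ind W\<^esub> (s \<odot>\<^bsub>ind W\<^esub> x)"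
      if "a \<in> carrier A" "b \<in> carrier B" "s \<in> carrier L" "x \<in> carrier (ind W)" for a b s x
      by (rule AB.add_hom_eq[OF T.abelian_T add_hom_comp[OF L_mult_right sm'(1)] add_hom_comp[OF sm'(1) sm'(2)]])
        (use that 1 in \<open>simp_all add: AB.pure_closed\<close>)
    show "(r \<otimes>\<^bsub>L\<^esub> s) \<odot>\<^bsub>ind W\<^esub> x = r \<odot>\<^bsub>ind W\<^esub> (s \<odot>\<^bsub>ind W\<^esub> x)"
      if "r \<in> carrier L" "s \<in> carrier L" "x \<in> carrier (ind W)" for r s x
      by (rule AB.add_hom_eq[OF T.abelian_T add_hom_comp[OF L_mult_left sm'(1)] sm'(1)])
        (use that 2 add_hom_closed[OF sm(2)] in simp_all)
  qed
qed

text \<open>Both sides of the linearity condition are additive in the scalar and in the element, so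
  pure tensors suffice in both places.\<close>

lemma ind_lmod_homI:
  assumes "left_module B W" "left_module L Y" "f \<in> add_hom (ind W) Y"
    "\<And>a b a' w. \<lbrakk>a \<in> carrier A; b \<in> carrier B; a' \<in> carrier A; w \<in> carrier W\<rbrakk> \<Longrightarrow>
      f (pW W (a \<otimes>\<^bsub>A\<^esub> a') (b \<odot>\<^bsub>W\<^esub> w)) = pure k A B a b \<odot>\<^bsub>Y\<^esub> f (pW W a' w)"
  shows "f \<in> lmod_hom L (ind W) Y"
proof (rule lmod_homI)
  interpret Y: left_module L Y by fact
  interpret W: left_module B W by fact
  interpret T: tensor_factors k A "base_space B W" by (rule factors_W[OF assms(1)])
  note sm = ind_smult[OF assms(1)]
  note sm' = sm(1,2)[unfolded add_hom_ind]
  have f: "f \<in> add_hom (tensor k A (base_space B W)) Y" using assms(3) by (simp add: add_hom_ind)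
  show "f x \<in> carrier Y" if "x \<in> carrier (ind W)" for x using add_hom_closed[OF assms(3) that] .
  show "f (x \<oplus>\<^bsub>ind W\<^esub> y) = f x \<oplus>\<^bsub>Y\<^esub> f y" if "x \<in> carrier (ind W)" "y \<in> carrier (ind W)" for x y
    using add_hom_add[OF assms(3) that] .
  have 1: "f (pure k A B a b \<odot>\<^bsub>ind W\<^esub> x) = pure k A B a b \<odot>\<^bsub>Y\<^esub> f x"
    if "a \<in> carrier A" "b \<in> carrier B" "x \<in> carrier (ind W)" for a b x
    by (rule T.add_hom_eq[OF Y.M.abelian_group_axioms add_hom_comp[OF sm'(2) f] add_hom_comp[OF f Y.smult_add_hom]])
      (use that assms(4) in \<open>simp_all add: AB.pure_closed sm(3)\<close>)
  have Yl: "(\<lambda>r. r \<odot>\<^bsub>Y\<^esub> y) \<in> add_hom (tensor k A B) Y" if "y \<in> carrier Y" for y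
    using that by (auto simp: add_hom_def Y.smult_closed Y.smult_l_distr[simplified])
  show "f (r \<odot>\<^bsub>ind W\<^esub> x) = r \<odot>\<^bsub>Y\<^esub> f x" if "r \<in> carrier L" "x \<in> carrier (ind W)" for r x
    by (rule AB.add_hom_eq[OF Y.M.abelian_group_axioms add_hom_comp[OF sm'(1) f] Yl])
      (use that 1 add_hom_closed[OF f] in simp_all)
qed

section \<open>Functoriality and exactness of A \<otimes> -\<close>

definition ind_map :: "('b, 'w) module \<Rightarrow> ('u \<Rightarrow> 'w) \<Rightarrow> ('a \<times> 'u \<Rightarrow>\<^sub>0 int) set \<Rightarrow> ('a \<times> 'w \<Rightarrow>\<^sub>0 int) set" where
  "ind_map W g = tensor_lift (tensor k A (base_space B W)) (\<lambda>(a, u). pW W a (g u))"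

lemma ind_map:
  assumes "left_module B U" "left_module B W" "g \<in> lmod_hom B U W"
  shows "\<lbrakk>a \<in> carrier A; u \<in> carrier U\<rbrakk> \<Longrightarrow> ind_map W g (pW U a u) = pW W a (g u)"
    "ind_map W g \<in> lmod_hom L (ind U) (ind W)"
proof -
  interpret U: left_module B U by fact
  interpret TU: tensor_factors k A "base_space B U" by (rule factors_W[OF assms(1)])
  interpret TW: tensor_factors k A "base_space B W" by (rule factors_W[OF assms(2)])
  have gc: "g u \<in> carrier W" if "u \<in> carrier U" for u by (rule lmod_hom_closed[OF assms(3) that])
  have g: "g \<in> lmod_hom k (base_space B U) (base_space B W)" by (rule B.lmod_hom_base_space[OF assms(3)])
  have bal: "TU.balanced (tensor k A (base_space B W)) (\<lambda>(a, u). pW W a (g u))"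
  proof (rule TU.balancedI, goal_cases)
    case (4 r x y)
    then have "pW W (r \<odot>\<^bsub>A\<^esub> x) (g y) = pW W x (r \<odot>\<^bsub>base_space B W\<^esub> g y)"
      using TW.pure_balanced[of r x "g y"] gc by simp
    also have "r \<odot>\<^bsub>base_space B W\<^esub> g y = g (r \<odot>\<^bsub>base_space B U\<^esub> y)"
      using lmod_hom_smult[OF g, of r y] 4 by simp
    finally show ?case by simp
  qed (use gc lmod_hom_add[OF assms(3)] in \<open>simp_all add: TW.pure_closed TW.pure_add_left TW.pure_add_right[unfolded base_space_simps]\<close>)
  show 1: "ind_map W g (pW U a u) = pW W a (g u)" if "a \<in> carrier A" "u \<in> carrier U" for a u
    unfolding ind_map_def using TU.tensor_lift_pure[OF TW.abelian_T bal] that by simp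
  show "ind_map W g \<in> lmod_hom L (ind U) (ind W)"
  proof (rule ind_lmod_homI[OF assms(1) left_module_ind[OF assms(2)]])
    show "ind_map W g \<in> add_hom (ind U) (ind W)"
      unfolding ind_map_def add_hom_ind by (rule TU.tensor_lift_add_hom[OF TW.abelian_T bal])
    fix a b a' u assume "a \<in> carrier A" "b \<in> carrier B" "a' \<in> carrier A" "u \<in> carrier U"
    then show "ind_map W g (pW U (a \<otimes>\<^bsub>A\<^esub> a') (b \<odot>\<^bsub>U\<^esub> u)) = pure k A B a b \<odot>\<^bsub>ind W\<^esub> ind_map W g (pW U a' u)"
      using 1 gc by (simp add: U.smult_closed lmod_hom_smult[OF assms(3)] ind_smult[OF assms(2)])
  qed
qed

lemma ind_map_surj:
  assumes "left_module B U" "left_module B W" "g \<in> lmod_hom B U W" "g ` carrier U = carrier W"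
  shows "ind_map W g ` carrier (ind U) = carrier (ind W)"
proof
  interpret TU: tensor_factors k A "base_space B U" by (rule factors_W[OF assms(1)])
  interpret TW: tensor_factors k A "base_space B W" by (rule factors_W[OF assms(2)])
  note im = ind_map[OF assms(1-3)]
  show "ind_map W g ` carrier (ind U) \<subseteq> carrier (ind W)" using lmod_hom_closed[OF im(2)] by blast
  have sub: "submod L (ind W) (ind_map W g ` carrier (ind U))"
    by (rule submod_image[OF left_module_ind left_module_ind im(2)]) (rule assms)+
  have addc: "x \<oplus>\<^bsub>ind W\<^esub> y \<in> ind_map W g ` carrier (ind U)"
    if "x \<in> ind_map W g ` carrier (ind U)" "y \<in> ind_map W g ` carrier (ind U)" for x y
    using sub that unfolding submod_def by blast
  show "carrier (ind W) \<subseteq> ind_map W g ` carrier (ind U)"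
  proof
    fix t assume "t \<in> carrier (ind W)"
    then have "t \<in> carrier TW.T" by simp
    then show "t \<in> ind_map W g ` carrier (ind U)"
    proof (induction rule: TW.tensor_induct)
      case (pure a w)
      then obtain u where "u \<in> carrier U" "w = g u" using assms(4) by auto
      then show ?case using pure im(1) by (intro image_eqI[of _ _ "pW U a u"]) (simp_all add: TU.pure_closed)
    next
      case (add s t)
      then show ?case using addc[of s t] by simp
    qed
  qed
qed

text \<open>A dual basis of A over k gives coordinates on A \<otimes> W with values in W: the i-th
  one sends a \<otimes> w to c i (a) w, and t is recovered as the sum of the p i \<otimes> \<kappa>
  i (t).\<close>

lemma ind_coordinates:
  assumes "left_module B W" "dual_basis k A n p c"
  shows "\<exists>\<kappa>. (\<forall>i<n. \<forall>t\<in>carrier (ind W). \<kappa> i t \<in> carrier W) \<and>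
    (\<forall>i<n. \<kappa> i \<in> add_hom (ind W) W) \<and>
    (\<forall>i<n. \<forall>a\<in>carrier A. \<forall>w\<in>carrier W. \<kappa> i (pW W a w) = (c i a \<odot>\<^bsub>B\<^esub> \<one>\<^bsub>B\<^esub>) \<odot>\<^bsub>W\<^esub> w) \<and>
    (\<forall>t\<in>carrier (ind W). t = msum (ind W) (\<lambda>i. pW W (p i) (\<kappa> i t)) n)"
proof -
  interpret W: left_module B W by fact
  interpret kW: left_module k "base_space B W" by (rule B.left_module_base_space[OF assms(1)])
  interpret T: tensor_factors k A "base_space B W" by (rule factors_W[OF assms(1)])
  note db = dual_basisD[OF assms(2)]
  define \<kappa> where "\<kappa> i = tensor_lift W (\<lambda>(a, w). c i a \<odot>\<^bsub>base_space B W\<^esub> w)" for i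
  have bal: "T.balanced W (\<lambda>(a, w). c i a \<odot>\<^bsub>base_space B W\<^esub> w)" if i: "i < n" for i
  proof (rule T.balancedI, goal_cases)
    case (1 a w)
    then show ?case using kW.smult_closed[OF db(3)[OF i], of a w] by simp
  next
    case (2 a a' w)
    then show ?case using lmod_hom_add[OF db(2)[OF i], of a a'] kW.smult_l_distr[OF db(3)[OF i] db(3)[OF i]] by simp
  next
    case (3 a w w')
    then show ?case using kW.smult_r_distr[OF db(3)[OF i]] by simp
  next
    case (4 r a w)
    then show ?case
      using lmod_hom_smult[OF db(2)[OF i], of r a] kW.smult_assoc[of r "c i a" w]
        kW.smult_assoc[of "c i a" r w] db(3)[OF i, of a]
      by (simp del: base_space_simps(4) add: A.m_comm)
  qed
  have \<kappa>: "\<kappa> i \<in> add_hom (ind W) W" if "i < n" for i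
    unfolding \<kappa>_def add_hom_ind by (rule T.tensor_lift_add_hom[OF W.M.abelian_group_axioms bal[OF that]])
  have \<kappa>p: "\<kappa> i (pW W a w) = c i a \<odot>\<^bsub>base_space B W\<^esub> w" if "i < n" "a \<in> carrier A" "w \<in> carrier W" for i a w
    unfolding \<kappa>_def using T.tensor_lift_pure[OF W.M.abelian_group_axioms bal[OF that(1)], of a w] that by simp
  have \<kappa>c: "\<kappa> i t \<in> carrier W" if "i < n" "t \<in> carrier (ind W)" for i t
    using add_hom_closed[OF \<kappa>] that by blast
  have "t = msum (ind W) (\<lambda>i. pW W (p i) (\<kappa> i t)) n" if t: "t \<in> carrier (ind W)" for t
  proof -
    have "t \<in> carrier T.T" using t by simp
    then have "t = msum T.T (\<lambda>i. pW W (p i) (\<kappa> i t)) n"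
    proof (induction rule: T.tensor_induct)
      case (pure a w)
      have "pW W (p i) (\<kappa> i (pW W a w)) = pW W (c i a \<odot>\<^bsub>A\<^esub> p i) w" if "i < n" for i
        using pure that db \<kappa>p by (simp add: T.pure_balanced del: base_space_simps(4))
      then have "msum T.T (\<lambda>i. pW W (p i) (\<kappa> i (pW W a w))) n = msum T.T (\<lambda>i. pW W (c i a \<odot>\<^bsub>A\<^esub> p i) w) n"
        by (intro msum_cong)
      also have "\<dots> = pW W (msum A (\<lambda>i. c i a \<odot>\<^bsub>A\<^esub> p i) n) w"
        by (rule add_hom_of_msum[OF T.abelian_M T.abelian_T, symmetric])
          (use pure db in \<open>auto intro!: T.pure_add_hom_left kA.smult_closed\<close>)
      also have "\<dots> = pW W a w" using db(4) pure by simp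
      finally show ?case by simp
    next
      case (add s t)
      have "msum T.T (\<lambda>i. pW W (p i) (\<kappa> i (s \<oplus>\<^bsub>T.T\<^esub> t))) n =
        msum T.T (\<lambda>i. pW W (p i) (\<kappa> i s) \<oplus>\<^bsub>T.T\<^esub> pW W (p i) (\<kappa> i t)) n"
        by (rule msum_cong) (use add db \<kappa>c add_hom_add[OF \<kappa>] in \<open>simp add: T.pure_add_right[unfolded base_space_simps]\<close>)
      also have "\<dots> = msum T.T (\<lambda>i. pW W (p i) (\<kappa> i s)) n \<oplus>\<^bsub>T.T\<^esub> msum T.T (\<lambda>i. pW W (p i) (\<kappa> i t)) n"
        by (rule T.T.msum_add) (use add db \<kappa>c in \<open>simp_all add: T.pure_closed\<close>)
      finally show ?case using add.IH by simp
    qed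
    then show ?thesis using msum_same_ops[of "ind W" T.T] by simp
  qed
  then show ?thesis using \<kappa> \<kappa>c \<kappa>p by (intro exI[of _ \<kappa>]) simp
qed

text \<open>Flatness of A over k, made explicit. Each coordinate of t is killed by g and so comes
  from some u i; the sum of the p i \<otimes> u i is a preimage of t.\<close>

lemma ind_exact:
  assumes "left_module B U" "left_module B V" "left_module B W" "f \<in> lmod_hom B U V" "g \<in> lmod_hom B V W"
    "a_kernel V W g \<subseteq> f ` carrier U" "t \<in> carrier (ind V)" "ind_map W g t = \<zero>\<^bsub>ind W\<^esub>"
  shows "t \<in> ind_map V f ` carrier (ind U)"
proof -
  interpret V: left_module B V by fact
  interpret W: left_module B W by fact
  interpret TU: tensor_factors k A "base_space B U" by (rule factors_W[OF assms(1)])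
  interpret TV: tensor_factors k A "base_space B V" by (rule factors_W[OF assms(2)])
  interpret TW: tensor_factors k A "base_space B W" by (rule factors_W[OF assms(3)])
  obtain n p c where db: "dual_basis k A n p c"
    using fin_gen_has_dual_basis[OF A.field_k modA A.finite_dimensional] by (auto simp: has_dual_basis_def)
  note dbD = dual_basisD[OF db]
  obtain \<kappa> where \<kappa>': "\<forall>i<n. \<forall>t\<in>carrier (ind V). \<kappa> i t \<in> carrier V" "\<forall>i<n. \<kappa> i \<in> add_hom (ind V) V"
    "\<forall>i<n. \<forall>a\<in>carrier A. \<forall>w\<in>carrier V. \<kappa> i (pW V a w) = (c i a \<odot>\<^bsub>B\<^esub> \<one>\<^bsub>B\<^esub>) \<odot>\<^bsub>V\<^esub> w"
    "\<forall>t\<in>carrier (ind V). t = msum (ind V) (\<lambda>i. pW V (p i) (\<kappa> i t)) n"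
    using ind_coordinates[OF assms(2) db] by (elim exE conjE) (rule that)
  note \<kappa> = \<kappa>'[rule_format]
  obtain \<mu> where \<mu>': "\<forall>i<n. \<mu> i \<in> add_hom (ind W) W"
    "\<forall>i<n. \<forall>a\<in>carrier A. \<forall>w\<in>carrier W. \<mu> i (pW W a w) = (c i a \<odot>\<^bsub>B\<^esub> \<one>\<^bsub>B\<^esub>) \<odot>\<^bsub>W\<^esub> w"
    using ind_coordinates[OF assms(3) db] by (elim exE conjE) (rule that)
  note \<mu> = \<mu>'[rule_format]
  note gm = ind_map[OF assms(2,3,5)] and fm = ind_map[OF assms(1,2,4)]
  \<comment> \<open>Coordinates are natural in the module, because g commutes with the scalars c i
    (a) acting through B.\<close>
  have nat: "\<mu> i (ind_map W g t) = g (\<kappa> i t)" if i: "i < n" for i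
  proof (rule TV.add_hom_eq[OF W.M.abelian_group_axioms])
    show "(\<lambda>t. \<mu> i (ind_map W g t)) \<in> add_hom TV.T W"
      by (rule add_hom_comp[OF lmod_hom_add_hom[OF gm(2), unfolded add_hom_ind] \<mu>(1)[OF i, unfolded add_hom_ind]])
    show "(\<lambda>t. g (\<kappa> i t)) \<in> add_hom TV.T W"
      by (rule add_hom_comp[OF \<kappa>(2)[OF i, unfolded add_hom_ind] lmod_hom_add_hom[OF assms(5)]])
    show "t \<in> carrier TV.T" using assms(7) by simp
    fix a v assume av: "a \<in> carrier A" "v \<in> carrier (base_space B V)"
    have "c i a \<odot>\<^bsub>B\<^esub> \<one>\<^bsub>B\<^esub> \<in> carrier B" using dbD(3)[OF i] av by (simp add: kB.smult_closed)
    then show "\<mu> i (ind_map W g (pW V a v)) = g (\<kappa> i (pW V a v))"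
      using av gm(1) \<mu>(2)[OF i] \<kappa>(3)[OF i] lmod_hom_closed[OF assms(5)] by (simp add: lmod_hom_smult[OF assms(5)])
  qed
  have "g (\<kappa> i t) = \<zero>\<^bsub>W\<^esub>" if i: "i < n" for i
    using nat[OF i] assms(8) add_hom_zero[OF left_module_abelian_group[OF left_module_ind[OF assms(3)]]
        W.M.abelian_group_axioms \<mu>(1)[OF i]] by simp
  then have "\<kappa> i t \<in> f ` carrier U" if "i < n" for i
    using \<kappa>(1)[OF that assms(7)] assms(6) that by (auto simp: a_kernel_def')
  then have "\<exists>u. u \<in> carrier U \<and> f u = \<kappa> i t" if "i < n" for i
    using that by (metis imageE)
  then obtain u where "\<forall>i. i < n \<longrightarrow> u i \<in> carrier U \<and> f (u i) = \<kappa> i t" by metis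
  then have u: "\<And>i. i < n \<Longrightarrow> u i \<in> carrier U" "\<And>i. i < n \<Longrightarrow> f (u i) = \<kappa> i t" by auto
  let ?s = "msum (ind U) (\<lambda>i. pW U (p i) (u i)) n"
  have pc: "pW U (p i) (u i) \<in> carrier (ind U)" if "i < n" for i
    using u(1)[OF that] dbD(1)[OF that] by (simp add: TU.pure_closed)
  have "ind_map V f ?s = msum (ind V) (\<lambda>i. ind_map V f (pW U (p i) (u i))) n"
    by (rule lmod_hom_of_msum[OF left_module_ind[OF assms(1)] left_module_ind[OF assms(2)] fm(2) pc])
  also have "\<dots> = msum (ind V) (\<lambda>i. pW V (p i) (\<kappa> i t)) n"
    by (rule msum_cong) (use u dbD fm(1) in simp)
  also have "\<dots> = t" by (rule \<kappa>(4)[OF assms(7), symmetric])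
  finally have "ind_map V f ?s = t" .
  moreover have "?s \<in> carrier (ind U)"
    by (rule abelian_group.msum_closed[OF left_module_abelian_group[OF left_module_ind[OF assms(1)]] pc])
  ultimately show ?thesis by blast
qed

text \<open>The underlying space of \<open>regular B\<close> lets c act as multiplication by c 1.
  This agrees with the action of k on B for elements of the carriers, and the relations mention no
  others.\<close>

lemma tensor_regular:
  "tensor k A (base_space B (regular B)) = tensor k A B"
  "pure k A (base_space B (regular B)) = pure k A B"
proof -
  have "{frag_of (r \<odot>\<^bsub>A\<^esub> x, y) - frag_of (x, r \<odot>\<^bsub>base_space B (regular B)\<^esub> y) |r x y.
      r \<in> carrier k \<and> x \<in> carrier A \<and> y \<in> carrier B} =
    {frag_of (r \<odot>\<^bsub>A\<^esub> x, y) - frag_of (x, r \<odot>\<^bsub>B\<^esub> y) |r x y.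
      r \<in> carrier k \<and> x \<in> carrier A \<and> y \<in> carrier B}"
  proof (rule Collect_cong, (rule ex_cong1)+)
    fix u r x y
    have "r \<odot>\<^bsub>base_space B (regular B)\<^esub> y = r \<odot>\<^bsub>B\<^esub> y" if "r \<in> carrier k" "y \<in> carrier B"
      using that by (simp add: B.scalar_one)
    then show "(u = frag_of (r \<odot>\<^bsub>A\<^esub> x, y) - frag_of (x, r \<odot>\<^bsub>base_space B (regular B)\<^esub> y) \<and>
      r \<in> carrier k \<and> x \<in> carrier A \<and> y \<in> carrier B) =
      (u = frag_of (r \<odot>\<^bsub>A\<^esub> x, y) - frag_of (x, r \<odot>\<^bsub>B\<^esub> y) \<and>
      r \<in> carrier k \<and> x \<in> carrier A \<and> y \<in> carrier B)"
      by metis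
  qed
  then have "tensor_relations k A (base_space B (regular B)) = tensor_relations k A B"
    unfolding tensor_relations_def by (simp only: base_space_simps regular_simps)
  then show "tensor k A (base_space B (regular B)) = tensor k A B"
    "pure k A (base_space B (regular B)) = pure k A B"
    by (simp_all add: tensor_def pure_def fun_eq_iff)
qed

text \<open>For W = B the induced module is the left regular module of \<open>L\<close>. As
  \<open>ind\<close> leaves \<open>mult\<close> and \<open>one\<close> undefined, the four fields
  that matter for modules are compared one by one.\<close>

lemma ind_regular:
  "carrier (ind (regular B)) = carrier (regular L)" "add (ind (regular B)) = add (regular L)"
  "smult (ind (regular B)) = smult (regular L)" "\<zero>\<^bsub>ind (regular B)\<^esub> = \<zero>\<^bsub>regular L\<^esub>"
proof -
  have reg: "left_module B (regular B)" by (rule left_module_regular[OF B.ring_A])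
  note mR = B.left_module_base_space[OF reg]
  have bil: "bilinear k B (base_space B (regular B)) (base_space B (regular B)) (mult B)"
    using bilinear_smult[OF reg] by simp
  have eq: "dlift k A (base_space B (regular B)) (mult A) (mult B) = dlift k A B (mult A) (mult B)"
    using dlift_def[OF modA modB modA mR modA mR bilinear_mult_A bil]
      dlift_def[OF modA modB modA modB modA modB bilinear_mult_A bilinear_mult_B]
    by (simp add: tensor_regular fun_eq_iff)
  show "smult (ind (regular B)) = smult (regular L)"
    by (simp add: ind_def Let_def eq L_mult)
qed (simp_all add: tensor_regular)

lemma lmod_hom_ind_regular: "lmod_hom L P (ind (regular B)) = lmod_hom L P (regular L)"
  by (rule lmod_hom_cong_target) (simp_all only: ind_regular)

text \<open>The elements are 1 \<otimes> q i, and the functionals are the maps induced by \<phi> i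
  from A \<otimes> Q to A \<otimes> B, which is \<open>L\<close>.\<close>

lemma has_dual_basis_ind:
  assumes "left_module B Q" "has_dual_basis B Q"
  shows "has_dual_basis L (ind Q)"
proof -
  interpret Q: left_module B Q by fact
  interpret T: tensor_factors k A "base_space B Q" by (rule factors_W[OF assms(1)])
  interpret N: left_module L "ind Q" by (rule left_module_ind[OF assms(1)])
  have reg: "left_module B (regular B)" by (rule left_module_regular[OF B.ring_A])
  obtain n q \<phi> where db: "dual_basis B Q n q \<phi>" using assms(2) by (auto simp: has_dual_basis_def)
  note dbD = dual_basisD[OF db]
  define \<psi> where "\<psi> i = ind_map (regular B) (\<phi> i)" for i
  have \<psi>: "\<psi> i \<in> lmod_hom L (ind Q) (regular L)" if "i < n" for i
    unfolding \<psi>_def lmod_hom_ind_regular[symmetric] by (rule ind_map(2)[OF assms(1) reg dbD(2)[OF that]])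
  have \<psi>p: "\<psi> i (pW Q a x) = pure k A B a (\<phi> i x)" if "i < n" "a \<in> carrier A" "x \<in> carrier Q" for i a x
    unfolding \<psi>_def using ind_map(1)[OF assms(1) reg dbD(2)] that by (simp add: tensor_regular)
  have pc: "pW Q \<one>\<^bsub>A\<^esub> (q i) \<in> carrier (ind Q)" if "i < n" for i using dbD(1)[OF that] by (simp add: T.pure_closed)
  have "dual_basis L (ind Q) n (\<lambda>i. pW Q \<one>\<^bsub>A\<^esub> (q i)) \<psi>"
    unfolding dual_basis_def
  proof (intro conjI allI impI ballI pc \<psi>)
    fix t assume t: "t \<in> carrier (ind Q)"
    have h: "(\<lambda>t. msum (ind Q) (\<lambda>i. \<psi> i t \<odot>\<^bsub>ind Q\<^esub> pW Q \<one>\<^bsub>A\<^esub> (q i)) n) \<in> lmod_hom L (ind Q) (ind Q)"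
      by (intro N.lmod_hom_msum N.lmod_hom_smult_elem \<psi> pc)
    show "t = msum (ind Q) (\<lambda>i. \<psi> i t \<odot>\<^bsub>ind Q\<^esub> pW Q \<one>\<^bsub>A\<^esub> (q i)) n"
    proof (rule T.add_hom_eq[OF T.abelian_T _ lmod_hom_add_hom[OF h, unfolded add_hom_ind]])
      show "(\<lambda>t. t) \<in> add_hom T.T T.T" by (simp add: add_hom_def)
      show "t \<in> carrier T.T" using t by simp
      fix a x assume ax: "a \<in> carrier A" "x \<in> carrier (base_space B Q)"
      then have x: "x \<in> carrier Q" by simp
      have "msum (ind Q) (\<lambda>i. \<psi> i (pW Q a x) \<odot>\<^bsub>ind Q\<^esub> pW Q \<one>\<^bsub>A\<^esub> (q i)) n =
        msum (ind Q) (\<lambda>i. pW Q a (\<phi> i x \<odot>\<^bsub>Q\<^esub> q i)) n"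
        by (rule msum_cong) (use ax(1) x dbD in \<open>simp add: \<psi>p ind_smult[OF assms(1)]\<close>)
      also have "\<dots> = msum T.T (\<lambda>i. pW Q a (\<phi> i x \<odot>\<^bsub>Q\<^esub> q i)) n" by (rule msum_same_ops) simp_all
      also have "\<dots> = pW Q a (msum (base_space B Q) (\<lambda>i. \<phi> i x \<odot>\<^bsub>Q\<^esub> q i) n)"
        by (rule add_hom_of_msum[OF T.abelian_N T.abelian_T, symmetric])
          (use ax(1) x dbD in \<open>auto intro!: T.pure_add_hom_right Q.smult_closed\<close>)
      also have "\<dots> = pW Q a x" using dbD(4)[OF x] msum_same_ops[of "base_space B Q" Q] by simp
      finally show "pW Q a x = msum (ind Q) (\<lambda>i. \<psi> i (pW Q a x) \<odot>\<^bsub>ind Q\<^esub> pW Q \<one>\<^bsub>A\<^esub> (q i)) n" by simp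
    qed
  qed
  then show ?thesis by (auto simp: has_dual_basis_def)
qed

end

section \<open>The functor given by the bimodule of a right module\<close>

text \<open>The factor group as an additive group; it is the target of the map that proves right
  exactness in \<open>Cmap_exact\<close>.\<close>

lemma ex_quotient_group:
  fixes G :: "('g, 'c) ring_scheme"
  assumes "abelian_group G" "additive_subgroup D G"
  shows "\<exists>(Q :: 'g set ring) \<pi>. abelian_group Q \<and> \<pi> \<in> add_hom G Q \<and> (\<forall>c\<in>carrier G. \<pi> c = \<zero>\<^bsub>Q\<^esub> \<longleftrightarrow> c \<in> D)"
proof -
  interpret D: abelian_subgroup D G by (rule abelian_subgroupI3) (rule assms)+
  interpret FQ: comm_group "G A_Mod D" by (rule D.a_factorgroup_is_comm_group)
  define Q where "Q = \<lparr>carrier = carrier (G A_Mod D), mult = mult (G A_Mod D), one = one (G A_Mod D),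
    ring.zero = one (G A_Mod D), add = mult (G A_Mod D)\<rparr>"
  have "abelian_group Q"
  proof (rule abelian_groupI)
    show "\<exists>y\<in>carrier Q. y \<oplus>\<^bsub>Q\<^esub> x = \<zero>\<^bsub>Q\<^esub>" if "x \<in> carrier Q" for x
      using that FQ.l_inv_ex by (auto simp: Q_def)
    show "x \<oplus>\<^bsub>Q\<^esub> y = y \<oplus>\<^bsub>Q\<^esub> x" if "x \<in> carrier Q" "y \<in> carrier Q" for x y
      using that FQ.m_comm by (simp add: Q_def del: add_A_FactGroup)
  qed (simp_all add: Q_def FQ.m_assoc del: add_A_FactGroup)
  moreover have "(\<lambda>c. D +>\<^bsub>G\<^esub> c) \<in> add_hom G Q"
    using D.a_r_coset_hom_A_Mod by (simp add: add_hom_def hom_def Q_def del: add_A_FactGroup)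
  moreover have "(D +>\<^bsub>G\<^esub> c = \<zero>\<^bsub>Q\<^esub>) = (c \<in> D)" if "c \<in> carrier G" for c
  proof -
    have "\<zero>\<^bsub>Q\<^esub> = D" by (simp add: Q_def A_FactGroup_def')
    then show ?thesis using D.a_rcos_self[OF that] D.a_rcos_const[of c] by auto
  qed
  ultimately show ?thesis by blast
qed

locale right_module_tensor = two_algebras k A B
  for k :: "'k ring" and A :: "('k, 'a) module" and B :: "('k, 'b) module" +
  fixes V :: "('b, 'v) module"
  assumes left_module_opp_V: "left_module (opp B) V"
begin

sublocale V: left_module "opp B" V by (rule left_module_opp_V)

abbreviation bV where "bV \<equiv> base_space B V"
abbreviation Wb where "Wb \<equiv> tensor_bimodule k A B V"
abbreviation pV where "pV \<equiv> pure k A bV"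

lemma algebra_opp_B: "algebra k (opp B)"
  by (rule algebra_opp[OF B.algebra_axioms])

lemma modV: "left_module k bV"
  using algebra.left_module_base_space[OF algebra_opp_B left_module_opp_V] by (simp add: base_space_opp)

sublocale TV: tensor_factors k A bV by (rule tensor_factors_modules[OF modA modV])

lemma bilinear_right: "bilinear k B bV bV (smult V)"
proof -
  interpret O: two_algebras k A "opp B"
    using A.algebra_axioms algebra_opp_B by (simp add: two_algebras_def)
  show ?thesis using O.bilinear_smult[OF left_module_opp_V] by (simp only: bilinear_def base_space_opp opp_simps smult_opp)
qed

lemma bilinear_opp_mult_A: "bilinear k A A A (\<lambda>x y. y \<otimes>\<^bsub>A\<^esub> x)"
  by (rule bilinearI) (auto simp: A.l_distr A.r_distr A.scalar_mult_left A.scalar_mult_right)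

lemma Wb_simps [simp]:
  "carrier Wb = carrier (tensor k A bV)" "add Wb = add (tensor k A bV)" "\<zero>\<^bsub>Wb\<^esub> = \<zero>\<^bsub>tensor k A bV\<^esub>"
  by (simp_all add: tensor_bimodule_def Let_def)

lemma abelian_Wb: "abelian_group Wb"
  by (rule abelian_group_cong[OF TV.abelian_T]) simp_all

lemma add_hom_Wb: "add_hom Wb H = add_hom (tensor k A bV) H"
  by (simp add: add_hom_def)

lemma Wb_smult:
  "w \<in> carrier (tensor k A bV) \<Longrightarrow> (\<lambda>l. l \<odot>\<^bsub>Wb\<^esub> w) \<in> add_hom (tensor k A B) (tensor k A bV)"
  "l \<in> carrier L \<Longrightarrow> smult Wb l \<in> add_hom (tensor k A bV) (tensor k A bV)"
  "\<lbrakk>a \<in> carrier A; b \<in> carrier B; a' \<in> carrier A; v \<in> carrier V\<rbrakk> \<Longrightarrow>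
    pure k A B a b \<odot>\<^bsub>Wb\<^esub> pV a' v = pV (a' \<otimes>\<^bsub>A\<^esub> a) (b \<odot>\<^bsub>V\<^esub> v)"
proof -
  note facts = modA modB modA modV modA modV bilinear_opp_mult_A bilinear_right
  have eq: "smult Wb = dlift k A bV (\<lambda>x y. y \<otimes>\<^bsub>A\<^esub> x) (smult V)"
    using dlift_def[OF facts] by (simp add: tensor_bimodule_def Let_def fun_eq_iff)
  show "w \<in> carrier (tensor k A bV) \<Longrightarrow> (\<lambda>l. l \<odot>\<^bsub>Wb\<^esub> w) \<in> add_hom (tensor k A B) (tensor k A bV)"
    unfolding eq by (rule dlift_left[OF facts])
  show "l \<in> carrier L \<Longrightarrow> smult Wb l \<in> add_hom (tensor k A bV) (tensor k A bV)"
    unfolding eq using dlift_right[OF facts] by simp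
  show "\<lbrakk>a \<in> carrier A; b \<in> carrier B; a' \<in> carrier A; v \<in> carrier V\<rbrakk> \<Longrightarrow>
    pure k A B a b \<odot>\<^bsub>Wb\<^esub> pV a' v = pV (a' \<otimes>\<^bsub>A\<^esub> a) (b \<odot>\<^bsub>V\<^esub> v)"
    unfolding eq using dlift_pure[OF facts] by simp
qed

lemma balanced_lsmult: "a \<in> carrier A \<Longrightarrow> TV.balanced (tensor k A bV) (\<lambda>(a', v). pV (a \<otimes>\<^bsub>A\<^esub> a') v)"
  by (rule TV.balancedI)
    (simp_all add: TV.pure_closed TV.pure_add_left TV.pure_add_right[unfolded base_space_simps] A.r_distr
      A.scalar_mult_right TV.pure_balanced[unfolded base_space_simps])

lemma lsmult_add_hom: "a \<in> carrier A \<Longrightarrow> lsmult Wb a \<in> add_hom (tensor k A bV) (tensor k A bV)"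
  using TV.tensor_lift_add_hom[OF TV.abelian_T balanced_lsmult]
  by (simp add: tensor_bimodule_def Let_def)

lemma lsmult_pure:
  "\<lbrakk>a \<in> carrier A; a' \<in> carrier A; v \<in> carrier V\<rbrakk> \<Longrightarrow> lsmult Wb a (pV a' v) = pV (a \<otimes>\<^bsub>A\<^esub> a') v"
  using TV.tensor_lift_pure[OF TV.abelian_T balanced_lsmult]
  by (simp add: tensor_bimodule_def Let_def)

lemma lsmult_closed: "\<lbrakk>a \<in> carrier A; w \<in> carrier (tensor k A bV)\<rbrakk> \<Longrightarrow> lsmult Wb a w \<in> carrier (tensor k A bV)"
  by (rule add_hom_closed[OF lsmult_add_hom])

text \<open>The two actions on A \<otimes> V commute by associativity in A. This is what lets A act
  on the tensor product over \<open>L\<close>.\<close>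

lemma lsmult_smult:
  assumes "a \<in> carrier A" "l \<in> carrier L" "w \<in> carrier (tensor k A bV)"
  shows "lsmult Wb a (l \<odot>\<^bsub>Wb\<^esub> w) = l \<odot>\<^bsub>Wb\<^esub> lsmult Wb a w"
proof -
  have 1: "lsmult Wb a (pure k A B a' b \<odot>\<^bsub>Wb\<^esub> w) = pure k A B a' b \<odot>\<^bsub>Wb\<^esub> lsmult Wb a w"
    if "a' \<in> carrier A" "b \<in> carrier B" for a' b
    by (rule TV.add_hom_eq[OF TV.abelian_T add_hom_comp[OF Wb_smult(2) lsmult_add_hom]
          add_hom_comp[OF lsmult_add_hom Wb_smult(2)]])
      (use assms that in \<open>simp_all add: Wb_smult(3) lsmult_pure AB.pure_closed V.smult_closed[simplified] A.m_assoc\<close>)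
  show ?thesis
    by (rule AB.add_hom_eq[OF TV.abelian_T add_hom_comp[OF Wb_smult(1) lsmult_add_hom] Wb_smult(1)])
      (use assms 1 lsmult_closed in simp_all)
qed

lemma factors_C: "left_module L P \<Longrightarrow> tensor_factors L Wb P"
proof -
  assume "left_module L P"
  then interpret P: left_module L P .
  show ?thesis
  proof (rule tensor_factors.intro)
    show "abelian_group Wb" by (rule abelian_Wb)
    show "abelian_group P" by (rule P.M.abelian_group_axioms)
    show "r \<odot>\<^bsub>Wb\<^esub> x \<in> carrier Wb" if "r \<in> carrier L" "x \<in> carrier Wb" for r x
      using add_hom_closed[OF Wb_smult(2)] that by simp
  qed (rule P.smult_closed)
qed

text \<open>Up to isomorphism C P is the tensor product of V and P over B with A acting on P. The
  form used here is the one through which monic modules are defined.\<close>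

abbreviation C where "C P \<equiv> bimodule_tensor L Wb P"
abbreviation q where "q P \<equiv> pure L Wb P"

lemma C_simps [simp]:
  "carrier (C P) = carrier (tensor L Wb P)" "add (C P) = add (tensor L Wb P)"
  "\<zero>\<^bsub>C P\<^esub> = \<zero>\<^bsub>tensor L Wb P\<^esub>"
  by (simp_all add: bimodule_tensor_def Let_def)

lemma add_hom_C: "add_hom (C P) H = add_hom (tensor L Wb P) H" "add_hom G (C P) = add_hom G (tensor L Wb P)"
  by (simp_all add: add_hom_def)

text \<open>Pure tensors are used in two layers: those over \<open>L\<close>, and inside their first
  factor those of A \<otimes> V.\<close>

lemma C_hom_eq:
  assumes "left_module L P" "abelian_group H" "f \<in> add_hom (C P) H" "g \<in> add_hom (C P) H" "c \<in> carrier (C P)"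
    "\<And>a v p. \<lbrakk>a \<in> carrier A; v \<in> carrier V; p \<in> carrier P\<rbrakk> \<Longrightarrow> f (q P (pV a v) p) = g (q P (pV a v) p)"
  shows "f c = g c"
proof -
  interpret T: tensor_factors L Wb P by (rule factors_C[OF assms(1)])
  note fg = assms(3,4)[unfolded add_hom_C]
  have 1: "f (q P w p) = g (q P w p)" if "w \<in> carrier (tensor k A bV)" "p \<in> carrier P" for w p
    by (rule TV.add_hom_eq[OF assms(2) add_hom_comp[OF T.pure_add_hom_left[unfolded add_hom_Wb] fg(1)]
          add_hom_comp[OF T.pure_add_hom_left[unfolded add_hom_Wb] fg(2)]])
      (use that assms(6) in simp_all)
  show ?thesis
    by (rule T.add_hom_eq[OF assms(2) fg]) (use assms(5) 1 in simp_all)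
qed

lemma C_smult:
  assumes "left_module L P" "a \<in> carrier A"
  shows "smult (C P) a \<in> add_hom (C P) (C P)"
    "\<lbrakk>w \<in> carrier (tensor k A bV); p \<in> carrier P\<rbrakk> \<Longrightarrow> a \<odot>\<^bsub>C P\<^esub> q P w p = q P (lsmult Wb a w) p"
proof -
  interpret T: tensor_factors L Wb P by (rule factors_C[OF assms(1)])
  have bal: "T.balanced (tensor L Wb P) (\<lambda>(w, x). q P (lsmult Wb a w) x)"
  proof (rule T.balancedI, goal_cases)
    case (4 l w x)
    then show ?case
      using lsmult_smult[OF assms(2), of l w] T.pure_balanced[of l "lsmult Wb a w" x] lsmult_closed[OF assms(2), of w]
      by simp
  next
    case (2 w w' x)
    then show ?case using add_hom_add[OF lsmult_add_hom[OF assms(2)], of w w']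
        T.pure_add_left[of "lsmult Wb a w" "lsmult Wb a w'" x] lsmult_closed[OF assms(2)] by simp
  qed (use lsmult_closed[OF assms(2)] in \<open>simp_all add: T.pure_closed T.pure_add_right\<close>)
  show "smult (C P) a \<in> add_hom (C P) (C P)"
    unfolding add_hom_C using T.tensor_lift_add_hom[OF T.abelian_T bal] by (simp add: bimodule_tensor_def Let_def)
  show "\<lbrakk>w \<in> carrier (tensor k A bV); p \<in> carrier P\<rbrakk> \<Longrightarrow> a \<odot>\<^bsub>C P\<^esub> q P w p = q P (lsmult Wb a w) p"
    using T.tensor_lift_pure[OF T.abelian_T bal] by (simp add: bimodule_tensor_def Let_def)
qed

lemma C_smult_pure:
  "\<lbrakk>left_module L P; a \<in> carrier A; a' \<in> carrier A; v \<in> carrier V; p \<in> carrier P\<rbrakk> \<Longrightarrow>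
    a \<odot>\<^bsub>C P\<^esub> q P (pV a' v) p = q P (pV (a \<otimes>\<^bsub>A\<^esub> a') v) p"
  using C_smult(2)[of P a "pV a' v" p] by (simp add: TV.pure_closed lsmult_pure)

lemma q_closed:
  "\<lbrakk>left_module L P; w \<in> carrier (tensor k A bV); p \<in> carrier P\<rbrakk> \<Longrightarrow> q P w p \<in> carrier (C P)"
  using tensor_factors.pure_closed[OF factors_C, of P w p] by simp

lemma abelian_C: "left_module L P \<Longrightarrow> abelian_group (C P)"
  by (rule abelian_group_cong[OF tensor_factors.abelian_T[OF factors_C]]) simp_all

lemma left_module_C:
  assumes "left_module L P"
  shows "left_module A (C P)"
proof (rule left_moduleI)
  interpret T: tensor_factors L Wb P by (rule factors_C[OF assms])
  note cl = add_hom_closed[OF C_smult(1)[OF assms]]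
  note sm = C_smult(1)[OF assms] C_smult_pure[OF assms]
  have ql: "q P (pV (a \<oplus>\<^bsub>A\<^esub> a') v) p = q P (pV a v) p \<oplus>\<^bsub>C P\<^esub> q P (pV a' v) p"
    if "a \<in> carrier A" "a' \<in> carrier A" "v \<in> carrier V" "p \<in> carrier P" for a a' v p
    using that T.pure_add_left[of "pV a v" "pV a' v" p] by (simp add: TV.pure_add_left TV.pure_closed)
  show "ring A" by (rule A.ring_A)
  show "abelian_group (C P)" by (rule abelian_C[OF assms])
  show "r \<odot>\<^bsub>C P\<^esub> x \<in> carrier (C P)" if "r \<in> carrier A" "x \<in> carrier (C P)" for r x
    using cl that by blast
  show "r \<odot>\<^bsub>C P\<^esub> (x \<oplus>\<^bsub>C P\<^esub> y) = r \<odot>\<^bsub>C P\<^esub> x \<oplus>\<^bsub>C P\<^esub> r \<odot>\<^bsub>C P\<^esub> y"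
    if "r \<in> carrier A" "x \<in> carrier (C P)" "y \<in> carrier (C P)" for r x y
    using add_hom_add[OF sm(1)] that by blast
  show "(r \<oplus>\<^bsub>A\<^esub> s) \<odot>\<^bsub>C P\<^esub> x = r \<odot>\<^bsub>C P\<^esub> x \<oplus>\<^bsub>C P\<^esub> s \<odot>\<^bsub>C P\<^esub> x"
    if "r \<in> carrier A" "s \<in> carrier A" "x \<in> carrier (C P)" for r s x
    by (rule C_hom_eq[OF assms abelian_C[OF assms] sm(1) add_hom_plus[OF abelian_C[OF assms] sm(1) sm(1)]])
      (use that ql in \<open>simp_all add: sm(2) A.l_distr\<close>)
  show "(r \<otimes>\<^bsub>A\<^esub> s) \<odot>\<^bsub>C P\<^esub> x = r \<odot>\<^bsub>C P\<^esub> (s \<odot>\<^bsub>C P\<^esub> x)"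
    if "r \<in> carrier A" "s \<in> carrier A" "x \<in> carrier (C P)" for r s x
    by (rule C_hom_eq[OF assms abelian_C[OF assms] sm(1) add_hom_comp[OF sm(1) sm(1)]])
      (use that in \<open>simp_all add: sm(2) A.m_assoc\<close>)
  show "\<one>\<^bsub>A\<^esub> \<odot>\<^bsub>C P\<^esub> x = x" if "x \<in> carrier (C P)" for x
    by (rule C_hom_eq[OF assms abelian_C[OF assms] sm(1), of "\<one>\<^bsub>A\<^esub>" "\<lambda>x. x"])
      (use that in \<open>simp_all add: sm(2) add_hom_def\<close>)
qed

lemma C_lmod_homI:
  assumes "left_module L P" "left_module A Y" "f \<in> add_hom (C P) Y"
    "\<And>a a' v p. \<lbrakk>a \<in> carrier A; a' \<in> carrier A; v \<in> carrier V; p \<in> carrier P\<rbrakk> \<Longrightarrow>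
      f (q P (pV (a \<otimes>\<^bsub>A\<^esub> a') v) p) = a \<odot>\<^bsub>Y\<^esub> f (q P (pV a' v) p)"
  shows "f \<in> lmod_hom A (C P) Y"
proof (rule lmod_homI)
  interpret Y: left_module A Y by fact
  show "f x \<in> carrier Y" if "x \<in> carrier (C P)" for x by (rule add_hom_closed[OF assms(3) that])
  show "f (x \<oplus>\<^bsub>C P\<^esub> y) = f x \<oplus>\<^bsub>Y\<^esub> f y" if "x \<in> carrier (C P)" "y \<in> carrier (C P)" for x y
    by (rule add_hom_add[OF assms(3) that])
  show "f (r \<odot>\<^bsub>C P\<^esub> x) = r \<odot>\<^bsub>Y\<^esub> f x" if "r \<in> carrier A" "x \<in> carrier (C P)" for r x
    by (rule C_hom_eq[OF assms(1) Y.M.abelian_group_axioms add_hom_comp[OF C_smult(1)[OF assms(1)] assms(3)]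
          add_hom_comp[OF assms(3) Y.smult_add_hom]])
      (use that assms(4) in \<open>simp_all add: C_smult_pure[OF assms(1)]\<close>)
qed

text \<open>The universal property of V \<otimes>_B P with its A-action. The hypothesis
  \<open>bal\<close> packs two conditions: for a = 1 it is balancedness over B, for b = 1 it is
  A-linearity in p.\<close>

lemma C_lift:
  assumes P: "left_module L P" and Y: "left_module A Y"
    and cl: "\<And>v p. \<lbrakk>v \<in> carrier V; p \<in> carrier P\<rbrakk> \<Longrightarrow> \<beta> v p \<in> carrier Y"
    and addl: "\<And>v v' p. \<lbrakk>v \<in> carrier V; v' \<in> carrier V; p \<in> carrier P\<rbrakk> \<Longrightarrow> \<beta> (v \<oplus>\<^bsub>V\<^esub> v') p = \<beta> v p \<oplus>\<^bsub>Y\<^esub> \<beta> v' p"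
    and addr: "\<And>v p p'. \<lbrakk>v \<in> carrier V; p \<in> carrier P; p' \<in> carrier P\<rbrakk> \<Longrightarrow> \<beta> v (p \<oplus>\<^bsub>P\<^esub> p') = \<beta> v p \<oplus>\<^bsub>Y\<^esub> \<beta> v p'"
    and bal: "\<And>a b v p. \<lbrakk>a \<in> carrier A; b \<in> carrier B; v \<in> carrier V; p \<in> carrier P\<rbrakk> \<Longrightarrow>
      \<beta> v (pure k A B a b \<odot>\<^bsub>P\<^esub> p) = a \<odot>\<^bsub>Y\<^esub> \<beta> (b \<odot>\<^bsub>V\<^esub> v) p"
  shows "\<exists>G\<in>lmod_hom A (C P) Y. \<forall>a\<in>carrier A. \<forall>v\<in>carrier V. \<forall>p\<in>carrier P. G (q P (pV a v) p) = a \<odot>\<^bsub>Y\<^esub> \<beta> v p"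
proof -
  interpret P: left_module L P by (rule P)
  interpret Y: left_module A Y by (rule Y)
  interpret T: tensor_factors L Wb P by (rule factors_C[OF P])
  \<comment> \<open>For fixed p this is the map on A \<otimes> V; lifting it once more with p
    varying gives the desired G.\<close>
  define g where "g p = tensor_lift Y (\<lambda>(a, v). a \<odot>\<^bsub>Y\<^esub> \<beta> v p)" for p
  have balg: "TV.balanced Y (\<lambda>(a, v). a \<odot>\<^bsub>Y\<^esub> \<beta> v p)" if p: "p \<in> carrier P" for p
  proof (rule TV.balancedI, goal_cases)
    case (4 r a v)
    have r1: "r \<odot>\<^bsub>B\<^esub> \<one>\<^bsub>B\<^esub> \<in> carrier B" "r \<odot>\<^bsub>A\<^esub> \<one>\<^bsub>A\<^esub> \<in> carrier A"
      using 4 by (simp_all add: kA.smult_closed kB.smult_closed)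
    have v: "v \<in> carrier V" using 4 by simp
    \<comment> \<open>A scalar r on V becomes 1 \<otimes> r 1 acting on p. In \<open>L\<close> this
      equals r 1 \<otimes> 1, which comes out as a scalar on Y.\<close>
    have "\<beta> ((r \<odot>\<^bsub>B\<^esub> \<one>\<^bsub>B\<^esub>) \<odot>\<^bsub>V\<^esub> v) p = \<one>\<^bsub>A\<^esub> \<odot>\<^bsub>Y\<^esub> \<beta> ((r \<odot>\<^bsub>B\<^esub> \<one>\<^bsub>B\<^esub>) \<odot>\<^bsub>V\<^esub> v) p"
      using v p r1 V.smult_closed[of "r \<odot>\<^bsub>B\<^esub> \<one>\<^bsub>B\<^esub>" v] by (simp add: Y.smult_one cl)
    also have "\<dots> = \<beta> v (pure k A B \<one>\<^bsub>A\<^esub> (r \<odot>\<^bsub>B\<^esub> \<one>\<^bsub>B\<^esub>) \<odot>\<^bsub>P\<^esub> p)" using bal[OF A.one_closed r1(1) v p] by simp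
    also have "pure k A B \<one>\<^bsub>A\<^esub> (r \<odot>\<^bsub>B\<^esub> \<one>\<^bsub>B\<^esub>) = pure k A B (r \<odot>\<^bsub>A\<^esub> \<one>\<^bsub>A\<^esub>) \<one>\<^bsub>B\<^esub>"
      using AB.pure_balanced[of r "\<one>\<^bsub>A\<^esub>" "\<one>\<^bsub>B\<^esub>"] 4 by simp
    also have "\<beta> v (pure k A B (r \<odot>\<^bsub>A\<^esub> \<one>\<^bsub>A\<^esub>) \<one>\<^bsub>B\<^esub> \<odot>\<^bsub>P\<^esub> p) = (r \<odot>\<^bsub>A\<^esub> \<one>\<^bsub>A\<^esub>) \<odot>\<^bsub>Y\<^esub> \<beta> v p"
      using bal[OF r1(2) B.one_closed v p] V.smult_one[OF v] by simp
    finally have "a \<odot>\<^bsub>Y\<^esub> \<beta> ((r \<odot>\<^bsub>B\<^esub> \<one>\<^bsub>B\<^esub>) \<odot>\<^bsub>V\<^esub> v) p = (a \<otimes>\<^bsub>A\<^esub> (r \<odot>\<^bsub>A\<^esub> \<one>\<^bsub>A\<^esub>)) \<odot>\<^bsub>Y\<^esub> \<beta> v p"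
      using 4 r1 cl[OF v p] by (simp add: Y.smult_assoc)
    then show ?case using 4 by (simp add: A.scalar_one)
  qed (use p cl addl in \<open>simp_all add: Y.smult_closed Y.smult_l_distr Y.smult_r_distr\<close>)
  have g: "g p \<in> add_hom (tensor k A bV) Y" if "p \<in> carrier P" for p
    unfolding g_def by (rule TV.tensor_lift_add_hom[OF Y.M.abelian_group_axioms balg[OF that]])
  have gp: "g p (pV a v) = a \<odot>\<^bsub>Y\<^esub> \<beta> v p" if "a \<in> carrier A" "v \<in> carrier V" "p \<in> carrier P" for a v p
    unfolding g_def using TV.tensor_lift_pure[OF Y.M.abelian_group_axioms balg[OF that(3)], of a v] that by simp
  have g_add: "g (p \<oplus>\<^bsub>P\<^esub> p') w = g p w \<oplus>\<^bsub>Y\<^esub> g p' w"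
    if "p \<in> carrier P" "p' \<in> carrier P" "w \<in> carrier (tensor k A bV)" for p p' w
    by (rule TV.add_hom_eq[OF Y.M.abelian_group_axioms g add_hom_plus[OF Y.M.abelian_group_axioms g g]])
      (use that gp addr cl in \<open>simp_all add: Y.smult_r_distr\<close>)
  have Vs: "b \<odot>\<^bsub>V\<^esub> v \<in> carrier V" if "b \<in> carrier B" "v \<in> carrier V" for b v
    using V.smult_closed[of b v] that by simp
  have g_add': "(\<lambda>p. g p w) \<in> add_hom P Y" if "w \<in> carrier (tensor k A bV)" for w
    using that add_hom_closed[OF g] g_add by (intro add_homI) auto
  have Pl: "(\<lambda>l. l \<odot>\<^bsub>P\<^esub> p) \<in> add_hom (tensor k A B) P" if "p \<in> carrier P" for p
    using that P.smult_closed P.smult_l_distr by (intro add_homI) auto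
  have g_bal1: "g p (pure k A B a b \<odot>\<^bsub>Wb\<^esub> w) = g (pure k A B a b \<odot>\<^bsub>P\<^esub> p) w"
    if "a \<in> carrier A" "b \<in> carrier B" "p \<in> carrier P" "w \<in> carrier (tensor k A bV)" for a b p w
  proof -
    have pp: "pure k A B a b \<odot>\<^bsub>P\<^esub> p \<in> carrier P" using that P.smult_closed[of "pure k A B a b" p] by (simp add: AB.pure_closed)
    show ?thesis
      by (rule TV.add_hom_eq[OF Y.M.abelian_group_axioms add_hom_comp[OF Wb_smult(2) g] g[OF pp]])
        (use that pp in \<open>simp_all add: AB.pure_closed Wb_smult(3) gp Vs bal Y.smult_assoc cl\<close>)
  qed
  have g_bal: "g p (l \<odot>\<^bsub>Wb\<^esub> w) = g (l \<odot>\<^bsub>P\<^esub> p) w"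
    if "l \<in> carrier L" "p \<in> carrier P" "w \<in> carrier (tensor k A bV)" for l p w
    by (rule AB.add_hom_eq[OF Y.M.abelian_group_axioms add_hom_comp[OF Wb_smult(1) g]
          add_hom_comp[OF Pl g_add']])
      (use that g_bal1 in simp_all)
  define G where "G = tensor_lift Y (\<lambda>(w, p). g p w)"
  have balG: "T.balanced Y (\<lambda>(w, p). g p w)"
    by (rule T.balancedI) (use g_bal g_add add_hom_closed[OF g] add_hom_add[OF g] in simp_all)
  have G: "G \<in> add_hom (C P) Y"
    unfolding G_def add_hom_C by (rule T.tensor_lift_add_hom[OF Y.M.abelian_group_axioms balG])
  have Gp: "G (q P (pV a v) p) = a \<odot>\<^bsub>Y\<^esub> \<beta> v p" if "a \<in> carrier A" "v \<in> carrier V" "p \<in> carrier P" for a v p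
    unfolding G_def using T.tensor_lift_pure[OF Y.M.abelian_group_axioms balG, of "pV a v" p] that
    by (simp add: TV.pure_closed gp)
  have "G \<in> lmod_hom A (C P) Y"
    by (rule C_lmod_homI[OF P Y G]) (simp add: Gp Y.smult_assoc cl)
  then show ?thesis using Gp by blast
qed

text \<open>The map induced by f on the second factor. It is verbatim the differential used in
  \<open>Tor\<close>, so homology of the C P is Tor.\<close>

definition Cmap :: "(('a \<times> 'b \<Rightarrow>\<^sub>0 int) set, 'y) module \<Rightarrow> ('x \<Rightarrow> 'y) \<Rightarrow>
    (('a \<times> 'v \<Rightarrow>\<^sub>0 int) set \<times> 'x \<Rightarrow>\<^sub>0 int) set \<Rightarrow> (('a \<times> 'v \<Rightarrow>\<^sub>0 int) set \<times> 'y \<Rightarrow>\<^sub>0 int) set" where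
  "Cmap P' f = tensor_lift (tensor L Wb P') (\<lambda>(w, p). pure L Wb P' w (f p))"

lemma Cmap:
  assumes "left_module L P" "left_module L P'" "f \<in> lmod_hom L P P'"
  shows "\<lbrakk>w \<in> carrier (tensor k A bV); p \<in> carrier P\<rbrakk> \<Longrightarrow> Cmap P' f (q P w p) = q P' w (f p)"
    "Cmap P' f \<in> lmod_hom A (C P) (C P')"
proof -
  interpret T: tensor_factors L Wb P by (rule factors_C[OF assms(1)])
  interpret T': tensor_factors L Wb P' by (rule factors_C[OF assms(2)])
  have bal: "T.balanced (tensor L Wb P') (\<lambda>(w, p). q P' w (f p))"
    by (rule T.balancedI)
      (use lmod_hom_closed[OF assms(3)] lmod_hom_add[OF assms(3)] lmod_hom_smult[OF assms(3)] T'.pure_balanced in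
        \<open>simp_all add: T'.pure_closed T'.pure_add_left[unfolded Wb_simps] T'.pure_add_right\<close>)
  show 1: "Cmap P' f (q P w p) = q P' w (f p)" if "w \<in> carrier (tensor k A bV)" "p \<in> carrier P" for w p
    unfolding Cmap_def using T.tensor_lift_pure[OF T'.abelian_T bal, of w p] that by simp
  show "Cmap P' f \<in> lmod_hom A (C P) (C P')"
  proof (rule C_lmod_homI[OF assms(1) left_module_C[OF assms(2)]])
    show "Cmap P' f \<in> add_hom (C P) (C P')"
      unfolding Cmap_def add_hom_C by (rule T.tensor_lift_add_hom[OF T'.abelian_T bal])
    fix a a' v p assume "a \<in> carrier A" "a' \<in> carrier A" "v \<in> carrier V" "p \<in> carrier P"
    then show "Cmap P' f (q P (pV (a \<otimes>\<^bsub>A\<^esub> a') v) p) = a \<odot>\<^bsub>C P'\<^esub> Cmap P' f (q P (pV a' v) p)"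
      using lmod_hom_closed[OF assms(3)] by (simp add: 1 TV.pure_closed C_smult_pure[OF assms(2)])
  qed
qed

lemma Cmap_surj:
  assumes "left_module L P" "left_module L P'" "f \<in> lmod_hom L P P'" "f ` carrier P = carrier P'"
  shows "Cmap P' f ` carrier (C P) = carrier (C P')"
proof
  interpret T: tensor_factors L Wb P by (rule factors_C[OF assms(1)])
  interpret T': tensor_factors L Wb P' by (rule factors_C[OF assms(2)])
  note fm = Cmap[OF assms(1-3)]
  show "Cmap P' f ` carrier (C P) \<subseteq> carrier (C P')" using lmod_hom_closed[OF fm(2)] by blast
  have sub: "submod A (C P') (Cmap P' f ` carrier (C P))"
    by (rule submod_image[OF left_module_C left_module_C fm(2)]) (rule assms)+
  have addc: "x \<oplus>\<^bsub>C P'\<^esub> y \<in> Cmap P' f ` carrier (C P)"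
    if "x \<in> Cmap P' f ` carrier (C P)" "y \<in> Cmap P' f ` carrier (C P)" for x y
    using sub that unfolding submod_def by blast
  show "carrier (C P') \<subseteq> Cmap P' f ` carrier (C P)"
  proof
    fix t assume "t \<in> carrier (C P')"
    then have "t \<in> carrier (tensor L Wb P')" by simp
    then show "t \<in> Cmap P' f ` carrier (C P)"
    proof (induction rule: T'.tensor_induct)
      case (pure w x)
      then have "x \<in> f ` carrier P" using assms(4) by simp
      then obtain p where p: "p \<in> carrier P" "x = f p" by (rule imageE)
      then show ?case using pure fm(1)[of w p] q_closed[OF assms(1), of w p]
        by (intro image_eqI[of _ _ "q P w p"]) simp_all
    next
      case (add s t)
      then show ?case using addc[of s t] by simp
    qed
  qed
qed

text \<open>Right exactness of the tensor product. The projection of C P0 onto its quotient by the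
  image of C P1 factors through C X by a map \<theta>, so whatever dies in C X already lies in that
  image.\<close>

lemma Cmap_exact:
  assumes P1: "left_module L P1" and P0: "left_module L P0" and X: "left_module L X"
    and d: "d \<in> lmod_hom L P1 P0" and e: "e \<in> lmod_hom L P0 X" "e ` carrier P0 = carrier X"
    and ex: "d ` carrier P1 = a_kernel P0 X e"
  shows "Cmap P0 d ` carrier (C P1) = a_kernel (C P0) (C X) (Cmap X e)"
proof
  interpret P0: left_module L P0 by (rule P0)
  interpret X: left_module L X by (rule X)
  interpret C0: left_module A "C P0" by (rule left_module_C[OF P0])
  interpret T1: tensor_factors L Wb P1 by (rule factors_C[OF P1])
  interpret T0: tensor_factors L Wb P0 by (rule factors_C[OF P0])
  interpret TX: tensor_factors L Wb X by (rule factors_C[OF X])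
  note dm = Cmap[OF P1 P0 d] and em = Cmap[OF P0 X e(1)]
  let ?D = "Cmap P0 d ` carrier (C P1)"
  have ed: "e (d x) = \<zero>\<^bsub>X\<^esub>" if "x \<in> carrier P1" for x
    using ex that by (auto simp: a_kernel_def' set_eq_iff image_iff)
  have dc: "d x \<in> carrier P0" if "x \<in> carrier P1" for x by (rule lmod_hom_closed[OF d that])
  show "?D \<subseteq> a_kernel (C P0) (C X) (Cmap X e)"
  proof
    fix y assume "y \<in> ?D"
    then obtain c where c: "c \<in> carrier (C P1)" "y = Cmap P0 d c" by (rule imageE)
    have "Cmap X e (Cmap P0 d c) = \<zero>\<^bsub>C X\<^esub>"
      by (rule T1.add_hom_eq[OF abelian_C[OF X] add_hom_comp[OF lmod_hom_add_hom[OF dm(2), unfolded add_hom_C(1)]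
              lmod_hom_add_hom[OF em(2)]], of "\<lambda>_. \<zero>\<^bsub>C X\<^esub>"])
        (use c(1) dc ed in \<open>simp_all add: dm(1) em(1) TX.pure_zero_right add_hom_def\<close>)
    then show "y \<in> a_kernel (C P0) (C X) (Cmap X e)"
      using c lmod_hom_closed[OF dm(2) c(1)] by (simp add: a_kernel_def')
  qed
  have subD: "submod A (C P0) ?D" by (rule submod_image[OF left_module_C[OF P1] C0.left_module_axioms dm(2)])
  have Dneg: "\<ominus>\<^bsub>C P0\<^esub> x \<in> ?D" if "x \<in> ?D" for x
  proof -
    have "(\<ominus>\<^bsub>A\<^esub> \<one>\<^bsub>A\<^esub>) \<odot>\<^bsub>C P0\<^esub> x \<in> ?D" using subD that unfolding submod_def by blast
    moreover have "x \<in> carrier (C P0)" using subD that unfolding submod_def by blast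
    ultimately show ?thesis using C0.smult_minus_one by simp
  qed
  have subgrp: "additive_subgroup ?D (C P0)"
    by (rule additive_subgroup.intro, rule C0.M.add.subgroupI)
      (use subD Dneg in \<open>auto simp: submod_def a_inv_def\<close>)
  \<comment> \<open>Q is the additive group C P0 modulo ?D; it serves as target of a balanced map
    defined on A \<otimes> V and X.\<close>
  obtain Q :: "(('a \<times> 'v \<Rightarrow>\<^sub>0 int) set \<times> 'd \<Rightarrow>\<^sub>0 int) set set ring" and \<pi>
    where Qab: "abelian_group Q" and \<pi>: "\<pi> \<in> add_hom (C P0) Q"
      and \<pi>0: "\<And>c. c \<in> carrier (C P0) \<Longrightarrow> \<pi> c = \<zero>\<^bsub>Q\<^esub> \<longleftrightarrow> c \<in> ?D"
    using ex_quotient_group[OF C0.M.abelian_group_axioms subgrp] by (elim exE conjE) (rule that, auto)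
  interpret Q: abelian_group Q by (rule Qab)
  have \<pi>d: "\<pi> (q P0 w p) = \<pi> (q P0 w p')"
    if w: "w \<in> carrier (tensor k A bV)" and p: "p \<in> carrier P0" "p' \<in> carrier P0" "e p = e p'" for w p p'
  proof -
    have "e (p \<ominus>\<^bsub>P0\<^esub> p') = \<zero>\<^bsub>X\<^esub>"
      using lmod_hom_diff[OF P0 X e(1) p(1,2)] p(3) lmod_hom_closed[OF e(1) p(2)]
      by (simp add: X.M.minus_eq_zero_iff)
    then have "p \<ominus>\<^bsub>P0\<^esub> p' \<in> d ` carrier P1" using p unfolding ex by (simp add: a_kernel_def')
    then obtain r where r: "r \<in> carrier P1" "p \<ominus>\<^bsub>P0\<^esub> p' = d r" by (rule imageE)
    have "p = d r \<oplus>\<^bsub>P0\<^esub> p'" using p r(2)[symmetric] by (simp add: a_minus_def P0.M.a_assoc P0.M.l_neg)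
    then have "q P0 w p = q P0 w (d r) \<oplus>\<^bsub>C P0\<^esub> q P0 w p'"
      using T0.pure_add_right[of w "d r" p'] w p dc[OF r(1)] by simp
    moreover have "q P0 w (d r) \<in> ?D"
      using dm(1)[OF w r(1)] q_closed[OF P1 w r(1)] by (metis imageI)
    ultimately show ?thesis
      using add_hom_add[OF \<pi> q_closed[OF P0 w dc[OF r(1)]] q_closed[OF P0 w p(2)]]
        \<pi>0[OF q_closed[OF P0 w dc[OF r(1)]]] add_hom_closed[OF \<pi> q_closed[OF P0 w p(2)]]
      by simp
  qed
  \<comment> \<open>A set-theoretic section of e without any linearity. By \<pi>d the class of w
    \<otimes> s x is independent of the choice, which restores additivity and balancedness.\<close>
  define s where "s x = (SOME p. p \<in> carrier P0 \<and> e p = x)" for x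
  have s: "s x \<in> carrier P0" "e (s x) = x" if "x \<in> carrier X" for x
  proof -
    have "x \<in> e ` carrier P0" using e(2) that by simp
    then have "\<exists>p. p \<in> carrier P0 \<and> e p = x" by blast
    from someI_ex[OF this] show "s x \<in> carrier P0" "e (s x) = x" by (simp_all add: s_def)
  qed
  have sq: "\<pi> (q P0 w (s x)) = \<pi> (q P0 w p)"
    if "w \<in> carrier (tensor k A bV)" "x \<in> carrier X" "p \<in> carrier P0" "e p = x" for w x p
    by (rule \<pi>d) (use that s in simp_all)
  have bal: "TX.balanced Q (\<lambda>(w, x). \<pi> (q P0 w (s x)))"
  proof (rule TX.balancedI, goal_cases)
    case (1 w x)
    then show ?case using add_hom_closed[OF \<pi> q_closed[OF P0]] s by simp
  next
    case (2 w w' x)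
    then show ?case
      using T0.pure_add_left[of w w' "s x"] s(1)[of x]
        add_hom_add[OF \<pi> q_closed[OF P0, of w "s x"] q_closed[OF P0, of w' "s x"]] by simp
  next
    case (3 w x x')
    have "\<pi> (q P0 w (s (x \<oplus>\<^bsub>X\<^esub> x'))) = \<pi> (q P0 w (s x \<oplus>\<^bsub>P0\<^esub> s x'))"
      by (rule sq) (use 3 s lmod_hom_add[OF e(1)] in simp_all)
    then show ?case
      using T0.pure_add_right[of w "s x" "s x'"] s(1) 3
        add_hom_add[OF \<pi> q_closed[OF P0, of w "s x"] q_closed[OF P0, of w "s x'"]] by simp
  next
    case (4 l w x)
    have "\<pi> (q P0 w (s (l \<odot>\<^bsub>X\<^esub> x))) = \<pi> (q P0 w (l \<odot>\<^bsub>P0\<^esub> s x))"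
      by (rule sq) (use 4 s lmod_hom_smult[OF e(1), of l "s x"] X.smult_closed[of l x] P0.smult_closed[of l "s x"] in simp_all)
    then show ?case using T0.pure_balanced[of l w "s x"] s(1) 4 by simp
  qed
  define \<theta> where "\<theta> = tensor_lift Q (\<lambda>(w, x). \<pi> (q P0 w (s x)))"
  have \<theta>: "\<theta> \<in> add_hom (C X) Q"
    unfolding \<theta>_def add_hom_C by (rule TX.tensor_lift_add_hom[OF Qab bal])
  have \<theta>p: "\<theta> (q X w x) = \<pi> (q P0 w (s x))" if "w \<in> carrier (tensor k A bV)" "x \<in> carrier X" for w x
    unfolding \<theta>_def using TX.tensor_lift_pure[OF Qab bal, of w x] that by simp
  have \<theta>e: "\<theta> (Cmap X e c) = \<pi> c" if c: "c \<in> carrier (C P0)" for c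
    by (rule T0.add_hom_eq[OF Qab add_hom_comp[OF lmod_hom_add_hom[OF em(2), unfolded add_hom_C(1)] \<theta>]
          \<pi>[unfolded add_hom_C(1)]])
      (use c sq lmod_hom_closed[OF e(1)] in \<open>simp_all add: em(1) \<theta>p\<close>)
  show "a_kernel (C P0) (C X) (Cmap X e) \<subseteq> ?D"
  proof
    fix c assume "c \<in> a_kernel (C P0) (C X) (Cmap X e)"
    then have c: "c \<in> carrier (C P0)" "Cmap X e c = \<zero>\<^bsub>C X\<^esub>" by (simp_all add: a_kernel_def')
    then have "\<pi> c = \<zero>\<^bsub>Q\<^esub>" using \<theta>e[OF c(1)] add_hom_zero[OF abelian_C[OF X] Qab \<theta>] by simp
    then show "c \<in> ?D" using \<pi>0[OF c(1)] by simp
  qed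
qed

end

section \<open>Duality\<close>

lemma add_hom_msum:
  assumes "abelian_group H" "\<And>i. i < n \<Longrightarrow> f i \<in> add_hom G H"
  shows "(\<lambda>x. msum H (\<lambda>i. f i x) n) \<in> add_hom G H"
  using assms(2)
proof (induction n)
  case 0
  interpret H: abelian_group H by fact
  show ?case by (simp add: add_hom_def)
next
  case (Suc n)
  then show ?case using add_hom_plus[OF assms(1), of _ G "f n"] by simp
qed

text \<open>Exhibits N as the k-dual of M by a bilinear form and finite families m, w that expand
  every element. The data are symmetric in M and N, and N may be any module, not only a module of
  functionals.\<close>

definition perfect_pairing :: "'k ring \<Rightarrow> ('k, 'r) module \<Rightarrow> ('r, 'm) module \<Rightarrow> ('r, 'n) module \<Rightarrow>
    ('m \<Rightarrow> 'n \<Rightarrow> 'k) \<Rightarrow> nat \<Rightarrow> (nat \<Rightarrow> 'm) \<Rightarrow> (nat \<Rightarrow> 'n) \<Rightarrow> bool" where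
  "perfect_pairing k R M N pr n m w \<longleftrightarrow>
     bilinear k (base_space R M) (base_space R N) (regular k) pr \<and>
     (\<forall>r\<in>carrier R. \<forall>x\<in>carrier M. \<forall>y\<in>carrier N. pr (r \<odot>\<^bsub>M\<^esub> x) y = pr x (r \<odot>\<^bsub>N\<^esub> y)) \<and>
     (\<forall>i<n. m i \<in> carrier M \<and> w i \<in> carrier N) \<and>
     (\<forall>x\<in>carrier M. msum (base_space R M) (\<lambda>i. pr x (w i) \<odot>\<^bsub>base_space R M\<^esub> m i) n = x) \<and>
     (\<forall>y\<in>carrier N. msum (base_space R N) (\<lambda>i. pr (m i) y \<odot>\<^bsub>base_space R N\<^esub> w i) n = y)"

lemma perfect_pairingD:
  assumes "perfect_pairing k R M N pr n m w"
  shows "bilinear k (base_space R M) (base_space R N) (regular k) pr"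
    "\<lbrakk>r \<in> carrier R; x \<in> carrier M; y \<in> carrier N\<rbrakk> \<Longrightarrow> pr (r \<odot>\<^bsub>M\<^esub> x) y = pr x (r \<odot>\<^bsub>N\<^esub> y)"
    "i < n \<Longrightarrow> m i \<in> carrier M" "i < n \<Longrightarrow> w i \<in> carrier N"
    "x \<in> carrier M \<Longrightarrow> msum (base_space R M) (\<lambda>i. pr x (w i) \<odot>\<^bsub>base_space R M\<^esub> m i) n = x"
    "y \<in> carrier N \<Longrightarrow> msum (base_space R N) (\<lambda>i. pr (m i) y \<odot>\<^bsub>base_space R N\<^esub> w i) n = y"
  using assms unfolding perfect_pairing_def by blast+

lemma bilinear_flip: "bilinear k M N P \<alpha> \<Longrightarrow> bilinear k N M P (\<lambda>x y. \<alpha> y x)"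
  unfolding bilinear_def by blast

lemma perfect_pairing_flip:
  assumes "perfect_pairing k R M N pr n m w"
  shows "perfect_pairing k R N M (\<lambda>y x. pr x y) n w m"
  using perfect_pairingD[OF assms] bilinear_flip[OF perfect_pairingD(1)[OF assms]]
  unfolding perfect_pairing_def by simp

text \<open>Only the carrier, the unit and the k-action of R are read, never its multiplication, so
  the sides may be exchanged.\<close>

lemma perfect_pairing_opp: "perfect_pairing k (opp R) = perfect_pairing k R"
  by (simp add: perfect_pairing_def fun_eq_iff base_space_opp)

definition dual_module :: "'k ring \<Rightarrow> ('k, 'r) module \<Rightarrow> ('r, 'm) module \<Rightarrow> ('r, 'm \<Rightarrow> 'k) module" where
  "dual_module k R M = (let H = Hom_group k (base_space R M) (regular k) in
     \<lparr>carrier = carrier H, mult = undefined, one = undefined, ring.zero = \<zero>\<^bsub>H\<^esub>, add = add H,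
      smult = (\<lambda>r \<xi>. \<lambda>x\<in>carrier M. \<xi> (r \<odot>\<^bsub>M\<^esub> x))\<rparr>)"

lemma dual_module_simps:
  "carrier (dual_module k R M) = lmod_hom k (base_space R M) (regular k) \<inter> extensional (carrier M)"
  "\<zero>\<^bsub>dual_module k R M\<^esub> = (\<lambda>x\<in>carrier M. \<zero>\<^bsub>k\<^esub>)"
  "\<xi> \<oplus>\<^bsub>dual_module k R M\<^esub> \<eta> = (\<lambda>x\<in>carrier M. \<xi> x \<oplus>\<^bsub>k\<^esub> \<eta> x)"
  "r \<odot>\<^bsub>dual_module k R M\<^esub> \<xi> = (\<lambda>x\<in>carrier M. \<xi> (r \<odot>\<^bsub>M\<^esub> x))"
  by (simp_all add: dual_module_def Let_def)

context algebra
begin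

lemma left_module_dual:
  assumes "left_module A M"
  shows "left_module (opp A) (dual_module k A M)"
proof (rule left_moduleI)
  interpret M: left_module A M by fact
  interpret kM: left_module k "base_space A M" by (rule left_module_base_space[OF assms])
  let ?D = "dual_module k A M"
  have kA: "c \<odot> \<one> \<in> carrier A" if "c \<in> carrier k" for c
    using left_module.smult_closed[OF left_module_k_A] that by simp
  have hom: "\<xi> x \<in> carrier k" "\<xi> (x \<oplus>\<^bsub>M\<^esub> y) = \<xi> x \<oplus>\<^bsub>k\<^esub> \<xi> y" "c \<in> carrier k \<Longrightarrow> \<xi> ((c \<odot> \<one>) \<odot>\<^bsub>M\<^esub> x) = c \<otimes>\<^bsub>k\<^esub> \<xi> x"
    if "\<xi> \<in> carrier ?D" "x \<in> carrier M" "y \<in> carrier M" for \<xi> x y c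
    using that lmod_hom_closed[of \<xi> k "base_space A M" "regular k" x]
      lmod_hom_add[of \<xi> k "base_space A M" "regular k" x y]
      lmod_hom_smult[of \<xi> k "base_space A M" "regular k" c x]
    by (simp_all add: dual_module_simps)
  have ext: "\<xi> = \<eta>" if "\<xi> \<in> carrier ?D" "\<eta> \<in> carrier ?D" "\<And>x. x \<in> carrier M \<Longrightarrow> \<xi> x = \<eta> x" for \<xi> \<eta>
    using that by (intro extensionalityI[of \<xi> "carrier M"]) (auto simp: dual_module_simps)
  show "ring (opp A)" by (rule ring_opp[OF ring_A])
  show ab: "abelian_group ?D"
    by (rule abelian_group_cong[OF abelian_group_Hom_group[OF left_module_base_space[OF assms]
            left_module_regular[of k]]])
      (use field_k in \<open>simp_all add: dual_module_def Let_def field_def domain_def cring_def\<close>)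
  show cl: "r \<odot>\<^bsub>?D\<^esub> \<xi> \<in> carrier ?D" if "r \<in> carrier (opp A)" "\<xi> \<in> carrier ?D" for r \<xi>
  proof -
    have "(\<lambda>x. \<xi> (r \<odot>\<^bsub>M\<^esub> x)) \<in> lmod_hom k (base_space A M) (regular k)"
    proof (rule lmod_homI)
      fix c x assume cx: "c \<in> carrier k" "x \<in> carrier (base_space A M)"
      have "r \<odot>\<^bsub>M\<^esub> ((c \<odot> \<one>) \<odot>\<^bsub>M\<^esub> x) = (c \<odot> \<one>) \<odot>\<^bsub>M\<^esub> (r \<odot>\<^bsub>M\<^esub> x)"
        using that cx kA by (simp add: M.smult_assoc[symmetric] scalar_one)
      then show "\<xi> (r \<odot>\<^bsub>M\<^esub> (c \<odot>\<^bsub>base_space A M\<^esub> x)) = c \<odot>\<^bsub>regular k\<^esub> \<xi> (r \<odot>\<^bsub>M\<^esub> x)"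
        using that cx hom(3)[of \<xi> "r \<odot>\<^bsub>M\<^esub> x" _ c] by (simp add: M.smult_closed)
    qed (use that hom in \<open>simp_all add: M.smult_closed M.smult_r_distr\<close>)
    then show ?thesis using lmod_hom_restrict[OF left_module_base_space[OF assms], of "\<lambda>x. \<xi> (r \<odot>\<^bsub>M\<^esub> x)"]
      by (simp add: dual_module_simps)
  qed
  interpret D: abelian_group ?D by (rule ab)
  show "(r \<oplus>\<^bsub>opp A\<^esub> s) \<odot>\<^bsub>?D\<^esub> \<xi> = r \<odot>\<^bsub>?D\<^esub> \<xi> \<oplus>\<^bsub>?D\<^esub> s \<odot>\<^bsub>?D\<^esub> \<xi>"
    if "r \<in> carrier (opp A)" "s \<in> carrier (opp A)" "\<xi> \<in> carrier ?D" for r s \<xi>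
    using that hom(2)[of \<xi>] by (auto simp: dual_module_simps(3,4) fun_eq_iff M.smult_l_distr M.smult_closed)
  show "r \<odot>\<^bsub>?D\<^esub> (\<xi> \<oplus>\<^bsub>?D\<^esub> \<eta>) = r \<odot>\<^bsub>?D\<^esub> \<xi> \<oplus>\<^bsub>?D\<^esub> r \<odot>\<^bsub>?D\<^esub> \<eta>"
    if "r \<in> carrier (opp A)" "\<xi> \<in> carrier ?D" "\<eta> \<in> carrier ?D" for r \<xi> \<eta>
    using that by (auto simp: dual_module_simps(3,4) fun_eq_iff M.smult_closed)
  show "(r \<otimes>\<^bsub>opp A\<^esub> s) \<odot>\<^bsub>?D\<^esub> \<xi> = r \<odot>\<^bsub>?D\<^esub> (s \<odot>\<^bsub>?D\<^esub> \<xi>)"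
    if "r \<in> carrier (opp A)" "s \<in> carrier (opp A)" "\<xi> \<in> carrier ?D" for r s \<xi>
    using that by (auto simp: dual_module_simps(3,4) fun_eq_iff M.smult_closed M.smult_assoc)
  show "\<one>\<^bsub>opp A\<^esub> \<odot>\<^bsub>?D\<^esub> \<xi> = \<xi>" if "\<xi> \<in> carrier ?D" for \<xi>
    by (rule ext[OF cl that]) (use that in \<open>simp_all add: dual_module_simps(4) M.smult_one\<close>)
qed

text \<open>The dual Hom_k(M, k) with the coordinate functionals of M as generating family, copied
  to \<open>'k univ\<close>, the type over which \<open>mon\<close> and \<open>gl_dim\<close>
  quantify.\<close>

lemma ex_perfect_pairing:
  fixes M :: "('a, 'm) module"
  assumes "fg_left_module A M"
  shows "\<exists>(N :: ('a, 'k univ) module) pr n m w. fg_left_module (opp A) N \<and> perfect_pairing k A M N pr n m w"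
proof -
  have MR: "left_module A M" using assms by (simp add: fg_left_module_def)
  interpret M: left_module A M by (rule MR)
  interpret kM: left_module k "base_space A M" by (rule left_module_base_space[OF MR])
  interpret kA: left_module k A by (rule left_module_k_A)
  interpret opp: algebra k "opp A" by (rule algebra_opp[OF algebra_axioms])
  let ?D = "dual_module k A M"
  let ?b = "base_space A M"
  have DL: "left_module (opp A) ?D" by (rule left_module_dual[OF MR])
  interpret D: left_module "opp A" ?D by (rule DL)
  interpret kD: left_module k "base_space (opp A) ?D" by (rule opp.left_module_base_space[OF DL])
  have rk: "left_module k (regular k)" by (rule left_module_regular[OF left_module_ring[OF left_module_k_A]])
  obtain n p \<phi> where db: "dual_basis k ?b n p \<phi>"
    using fg_has_dual_basis[OF assms] by (auto simp: has_dual_basis_def)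
  note dbD = dual_basisD[OF db]
  have hom: "\<xi> \<in> lmod_hom k ?b (regular k)" if "\<xi> \<in> carrier ?D" for \<xi> using that by (simp add: dual_module_simps)
  have homc: "\<xi> x \<in> carrier k" if "\<xi> \<in> carrier ?D" "x \<in> carrier M" for \<xi> x
    using lmod_hom_closed[OF hom[OF that(1)], of x] that by simp
  have csm: "(c \<odot>\<^bsub>base_space (opp A) ?D\<^esub> \<xi>) x = c \<otimes>\<^bsub>k\<^esub> \<xi> x"
    if "c \<in> carrier k" "\<xi> \<in> carrier ?D" "x \<in> carrier M" for c \<xi> x
    using lmod_hom_smult[OF hom[OF that(2)] that(1), of x] that by (simp add: dual_module_simps(4))
  have ext: "\<xi> = \<eta>" if "\<xi> \<in> carrier ?D" "\<eta> \<in> carrier ?D" "\<And>x. x \<in> carrier M \<Longrightarrow> \<xi> x = \<eta> x" for \<xi> \<eta>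
    using that by (intro extensionalityI[of \<xi> "carrier M"]) (auto simp: dual_module_simps)
  define \<psi> where "\<psi> i = restrict (\<phi> i) (carrier M)" for i
  have \<psi>: "\<psi> i \<in> carrier ?D" if "i < n" for i
    using lmod_hom_restrict[OF kM.left_module_axioms dbD(2)[OF that]] by (simp add: \<psi>_def dual_module_simps)
  have eval: "(\<lambda>\<xi>. \<xi> x) \<in> lmod_hom k (base_space (opp A) ?D) (regular k)" if "x \<in> carrier M" for x
    by (rule lmod_homI)
      (use that homc csm in \<open>simp_all add: dual_module_simps(3) del: base_space_simps(4)\<close>)
  \<comment> \<open>A functional is determined by its values at the p i, so \<xi> is the combination
    of the coordinate functionals \<psi> i with coefficients \<xi> (p i).\<close>
  have expand: "\<xi> = msum (base_space (opp A) ?D) (\<lambda>i. \<xi> (p i) \<odot>\<^bsub>base_space (opp A) ?D\<^esub> \<psi> i) n" (is "_ = ?s")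
    if \<xi>: "\<xi> \<in> carrier ?D" for \<xi>
  proof (rule ext[OF \<xi>])
    have pc: "p i \<in> carrier M" if "i < n" for i using dbD(1)[OF that] by simp
    have sc: "\<xi> (p i) \<odot>\<^bsub>base_space (opp A) ?D\<^esub> \<psi> i \<in> carrier (base_space (opp A) ?D)" if "i < n" for i
      using kD.smult_closed[of "\<xi> (p i)" "\<psi> i"] \<psi>[OF that] homc[OF \<xi> pc[OF that]] by simp
    have "?s \<in> carrier (base_space (opp A) ?D)" by (rule kD.M.msum_closed[OF sc])
    then show "?s \<in> carrier ?D" by simp
    fix x assume x: "x \<in> carrier M"
    have "?s x = msum (regular k) (\<lambda>i. (\<xi> (p i) \<odot>\<^bsub>base_space (opp A) ?D\<^esub> \<psi> i) x) n"
      by (rule lmod_hom_of_msum[OF kD.left_module_axioms rk eval[OF x] sc])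
    also have "\<dots> = msum (regular k) (\<lambda>i. \<phi> i x \<odot>\<^bsub>regular k\<^esub> \<xi> (p i)) n"
      by (rule msum_cong)
        (use x csm[OF homc[OF \<xi> pc] \<psi> x] dbD(3) homc[OF \<xi> pc] in \<open>simp add: \<psi>_def m_comm del: base_space_simps(4)\<close>)
    also have "\<dots> = \<xi> x"
      using lmod_hom_dual_basis[OF kM.left_module_axioms rk db hom[OF \<xi>], of x] x by simp
    finally show "\<xi> x = ?s x" by simp
  qed
  have "has_dual_basis k (base_space (opp A) ?D)"
    unfolding has_dual_basis_def dual_basis_def
    by (intro exI[of _ n] exI[of _ \<psi>] exI[of _ "\<lambda>i \<xi>. \<xi> (p i)"] conjI allI impI ballI)
      (use \<psi> eval dbD(1) expand in \<open>simp_all del: base_space_simps(4)\<close>)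
  then have fgD: "fg_left_module (opp A) ?D" by (rule opp.fg_of_dual_basis_base_space[OF DL])
  obtain N :: "('a, 'k univ) module" and \<iota> \<kappa> where N: "fg_left_module (opp A) N" "module_iso (opp A) ?D N \<iota> \<kappa>"
    using opp.fg_univ_copy[OF fgD] by blast
  have NL: "left_module (opp A) N" using N by (simp add: fg_left_module_def)
  interpret kN: left_module k "base_space (opp A) N" by (rule opp.left_module_base_space[OF NL])
  have iso: "\<iota> \<in> lmod_hom (opp A) ?D N" "\<kappa> \<in> lmod_hom (opp A) N ?D" "\<And>\<xi>. \<xi> \<in> carrier ?D \<Longrightarrow> \<kappa> (\<iota> \<xi>) = \<xi>"
    "\<And>y. y \<in> carrier N \<Longrightarrow> \<iota> (\<kappa> y) = y" using N(2) by (auto simp: module_iso_def)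
  have \<kappa>c: "\<kappa> y \<in> carrier ?D" if "y \<in> carrier N" for y by (rule lmod_hom_closed[OF iso(2) that])
  have one: "c \<odot> \<one> \<in> carrier A" if "c \<in> carrier k" for c using that by (simp add: kA.smult_closed)
  have "bilinear k ?b (base_space A N) (regular k) (\<lambda>x y. \<kappa> y x)"
  proof (rule bilinearI)
    fix c x y assume *: "c \<in> carrier k" "x \<in> carrier ?b" "y \<in> carrier (base_space A N)"
    show "\<kappa> y (c \<odot>\<^bsub>?b\<^esub> x) = c \<odot>\<^bsub>regular k\<^esub> \<kappa> y x"
      using lmod_hom_smult[OF hom[OF \<kappa>c], of y c x] * by simp
    show "\<kappa> (c \<odot>\<^bsub>base_space A N\<^esub> y) x = c \<odot>\<^bsub>regular k\<^esub> \<kappa> y x"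
      using lmod_hom_smult[OF iso(2), of "c \<odot> \<one>" y] csm[OF *(1) \<kappa>c, of y x] * one by simp
  next
    fix x x' y assume "x \<in> carrier ?b" "x' \<in> carrier ?b" "y \<in> carrier (base_space A N)"
    then show "\<kappa> y (x \<oplus>\<^bsub>?b\<^esub> x') = \<kappa> y x \<oplus>\<^bsub>regular k\<^esub> \<kappa> y x'"
      using lmod_hom_add[OF hom[OF \<kappa>c], of y x x'] by simp
  next
    fix x y y' assume "x \<in> carrier ?b" "y \<in> carrier (base_space A N)" "y' \<in> carrier (base_space A N)"
    then show "\<kappa> (y \<oplus>\<^bsub>base_space A N\<^esub> y') x = \<kappa> y x \<oplus>\<^bsub>regular k\<^esub> \<kappa> y' x"
      using lmod_hom_add[OF iso(2), of y y'] by (simp add: dual_module_simps(3))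
  qed (use homc \<kappa>c in simp)
  moreover have "\<kappa> y (r \<odot>\<^bsub>M\<^esub> x) = \<kappa> (r \<odot>\<^bsub>N\<^esub> y) x" if "r \<in> carrier A" "x \<in> carrier M" "y \<in> carrier N" for r x y
    using lmod_hom_smult[OF iso(2), of r y] that by (simp add: dual_module_simps(4))
  moreover have "p i \<in> carrier M \<and> \<iota> (\<psi> i) \<in> carrier N" if "i < n" for i
    using dbD(1)[OF that] lmod_hom_closed[OF iso(1) \<psi>[OF that]] by simp
  moreover have "msum ?b (\<lambda>i. \<kappa> (\<iota> (\<psi> i)) x \<odot>\<^bsub>?b\<^esub> p i) n = x" if x: "x \<in> carrier M" for x
  proof -
    have "msum ?b (\<lambda>i. \<kappa> (\<iota> (\<psi> i)) x \<odot>\<^bsub>?b\<^esub> p i) n = msum ?b (\<lambda>i. \<phi> i x \<odot>\<^bsub>?b\<^esub> p i) n"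
    proof (rule msum_cong)
      fix i assume "i < n"
      have "\<kappa> (\<iota> (\<psi> i)) x = \<phi> i x" unfolding iso(3)[OF \<psi>[OF \<open>i < n\<close>]] using x by (simp add: \<psi>_def)
      then show "\<kappa> (\<iota> (\<psi> i)) x \<odot>\<^bsub>?b\<^esub> p i = \<phi> i x \<odot>\<^bsub>?b\<^esub> p i" by simp
    qed
    then show ?thesis using dbD(4)[of x] x by simp
  qed
  moreover have "msum (base_space A N) (\<lambda>i. \<kappa> y (p i) \<odot>\<^bsub>base_space A N\<^esub> \<iota> (\<psi> i)) n = y" if y: "y \<in> carrier N" for y
  proof -
    have \<iota>k: "\<iota> \<in> lmod_hom k (base_space (opp A) ?D) (base_space (opp A) N)"
      by (rule opp.lmod_hom_base_space[OF iso(1)])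
    have sc: "\<kappa> y (p i) \<odot>\<^bsub>base_space (opp A) ?D\<^esub> \<psi> i \<in> carrier (base_space (opp A) ?D)" if "i < n" for i
      using kD.smult_closed[of "\<kappa> y (p i)" "\<psi> i"] \<psi>[OF that] homc[OF \<kappa>c[OF y]] dbD(1)[OF that] by simp
    have "y = \<iota> (\<kappa> y)" using iso(4)[OF y] by simp
    also have "\<dots> = \<iota> (msum (base_space (opp A) ?D) (\<lambda>i. \<kappa> y (p i) \<odot>\<^bsub>base_space (opp A) ?D\<^esub> \<psi> i) n)"
      using expand[OF \<kappa>c[OF y]] by simp
    also have "\<dots> = msum (base_space (opp A) N) (\<lambda>i. \<iota> (\<kappa> y (p i) \<odot>\<^bsub>base_space (opp A) ?D\<^esub> \<psi> i)) n"
      by (rule lmod_hom_of_msum[OF kD.left_module_axioms kN.left_module_axioms \<iota>k sc])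
    also have "\<dots> = msum (base_space (opp A) N) (\<lambda>i. \<kappa> y (p i) \<odot>\<^bsub>base_space (opp A) N\<^esub> \<iota> (\<psi> i)) n"
      by (rule msum_cong, rule lmod_hom_smult[OF \<iota>k])
        (use dbD(1) homc[OF \<kappa>c[OF y]] \<psi> in simp_all)
    finally show ?thesis by (simp add: base_space_opp)
  qed
  ultimately have "perfect_pairing k A M N (\<lambda>x y. \<kappa> y x) n p (\<lambda>i. \<iota> (\<psi> i))"
    unfolding perfect_pairing_def by blast
  then show ?thesis using N(1) by blast
qed

end

section \<open>Tensor-hom adjunction\<close>

lemma (in two_algebras) L_lmod_homI:
  assumes "left_module L P" "left_module L Y" "f \<in> add_hom P Y"
    "\<And>a b x. \<lbrakk>a \<in> carrier A; b \<in> carrier B; x \<in> carrier P\<rbrakk> \<Longrightarrow>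
      f (pure k A B a b \<odot>\<^bsub>P\<^esub> x) = pure k A B a b \<odot>\<^bsub>Y\<^esub> f x"
  shows "f \<in> lmod_hom L P Y"
proof (rule lmod_homI)
  interpret P: left_module L P by fact
  interpret Y: left_module L Y by fact
  have l: "(\<lambda>r. r \<odot>\<^bsub>P\<^esub> x) \<in> add_hom (tensor k A B) P" if "x \<in> carrier P" for x
    using that P.smult_closed P.smult_l_distr by (intro add_homI) auto
  have l': "(\<lambda>r. r \<odot>\<^bsub>Y\<^esub> x) \<in> add_hom (tensor k A B) Y" if "x \<in> carrier Y" for x
    using that Y.smult_closed Y.smult_l_distr by (intro add_homI) auto
  show "f x \<in> carrier Y" if "x \<in> carrier P" for x by (rule add_hom_closed[OF assms(3) that])
  show "f (x \<oplus>\<^bsub>P\<^esub> y) = f x \<oplus>\<^bsub>Y\<^esub> f y" if "x \<in> carrier P" "y \<in> carrier P" for x y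
    by (rule add_hom_add[OF assms(3) that])
  show "f (r \<odot>\<^bsub>P\<^esub> x) = r \<odot>\<^bsub>Y\<^esub> f x" if "r \<in> carrier L" "x \<in> carrier P" for r x
    by (rule AB.add_hom_eq[OF Y.M.abelian_group_axioms add_hom_comp[OF l assms(3)] l'])
      (use that assms(4) add_hom_closed[OF assms(3)] in simp_all)
qed

text \<open>A right B-module V and a left B-module W dual to each other: the setting in which
  Hom_A(C P, A) and Hom_L(P, \<open>ind W\<close>) correspond.\<close>

locale paired_modules = right_module_tensor k A B V
  for k :: "'k ring" and A :: "('k, 'a) module" and B :: "('k, 'b) module" and V :: "('b, 'v) module" +
  fixes W :: "('b, 'w) module" and pr :: "'v \<Rightarrow> 'w \<Rightarrow> 'k" and n :: nat and v :: "nat \<Rightarrow> 'v" and w :: "nat \<Rightarrow> 'w"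
  assumes left_module_W: "left_module B W" and pairing: "perfect_pairing k B V W pr n v w"
begin

sublocale W: left_module B W by (rule left_module_W)

abbreviation bW where "bW \<equiv> base_space B W"

lemma modW: "left_module k bW" by (rule B.left_module_base_space[OF left_module_W])

sublocale kW: left_module k bW by (rule modW)
sublocale kV: left_module k bV by (rule modV)
sublocale TW: tensor_factors k A bW by (rule factors_W[OF left_module_W])
sublocale N: left_module L "ind W" by (rule left_module_ind[OF left_module_W])

lemmas prD = perfect_pairingD[OF pairing]
lemmas prB = bilinearD[OF prD(1), unfolded base_space_simps(1-3) regular_simps]

text \<open>Contraction of the factor W against a vector of V. All contractions together identify A
  \<otimes> W with Hom_k(V, A).\<close>

definition ev :: "'v \<Rightarrow> ('a \<times> 'w \<Rightarrow>\<^sub>0 int) set \<Rightarrow> 'a" where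
  "ev x = tensor_lift A (\<lambda>(a, y). pr x y \<odot>\<^bsub>A\<^esub> a)"

lemma balanced_ev: "x \<in> carrier V \<Longrightarrow> TW.balanced A (\<lambda>(a, y). pr x y \<odot>\<^bsub>A\<^esub> a)"
proof (rule TW.balancedI, goal_cases)
  case (4 r a y)
  then have "pr x (r \<odot>\<^bsub>bW\<^esub> y) = r \<otimes>\<^bsub>k\<^esub> pr x y" using prB(5)[of r x y] by simp
  then show ?case using 4 prB(1)[of x y]
    by (simp del: base_space_simps(4) add: kA.smult_assoc[symmetric] A.m_comm)
qed (simp_all add: prB(1,3) kA.smult_closed kA.smult_r_distr kA.smult_l_distr)

lemma ev_add_hom: "x \<in> carrier V \<Longrightarrow> ev x \<in> add_hom (tensor k A bW) A"
  unfolding ev_def by (rule TW.tensor_lift_add_hom[OF TW.abelian_M balanced_ev])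

lemma ev_pure: "\<lbrakk>x \<in> carrier V; a \<in> carrier A; y \<in> carrier W\<rbrakk> \<Longrightarrow> ev x (pW W a y) = pr x y \<odot>\<^bsub>A\<^esub> a"
  unfolding ev_def using TW.tensor_lift_pure[OF TW.abelian_M balanced_ev, of x a y] by simp

lemma ev_closed: "\<lbrakk>x \<in> carrier V; t \<in> carrier (ind W)\<rbrakk> \<Longrightarrow> ev x t \<in> carrier A"
  using add_hom_closed[OF ev_add_hom] by simp

lemma Vs: "\<lbrakk>b \<in> carrier B; x \<in> carrier V\<rbrakk> \<Longrightarrow> b \<odot>\<^bsub>V\<^esub> x \<in> carrier V"
  using V.smult_closed[of b x] by simp

lemma ind_add_homs: "l \<in> carrier L \<Longrightarrow> smult (ind W) l \<in> add_hom (tensor k A bW) (tensor k A bW)"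
  "t \<in> carrier (ind W) \<Longrightarrow> (\<lambda>l. l \<odot>\<^bsub>ind W\<^esub> t) \<in> add_hom (tensor k A B) (tensor k A bW)"
  using ind_smult(1,2)[OF left_module_W] by (simp_all add: add_hom_ind)

lemma ev_add: "\<lbrakk>x \<in> carrier V; x' \<in> carrier V; t \<in> carrier (ind W)\<rbrakk> \<Longrightarrow> ev (x \<oplus>\<^bsub>V\<^esub> x') t = ev x t \<oplus>\<^bsub>A\<^esub> ev x' t"
  by (rule TW.add_hom_eq[OF TW.abelian_M ev_add_hom add_hom_plus[OF TW.abelian_M ev_add_hom ev_add_hom]])
    (simp_all add: ev_pure prB kA.smult_l_distr)

lemma mult_A_add_hom: "a \<in> carrier A \<Longrightarrow> (\<lambda>y. a \<otimes>\<^bsub>A\<^esub> y) \<in> add_hom A A"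
  by (auto simp: add_hom_def A.r_distr)

text \<open>The action of b moves across the pairing from W to V. The formula is the hypothesis
  \<open>bal\<close> of \<open>C_lift\<close> for contraction.\<close>

lemma ev_smult:
  assumes "x \<in> carrier V" "a \<in> carrier A" "b \<in> carrier B" "t \<in> carrier (ind W)"
  shows "ev x (pure k A B a b \<odot>\<^bsub>ind W\<^esub> t) = a \<otimes>\<^bsub>A\<^esub> ev (b \<odot>\<^bsub>V\<^esub> x) t"
proof (rule TW.add_hom_eq[OF TW.abelian_M, where f = "\<lambda>t. ev x (pure k A B a b \<odot>\<^bsub>ind W\<^esub> t)"
      and g = "\<lambda>t. a \<otimes>\<^bsub>A\<^esub> ev (b \<odot>\<^bsub>V\<^esub> x) t"])
  show "(\<lambda>t. ev x (pure k A B a b \<odot>\<^bsub>ind W\<^esub> t)) \<in> add_hom TW.T A"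
    by (rule add_hom_comp[OF ind_add_homs(1)[OF pure_L_closed[OF assms(2,3)]] ev_add_hom[OF assms(1)]])
  show "(\<lambda>t. a \<otimes>\<^bsub>A\<^esub> ev (b \<odot>\<^bsub>V\<^esub> x) t) \<in> add_hom TW.T A"
    by (rule add_hom_comp[OF ev_add_hom[OF Vs[OF assms(3,1)]] mult_A_add_hom[OF assms(2)]])
  show "t \<in> carrier TW.T" using assms by simp
  fix a' y assume ay: "a' \<in> carrier A" "y \<in> carrier bW"
  then have y: "y \<in> carrier W" by simp
  have bx: "b \<odot>\<^bsub>V\<^esub> x \<in> carrier V" by (rule Vs[OF assms(3,1)])
  have "ev x (pure k A B a b \<odot>\<^bsub>ind W\<^esub> pW W a' y) = pr x (b \<odot>\<^bsub>W\<^esub> y) \<odot>\<^bsub>A\<^esub> (a \<otimes>\<^bsub>A\<^esub> a')"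
    using ind_smult(3)[OF left_module_W assms(2,3) ay(1) y] ev_pure[OF assms(1)] W.smult_closed[OF assms(3) y]
      assms(2) ay(1) by simp
  also have "pr x (b \<odot>\<^bsub>W\<^esub> y) = pr (b \<odot>\<^bsub>V\<^esub> x) y" using prD(2)[OF assms(3,1) y] by simp
  also have "pr (b \<odot>\<^bsub>V\<^esub> x) y \<odot>\<^bsub>A\<^esub> (a \<otimes>\<^bsub>A\<^esub> a') = a \<otimes>\<^bsub>A\<^esub> ev (b \<odot>\<^bsub>V\<^esub> x) (pW W a' y)"
    using ev_pure[OF bx ay(1) y] A.scalar_mult_right[OF prB(1)[OF bx y] assms(2) ay(1)] by simp
  finally show "ev x (pure k A B a b \<odot>\<^bsub>ind W\<^esub> pW W a' y) = a \<otimes>\<^bsub>A\<^esub> ev (b \<odot>\<^bsub>V\<^esub> x) (pW W a' y)" .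
qed

text \<open>Contractions against the v i are the coordinates of t relative to the w i. Hence
  contractions detect equality in A \<otimes> W, and identities there can be checked inside
  A.\<close>

lemma ind_expand:
  assumes "t \<in> carrier (ind W)"
  shows "t = msum (ind W) (\<lambda>i. pW W (ev (v i) t) (w i)) n"
proof -
  have "t = msum TW.T (\<lambda>i. pW W (ev (v i) t) (w i)) n"
  proof (rule TW.add_hom_eq[OF TW.abelian_T, where f = "\<lambda>t. t" and
        g = "\<lambda>t. msum TW.T (\<lambda>i. pW W (ev (v i) t) (w i)) n"])
    show "(\<lambda>t. t) \<in> add_hom TW.T TW.T" by (simp add: add_hom_def)
    show "t \<in> carrier TW.T" using assms by simp
    show "(\<lambda>t. msum TW.T (\<lambda>i. pW W (ev (v i) t) (w i)) n) \<in> add_hom TW.T TW.T"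
      by (rule add_hom_msum[OF TW.abelian_T], rule add_hom_comp[OF ev_add_hom TW.pure_add_hom_left])
        (use prD(3,4) in simp_all)
    fix a y assume ay: "a \<in> carrier A" "y \<in> carrier bW"
    have y: "y \<in> carrier W" using ay by simp
    have "msum TW.T (\<lambda>i. pW W (ev (v i) (pW W a y)) (w i)) n = msum TW.T (\<lambda>i. pW W a (pr (v i) y \<odot>\<^bsub>bW\<^esub> w i)) n"
      by (rule msum_cong)
        (use ay(1) y prD(3,4) prB(1) in \<open>simp add: ev_pure TW.pure_balanced del: base_space_simps(4)\<close>)
    also have "\<dots> = pW W a (msum bW (\<lambda>i. pr (v i) y \<odot>\<^bsub>bW\<^esub> w i) n)"
      by (rule add_hom_of_msum[OF TW.abelian_N TW.abelian_T TW.pure_add_hom_right[OF ay(1)], symmetric],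
          rule kW.smult_closed)
        (use y prD(3,4) prB(1) in simp_all)
    also have "\<dots> = pW W a y" using prD(6)[OF y] by simp
    finally show "pW W a y = msum TW.T (\<lambda>i. pW W (ev (v i) (pW W a y)) (w i)) n" by simp
  qed
  then show ?thesis using msum_same_ops[of "ind W" TW.T] by simp
qed

lemma ev_eq:
  assumes "t \<in> carrier (ind W)" "t' \<in> carrier (ind W)" "\<And>x. x \<in> carrier V \<Longrightarrow> ev x t = ev x t'"
  shows "t = t'"
proof -
  have "t = msum (ind W) (\<lambda>i. pW W (ev (v i) t) (w i)) n" by (rule ind_expand[OF assms(1)])
  also have "\<dots> = msum (ind W) (\<lambda>i. pW W (ev (v i) t') (w i)) n"
    by (rule msum_cong) (use assms(3) prD(3) in simp)
  also have "\<dots> = t'" by (rule ind_expand[OF assms(2), symmetric])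
  finally show ?thesis .
qed

text \<open>One direction of the adjunction: f gives the balanced map sending (x, p) to the
  contraction of f p against x.\<close>

lemma hom_to_C:
  assumes P: "left_module L P" and f: "f \<in> lmod_hom L P (ind W)"
  shows "\<exists>G\<in>lmod_hom A (C P) (regular A). \<forall>a\<in>carrier A. \<forall>x\<in>carrier V. \<forall>p\<in>carrier P.
    G (q P (pV a x) p) = a \<otimes>\<^bsub>A\<^esub> ev x (f p)"
proof -
  have fc: "f p \<in> carrier (ind W)" if "p \<in> carrier P" for p by (rule lmod_hom_closed[OF f that])
  have "\<exists>G\<in>lmod_hom A (C P) (regular A). \<forall>a\<in>carrier A. \<forall>x\<in>carrier V. \<forall>p\<in>carrier P.
    G (q P (pV a x) p) = a \<odot>\<^bsub>regular A\<^esub> ev x (f p)"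
  proof (rule C_lift[OF P left_module_regular[OF A.ring_A]], goal_cases)
    case (1 x p)
    then show ?case using ev_closed fc by simp
  next
    case (2 x x' p)
    then show ?case using ev_add fc by simp
  next
    case (3 x p p')
    then show ?case using add_hom_add[OF ev_add_hom, of x "f p" "f p'"] lmod_hom_add[OF f, of p p'] fc by simp
  next
    case (4 a b x p)
    then show ?case using lmod_hom_smult[OF f pure_L_closed, of a b p] ev_smult[OF _ _ _ fc] by simp
  qed
  then show ?thesis by simp
qed

text \<open>The inverse direction: f p is the element of A \<otimes> W whose contraction against
  each x is the value of G at 1 \<otimes> x \<otimes> p. Linearity of f over \<open>L\<close> is
  then verified contraction by contraction.\<close>

lemma C_to_hom:
  assumes P: "left_module L P" and G: "G \<in> lmod_hom A (C P) (regular A)"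
  shows "\<exists>f\<in>lmod_hom L P (ind W). \<forall>x\<in>carrier V. \<forall>p\<in>carrier P. ev x (f p) = G (q P (pV \<one>\<^bsub>A\<^esub> x) p)"
proof -
  interpret P: left_module L P by (rule P)
  interpret T: tensor_factors L Wb P by (rule factors_C[OF P])
  have one: "\<one>\<^bsub>A\<^esub> \<in> carrier A" by simp
  have qc: "q P (pV a x) p \<in> carrier (C P)" if "a \<in> carrier A" "x \<in> carrier V" "p \<in> carrier P" for a x p
    using that q_closed[OF P, of "pV a x" p] by (simp add: TV.pure_closed)
  have Gc: "G (q P (pV a x) p) \<in> carrier A" if "a \<in> carrier A" "x \<in> carrier V" "p \<in> carrier P" for a x p
    using lmod_hom_closed[OF G qc[OF that]] by simp
  \<comment> \<open>The coordinates are forced by \<open>ind_expand\<close>: the coefficient at w i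
    must be the contraction against v i.\<close>
  define f where "f p = msum (ind W) (\<lambda>i. pW W (G (q P (pV \<one>\<^bsub>A\<^esub> (v i)) p)) (w i)) n" for p
  have tc: "pW W (G (q P (pV \<one>\<^bsub>A\<^esub> (v i)) p)) (w i) \<in> carrier (ind W)" if "i < n" "p \<in> carrier P" for i p
    using that prD(3,4) Gc[OF one] by (simp add: TW.pure_closed)
  have fc: "f p \<in> carrier (ind W)" if "p \<in> carrier P" for p
    unfolding f_def by (rule N.M.msum_closed) (use tc that in blast)
  have evf: "ev x (f p) = G (q P (pV \<one>\<^bsub>A\<^esub> x) p)" if x: "x \<in> carrier V" and p: "p \<in> carrier P" for x p
  proof -
    have h: "(\<lambda>y. G (q P (pV \<one>\<^bsub>A\<^esub> y) p)) \<in> add_hom bV A"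
    proof -
      have "(\<lambda>w. G (q P w p)) \<in> add_hom (tensor k A bV) (regular A)"
        by (rule add_hom_comp[OF T.pure_add_hom_left[OF p, unfolded add_hom_Wb] lmod_hom_add_hom[OF G, unfolded add_hom_C]])
      then have "(\<lambda>w. G (q P w p)) \<in> add_hom (tensor k A bV) A" by (simp add: add_hom_def)
      then show ?thesis by (rule add_hom_comp[OF TV.pure_add_hom_right[OF one]])
    qed
    have "ev x (f p) = msum A (\<lambda>i. ev x (pW W (G (q P (pV \<one>\<^bsub>A\<^esub> (v i)) p)) (w i))) n"
      unfolding f_def
      by (rule add_hom_of_msum[OF N.M.abelian_group_axioms TW.abelian_M, of "ev x"])
        (use ev_add_hom[OF x] tc[OF _ p] in \<open>simp_all add: add_hom_ind\<close>)
    \<comment> \<open>Each scalar pr x (w i) is drawn through G and into V; afterwards the sum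
      collapses by the expansion of x in the v i.\<close>
    also have "\<dots> = msum A (\<lambda>i. G (q P (pV \<one>\<^bsub>A\<^esub> (pr x (w i) \<odot>\<^bsub>bV\<^esub> v i)) p)) n"
    proof (rule msum_cong)
      fix i assume i: "i < n"
      let ?c = "pr x (w i)"
      have c: "?c \<in> carrier k" using prB(1)[OF x prD(4)[OF i]] .
      have c1: "?c \<odot>\<^bsub>A\<^esub> \<one>\<^bsub>A\<^esub> \<in> carrier A" using c by (simp add: kA.smult_closed)
      have g: "G (q P (pV \<one>\<^bsub>A\<^esub> (v i)) p) \<in> carrier A" by (rule Gc[OF one prD(3)[OF i] p])
      have "ev x (pW W (G (q P (pV \<one>\<^bsub>A\<^esub> (v i)) p)) (w i)) = ?c \<odot>\<^bsub>A\<^esub> G (q P (pV \<one>\<^bsub>A\<^esub> (v i)) p)"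
        by (rule ev_pure[OF x g prD(4)[OF i]])
      also have "\<dots> = (?c \<odot>\<^bsub>A\<^esub> \<one>\<^bsub>A\<^esub>) \<otimes>\<^bsub>A\<^esub> G (q P (pV \<one>\<^bsub>A\<^esub> (v i)) p)" using A.scalar_one(1)[OF c g] by simp
      also have "\<dots> = G ((?c \<odot>\<^bsub>A\<^esub> \<one>\<^bsub>A\<^esub>) \<odot>\<^bsub>C P\<^esub> q P (pV \<one>\<^bsub>A\<^esub> (v i)) p)"
        using lmod_hom_smult[OF G c1 qc[OF one prD(3)[OF i] p]] by simp
      also have "(?c \<odot>\<^bsub>A\<^esub> \<one>\<^bsub>A\<^esub>) \<odot>\<^bsub>C P\<^esub> q P (pV \<one>\<^bsub>A\<^esub> (v i)) p = q P (pV ((?c \<odot>\<^bsub>A\<^esub> \<one>\<^bsub>A\<^esub>) \<otimes>\<^bsub>A\<^esub> \<one>\<^bsub>A\<^esub>) (v i)) p"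
        by (rule C_smult_pure[OF P c1 one prD(3)[OF i] p])
      also have "pV ((?c \<odot>\<^bsub>A\<^esub> \<one>\<^bsub>A\<^esub>) \<otimes>\<^bsub>A\<^esub> \<one>\<^bsub>A\<^esub>) (v i) = pV \<one>\<^bsub>A\<^esub> (?c \<odot>\<^bsub>bV\<^esub> v i)"
        using TV.pure_balanced[of ?c "\<one>\<^bsub>A\<^esub>" "v i"] c c1 prD(3)[OF i] by (simp del: base_space_simps(4))
      finally show "ev x (pW W (G (q P (pV \<one>\<^bsub>A\<^esub> (v i)) p)) (w i)) = G (q P (pV \<one>\<^bsub>A\<^esub> (?c \<odot>\<^bsub>bV\<^esub> v i)) p)" .
    qed
    also have "\<dots> = G (q P (pV \<one>\<^bsub>A\<^esub> (msum bV (\<lambda>i. pr x (w i) \<odot>\<^bsub>bV\<^esub> v i) n)) p)"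
      by (rule add_hom_of_msum[OF TV.abelian_N TW.abelian_M h, symmetric], rule kV.smult_closed)
        (use prB(1)[OF x] prD(3,4) in simp_all)
    also have "\<dots> = G (q P (pV \<one>\<^bsub>A\<^esub> x) p)" using prD(5)[OF x] by simp
    finally show ?thesis .
  qed
  have p1: "pV \<one>\<^bsub>A\<^esub> x \<in> carrier (tensor k A bV)" if "x \<in> carrier V" for x using that by (simp add: TV.pure_closed)
  have "f \<in> lmod_hom L P (ind W)"
  proof (rule L_lmod_homI[OF P N.left_module_axioms])
    show "f \<in> add_hom P (ind W)"
    proof (rule add_homI[OF fc])
      fix p p' assume pp: "p \<in> carrier P" "p' \<in> carrier P"
      show "f (p \<oplus>\<^bsub>P\<^esub> p') = f p \<oplus>\<^bsub>ind W\<^esub> f p'"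
      proof (rule ev_eq)
        fix x assume x: "x \<in> carrier V"
        have "ev x (f (p \<oplus>\<^bsub>P\<^esub> p')) = G (q P (pV \<one>\<^bsub>A\<^esub> x) p \<oplus>\<^bsub>C P\<^esub> q P (pV \<one>\<^bsub>A\<^esub> x) p')"
          using evf[OF x, of "p \<oplus>\<^bsub>P\<^esub> p'"] pp T.pure_add_right[of "pV \<one>\<^bsub>A\<^esub> x" p p'] p1[OF x] by simp
        also have "\<dots> = ev x (f p) \<oplus>\<^bsub>A\<^esub> ev x (f p')"
          using lmod_hom_add[OF G qc[OF one x pp(1)] qc[OF one x pp(2)]] evf[OF x] pp by simp
        also have "\<dots> = ev x (f p \<oplus>\<^bsub>ind W\<^esub> f p')"
          using add_hom_add[OF ev_add_hom[OF x], of "f p" "f p'"] fc[OF pp(1)] fc[OF pp(2)] by simp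
        finally show "ev x (f (p \<oplus>\<^bsub>P\<^esub> p')) = ev x (f p \<oplus>\<^bsub>ind W\<^esub> f p')" .
      qed (use pp fc N.M.a_closed[OF fc fc] in auto)
    qed
    fix a b p assume abp: "a \<in> carrier A" "b \<in> carrier B" "p \<in> carrier P"
    have lp: "pure k A B a b \<odot>\<^bsub>P\<^esub> p \<in> carrier P" by (rule P.smult_closed[OF pure_L_closed[OF abp(1,2)] abp(3)])
    show "f (pure k A B a b \<odot>\<^bsub>P\<^esub> p) = pure k A B a b \<odot>\<^bsub>ind W\<^esub> f p"
    proof (rule ev_eq[OF fc[OF lp] N.smult_closed[OF pure_L_closed[OF abp(1,2)] fc[OF abp(3)]]])
      fix x assume x: "x \<in> carrier V"
      have bx: "b \<odot>\<^bsub>V\<^esub> x \<in> carrier V" by (rule Vs[OF abp(2) x])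
      have "ev x (f (pure k A B a b \<odot>\<^bsub>P\<^esub> p)) = G (q P (pV \<one>\<^bsub>A\<^esub> x) (pure k A B a b \<odot>\<^bsub>P\<^esub> p))" by (rule evf[OF x lp])
      also have "q P (pV \<one>\<^bsub>A\<^esub> x) (pure k A B a b \<odot>\<^bsub>P\<^esub> p) = q P (pV (\<one>\<^bsub>A\<^esub> \<otimes>\<^bsub>A\<^esub> a) (b \<odot>\<^bsub>V\<^esub> x)) p"
        using T.pure_balanced[of "pure k A B a b" "pV \<one>\<^bsub>A\<^esub> x" p] p1[OF x] abp
          Wb_smult(3)[OF abp(1,2) one x] pure_L_closed[OF abp(1,2)] by simp
      also have "\<dots> = a \<odot>\<^bsub>C P\<^esub> q P (pV \<one>\<^bsub>A\<^esub> (b \<odot>\<^bsub>V\<^esub> x)) p"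
        using C_smult_pure[OF P abp(1) one bx abp(3)] abp(1) by simp
      also have "G \<dots> = a \<otimes>\<^bsub>A\<^esub> G (q P (pV \<one>\<^bsub>A\<^esub> (b \<odot>\<^bsub>V\<^esub> x)) p)"
        using lmod_hom_smult[OF G abp(1) qc[OF one bx abp(3)]] by simp
      also have "\<dots> = a \<otimes>\<^bsub>A\<^esub> ev (b \<odot>\<^bsub>V\<^esub> x) (f p)" using evf[OF bx abp(3)] by simp
      also have "\<dots> = ev x (pure k A B a b \<odot>\<^bsub>ind W\<^esub> f p)"
        using ev_smult[OF x abp(1,2) fc[OF abp(3)]] by simp
      finally show "ev x (f (pure k A B a b \<odot>\<^bsub>P\<^esub> p)) = ev x (pure k A B a b \<odot>\<^bsub>ind W\<^esub> f p)" .
    qed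
  qed
  then show ?thesis using evf by blast
qed

text \<open>The elements 1 \<otimes> x \<otimes> p generate C P over A.\<close>

lemma C_hom_eq_one:
  assumes P: "left_module L P" and Y: "left_module A Y" and f: "f \<in> lmod_hom A (C P) Y" and g: "g \<in> lmod_hom A (C P) Y"
    and c: "c \<in> carrier (C P)"
    and eq: "\<And>x p. \<lbrakk>x \<in> carrier V; p \<in> carrier P\<rbrakk> \<Longrightarrow> f (q P (pV \<one>\<^bsub>A\<^esub> x) p) = g (q P (pV \<one>\<^bsub>A\<^esub> x) p)"
  shows "f c = g c"
proof (rule C_hom_eq[OF P left_module_abelian_group[OF Y] lmod_hom_add_hom[OF f] lmod_hom_add_hom[OF g] c])
  fix a x p assume axp: "a \<in> carrier A" "x \<in> carrier V" "p \<in> carrier P"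
  have qc: "q P (pV \<one>\<^bsub>A\<^esub> x) p \<in> carrier (C P)"
    using axp q_closed[OF P, of "pV \<one>\<^bsub>A\<^esub> x" p] by (simp add: TV.pure_closed)
  have "q P (pV a x) p = a \<odot>\<^bsub>C P\<^esub> q P (pV \<one>\<^bsub>A\<^esub> x) p"
    using C_smult_pure[OF P axp(1) _ axp(2,3), of "\<one>\<^bsub>A\<^esub>"] axp(1) by simp
  then show "f (q P (pV a x) p) = g (q P (pV a x) p)"
    using lmod_hom_smult[OF f axp(1) qc] lmod_hom_smult[OF g axp(1) qc] eq[OF axp(2,3)] by simp
qed

text \<open>The adjunction is compatible with the differentials, so a cocycle is carried to the
  other side, bounded there, and the bounding cochain is carried back. Equalities are tested at the
  elements 1 \<otimes> x \<otimes> p on the A side and by contractions on the L side.\<close>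

lemma cohom_van_C_iff:
  assumes P: "\<And>i. left_module L (P i)" and d: "\<And>i. d i \<in> lmod_hom L (P (Suc i)) (P i)"
  shows "cohom_van A (\<lambda>i. C (P i)) (\<lambda>i. Cmap (P i) (d i)) (regular A) \<longleftrightarrow> cohom_van L P d (ind W)"
proof -
  have regA: "left_module A (regular A)" by (rule left_module_regular[OF A.ring_A])
  have dc: "d i p \<in> carrier (P i)" if "p \<in> carrier (P (Suc i))" for i p by (rule lmod_hom_closed[OF d that])
  have p1: "pV a x \<in> carrier (tensor k A bV)" if "a \<in> carrier A" "x \<in> carrier V" for a x using that by (simp add: TV.pure_closed)
  note one = A.one_closed
  have Cq: "Cmap (P i) (d i) (q (P (Suc i)) (pV a x) p) = q (P i) (pV a x) (d i p)"
    if "a \<in> carrier A" "x \<in> carrier V" "p \<in> carrier (P (Suc i))" for i a x p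
    by (rule Cmap(1)[OF P P d p1[OF that(1,2)] that(3)])
  have Ch: "Cmap (P i) (d i) \<in> lmod_hom A (C (P (Suc i))) (C (P i))" for i by (rule Cmap(2)[OF P P d])
  have qc: "q (P i) (pV a x) p \<in> carrier (C (P i))" if "a \<in> carrier A" "x \<in> carrier V" "p \<in> carrier (P i)" for i a x p
    by (rule q_closed[OF P p1[OF that(1,2)] that(3)])
  show ?thesis
  proof
    assume van: "cohom_van A (\<lambda>i. C (P i)) (\<lambda>i. Cmap (P i) (d i)) (regular A)"
    show "cohom_van L P d (ind W)" unfolding cohom_van_def
    proof (intro allI ballI impI)
      fix j f assume f: "f \<in> lmod_hom L (P (Suc j)) (ind W)" "\<forall>x\<in>carrier (P (Suc (Suc j))). f (d (Suc j) x) = \<zero>\<^bsub>ind W\<^esub>"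
      obtain G where G: "G \<in> lmod_hom A (C (P (Suc j))) (regular A)"
        "\<forall>a\<in>carrier A. \<forall>x\<in>carrier V. \<forall>p\<in>carrier (P (Suc j)). G (q (P (Suc j)) (pV a x) p) = a \<otimes>\<^bsub>A\<^esub> ev x (f p)"
        using hom_to_C[OF P f(1)] by blast
      have "\<exists>H\<in>lmod_hom A (C (P j)) (regular A). \<forall>x\<in>carrier (C (P (Suc j))). H (Cmap (P j) (d j) x) = G x"
      proof (rule cohom_vanD[OF van])
        show "G \<in> lmod_hom A (C (P (Suc j))) (regular A)" by (rule G)
        fix c assume c: "c \<in> carrier (C (P (Suc (Suc j))))"
        show "G (Cmap (P (Suc j)) (d (Suc j)) c) = \<zero>\<^bsub>regular A\<^esub>"
        proof (rule C_hom_eq_one[OF P regA lmod_hom_comp[OF Ch G(1)] left_module.lmod_hom_const_zero[OF regA] c])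
          fix x p assume xp: "x \<in> carrier V" "p \<in> carrier (P (Suc (Suc j)))"
          have "ev x (f (d (Suc j) p)) = \<zero>\<^bsub>A\<^esub>"
            using f(2) xp add_hom_zero[OF TW.abelian_T TW.abelian_M ev_add_hom[OF xp(1)]] by simp
          then show "G (Cmap (P (Suc j)) (d (Suc j)) (q (P (Suc (Suc j))) (pV \<one>\<^bsub>A\<^esub> x) p)) = \<zero>\<^bsub>regular A\<^esub>"
            using G(2) xp dc[OF xp(2)] by (simp add: Cq[OF one xp])
        qed
      qed
      then obtain H where H: "H \<in> lmod_hom A (C (P j)) (regular A)"
        "\<forall>x\<in>carrier (C (P (Suc j))). H (Cmap (P j) (d j) x) = G x" by blast
      obtain g where g: "g \<in> lmod_hom L (P j) (ind W)"
        "\<forall>x\<in>carrier V. \<forall>p\<in>carrier (P j). ev x (g p) = H (q (P j) (pV \<one>\<^bsub>A\<^esub> x) p)"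
        using C_to_hom[OF P H(1)] by blast
      have "g (d j p) = f p" if p: "p \<in> carrier (P (Suc j))" for p
      proof (rule ev_eq[OF lmod_hom_closed[OF g(1) dc[OF p]] lmod_hom_closed[OF f(1) p]])
        fix x assume x: "x \<in> carrier V"
        have "ev x (g (d j p)) = H (Cmap (P j) (d j) (q (P (Suc j)) (pV \<one>\<^bsub>A\<^esub> x) p))"
          using g(2) x dc[OF p] by (simp add: Cq[OF one x p])
        also have "\<dots> = G (q (P (Suc j)) (pV \<one>\<^bsub>A\<^esub> x) p)" using H(2) qc[OF one x p] by blast
        also have "\<dots> = ev x (f p)" using G(2) x p ev_closed[OF x lmod_hom_closed[OF f(1) p]] by simp
        finally show "ev x (g (d j p)) = ev x (f p)" .
      qed
      then show "\<exists>g\<in>lmod_hom L (P j) (ind W). \<forall>x\<in>carrier (P (Suc j)). g (d j x) = f x" using g(1) by blast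
    qed
  next
    assume van: "cohom_van L P d (ind W)"
    show "cohom_van A (\<lambda>i. C (P i)) (\<lambda>i. Cmap (P i) (d i)) (regular A)" unfolding cohom_van_def
    proof (intro allI ballI impI)
      fix j G assume G: "G \<in> lmod_hom A (C (P (Suc j))) (regular A)"
        "\<forall>x\<in>carrier (C (P (Suc (Suc j)))). G (Cmap (P (Suc j)) (d (Suc j)) x) = \<zero>\<^bsub>regular A\<^esub>"
      obtain f where f: "f \<in> lmod_hom L (P (Suc j)) (ind W)"
        "\<forall>x\<in>carrier V. \<forall>p\<in>carrier (P (Suc j)). ev x (f p) = G (q (P (Suc j)) (pV \<one>\<^bsub>A\<^esub> x) p)"
        using C_to_hom[OF P G(1)] by blast
      have "\<exists>g\<in>lmod_hom L (P j) (ind W). \<forall>x\<in>carrier (P (Suc j)). g (d j x) = f x"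
      proof (rule cohom_vanD[OF van f(1)])
        fix p assume p: "p \<in> carrier (P (Suc (Suc j)))"
        show "f (d (Suc j) p) = \<zero>\<^bsub>ind W\<^esub>"
        proof (rule ev_eq[OF lmod_hom_closed[OF f(1) dc[OF p]] N.M.zero_closed])
          fix x assume x: "x \<in> carrier V"
          have "ev x (f (d (Suc j) p)) = G (Cmap (P (Suc j)) (d (Suc j)) (q (P (Suc (Suc j))) (pV \<one>\<^bsub>A\<^esub> x) p))"
            using f(2) x dc[OF p] by (simp add: Cq[OF one x p])
          also have "\<dots> = \<zero>\<^bsub>A\<^esub>" using G(2) qc[OF one x p] by simp
          also have "\<dots> = ev x \<zero>\<^bsub>ind W\<^esub>"
            using add_hom_zero[OF TW.abelian_T TW.abelian_M ev_add_hom[OF x]] by simp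
          finally show "ev x (f (d (Suc j) p)) = ev x \<zero>\<^bsub>ind W\<^esub>" .
        qed
      qed
      then obtain g where g: "g \<in> lmod_hom L (P j) (ind W)" "\<forall>x\<in>carrier (P (Suc j)). g (d j x) = f x" by blast
      obtain H where H: "H \<in> lmod_hom A (C (P j)) (regular A)"
        "\<forall>a\<in>carrier A. \<forall>x\<in>carrier V. \<forall>p\<in>carrier (P j). H (q (P j) (pV a x) p) = a \<otimes>\<^bsub>A\<^esub> ev x (g p)"
        using hom_to_C[OF P g(1)] by blast
      have "H (Cmap (P j) (d j) c) = G c" if c: "c \<in> carrier (C (P (Suc j)))" for c
      proof (rule C_hom_eq_one[OF P regA lmod_hom_comp[OF Ch H(1)] G(1) c])
        fix x p assume xp: "x \<in> carrier V" "p \<in> carrier (P (Suc j))"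
        have "H (Cmap (P j) (d j) (q (P (Suc j)) (pV \<one>\<^bsub>A\<^esub> x) p)) = \<one>\<^bsub>A\<^esub> \<otimes>\<^bsub>A\<^esub> ev x (f p)"
          using H(2) g(2) xp dc[OF xp(2)] by (simp add: Cq[OF one xp])
        also have "\<dots> = ev x (f p)" using ev_closed[OF xp(1) lmod_hom_closed[OF f(1) xp(2)]] by simp
        also have "\<dots> = G (q (P (Suc j)) (pV \<one>\<^bsub>A\<^esub> x) p)" using f(2) xp by simp
        finally show "H (Cmap (P j) (d j) (q (P (Suc j)) (pV \<one>\<^bsub>A\<^esub> x) p)) = G (q (P (Suc j)) (pV \<one>\<^bsub>A\<^esub> x) p)" .
      qed
      then show "\<exists>g\<in>lmod_hom A (C (P j)) (regular A). \<forall>x\<in>carrier (C (P (Suc j))). g (Cmap (P j) (d j) x) = G x"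
        using H(1) by blast
    qed
  qed
qed

text \<open>The statement concerns V alone, but W supplies the functionals: by the adjunction they
  come from the maps p |-> \<phi> s (p) (1 \<otimes> w i). The matching elements are 1 \<otimes> v i
  \<otimes> r s.\<close>

lemma has_dual_basis_C:
  assumes P: "left_module L P" and db: "has_dual_basis L P"
  shows "has_dual_basis A (C P)"
proof -
  interpret P: left_module L P by (rule P)
  interpret T: tensor_factors L Wb P by (rule factors_C[OF P])
  interpret CP: left_module A "C P" by (rule left_module_C[OF P])
  have regA: "left_module A (regular A)" by (rule left_module_regular[OF A.ring_A])
  note one = A.one_closed
  obtain m r \<phi> where mb: "dual_basis L P m r \<phi>" using db by (auto simp: has_dual_basis_def)
  note mbD = dual_basisD[OF mb]
  have w1: "pW W \<one>\<^bsub>A\<^esub> (w i) \<in> carrier (ind W)" if "i < n" for i using prD(4)[OF that] by (simp add: TW.pure_closed)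
  have h: "(\<lambda>p. \<phi> s p \<odot>\<^bsub>ind W\<^esub> pW W \<one>\<^bsub>A\<^esub> (w i)) \<in> lmod_hom L P (ind W)" if "s < m" "i < n" for s i
    by (rule N.lmod_hom_smult_elem[OF mbD(2)[OF that(1)] w1[OF that(2)]])
  have "\<exists>G. s < m \<and> i < n \<longrightarrow> G \<in> lmod_hom A (C P) (regular A) \<and> (\<forall>a\<in>carrier A. \<forall>x\<in>carrier V. \<forall>p\<in>carrier P.
    G (q P (pV a x) p) = a \<otimes>\<^bsub>A\<^esub> ev x (\<phi> s p \<odot>\<^bsub>ind W\<^esub> pW W \<one>\<^bsub>A\<^esub> (w i)))" for s i
    using hom_to_C[OF P h, of s i] by blast
  then obtain G where "\<forall>s i. s < m \<and> i < n \<longrightarrow> G s i \<in> lmod_hom A (C P) (regular A) \<and>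
    (\<forall>a\<in>carrier A. \<forall>x\<in>carrier V. \<forall>p\<in>carrier P.
    G s i (q P (pV a x) p) = a \<otimes>\<^bsub>A\<^esub> ev x (\<phi> s p \<odot>\<^bsub>ind W\<^esub> pW W \<one>\<^bsub>A\<^esub> (w i)))" by metis
  then have G: "\<And>s i. \<lbrakk>s < m; i < n\<rbrakk> \<Longrightarrow> G s i \<in> lmod_hom A (C P) (regular A)"
    "\<And>s i a x p. \<lbrakk>s < m; i < n; a \<in> carrier A; x \<in> carrier V; p \<in> carrier P\<rbrakk> \<Longrightarrow>
    G s i (q P (pV a x) p) = a \<otimes>\<^bsub>A\<^esub> ev x (\<phi> s p \<odot>\<^bsub>ind W\<^esub> pW W \<one>\<^bsub>A\<^esub> (w i))" by simp_all
  have p1: "pV a x \<in> carrier (tensor k A bV)" if "a \<in> carrier A" "x \<in> carrier V" for a x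
    using that by (simp add: TV.pure_closed)
  have qc: "q P (pV a x) p \<in> carrier (C P)" if "a \<in> carrier A" "x \<in> carrier V" "p \<in> carrier P" for a x p
    by (rule q_closed[OF P p1[OF that(1,2)] that(3)])
  let ?e = "\<lambda>s i. q P (pV \<one>\<^bsub>A\<^esub> (v i)) (r s)"
  have ec: "?e s i \<in> carrier (C P)" if "s < m" "i < n" for s i
    by (rule qc[OF one prD(3)[OF that(2)] mbD(1)[OF that(1)]])
  \<comment> \<open>For one scalar l, the product of a \<otimes> x with l on the right is expanded
    in the elements 1 \<otimes> v i of A \<otimes> V. The identity is additive in l, so l may be
    taken pure.\<close>
  have inner: "msum (C P) (\<lambda>i. (a \<otimes>\<^bsub>A\<^esub> ev x (l \<odot>\<^bsub>ind W\<^esub> pW W \<one>\<^bsub>A\<^esub> (w i))) \<odot>\<^bsub>C P\<^esub> q P (pV \<one>\<^bsub>A\<^esub> (v i)) y) n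
    = q P (l \<odot>\<^bsub>Wb\<^esub> pV a x) y"
    if l: "l \<in> carrier L" and a: "a \<in> carrier A" and x: "x \<in> carrier V" and y: "y \<in> carrier P" for l a x y
  proof (rule AB.add_hom_eq[OF CP.M.abelian_group_axioms, where g = "\<lambda>l. q P (l \<odot>\<^bsub>Wb\<^esub> pV a x) y" and
        f = "\<lambda>l. msum (C P) (\<lambda>i. (a \<otimes>\<^bsub>A\<^esub> ev x (l \<odot>\<^bsub>ind W\<^esub> pW W \<one>\<^bsub>A\<^esub> (w i))) \<odot>\<^bsub>C P\<^esub> q P (pV \<one>\<^bsub>A\<^esub> (v i)) y) n"])
    have Cl: "(\<lambda>a. a \<odot>\<^bsub>C P\<^esub> c) \<in> add_hom A (C P)" if "c \<in> carrier (C P)" for c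
      using that CP.smult_closed CP.smult_l_distr by (intro add_homI) auto
    have "(\<lambda>l. (a \<otimes>\<^bsub>A\<^esub> ev x (l \<odot>\<^bsub>ind W\<^esub> pW W \<one>\<^bsub>A\<^esub> (w i))) \<odot>\<^bsub>C P\<^esub> q P (pV \<one>\<^bsub>A\<^esub> (v i)) y) \<in> add_hom (tensor k A B) (C P)"
      if i: "i < n" for i
      by (rule add_hom_comp[OF add_hom_comp[OF add_hom_comp[OF ind_add_homs(2)[OF w1[OF i]] ev_add_hom[OF x]] mult_A_add_hom[OF a]]
            Cl[OF qc[OF one prD(3)[OF i] y]]])
    then show "(\<lambda>l. msum (C P) (\<lambda>i. (a \<otimes>\<^bsub>A\<^esub> ev x (l \<odot>\<^bsub>ind W\<^esub> pW W \<one>\<^bsub>A\<^esub> (w i))) \<odot>\<^bsub>C P\<^esub> q P (pV \<one>\<^bsub>A\<^esub> (v i)) y) n)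
      \<in> add_hom (tensor k A B) (C P)"
      by (rule add_hom_msum[OF CP.M.abelian_group_axioms])
    show "(\<lambda>l. q P (l \<odot>\<^bsub>Wb\<^esub> pV a x) y) \<in> add_hom (tensor k A B) (C P)"
      unfolding add_hom_C
      by (rule add_hom_comp[OF Wb_smult(1)[OF p1[OF a x]] T.pure_add_hom_left[OF y, unfolded add_hom_Wb]])
    show "l \<in> carrier (tensor k A B)" using l by simp
    fix a' b assume ab: "a' \<in> carrier A" "b \<in> carrier B"
    have bx: "b \<odot>\<^bsub>V\<^esub> x \<in> carrier V" by (rule Vs[OF ab(2) x])
    have aa: "a \<otimes>\<^bsub>A\<^esub> a' \<in> carrier A" using a ab by simp
    have c: "pr (b \<odot>\<^bsub>V\<^esub> x) (w i) \<in> carrier k" if "i < n" for i using prB(1)[OF bx prD(4)[OF that]] .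
    have sc: "pr (b \<odot>\<^bsub>V\<^esub> x) (w i) \<odot>\<^bsub>bV\<^esub> v i \<in> carrier bV" if "i < n" for i
      by (rule kV.smult_closed[OF c[OF that]]) (use prD(3)[OF that] in simp)
    have "msum (C P) (\<lambda>i. (a \<otimes>\<^bsub>A\<^esub> ev x (pure k A B a' b \<odot>\<^bsub>ind W\<^esub> pW W \<one>\<^bsub>A\<^esub> (w i))) \<odot>\<^bsub>C P\<^esub> q P (pV \<one>\<^bsub>A\<^esub> (v i)) y) n
      = msum (C P) (\<lambda>i. q P (pV (a \<otimes>\<^bsub>A\<^esub> a') (pr (b \<odot>\<^bsub>V\<^esub> x) (w i) \<odot>\<^bsub>bV\<^esub> v i)) y) n"
    proof (rule msum_cong)
      fix i assume i: "i < n"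
      have "ev x (pure k A B a' b \<odot>\<^bsub>ind W\<^esub> pW W \<one>\<^bsub>A\<^esub> (w i)) = pr (b \<odot>\<^bsub>V\<^esub> x) (w i) \<odot>\<^bsub>A\<^esub> a'"
        using ev_smult[OF x ab w1[OF i]] ev_pure[OF bx one prD(4)[OF i]] A.scalar_one(2)[OF c[OF i] ab(1)] by simp
      then have "a \<otimes>\<^bsub>A\<^esub> ev x (pure k A B a' b \<odot>\<^bsub>ind W\<^esub> pW W \<one>\<^bsub>A\<^esub> (w i)) = pr (b \<odot>\<^bsub>V\<^esub> x) (w i) \<odot>\<^bsub>A\<^esub> (a \<otimes>\<^bsub>A\<^esub> a')"
        using A.scalar_mult_right[OF c[OF i] a ab(1)] by simp
      moreover have "pr (b \<odot>\<^bsub>V\<^esub> x) (w i) \<odot>\<^bsub>A\<^esub> (a \<otimes>\<^bsub>A\<^esub> a') \<in> carrier A" by (rule kA.smult_closed[OF c[OF i] aa])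
      ultimately show "(a \<otimes>\<^bsub>A\<^esub> ev x (pure k A B a' b \<odot>\<^bsub>ind W\<^esub> pW W \<one>\<^bsub>A\<^esub> (w i))) \<odot>\<^bsub>C P\<^esub> q P (pV \<one>\<^bsub>A\<^esub> (v i)) y
        = q P (pV (a \<otimes>\<^bsub>A\<^esub> a') (pr (b \<odot>\<^bsub>V\<^esub> x) (w i) \<odot>\<^bsub>bV\<^esub> v i)) y"
        using C_smult_pure[OF P _ one prD(3)[OF i] y, of "pr (b \<odot>\<^bsub>V\<^esub> x) (w i) \<odot>\<^bsub>A\<^esub> (a \<otimes>\<^bsub>A\<^esub> a')"]
          TV.pure_balanced[OF c[OF i] aa, of "v i"] prD(3)[OF i] by (simp del: base_space_simps(4))
    qed
    also have "\<dots> = q P (pV (a \<otimes>\<^bsub>A\<^esub> a') (msum bV (\<lambda>i. pr (b \<odot>\<^bsub>V\<^esub> x) (w i) \<odot>\<^bsub>bV\<^esub> v i) n)) y"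
      by (rule add_hom_of_msum[OF TV.abelian_N CP.M.abelian_group_axioms _ sc, symmetric], unfold add_hom_C,
          rule add_hom_comp[OF TV.pure_add_hom_right[OF aa] T.pure_add_hom_left[OF y, unfolded add_hom_Wb]])
    also have "\<dots> = q P (pure k A B a' b \<odot>\<^bsub>Wb\<^esub> pV a x) y"
      using prD(5)[OF bx] Wb_smult(3)[OF ab a x] by simp
    finally show "msum (C P) (\<lambda>i. (a \<otimes>\<^bsub>A\<^esub> ev x (pure k A B a' b \<odot>\<^bsub>ind W\<^esub> pW W \<one>\<^bsub>A\<^esub> (w i))) \<odot>\<^bsub>C P\<^esub> q P (pV \<one>\<^bsub>A\<^esub> (v i)) y) n
      = q P (pure k A B a' b \<odot>\<^bsub>Wb\<^esub> pV a x) y" .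
  qed
  have exp: "c = msum (C P) (\<lambda>s. msum (C P) (\<lambda>i. G s i c \<odot>\<^bsub>C P\<^esub> ?e s i) n) m" if c: "c \<in> carrier (C P)" for c
  proof (rule C_hom_eq[OF P CP.M.abelian_group_axioms _ _ c, where f = "\<lambda>c. c" and
        g = "\<lambda>c. msum (C P) (\<lambda>s. msum (C P) (\<lambda>i. G s i c \<odot>\<^bsub>C P\<^esub> ?e s i) n) m"])
    show "(\<lambda>c. c) \<in> add_hom (C P) (C P)" by (auto simp: add_hom_def)
    show "(\<lambda>c. msum (C P) (\<lambda>s. msum (C P) (\<lambda>i. G s i c \<odot>\<^bsub>C P\<^esub> ?e s i) n) m) \<in> add_hom (C P) (C P)"
      by (rule lmod_hom_add_hom[of _ A], intro CP.lmod_hom_msum CP.lmod_hom_smult_elem G(1) ec)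
    fix a x p assume axp: "a \<in> carrier A" "x \<in> carrier V" "p \<in> carrier P"
    have "msum (C P) (\<lambda>s. msum (C P) (\<lambda>i. G s i (q P (pV a x) p) \<odot>\<^bsub>C P\<^esub> ?e s i) n) m =
      msum (C P) (\<lambda>s. q P (pV a x) (\<phi> s p \<odot>\<^bsub>P\<^esub> r s)) m"
    proof (rule msum_cong)
      fix s assume s: "s < m"
      have "msum (C P) (\<lambda>i. G s i (q P (pV a x) p) \<odot>\<^bsub>C P\<^esub> ?e s i) n = q P (\<phi> s p \<odot>\<^bsub>Wb\<^esub> pV a x) (r s)"
        unfolding inner[OF mbD(3)[OF s axp(3)] axp(1,2) mbD(1)[OF s], symmetric]
        by (rule msum_cong) (simp add: G(2)[OF s _ axp])
      also have "\<dots> = q P (pV a x) (\<phi> s p \<odot>\<^bsub>P\<^esub> r s)"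
        by (rule T.pure_balanced[OF mbD(3)[OF s axp(3)] _ mbD(1)[OF s]]) (use p1 axp in simp)
      finally show "msum (C P) (\<lambda>i. G s i (q P (pV a x) p) \<odot>\<^bsub>C P\<^esub> ?e s i) n = q P (pV a x) (\<phi> s p \<odot>\<^bsub>P\<^esub> r s)" .
    qed
    also have "\<dots> = q P (pV a x) (msum P (\<lambda>s. \<phi> s p \<odot>\<^bsub>P\<^esub> r s) m)"
      by (rule add_hom_of_msum[OF P.M.abelian_group_axioms CP.M.abelian_group_axioms, symmetric], unfold add_hom_C,
          rule T.pure_add_hom_right) (use p1 axp mbD in \<open>auto intro: P.smult_closed\<close>)
    also have "\<dots> = q P (pV a x) p" using mbD(4)[OF axp(3)] by simp
    finally show "q P (pV a x) p = msum (C P) (\<lambda>s. msum (C P) (\<lambda>i. G s i (q P (pV a x) p) \<odot>\<^bsub>C P\<^esub> ?e s i) n) m" by simp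
  qed
  have lt: "l div n < m \<and> l mod n < n" if "l < m * n" for l
    using that by (cases "n = 0") (auto simp: div_less_iff_less_mult)
  \<comment> \<open>The index l encodes the pair (s, i) as (l div n, l mod n).\<close>
  have "dual_basis A (C P) (m * n) (\<lambda>l. ?e (l div n) (l mod n)) (\<lambda>l. G (l div n) (l mod n))"
    unfolding dual_basis_def
  proof (intro conjI allI impI ballI)
    fix c assume c: "c \<in> carrier (C P)"
    have "msum (C P) (\<lambda>s. msum (C P) (\<lambda>i. G s i c \<odot>\<^bsub>C P\<^esub> ?e s i) n) m =
      msum (C P) (\<lambda>l. G (l div n) (l mod n) c \<odot>\<^bsub>C P\<^esub> ?e (l div n) (l mod n)) (m * n)"
      by (rule CP.M.msum_double, rule CP.smult_closed) (use lmod_hom_closed[OF G(1)] c ec in auto)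
    then show "c = msum (C P) (\<lambda>l. G (l div n) (l mod n) c \<odot>\<^bsub>C P\<^esub> ?e (l div n) (l mod n)) (m * n)"
      using exp[OF c] by simp
  qed (use lt ec G(1) in auto)
  then show ?thesis by (auto simp: has_dual_basis_def)
qed

end

section \<open>Dimension shifting\<close>

text \<open>The coordinates of a cocycle with values in N are cocycles with values in R; their
  bounding cochains, multiplied by the b s, add up to one for the given cocycle.\<close>

lemma cohom_van_has_dual_basis:
  assumes N: "left_module R N" and db: "has_dual_basis R N" and van: "cohom_van R P d (regular R)"
    and dc: "\<And>i x. x \<in> carrier (P (Suc i)) \<Longrightarrow> d i x \<in> carrier (P i)"
  shows "cohom_van R P d N"
  unfolding cohom_van_def
proof (intro allI ballI impI)
  interpret N: left_module R N by (rule N)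
  obtain n b \<phi> where db: "dual_basis R N n b \<phi>" using db by (auto simp: has_dual_basis_def)
  note dbD = dual_basisD[OF db]
  have reg: "left_module R (regular R)" by (rule left_module_regular[OF left_module_ring[OF N]])
  fix j f assume f: "f \<in> lmod_hom R (P (Suc j)) N" "\<forall>x\<in>carrier (P (Suc (Suc j))). f (d (Suc j) x) = \<zero>\<^bsub>N\<^esub>"
  have fc: "f x \<in> carrier N" if "x \<in> carrier (P (Suc j))" for x by (rule lmod_hom_closed[OF f(1) that])
  have "\<exists>g. g \<in> lmod_hom R (P j) (regular R) \<and> (\<forall>x\<in>carrier (P (Suc j)). g (d j x) = \<phi> s (f x))" if "s < n" for s
  proof -
    have "\<exists>g\<in>lmod_hom R (P j) (regular R). \<forall>x\<in>carrier (P (Suc j)). g (d j x) = \<phi> s (f x)"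
      by (rule cohom_vanD[OF van lmod_hom_comp[OF f(1) dbD(2)[OF that]]])
        (use f(2) lmod_hom_zero[OF N reg dbD(2)[OF that]] in simp)
    then show ?thesis by blast
  qed
  then obtain g where "\<forall>s. s < n \<longrightarrow> g s \<in> lmod_hom R (P j) (regular R) \<and>
    (\<forall>x\<in>carrier (P (Suc j)). g s (d j x) = \<phi> s (f x))" by metis
  then have g: "\<And>s. s < n \<Longrightarrow> g s \<in> lmod_hom R (P j) (regular R)"
    "\<And>s x. \<lbrakk>s < n; x \<in> carrier (P (Suc j))\<rbrakk> \<Longrightarrow> g s (d j x) = \<phi> s (f x)" by simp_all
  have "(\<lambda>y. msum N (\<lambda>s. g s y \<odot>\<^bsub>N\<^esub> b s) n) \<in> lmod_hom R (P j) N"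
    by (rule N.lmod_hom_msum, rule N.lmod_hom_smult_elem[OF g(1) dbD(1)])
  moreover have "msum N (\<lambda>s. g s (d j x) \<odot>\<^bsub>N\<^esub> b s) n = f x" if x: "x \<in> carrier (P (Suc j))" for x
  proof -
    have "msum N (\<lambda>s. g s (d j x) \<odot>\<^bsub>N\<^esub> b s) n = msum N (\<lambda>s. \<phi> s (f x) \<odot>\<^bsub>N\<^esub> b s) n"
      by (rule msum_cong) (simp add: g(2)[OF _ x])
    then show ?thesis using dbD(4)[OF fc[OF x]] by simp
  qed
  ultimately show "\<exists>g\<in>lmod_hom R (P j) N. \<forall>x\<in>carrier (P (Suc j)). g (d j x) = f x"
    by (intro bexI[of _ "\<lambda>y. msum N (\<lambda>s. g s y \<odot>\<^bsub>N\<^esub> b s) n"] ballI)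
qed

text \<open>
  Dimension shifting runs along kernels inside the terms of a resolution; restricting the values of the
  cochains to a subset K avoids forming the kernel modules.
\<close>

definition cohom_van_in :: "('r, 'c) ring_scheme \<Rightarrow> (nat \<Rightarrow> ('r, 'm, 'd) module_scheme) \<Rightarrow> (nat \<Rightarrow> 'm \<Rightarrow> 'm) \<Rightarrow>
    ('r, 'n, 'e) module_scheme \<Rightarrow> 'n set \<Rightarrow> bool" where
  "cohom_van_in R P d N K \<longleftrightarrow> (\<forall>j. \<forall>f\<in>lmod_hom R (P (Suc j)) N.
     (\<forall>x\<in>carrier (P (Suc j)). f x \<in> K) \<longrightarrow> (\<forall>x\<in>carrier (P (Suc (Suc j))). f (d (Suc j) x) = \<zero>\<^bsub>N\<^esub>) \<longrightarrow>
     (\<exists>g\<in>lmod_hom R (P j) N. (\<forall>y\<in>carrier (P j). g y \<in> K) \<and> (\<forall>x\<in>carrier (P (Suc j)). g (d j x) = f x)))"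

lemma cohom_van_in_carrier:
  assumes "cohom_van_in R P d N (carrier N)"
  shows "cohom_van R P d N"
  unfolding cohom_van_def
proof (intro allI ballI impI)
  fix j f assume f: "f \<in> lmod_hom R (P (Suc j)) N" "\<forall>x\<in>carrier (P (Suc (Suc j))). f (d (Suc j) x) = \<zero>\<^bsub>N\<^esub>"
  have "\<forall>x\<in>carrier (P (Suc j)). f x \<in> carrier N" by (intro ballI lmod_hom_closed[OF f(1)])
  then show "\<exists>g\<in>lmod_hom R (P j) N. \<forall>x\<in>carrier (P (Suc j)). g (d j x) = f x"
    using assms[unfolded cohom_van_in_def, rule_format, of f j] f by auto
qed

lemma cohom_van_in_zero:
  assumes "left_module R N"
  shows "cohom_van_in R P d N {\<zero>\<^bsub>N\<^esub>}"
  unfolding cohom_van_in_def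
proof (intro allI ballI impI)
  fix j f assume "\<forall>x\<in>carrier (P (Suc j)). f x \<in> {\<zero>\<^bsub>N\<^esub>}"
  then show "\<exists>g\<in>lmod_hom R (P j) N. (\<forall>y\<in>carrier (P j). g y \<in> {\<zero>\<^bsub>N\<^esub>}) \<and> (\<forall>x\<in>carrier (P (Suc j)). g (d j x) = f x)"
    using left_module.lmod_hom_const_zero[OF assms] by (intro bexI[of _ "\<lambda>_. \<zero>\<^bsub>N\<^esub>"]) auto
qed

text \<open>One dimension shift, from the kernel of D to its image. A lift h of f along D has
  coboundary in the kernel, so it equals the coboundary of some kernel-valued g. Then h - g is a
  cocycle in Y1; if u bounds it, D u bounds f.\<close>

lemma cohom_van_in_image:
  assumes P: "\<And>i. left_module R (P i)" "\<And>i. has_dual_basis R (P i)" "\<And>i. d i \<in> lmod_hom R (P (Suc i)) (P i)"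
      "\<And>i x. x \<in> carrier (P (Suc (Suc i))) \<Longrightarrow> d i (d (Suc i) x) = \<zero>\<^bsub>P i\<^esub>"
    and Y: "left_module R Y1" "left_module R Y0" "D \<in> lmod_hom R Y1 Y0"
    and van: "cohom_van R P d Y1" and ker: "cohom_van_in R P d Y1 (a_kernel Y1 Y0 D)"
  shows "cohom_van_in R P d Y0 (D ` carrier Y1)"
  unfolding cohom_van_in_def
proof (intro allI ballI impI)
  interpret Y1: left_module R Y1 by (rule Y)
  interpret Y0: left_module R Y0 by (rule Y)
  fix j f assume f: "f \<in> lmod_hom R (P (Suc j)) Y0" "\<forall>x\<in>carrier (P (Suc j)). f x \<in> D ` carrier Y1"
    "\<forall>x\<in>carrier (P (Suc (Suc j))). f (d (Suc j) x) = \<zero>\<^bsub>Y0\<^esub>"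
  have dc: "d i x \<in> carrier (P i)" if "x \<in> carrier (P (Suc i))" for i x by (rule lmod_hom_closed[OF P(3) that])
  have "f ` carrier (P (Suc j)) \<subseteq> D ` carrier Y1" by (intro image_subsetI) (rule bspec[OF f(2)])
  from dual_basis_lift[OF P(1,2) Y f(1) this]
  obtain h where h: "h \<in> lmod_hom R (P (Suc j)) Y1" "\<And>x. x \<in> carrier (P (Suc j)) \<Longrightarrow> D (h x) = f x" by blast
  have hc: "h x \<in> carrier Y1" if "x \<in> carrier (P (Suc j))" for x by (rule lmod_hom_closed[OF h(1) that])
  \<comment> \<open>The coboundary of h sits one degree above f, so the hypothesis on the kernel is
    applied at \<open>Suc j\<close>.\<close>
  have hd: "(\<lambda>x. h (d (Suc j) x)) \<in> lmod_hom R (P (Suc (Suc j))) Y1" by (rule lmod_hom_comp[OF P(3) h(1)])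
  have "\<forall>x\<in>carrier (P (Suc (Suc j))). h (d (Suc j) x) \<in> a_kernel Y1 Y0 D"
    using f(3) h(2) dc hc by (simp add: a_kernel_def')
  moreover have "\<forall>x\<in>carrier (P (Suc (Suc (Suc j)))). h (d (Suc j) (d (Suc (Suc j)) x)) = \<zero>\<^bsub>Y1\<^esub>"
    using P(4) lmod_hom_zero[OF P(1) Y(1) h(1)] by simp
  ultimately have "\<exists>g\<in>lmod_hom R (P (Suc j)) Y1. (\<forall>y\<in>carrier (P (Suc j)). g y \<in> a_kernel Y1 Y0 D) \<and>
    (\<forall>x\<in>carrier (P (Suc (Suc j))). g (d (Suc j) x) = h (d (Suc j) x))"
    using ker[unfolded cohom_van_in_def, rule_format, of "\<lambda>x. h (d (Suc j) x)" "Suc j"] hd by simp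
  then obtain g where g: "g \<in> lmod_hom R (P (Suc j)) Y1" "\<forall>y\<in>carrier (P (Suc j)). g y \<in> a_kernel Y1 Y0 D"
    "\<forall>x\<in>carrier (P (Suc (Suc j))). g (d (Suc j) x) = h (d (Suc j) x)" by blast
  have gc: "g x \<in> carrier Y1" if "x \<in> carrier (P (Suc j))" for x by (rule lmod_hom_closed[OF g(1) that])
  have "\<exists>u\<in>lmod_hom R (P j) Y1. \<forall>x\<in>carrier (P (Suc j)). u (d j x) = h x \<ominus>\<^bsub>Y1\<^esub> g x"
    by (rule cohom_vanD[OF van Y1.lmod_hom_minus[OF h(1) g(1)]])
      (use g(3) gc hc dc in \<open>simp add: Y1.M.minus_eq_zero_iff\<close>)
  then obtain u where u: "u \<in> lmod_hom R (P j) Y1" "\<forall>x\<in>carrier (P (Suc j)). u (d j x) = h x \<ominus>\<^bsub>Y1\<^esub> g x" by blast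
  have "D (u (d j x)) = f x" if x: "x \<in> carrier (P (Suc j))" for x
  proof -
    have "D (u (d j x)) = D (h x) \<ominus>\<^bsub>Y0\<^esub> D (g x)"
      using u(2) x lmod_hom_diff[OF Y hc[OF x] gc[OF x]] by simp
    also have "D (g x) = \<zero>\<^bsub>Y0\<^esub>" using g(2) x by (simp add: a_kernel_def')
    finally show ?thesis using h(2)[OF x] lmod_hom_closed[OF f(1) x] by (simp add: a_minus_def)
  qed
  then show "\<exists>g\<in>lmod_hom R (P j) Y0. (\<forall>y\<in>carrier (P j). g y \<in> D ` carrier Y1) \<and>
    (\<forall>x\<in>carrier (P (Suc j)). g (d j x) = f x)"
    using lmod_hom_comp[OF u(1) Y(3)] lmod_hom_closed[OF u(1)] by (intro bexI[of _ "\<lambda>y. D (u y)"]) auto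
qed

lemma (in algebra) proj_dim_finite:
  fixes W :: "('a, 'k univ) module"
  assumes "gl_dim A < \<infinity>" "fg_left_module A W"
  shows "\<exists>(P :: nat \<Rightarrow> ('a, 'k univ) module) d e n. resolution A W P d e \<and> (\<forall>i>n::nat. carrier (P i) = {\<zero>\<^bsub>P i\<^esub>})"
proof -
  have "proj_dim A W \<le> gl_dim A" unfolding gl_dim_def by (rule Sup_upper) (use assms(2) in blast)
  then have "proj_dim A W < \<infinity>" using assms(1) by (rule le_less_trans)
  \<comment> \<open>The infimum of the empty set in \<open>enat\<close> is \<infinity>, so a finite
    value yields an actual finite resolution.\<close>
  then have "{enat n |n. \<exists>P d e. projective_resolution A W P d e \<and> (\<forall>i>n. carrier (P i) = {\<zero>\<^bsub>P i\<^esub>})} \<noteq> {}"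
    unfolding proj_dim_def by (metis (no_types, lifting) Inf_enat_def less_irrefl)
  then obtain n P d e where P: "projective_resolution A W P d e" "\<forall>i>n. carrier (P i) = {\<zero>\<^bsub>P i\<^esub>}" by auto
  have "projective A (P i)" for i using P(1) by (simp add: projective_resolution_def)
  then have "resolution A W P d e"
    using P(1) assms(2) projective_has_dual_basis
    by (auto simp: resolution_def projective_resolution_def fg_left_module_def)
  then show ?thesis using P(2) by blast
qed

text \<open>Exactness of A \<otimes> - makes the terms \<open>ind (Q j)\<close> a resolution of
  \<open>ind W\<close>; vanishing holds for each term by \<open>cohom_van_has_dual_basis\<close> and
  is shifted from the zero end of the resolution down to \<open>ind W\<close>.\<close>

lemma (in two_algebras) cohom_van_ind:
  fixes W :: "('b, 'w) module" and Q :: "nat \<Rightarrow> ('b, 'q) module"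
  assumes P: "\<And>i. left_module L (P i)" "\<And>i. has_dual_basis L (P i)" "\<And>i. d i \<in> lmod_hom L (P (Suc i)) (P i)"
      "\<And>i x. x \<in> carrier (P (Suc (Suc i))) \<Longrightarrow> d i (d (Suc i) x) = \<zero>\<^bsub>P i\<^esub>"
    and van: "cohom_van L P d (regular L)"
    and Q: "resolution B W Q \<delta> \<epsilon>" "\<forall>i>n::nat. carrier (Q i) = {\<zero>\<^bsub>Q i\<^esub>}"
  shows "cohom_van L P d (ind W)"
proof -
  note QD = resolutionD[OF Q(1)]
  have dc: "d i x \<in> carrier (P i)" if "x \<in> carrier (P (Suc i))" for i x by (rule lmod_hom_closed[OF P(3) that])
  have N: "left_module L (ind (Q j))" for j by (rule left_module_ind[OF QD(2)])
  have vanQ: "cohom_van L P d (ind (Q j))" for j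
    by (rule cohom_van_has_dual_basis[OF N has_dual_basis_ind[OF QD(2,3)] van dc])
  note \<delta> = ind_map(2)[OF QD(2) QD(2) QD(4)]
  note \<epsilon> = ind_map(2)[OF QD(2) QD(1) QD(5)]
  have ex: "a_kernel (ind (Q (Suc j))) (ind (Q j)) (ind_map (Q j) (\<delta> j)) =
    ind_map (Q (Suc j)) (\<delta> (Suc j)) ` carrier (ind (Q (Suc (Suc j))))" for j
  proof
    show "a_kernel (ind (Q (Suc j))) (ind (Q j)) (ind_map (Q j) (\<delta> j)) \<subseteq>
      ind_map (Q (Suc j)) (\<delta> (Suc j)) ` carrier (ind (Q (Suc (Suc j))))"
      using ind_exact[OF QD(2) QD(2) QD(2) QD(4) QD(4), of j] QD(8)[of j]
      unfolding a_kernel_def'[of "ind (Q (Suc j))"] by blast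
    interpret T: tensor_factors k A "base_space B (Q (Suc (Suc j)))" by (rule factors_W[OF QD(2)])
    interpret T0: tensor_factors k A "base_space B (Q j)" by (rule factors_W[OF QD(2)])
    have "ind_map (Q j) (\<delta> j) (ind_map (Q (Suc j)) (\<delta> (Suc j)) t) = \<zero>\<^bsub>ind (Q j)\<^esub>"
      if t: "t \<in> carrier (ind (Q (Suc (Suc j))))" for t
    proof (rule T.add_hom_eq[OF left_module_abelian_group[OF N], where f = "\<lambda>t. ind_map (Q j) (\<delta> j) (ind_map (Q (Suc j)) (\<delta> (Suc j)) t)" and g = "\<lambda>t. \<zero>\<^bsub>ind (Q j)\<^esub>"])
      show "(\<lambda>t. ind_map (Q j) (\<delta> j) (ind_map (Q (Suc j)) (\<delta> (Suc j)) t)) \<in> add_hom T.T (ind (Q j))"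
        by (rule add_hom_comp[OF lmod_hom_add_hom[OF \<delta>, unfolded add_hom_ind(1)] lmod_hom_add_hom[OF \<delta>]])
      show "(\<lambda>t. \<zero>\<^bsub>ind (Q j)\<^esub>) \<in> add_hom T.T (ind (Q j))"
        using left_module.lmod_hom_const_zero[OF N] by (auto simp: add_hom_def)
      fix a x assume ax: "a \<in> carrier A" "x \<in> carrier (base_space B (Q (Suc (Suc j))))"
      then show "ind_map (Q j) (\<delta> j) (ind_map (Q (Suc j)) (\<delta> (Suc j)) (T.pur a x)) = \<zero>\<^bsub>ind (Q j)\<^esub>"
        using ind_map(1)[OF QD(2) QD(2) QD(4) ax(1), of x "Suc j"]
          ind_map(1)[OF QD(2) QD(2) QD(4) ax(1), of "\<delta> (Suc j) x" j] QD(9)[of x "Suc j"] QD(10)[of x j]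
          T0.pure_zero_right[OF ax(1)] by simp
    qed (use t in simp)
    then show "ind_map (Q (Suc j)) (\<delta> (Suc j)) ` carrier (ind (Q (Suc (Suc j)))) \<subseteq>
      a_kernel (ind (Q (Suc j))) (ind (Q j)) (ind_map (Q j) (\<delta> j))"
      unfolding a_kernel_def' using lmod_hom_closed[OF \<delta>] by blast
  qed
  \<comment> \<open>Descending induction on j. For j at least n the module \<open>Q (Suc j)\<close>
    is zero; in the step, the image of the differential with index \<open>Suc j\<close> is the
    kernel of the one with index j.\<close>
  have S: "cohom_van_in L P d (ind (Q j)) (ind_map (Q j) (\<delta> j) ` carrier (ind (Q (Suc j))))" for j
  proof (induction "n - j" arbitrary: j)
    case 0
    then have "carrier (Q (Suc j)) = {\<zero>\<^bsub>Q (Suc j)\<^esub>}" using Q(2) by simp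
    moreover interpret T: tensor_factors k A "base_space B (Q (Suc j))" by (rule factors_W[OF QD(2)])
    interpret N: left_module L "ind (Q (Suc j))" by (rule N)
    have "t = \<zero>\<^bsub>ind (Q (Suc j))\<^esub>" if "t \<in> carrier T.T" for t
      using that
    proof (induction rule: T.tensor_induct)
      case (pure x y)
      then show ?case using T.pure_zero_right[OF pure(1)] calculation by simp
    qed simp
    then have "carrier (ind (Q (Suc j))) = {\<zero>\<^bsub>ind (Q (Suc j))\<^esub>}" using T.T.zero_closed by auto
    then have "ind_map (Q j) (\<delta> j) ` carrier (ind (Q (Suc j))) = {\<zero>\<^bsub>ind (Q j)\<^esub>}"
      using lmod_hom_zero[OF N N \<delta>, of j] by simp
    then show ?case using cohom_van_in_zero[OF N] by simp
  next
    case (Suc m)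
    then have "cohom_van_in L P d (ind (Q (Suc j))) (ind_map (Q (Suc j)) (\<delta> (Suc j)) ` carrier (ind (Q (Suc (Suc j)))))"
      by simp
    then have "cohom_van_in L P d (ind (Q (Suc j))) (a_kernel (ind (Q (Suc j))) (ind (Q j)) (ind_map (Q j) (\<delta> j)))"
      by (simp only: ex)
    from cohom_van_in_image[where P = P and d = d, OF P N[of "Suc j"] N[of j] \<delta>[of j] vanQ[of "Suc j"] this]
    show ?case .
  qed
  have "a_kernel (ind (Q 0)) (ind W) (ind_map W \<epsilon>) \<subseteq> ind_map (Q 0) (\<delta> 0) ` carrier (ind (Q (Suc 0)))"
    using ind_exact[OF QD(2) QD(2) QD(1) QD(4) QD(5)] QD(7)
    unfolding a_kernel_def'[of "ind (Q 0)"] by blast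
  moreover have "ind_map (Q 0) (\<delta> 0) ` carrier (ind (Q (Suc 0))) \<subseteq> a_kernel (ind (Q 0)) (ind W) (ind_map W \<epsilon>)"
  proof -
    interpret T: tensor_factors k A "base_space B (Q (Suc 0))" by (rule factors_W[OF QD(2)])
    interpret TW: tensor_factors k A "base_space B W" by (rule factors_W[OF QD(1)])
    note NW = left_module_ind[OF QD(1)]
    have "ind_map W \<epsilon> (ind_map (Q 0) (\<delta> 0) t) = \<zero>\<^bsub>ind W\<^esub>" if t: "t \<in> carrier (ind (Q (Suc 0)))" for t
    proof (rule T.add_hom_eq[OF left_module_abelian_group[OF NW], where f = "\<lambda>t. ind_map W \<epsilon> (ind_map (Q 0) (\<delta> 0) t)" and g = "\<lambda>t. \<zero>\<^bsub>ind W\<^esub>"])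
      show "(\<lambda>t. ind_map W \<epsilon> (ind_map (Q 0) (\<delta> 0) t)) \<in> add_hom T.T (ind W)"
        by (rule add_hom_comp[OF lmod_hom_add_hom[OF \<delta>, unfolded add_hom_ind(1)] lmod_hom_add_hom[OF \<epsilon>]])
      show "(\<lambda>t. \<zero>\<^bsub>ind W\<^esub>) \<in> add_hom T.T (ind W)"
        using left_module.lmod_hom_const_zero[OF NW] by (auto simp: add_hom_def)
      fix a x assume ax: "a \<in> carrier A" "x \<in> carrier (base_space B (Q (Suc 0)))"
      then show "ind_map W \<epsilon> (ind_map (Q 0) (\<delta> 0) (T.pur a x)) = \<zero>\<^bsub>ind W\<^esub>"
        using ind_map(1)[OF QD(2) QD(2) QD(4) ax(1), of x 0]
          ind_map(1)[OF QD(2) QD(1) QD(5) ax(1), of "\<delta> 0 x"] QD(9)[of x 0] QD(11)[of x]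
          TW.pure_zero_right[OF ax(1)] by simp
    qed (use t in simp)
    then show ?thesis unfolding a_kernel_def' using lmod_hom_closed[OF \<delta>] by blast
  qed
  ultimately have "a_kernel (ind (Q 0)) (ind W) (ind_map W \<epsilon>) = ind_map (Q 0) (\<delta> 0) ` carrier (ind (Q (Suc 0)))"
    by (rule subset_antisym)
  then have "cohom_van_in L P d (ind (Q 0)) (a_kernel (ind (Q 0)) (ind W) (ind_map W \<epsilon>))" using S[of 0] by simp
  from cohom_van_in_image[where P = P and d = d, OF P N[of 0] left_module_ind[OF QD(1)] \<epsilon> vanQ[of 0] this]
  have "cohom_van_in L P d (ind W) (ind_map W \<epsilon> ` carrier (ind (Q 0)))" .
  then show ?thesis
    unfolding ind_map_surj[OF QD(2) QD(1) QD(5) QD(6)] by (rule cohom_van_in_carrier)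
qed

section \<open>Finite injective dimension\<close>

context algebra
begin

text \<open>E is exact in positive degrees with projective terms, and X has a finite injective
  coresolution. The obstruction to extending f is pushed to later cosyzygies of X and higher degrees
  of E until J vanishes.\<close>

lemma injective_chase:
  fixes E :: "nat \<Rightarrow> ('a, 'm) module"
  assumes E: "\<And>i. left_module A (E i)" "\<And>i. has_dual_basis A (E i)" "\<And>i. \<delta> i \<in> lmod_hom A (E i) (E (Suc i))"
      "\<And>i. a_kernel (E (Suc i)) (E (Suc (Suc i))) (\<delta> (Suc i)) = \<delta> i ` carrier (E i)"
    and J: "injective_coresolution A X J dJ e" "\<forall>i>n::nat. carrier (J i) = {\<zero>\<^bsub>J i\<^esub>}" and X: "left_module A X"
    and f: "f \<in> lmod_hom A (E (Suc i)) X" "\<And>x. x \<in> carrier (E i) \<Longrightarrow> f (\<delta> i x) = \<zero>\<^bsub>X\<^esub>"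
  shows "\<exists>g\<in>lmod_hom A (E (Suc (Suc i))) X. \<forall>x\<in>carrier (E (Suc i)). g (\<delta> (Suc i) x) = f x"
proof -
  have inj: "injective A (J i)" and dJ: "dJ i \<in> lmod_hom A (J i) (J (Suc i))"
    and eJ: "e \<in> lmod_hom A X (J 0)" "inj_on e (carrier X)" "e ` carrier X = a_kernel (J 0) (J 1) (dJ 0)"
    and exJ: "dJ i ` carrier (J i) = a_kernel (J (Suc i)) (J (Suc (Suc i))) (dJ (Suc i))" for i
    using J(1) by (simp_all add: injective_coresolution_def)
  have JL: "left_module A (J i)" for i using inj[of i] by (simp add: injective_def fg_left_module_def)
  have fgE: "fg_left_module A (E i)" for i
    using E(1) has_dual_basis_fin_gen[OF E(1,2)] by (simp add: fg_left_module_def)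
  have \<delta>c: "\<delta> i x \<in> carrier (E (Suc i))" if "x \<in> carrier (E i)" for i x by (rule lmod_hom_closed[OF E(3) that])
  have \<delta>\<delta>: "\<delta> (Suc i) (\<delta> i x) = \<zero>\<^bsub>E (Suc (Suc i))\<^esub>" if "x \<in> carrier (E i)" for i x
    using E(4)[of i] that by (auto simp: a_kernel_def' set_eq_iff image_iff)
  have dJdJ: "dJ (Suc i) (dJ i x) = \<zero>\<^bsub>J (Suc (Suc i))\<^esub>" if "x \<in> carrier (J i)" for i x
    using exJ[of i] that by (auto simp: a_kernel_def' set_eq_iff image_iff)
  \<comment> \<open>The claim for the j-th cosyzygy, whose elements are those of J j killed by dJ j.
    The measure Suc n - j is zero exactly for j > n, where J j is zero.\<close>
  have S: "\<exists>g\<in>lmod_hom A (E (Suc (Suc i))) (J j). (\<forall>y\<in>carrier (E (Suc (Suc i))). dJ j (g y) = \<zero>\<^bsub>J (Suc j)\<^esub>) \<and>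
      (\<forall>x\<in>carrier (E (Suc i)). g (\<delta> (Suc i) x) = f x)"
    if "f \<in> lmod_hom A (E (Suc i)) (J j)" "\<And>x. x \<in> carrier (E (Suc i)) \<Longrightarrow> dJ j (f x) = \<zero>\<^bsub>J (Suc j)\<^esub>"
      "\<And>x. x \<in> carrier (E i) \<Longrightarrow> f (\<delta> i x) = \<zero>\<^bsub>J j\<^esub>" for i j f
    using that
  proof (induction "Suc n - j" arbitrary: i j f)
    case 0
    then have "carrier (J j) = {\<zero>\<^bsub>J j\<^esub>}" using J(2) by simp
    then have "f x = \<zero>\<^bsub>J j\<^esub>" if "x \<in> carrier (E (Suc i))" for x using lmod_hom_closed[OF 0(2) that] by simp
    then show ?case
      using left_module.lmod_hom_const_zero[OF JL] lmod_hom_zero[OF JL JL dJ]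
      by (intro bexI[of _ "\<lambda>_. \<zero>\<^bsub>J j\<^esub>"]) auto
  next
    case (Suc m)
    interpret Jj: left_module A "J j" by (rule JL)
    interpret Jj1: left_module A "J (Suc j)" by (rule JL)
    \<comment> \<open>Injectivity of J j extends f, but the extension g need not take values in the
      cosyzygy.\<close>
    have "\<exists>g\<in>lmod_hom A (E (Suc (Suc i))) (J j). \<forall>x\<in>carrier (E (Suc i)). g (\<delta> (Suc i) x) = f x"
    proof (rule injective_extend[OF inj E(1) fgE E(3) Suc.prems(1)])
      fix x assume "x \<in> carrier (E (Suc i))" "\<delta> (Suc i) x = \<zero>\<^bsub>E (Suc (Suc i))\<^esub>"
      then have "x \<in> \<delta> i ` carrier (E i)" unfolding E(4)[symmetric] by (simp add: a_kernel_def')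
      then show "f x = \<zero>\<^bsub>J j\<^esub>" using Suc.prems(3) by auto
    qed
    then obtain g where g: "g \<in> lmod_hom A (E (Suc (Suc i))) (J j)"
      "\<And>x. x \<in> carrier (E (Suc i)) \<Longrightarrow> g (\<delta> (Suc i) x) = f x" by blast
    have gc: "g x \<in> carrier (J j)" if "x \<in> carrier (E (Suc (Suc i)))" for x by (rule lmod_hom_closed[OF g(1) that])
    have dg: "(\<lambda>x. dJ j (g x)) \<in> lmod_hom A (E (Suc (Suc i))) (J (Suc j))" by (rule lmod_hom_comp[OF g(1) dJ])
    \<comment> \<open>The defect dJ j g kills the image of the previous differential and lies in the
      next cosyzygy, so the induction hypothesis applies with i and j both raised by one.\<close>
    have "\<exists>h\<in>lmod_hom A (E (Suc (Suc (Suc i)))) (J (Suc j)).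
      (\<forall>y\<in>carrier (E (Suc (Suc (Suc i)))). dJ (Suc j) (h y) = \<zero>\<^bsub>J (Suc (Suc j))\<^esub>) \<and>
      (\<forall>x\<in>carrier (E (Suc (Suc i))). h (\<delta> (Suc (Suc i)) x) = dJ j (g x))"
      by (rule Suc.hyps(1)[OF _ dg]) (use Suc.hyps(2) dJdJ gc g(2) Suc.prems(2) in simp_all)
    then obtain h where h: "h \<in> lmod_hom A (E (Suc (Suc (Suc i)))) (J (Suc j))"
      "\<forall>y\<in>carrier (E (Suc (Suc (Suc i)))). dJ (Suc j) (h y) = \<zero>\<^bsub>J (Suc (Suc j))\<^esub>"
      "\<forall>x\<in>carrier (E (Suc (Suc i))). h (\<delta> (Suc (Suc i)) x) = dJ j (g x)" by blast
    have "h ` carrier (E (Suc (Suc (Suc i)))) \<subseteq> dJ j ` carrier (J j)"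
      unfolding exJ a_kernel_def' using h(2) lmod_hom_closed[OF h(1)] by blast
    from dual_basis_lift[OF E(1,2) JL JL dJ h(1) this]
    obtain h' where h': "h' \<in> lmod_hom A (E (Suc (Suc (Suc i)))) (J j)"
      "\<And>x. x \<in> carrier (E (Suc (Suc (Suc i)))) \<Longrightarrow> dJ j (h' x) = h x" by blast
    \<comment> \<open>Here h' lifts h along dJ j, which the dual basis of the term of E makes
      possible. Subtracting it removes the defect and changes nothing on boundaries.\<close>
    let ?g = "\<lambda>y. g y \<ominus>\<^bsub>J j\<^esub> h' (\<delta> (Suc (Suc i)) y)"
    have h'd: "(\<lambda>y. h' (\<delta> (Suc (Suc i)) y)) \<in> lmod_hom A (E (Suc (Suc i))) (J j)" by (rule lmod_hom_comp[OF E(3) h'(1)])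
    have "?g \<in> lmod_hom A (E (Suc (Suc i))) (J j)" by (rule Jj.lmod_hom_minus[OF g(1) h'd])
    moreover have "dJ j (?g y) = \<zero>\<^bsub>J (Suc j)\<^esub>" if y: "y \<in> carrier (E (Suc (Suc i)))" for y
      using lmod_hom_diff[OF JL JL dJ gc[OF y] lmod_hom_closed[OF h'd y]] h'(2)[OF \<delta>c[OF y]] h(3) y
        lmod_hom_closed[OF dg y] by (simp add: Jj1.M.minus_eq_zero_iff)
    moreover have "?g (\<delta> (Suc i) x) = f x" if x: "x \<in> carrier (E (Suc i))" for x
      using \<delta>\<delta>[OF x] lmod_hom_zero[OF E(1) JL h'(1)] g(2)[OF x] lmod_hom_closed[OF Suc.prems(1) x]
      by (simp add: a_minus_def)
    ultimately show ?case by (intro bexI[of _ ?g] conjI ballI)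
  qed
  have ef: "(\<lambda>x. e (f x)) \<in> lmod_hom A (E (Suc i)) (J 0)" by (rule lmod_hom_comp[OF f(1) eJ(1)])
  have ekc: "dJ 0 (e x) = \<zero>\<^bsub>J (Suc 0)\<^esub>" if "x \<in> carrier X" for x
    using eJ(3) that by (auto simp: a_kernel_def' set_eq_iff image_iff)
  \<comment> \<open>X embeds as the cosyzygy for j = 0. The extension obtained in J 0 is afterwards
    lifted back along e.\<close>
  have "\<exists>g\<in>lmod_hom A (E (Suc (Suc i))) (J 0). (\<forall>y\<in>carrier (E (Suc (Suc i))). dJ 0 (g y) = \<zero>\<^bsub>J (Suc 0)\<^esub>) \<and>
      (\<forall>x\<in>carrier (E (Suc i)). g (\<delta> (Suc i) x) = e (f x))"
    by (rule S[OF ef]) (use f(2) ekc lmod_hom_closed[OF f(1)] lmod_hom_zero[OF X JL eJ(1)] in simp_all)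
  then obtain g where g: "g \<in> lmod_hom A (E (Suc (Suc i))) (J 0)"
    "\<forall>y\<in>carrier (E (Suc (Suc i))). dJ 0 (g y) = \<zero>\<^bsub>J (Suc 0)\<^esub>"
    "\<forall>x\<in>carrier (E (Suc i)). g (\<delta> (Suc i) x) = e (f x)" by blast
  have "g ` carrier (E (Suc (Suc i))) \<subseteq> e ` carrier X"
    unfolding eJ(3) a_kernel_def' using g(2) lmod_hom_closed[OF g(1)] by auto
  from dual_basis_lift[OF E(1,2) X JL eJ(1) g(1) this]
  obtain g' where g': "g' \<in> lmod_hom A (E (Suc (Suc i))) X" "\<And>y. y \<in> carrier (E (Suc (Suc i))) \<Longrightarrow> e (g' y) = g y"
    by blast
  have "g' (\<delta> (Suc i) x) = f x" if x: "x \<in> carrier (E (Suc i))" for x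
    using inj_onD[OF eJ(2)] g'(2)[OF \<delta>c[OF x]] g(3) x lmod_hom_closed[OF g'(1) \<delta>c[OF x]] lmod_hom_closed[OF f(1) x]
    by simp
  then show ?thesis using g'(1) by blast
qed

section \<open>The right modules Hom_A(M, A) and reflexivity of projective modules\<close>

definition transpose_module :: "('a, 'm) module \<Rightarrow> ('a, 'm \<Rightarrow> 'a) module" where
  "transpose_module M = (let H = Hom_group A M (regular A) in
     \<lparr>carrier = carrier H, mult = undefined, one = undefined, ring.zero = \<zero>\<^bsub>H\<^esub>, add = add H,
      smult = (\<lambda>r \<phi>. \<lambda>x\<in>carrier M. \<phi> x \<otimes> r)\<rparr>)"

lemma transpose_simps:
  "carrier (transpose_module M) = lmod_hom A M (regular A) \<inter> extensional (carrier M)"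
  "\<zero>\<^bsub>transpose_module M\<^esub> = (\<lambda>x\<in>carrier M. \<zero>)"
  "\<phi> \<oplus>\<^bsub>transpose_module M\<^esub> \<psi> = (\<lambda>x\<in>carrier M. \<phi> x \<oplus> \<psi> x)"
  "r \<odot>\<^bsub>transpose_module M\<^esub> \<phi> = (\<lambda>x\<in>carrier M. \<phi> x \<otimes> r)"
  by (simp_all add: transpose_module_def Let_def)

lemma transposeD:
  assumes "\<phi> \<in> carrier (transpose_module M)"
  shows "\<phi> \<in> lmod_hom A M (regular A)" "x \<in> carrier M \<Longrightarrow> \<phi> x \<in> carrier A"
  using assms lmod_hom_closed[of \<phi> A M "regular A" x] by (simp_all add: transpose_simps)

lemma transpose_eqI:
  "\<lbrakk>\<phi> \<in> carrier (transpose_module M); \<psi> \<in> carrier (transpose_module M);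
    \<And>x. x \<in> carrier M \<Longrightarrow> \<phi> x = \<psi> x\<rbrakk> \<Longrightarrow> \<phi> = \<psi>"
  by (intro extensionalityI[of \<phi> "carrier M"]) (auto simp: transpose_simps)

lemma transposeI: "\<lbrakk>left_module A M; \<phi> \<in> lmod_hom A M (regular A)\<rbrakk> \<Longrightarrow> restrict \<phi> (carrier M) \<in> carrier (transpose_module M)"
  using lmod_hom_restrict[of A M \<phi> "regular A"] by (simp add: transpose_simps)

lemma left_module_transpose:
  assumes "left_module A M"
  shows "left_module (opp A) (transpose_module M)"
proof (rule left_moduleI)
  interpret M: left_module A M by fact
  show "ring (opp A)" by (rule ring_opp[OF ring_A])
  show "abelian_group (transpose_module M)"
    by (rule abelian_group_cong[OF abelian_group_Hom_group[OF assms left_module_regular[OF ring_A]]])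
      (simp_all add: transpose_module_def Let_def)
  show cl: "r \<odot>\<^bsub>transpose_module M\<^esub> \<phi> \<in> carrier (transpose_module M)"
    if "r \<in> carrier (opp A)" "\<phi> \<in> carrier (transpose_module M)" for r \<phi>
  proof -
    have "(\<lambda>x. \<phi> x \<otimes> r) \<in> lmod_hom A M (regular A)"
      by (rule lmod_homI)
        (use that transposeD[OF that(2)] lmod_hom_add[OF transposeD(1)[OF that(2)]]
          lmod_hom_smult[OF transposeD(1)[OF that(2)]] in \<open>simp_all add: l_distr m_assoc\<close>)
    then show ?thesis unfolding transpose_simps(4) by (rule transposeI[OF assms])
  qed
  show "\<one>\<^bsub>opp A\<^esub> \<odot>\<^bsub>transpose_module M\<^esub> \<phi> = \<phi>" if "\<phi> \<in> carrier (transpose_module M)" for \<phi>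
    by (rule transpose_eqI[OF cl that]) (use that transposeD(2)[OF that] in \<open>simp_all add: transpose_simps(4)\<close>)
qed (use transposeD(2)[of _ M] in \<open>auto simp: transpose_simps(3,4) fun_eq_iff l_distr r_distr m_assoc\<close>)

lemma eval_transpose:
  "c \<in> carrier M \<Longrightarrow> (\<lambda>\<phi>. \<phi> c) \<in> lmod_hom (opp A) (transpose_module M) (regular (opp A))"
  by (rule lmod_homI) (simp_all add: transposeD(2) transpose_simps(3,4))

text \<open>Under the A-dual a dual basis exchanges its roles: the functionals become elements, and
  evaluation at the old elements gives the new functionals.\<close>

lemma transpose_expand:
  assumes M: "left_module A M" and db: "dual_basis A M n c \<phi>" and \<psi>: "\<psi> \<in> carrier (transpose_module M)"
  shows "\<psi> = msum (transpose_module M) (\<lambda>s. \<psi> (c s) \<odot>\<^bsub>transpose_module M\<^esub> restrict (\<phi> s) (carrier M)) n" (is "_ = ?s")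
proof (rule transpose_eqI[OF \<psi>])
  interpret T: left_module "opp A" "transpose_module M" by (rule left_module_transpose[OF M])
  note dbD = dual_basisD[OF db]
  have sc: "\<psi> (c s) \<odot>\<^bsub>transpose_module M\<^esub> restrict (\<phi> s) (carrier M) \<in> carrier (transpose_module M)" if "s < n" for s
    by (rule T.smult_closed) (use transposeD(2)[OF \<psi> dbD(1)[OF that]] transposeI[OF M dbD(2)[OF that]] in simp_all)
  show "?s \<in> carrier (transpose_module M)" by (rule T.M.msum_closed[OF sc])
  fix x assume x: "x \<in> carrier M"
  have "?s x = msum (regular (opp A)) (\<lambda>s. (\<psi> (c s) \<odot>\<^bsub>transpose_module M\<^esub> restrict (\<phi> s) (carrier M)) x) n"
    by (rule lmod_hom_of_msum[OF T.left_module_axioms left_module_regular[OF ring_opp[OF ring_A]] eval_transpose[OF x] sc])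
  also have "\<dots> = msum (regular (opp A)) (\<lambda>s. \<phi> s x \<otimes> \<psi> (c s)) n"
    by (rule msum_cong) (use x in \<open>simp add: transpose_simps(4)\<close>)
  also have "\<dots> = msum (regular A) (\<lambda>s. \<phi> s x \<odot>\<^bsub>regular A\<^esub> \<psi> (c s)) n"
    by (subst msum_same_ops[of "regular (opp A)" "regular A"]) simp_all
  also have "\<dots> = \<psi> x"
    using lmod_hom_dual_basis[OF M left_module_regular[OF ring_A] db transposeD(1)[OF \<psi>] x] by simp
  finally show "\<psi> x = ?s x" by simp
qed

lemma has_dual_basis_transpose:
  assumes M: "left_module A M" and "has_dual_basis A M"
  shows "has_dual_basis (opp A) (transpose_module M)"
proof -
  obtain n c \<phi> where db: "dual_basis A M n c \<phi>" using assms(2) by (auto simp: has_dual_basis_def)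
  have "dual_basis (opp A) (transpose_module M) n (\<lambda>s. restrict (\<phi> s) (carrier M)) (\<lambda>s \<psi>. \<psi> (c s))"
    unfolding dual_basis_def
    using transposeI[OF M dual_basisD(2)[OF db]] eval_transpose[OF dual_basisD(1)[OF db]] transpose_expand[OF M db]
    by simp
  then show ?thesis by (auto simp: has_dual_basis_def)
qed

text \<open>
  A cycle c gives the cocycle "evaluate at c" on the dual complex; its bounding cochain is evaluation at
  some c', because the terms are reflexive, and c' bounds c.
\<close>

lemma exact_of_dual_exact:
  fixes C :: "nat \<Rightarrow> ('a, 'm) module"
  assumes C: "\<And>i. left_module A (C i)" "\<And>i. has_dual_basis A (C i)" "\<And>i. d i \<in> lmod_hom A (C (Suc i)) (C i)"
      "\<And>i x. x \<in> carrier (C (Suc (Suc i))) \<Longrightarrow> d i (d (Suc i) x) = \<zero>\<^bsub>C i\<^esub>"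
    and van: "cohom_van A C d (regular A)"
    and fin: "inj_dim (opp A) (regular (opp A)) < \<infinity>"
  shows "a_kernel (C (Suc j)) (C j) (d j) \<subseteq> d (Suc j) ` carrier (C (Suc (Suc j)))"
proof
  fix c assume "c \<in> a_kernel (C (Suc j)) (C j) (d j)"
  then have c: "c \<in> carrier (C (Suc j))" "d j c = \<zero>\<^bsub>C j\<^esub>" by (simp_all add: a_kernel_def')
  interpret opp: algebra k "opp A" by (rule algebra_opp[OF algebra_axioms])
  have regA: "left_module A (regular A)" by (rule left_module_regular[OF ring_A])
  have regO: "left_module (opp A) (regular (opp A))" by (rule left_module_regular[OF ring_opp[OF ring_A]])
  define E where "E i = transpose_module (C i)" for i
  define \<delta> :: "nat \<Rightarrow> ('m \<Rightarrow> 'a) \<Rightarrow> 'm \<Rightarrow> 'a" where "\<delta> i \<phi> = (\<lambda>x\<in>carrier (C (Suc i)). \<phi> (d i x))" for i \<phi>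
  have dc: "d i x \<in> carrier (C i)" if "x \<in> carrier (C (Suc i))" for i x by (rule lmod_hom_closed[OF C(3) that])
  have E: "left_module (opp A) (E i)" "has_dual_basis (opp A) (E i)" for i
    unfolding E_def by (rule left_module_transpose[OF C(1)], rule has_dual_basis_transpose[OF C(1,2)])
  have \<delta>E: "\<delta> i \<phi> \<in> carrier (E (Suc i))" if "\<phi> \<in> carrier (E i)" for i \<phi>
    unfolding E_def \<delta>_def by (rule transposeI[OF C(1) lmod_hom_comp[OF C(3) transposeD(1)]]) (use that in \<open>simp add: E_def\<close>)
  have \<delta>: "\<delta> i \<in> lmod_hom (opp A) (E i) (E (Suc i))" for i
    by (rule lmod_homI[OF \<delta>E]) (auto simp: E_def \<delta>_def transpose_simps(3,4) dc fun_eq_iff)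
  have Ezero: "\<zero>\<^bsub>E i\<^esub> = (\<lambda>x\<in>carrier (C i). \<zero>)" for i by (simp add: E_def transpose_simps)
  \<comment> \<open>Exactness of the dual complex in positive degrees, which is \<open>van\<close>
    rewritten for extensional maps; its terms are projective right modules.\<close>
  have ex: "a_kernel (E (Suc i)) (E (Suc (Suc i))) (\<delta> (Suc i)) = \<delta> i ` carrier (E i)" for i
  proof
    show "\<delta> i ` carrier (E i) \<subseteq> a_kernel (E (Suc i)) (E (Suc (Suc i))) (\<delta> (Suc i))"
    proof
      fix \<psi> assume "\<psi> \<in> \<delta> i ` carrier (E i)"
      then obtain \<phi> where \<phi>: "\<phi> \<in> carrier (E i)" "\<psi> = \<delta> i \<phi>" by (rule imageE)
      have "\<phi> \<zero>\<^bsub>C i\<^esub> = \<zero>" using lmod_hom_zero[OF C(1) regA transposeD(1)] \<phi>(1) by (simp add: E_def)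
      then have "\<delta> (Suc i) \<psi> = \<zero>\<^bsub>E (Suc (Suc i))\<^esub>"
        unfolding Ezero \<phi>(2) by (auto simp: \<delta>_def fun_eq_iff dc C(4))
      then show "\<psi> \<in> a_kernel (E (Suc i)) (E (Suc (Suc i))) (\<delta> (Suc i))"
        using \<delta>E[OF \<phi>(1)] \<phi>(2) by (simp add: a_kernel_def')
    qed
    show "a_kernel (E (Suc i)) (E (Suc (Suc i))) (\<delta> (Suc i)) \<subseteq> \<delta> i ` carrier (E i)"
    proof
      fix \<psi> assume "\<psi> \<in> a_kernel (E (Suc i)) (E (Suc (Suc i))) (\<delta> (Suc i))"
      then have \<psi>: "\<psi> \<in> carrier (E (Suc i))" "\<delta> (Suc i) \<psi> = \<zero>\<^bsub>E (Suc (Suc i))\<^esub>" by (simp_all add: a_kernel_def')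
      have \<psi>h: "\<psi> \<in> lmod_hom A (C (Suc i)) (regular A)" using transposeD(1) \<psi>(1) by (simp add: E_def)
      have "\<psi> (d (Suc i) x) = \<zero>\<^bsub>regular A\<^esub>" if "x \<in> carrier (C (Suc (Suc i)))" for x
        using fun_cong[OF \<psi>(2), of x] that by (simp add: \<delta>_def Ezero)
      from cohom_vanD[OF van \<psi>h this] obtain g where g: "g \<in> lmod_hom A (C i) (regular A)"
        "\<forall>x\<in>carrier (C (Suc i)). g (d i x) = \<psi> x" by blast
      have gE: "restrict g (carrier (C i)) \<in> carrier (E i)" unfolding E_def by (rule transposeI[OF C(1) g(1)])
      have "\<psi> = \<delta> i (restrict g (carrier (C i)))"
        by (rule transpose_eqI[OF \<psi>(1)[unfolded E_def] \<delta>E[OF gE, unfolded E_def]])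
          (use g(2) dc in \<open>simp add: \<delta>_def\<close>)
      then show "\<psi> \<in> \<delta> i ` carrier (E i)" using gE by (rule image_eqI)
    qed
  qed
  have "{enat n |n. \<exists>J dJ e. injective_coresolution (opp A) (regular (opp A)) J dJ e \<and>
      (\<forall>i>n. carrier (J i) = {\<zero>\<^bsub>J i\<^esub>})} \<noteq> {}"
    using fin unfolding inj_dim_def by (metis (no_types, lifting) Inf_enat_def less_irrefl)
  then obtain n J dJ e where J: "injective_coresolution (opp A) (regular (opp A)) J dJ e"
    "\<forall>i>n. carrier (J i) = {\<zero>\<^bsub>J i\<^esub>}" by auto
  have evc: "(\<lambda>\<phi>. \<phi> c) \<in> lmod_hom (opp A) (E (Suc j)) (regular (opp A))" unfolding E_def by (rule eval_transpose[OF c(1)])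
  \<comment> \<open>Evaluation at c kills coboundaries from degree j because c is a cycle, so
    \<open>injective_chase\<close> over the opposite algebra extends it along the next
    differential.\<close>
  have "\<exists>g\<in>lmod_hom (opp A) (E (Suc (Suc j))) (regular (opp A)). \<forall>\<phi>\<in>carrier (E (Suc j)). g (\<delta> (Suc j) \<phi>) = \<phi> c"
  proof (rule opp.injective_chase[OF E \<delta> ex J regO evc])
    fix \<phi> assume "\<phi> \<in> carrier (E j)"
    then have "\<phi> \<zero>\<^bsub>C j\<^esub> = \<zero>" using lmod_hom_zero[OF C(1) regA transposeD(1)] by (simp add: E_def)
    then show "\<delta> j \<phi> c = \<zero>\<^bsub>regular (opp A)\<^esub>" using c by (simp add: \<delta>_def)
  qed
  then obtain g where g: "g \<in> lmod_hom (opp A) (E (Suc (Suc j))) (regular (opp A))"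
    "\<And>\<phi>. \<phi> \<in> carrier (E (Suc j)) \<Longrightarrow> g (\<delta> (Suc j) \<phi>) = \<phi> c" by blast
  obtain m b \<phi> where db: "dual_basis A (C (Suc (Suc j))) m b \<phi>" using C(2)[of "Suc (Suc j)"] by (auto simp: has_dual_basis_def)
  note dbD = dual_basisD[OF db]
  interpret C2: left_module A "C (Suc (Suc j))" by (rule C(1))
  interpret E2: left_module "opp A" "E (Suc (Suc j))" by (rule E(1))
  let ?r = "\<lambda>s. restrict (\<phi> s) (carrier (C (Suc (Suc j))))"
  have rE: "?r s \<in> carrier (E (Suc (Suc j)))" if "s < m" for s unfolding E_def by (rule transposeI[OF C(1) dbD(2)[OF that]])
  have gr: "g (?r s) \<in> carrier A" if "s < m" for s using lmod_hom_closed[OF g(1) rE[OF that]] by simp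
  have sc: "g (?r s) \<odot>\<^bsub>C (Suc (Suc j))\<^esub> b s \<in> carrier (C (Suc (Suc j)))" if "s < m" for s
    by (rule C2.smult_closed[OF gr[OF that] dbD(1)[OF that]])
  \<comment> \<open>The combination of the b s with coefficients the values of g on the functionals
    \<phi> s. By reflexivity g is evaluation at this element.\<close>
  define c' where "c' = msum (C (Suc (Suc j))) (\<lambda>s. g (?r s) \<odot>\<^bsub>C (Suc (Suc j))\<^esub> b s) m"
  have c': "c' \<in> carrier (C (Suc (Suc j)))" unfolding c'_def by (rule C2.M.msum_closed[OF sc])
  have gev: "g \<psi> = \<psi> c'" if \<psi>: "\<psi> \<in> carrier (E (Suc (Suc j)))" for \<psi>
  proof -
    have \<psi>h: "\<psi> \<in> lmod_hom A (C (Suc (Suc j))) (regular A)" using transposeD(1) \<psi> by (simp add: E_def)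
    have \<psi>b: "\<psi> (b s) \<in> carrier A" if "s < m" for s using lmod_hom_closed[OF \<psi>h dbD(1)[OF that]] by simp
    have sE: "\<psi> (b s) \<odot>\<^bsub>E (Suc (Suc j))\<^esub> ?r s \<in> carrier (E (Suc (Suc j)))" if "s < m" for s
      by (rule E2.smult_closed) (use \<psi>b[OF that] rE[OF that] in simp_all)
    have "g \<psi> = g (msum (E (Suc (Suc j))) (\<lambda>s. \<psi> (b s) \<odot>\<^bsub>E (Suc (Suc j))\<^esub> ?r s) m)"
      using transpose_expand[OF C(1) db \<psi>[unfolded E_def]] by (simp add: E_def)
    also have "\<dots> = msum (regular (opp A)) (\<lambda>s. g (\<psi> (b s) \<odot>\<^bsub>E (Suc (Suc j))\<^esub> ?r s)) m"
      by (rule lmod_hom_of_msum[OF E(1) regO g(1) sE])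
    also have "\<dots> = msum (regular (opp A)) (\<lambda>s. g (?r s) \<otimes> \<psi> (b s)) m"
      by (rule msum_cong) (use lmod_hom_smult[OF g(1)] \<psi>b rE in simp)
    also have "\<dots> = msum (regular A) (\<lambda>s. \<psi> (g (?r s) \<odot>\<^bsub>C (Suc (Suc j))\<^esub> b s)) m"
    proof -
      have "msum (regular (opp A)) (\<lambda>s. g (?r s) \<otimes> \<psi> (b s)) m = msum (regular A) (\<lambda>s. g (?r s) \<otimes> \<psi> (b s)) m"
        by (rule msum_same_ops) simp_all
      also have "\<dots> = msum (regular A) (\<lambda>s. \<psi> (g (?r s) \<odot>\<^bsub>C (Suc (Suc j))\<^esub> b s)) m"
        by (rule msum_cong) (use lmod_hom_smult[OF \<psi>h gr dbD(1)] in simp)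
      finally show ?thesis .
    qed
    also have "\<dots> = \<psi> c'" unfolding c'_def by (rule lmod_hom_of_msum[OF C(1) regA \<psi>h sc, symmetric])
    finally show ?thesis .
  qed
  obtain m1 b1 \<phi>1 where db1: "dual_basis A (C (Suc j)) m1 b1 \<phi>1" using C(2)[of "Suc j"] by (auto simp: has_dual_basis_def)
  \<comment> \<open>The functionals of a dual basis separate points, so agreement of all of them at
    c and at the boundary of c' makes these equal.\<close>
  have sep: "\<phi>1 s (d (Suc j) c') = \<phi>1 s c" if s: "s < m1" for s
  proof -
    let ?r1 = "restrict (\<phi>1 s) (carrier (C (Suc j)))"
    have r1: "?r1 \<in> carrier (E (Suc j))" unfolding E_def by (rule transposeI[OF C(1) dual_basisD(2)[OF db1 s]])
    have "?r1 c = \<delta> (Suc j) ?r1 c'" using g(2)[OF r1] gev[OF \<delta>E[OF r1]] by simp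
    then show ?thesis using c c' dc[OF c'] by (simp add: \<delta>_def)
  qed
  have "c = msum (C (Suc j)) (\<lambda>i. \<phi>1 i c \<odot>\<^bsub>C (Suc j)\<^esub> b1 i) m1" using dual_basisD(4)[OF db1 c(1)] by simp
  also have "\<dots> = msum (C (Suc j)) (\<lambda>i. \<phi>1 i (d (Suc j) c') \<odot>\<^bsub>C (Suc j)\<^esub> b1 i) m1"
    by (rule msum_cong) (simp add: sep)
  also have "\<dots> = d (Suc j) c'" by (rule dual_basisD(4)[OF db1 dc[OF c']])
  finally show "c \<in> d (Suc j) ` carrier (C (Suc (Suc j)))" using c' by (rule image_eqI)
qed

end

section \<open>Monic modules\<close>

context right_module_tensor
begin

lemma Cmap_comp_zero:
  assumes P: "left_module L P" "left_module L P'" "left_module L P''"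
    and f: "f \<in> lmod_hom L P P'" and g: "g \<in> lmod_hom L P' P''" and gf: "\<And>p. p \<in> carrier P \<Longrightarrow> g (f p) = \<zero>\<^bsub>P''\<^esub>"
    and c: "c \<in> carrier (C P)"
  shows "Cmap P'' g (Cmap P' f c) = \<zero>\<^bsub>C P''\<^esub>"
proof (rule C_hom_eq[OF P(1) abelian_C[OF P(3)] _ _ c, where f = "\<lambda>c. Cmap P'' g (Cmap P' f c)" and g = "\<lambda>_. \<zero>\<^bsub>C P''\<^esub>"])
  interpret T: tensor_factors L Wb P'' by (rule factors_C[OF P(3)])
  show "(\<lambda>c. Cmap P'' g (Cmap P' f c)) \<in> add_hom (C P) (C P'')"
    by (rule add_hom_comp[OF lmod_hom_add_hom[OF Cmap(2)[OF P(1,2) f]] lmod_hom_add_hom[OF Cmap(2)[OF P(2,3) g]]])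
  show "(\<lambda>_. \<zero>\<^bsub>C P''\<^esub>) \<in> add_hom (C P) (C P'')" by (simp add: add_hom_def)
  fix a v p assume avp: "a \<in> carrier A" "v \<in> carrier V" "p \<in> carrier P"
  then have w: "pV a v \<in> carrier (tensor k A bV)" by (simp add: TV.pure_closed)
  show "Cmap P'' g (Cmap P' f (q P (pV a v) p)) = \<zero>\<^bsub>C P''\<^esub>"
    using Cmap(1)[OF P(1,2) f w avp(3)] Cmap(1)[OF P(2,3) g w lmod_hom_closed[OF f avp(3)]] gf[OF avp(3)]
      T.pure_zero_right[of "pV a v"] w by simp
qed

text \<open>The complex in \<open>Tor\<close> and the complex of the C P have the same additive
  groups and the same differentials; C merely adds the action of A.\<close>

lemma Tor_trivial_iff:
  fixes P :: "nat \<Rightarrow> (('a \<times> 'b \<Rightarrow>\<^sub>0 int) set, 'k univ) module"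
  assumes X: "fg_left_module L X" and ch: "chosen_resolution L X = (P, d)"
  shows "(\<forall>i\<ge>1. trivial_group (Tor L Wb X i)) \<longleftrightarrow>
    (\<forall>j. a_kernel (C (P (Suc j))) (C (P j)) (Cmap (P j) (d j)) \<subseteq>
      Cmap (P (Suc j)) (d (Suc j)) ` carrier (C (P (Suc (Suc j)))))"
proof -
  obtain e where "resolution L X P d e" using L.chosen_resolution[OF X ch] ..
  note PD = resolutionD[OF this]
  let ?T = "\<lambda>j. tensor L Wb (P j)"
  have ab: "abelian_group (?T j)" for j by (rule tensor_factors.abelian_T[OF factors_C[OF PD(2)]])
  have h: "Cmap (P j) (d j) \<in> add_hom (?T (Suc j)) (?T j)" for j
    using lmod_hom_add_hom[OF Cmap(2)[OF PD(2) PD(2) PD(4)], of j] by (simp add: add_hom_C)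
  have step: "trivial_group (Tor L Wb X (Suc j)) \<longleftrightarrow> a_kernel (C (P (Suc j))) (C (P j)) (Cmap (P j) (d j)) \<subseteq>
      Cmap (P (Suc j)) (d (Suc j)) ` carrier (C (P (Suc (Suc j))))" for j
  proof -
    have "trivial_group (Tor L Wb X (Suc j)) \<longleftrightarrow>
      trivial_group ((?T (Suc j))\<lparr>carrier := a_kernel (?T (Suc j)) (?T j) (Cmap (P j) (d j))\<rparr> A_Mod
        (Cmap (P (Suc j)) (d (Suc j)) ` carrier (?T (Suc (Suc j)))))"
      by (simp add: Tor_def ch Let_def Cmap_def)
    also have "\<dots> \<longleftrightarrow> a_kernel (?T (Suc j)) (?T j) (Cmap (P j) (d j)) \<subseteq>
        Cmap (P (Suc j)) (d (Suc j)) ` carrier (?T (Suc (Suc j)))"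
      by (rule trivial_homology_iff[OF ab ab ab h h])
        (use Cmap_comp_zero[OF PD(2) PD(2) PD(2) PD(4) PD(4)] PD(10) in simp)
    finally show ?thesis by (simp add: a_kernel_def')
  qed
  have "(\<forall>i\<ge>1. trivial_group (Tor L Wb X i)) \<longleftrightarrow> (\<forall>j. trivial_group (Tor L Wb X (Suc j)))"
    by (metis One_nat_def Suc_le_D le_add1 plus_1_eq_Suc)
  then show ?thesis unfolding step .
qed

end

context paired_modules
begin

text \<open>Right exactness accounts for the augmentation and degree zero, the hypothesis for higher
  degrees; the dual bases come from the pairing.\<close>

lemma resolution_C:
  assumes res: "resolution L X P d e"
    and ex: "\<And>j. a_kernel (C (P (Suc j))) (C (P j)) (Cmap (P j) (d j)) \<subseteq>
      Cmap (P (Suc j)) (d (Suc j)) ` carrier (C (P (Suc (Suc j))))"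
  shows "resolution A (C X) (\<lambda>i. C (P i)) (\<lambda>i. Cmap (P i) (d i)) (Cmap X e)"
  unfolding resolution_def
proof (intro conjI allI)
  note PD = resolutionD[OF res]
  note dm = Cmap(2)[OF PD(2) PD(2) PD(4)]
  show "left_module A (C X)" by (rule left_module_C[OF PD(1)])
  show "left_module A (C (P i))" "has_dual_basis A (C (P i))" for i
    by (rule left_module_C[OF PD(2)], rule has_dual_basis_C[OF PD(2,3)])
  show "Cmap (P i) (d i) \<in> lmod_hom A (C (P (Suc i))) (C (P i))" for i by (rule dm)
  show "Cmap X e \<in> lmod_hom A (C (P 0)) (C X)" by (rule Cmap(2)[OF PD(2) PD(1) PD(5)])
  show "Cmap X e ` carrier (C (P 0)) = carrier (C X)" by (rule Cmap_surj[OF PD(2) PD(1) PD(5,6)])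
  show "Cmap (P 0) (d 0) ` carrier (C (P (Suc 0))) = a_kernel (C (P 0)) (C X) (Cmap X e)"
    by (rule Cmap_exact[OF PD(2) PD(2) PD(1) PD(4) PD(5,6,7)])
  show "Cmap (P (Suc i)) (d (Suc i)) ` carrier (C (P (Suc (Suc i)))) =
    a_kernel (C (P (Suc i))) (C (P i)) (Cmap (P i) (d i))" for i
  proof (rule subset_antisym[OF _ ex])
    show "Cmap (P (Suc i)) (d (Suc i)) ` carrier (C (P (Suc (Suc i)))) \<subseteq>
      a_kernel (C (P (Suc i))) (C (P i)) (Cmap (P i) (d i))"
    proof (rule image_subsetI)
      fix c assume c: "c \<in> carrier (C (P (Suc (Suc i))))"
      have "Cmap (P i) (d i) (Cmap (P (Suc i)) (d (Suc i)) c) = \<zero>\<^bsub>C (P i)\<^esub>"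
        by (rule Cmap_comp_zero[OF PD(2) PD(2) PD(2) PD(4) PD(4) _ c]) (rule PD(10))
      then show "Cmap (P (Suc i)) (d (Suc i)) c \<in> a_kernel (C (P (Suc i))) (C (P i)) (Cmap (P i) (d i))"
        using lmod_hom_closed[OF dm c] by (simp add: a_kernel_def')
    qed
  qed
qed

text \<open>Ext of C X is attached to its own chosen resolution. \<open>cohom_van_resolution\<close>
  replaces that by the complex of the C P, where the adjunction applies.\<close>

lemma perp_C_iff:
  assumes X: "fg_left_module L X" and ch: "chosen_resolution L X = (P, d)"
    and tor: "\<forall>i\<ge>1. trivial_group (Tor L Wb X i)"
  shows "C X \<in> perp A (regular A) \<longleftrightarrow> cohom_van L P d (ind W)"
proof -
  obtain e where res: "resolution L X P d e" using L.chosen_resolution[OF X ch] ..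
  note PD = resolutionD[OF res]
  have regA: "left_module A (regular A)" by (rule left_module_regular[OF A.ring_A])
  have resC: "resolution A (C X) (\<lambda>i. C (P i)) (\<lambda>i. Cmap (P i) (d i)) (Cmap X e)"
    by (rule resolution_C[OF res]) (use tor Tor_trivial_iff[OF X ch] in blast)
  note CD = resolutionD[OF resC]
  \<comment> \<open>\<open>perp\<close> asks for finite generation; C X inherits it as a quotient of
    C (P 0).\<close>
  have "fin_gen A (C X)"
    by (rule fin_gen_image[OF CD(2)[of 0] CD(1) CD(5,6) has_dual_basis_fin_gen[OF CD(2,3)]])
  then have fg: "fg_left_module A (C X)" using CD(1) by (simp add: fg_left_module_def)
  obtain Q d' where ch': "chosen_resolution A (C X) = (Q, d')" by (cases "chosen_resolution A (C X)")
  obtain e' where res': "resolution A (C X) Q d' e'" using A.chosen_resolution[OF fg ch'] ..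
  have "C X \<in> perp A (regular A) \<longleftrightarrow> cohom_van A Q d' (regular A)"
    using A.Ext_trivial_iff[OF fg ch' regA] fg by (simp add: perp_def)
  also have "\<dots> \<longleftrightarrow> cohom_van A (\<lambda>i. C (P i)) (\<lambda>i. Cmap (P i) (d i)) (regular A)"
    using cohom_van_resolution[OF res' resC regA] cohom_van_resolution[OF resC res' regA] by blast
  also have "\<dots> \<longleftrightarrow> cohom_van L P d (ind W)" by (rule cohom_van_C_iff[where P = P and d = d, OF PD(2) PD(4)])
  finally show ?thesis .
qed

text \<open>The adjunction turns vanishing at \<open>ind W\<close> into exactness of the A-dual of
  the complex C P, and \<open>exact_of_dual_exact\<close> carries exactness back to C P.\<close>

lemma Tor_trivial:
  assumes X: "fg_left_module L X" and ch: "chosen_resolution L X = (P, d)"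
    and van: "cohom_van L P d (ind W)" and fin: "inj_dim (opp A) (regular (opp A)) < \<infinity>"
  shows "\<forall>i\<ge>1. trivial_group (Tor L Wb X i)"
proof -
  obtain e where res: "resolution L X P d e" using L.chosen_resolution[OF X ch] ..
  note PD = resolutionD[OF res]
  have van': "cohom_van A (\<lambda>i. C (P i)) (\<lambda>i. Cmap (P i) (d i)) (regular A)"
    using van cohom_van_C_iff[where P = P and d = d, OF PD(2) PD(4)] by blast
  have zero: "Cmap (P i) (d i) (Cmap (P (Suc i)) (d (Suc i)) c) = \<zero>\<^bsub>C (P i)\<^esub>"
    if "c \<in> carrier (C (P (Suc (Suc i))))" for i c
    by (rule Cmap_comp_zero[OF PD(2) PD(2) PD(2) PD(4) PD(4) _ that]) (rule PD(10))
  have "a_kernel (C (P (Suc j))) (C (P j)) (Cmap (P j) (d j)) \<subseteq>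
      Cmap (P (Suc j)) (d (Suc j)) ` carrier (C (P (Suc (Suc j))))" for j
    by (rule A.exact_of_dual_exact[where C = "\<lambda>i. C (P i)" and d = "\<lambda>i. Cmap (P i) (d i)",
          OF left_module_C[OF PD(2)] has_dual_basis_C[OF PD(2,3)] Cmap(2)[OF PD(2) PD(2) PD(4)] zero van' fin])
  then show ?thesis using Tor_trivial_iff[OF X ch] by blast
qed

end

section \<open>From dual pairs (V, W) to monic and perpendicular modules\<close>

context two_algebras
begin

lemma cohom_van_ind_regular: "cohom_van L P d (ind (regular B)) \<longleftrightarrow> cohom_van L P d (regular L)"
  unfolding cohom_van_def lmod_hom_ind_regular ind_regular(4) ..

text \<open>The dual is taken over the opposite of B, and the opposite of the opposite is B
  again.\<close>

lemma ex_paired_left: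
  fixes V :: "('b, 'k univ) module"
  assumes "fg_right_module B V"
  shows "\<exists>(W :: ('b, 'k univ) module) pr n v w. fg_left_module B W \<and> paired_modules k A B V W pr n v w"
proof -
  interpret O: algebra k "opp B" by (rule algebra_opp[OF B.algebra_axioms])
  obtain W :: "('b, 'k univ) module" and pr n v w
    where W: "fg_left_module (opp (opp B)) W" "perfect_pairing k (opp B) V W pr n v w"
    using O.ex_perfect_pairing[OF assms] by blast
  have "paired_modules k A B V W pr n v w"
    using assms W two_algebras_axioms
    by (simp add: paired_modules_def paired_modules_axioms_def right_module_tensor_def
        right_module_tensor_axioms_def fg_left_module_def opp_opp perfect_pairing_opp)
  then show ?thesis using W(1) unfolding opp_opp by blast
qed

text \<open>The dual is built with B as the first argument of the pairing, which is then flipped so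
  that the right module comes first.\<close>

lemma ex_paired_regular:
  "\<exists>(V :: ('b, 'k univ) module) pr n v w. fg_right_module B V \<and> paired_modules k A B V (regular B) pr n v w"
proof -
  have reg: "left_module B (regular B)" by (rule left_module_regular[OF B.ring_A])
  then have "fg_left_module B (regular B)"
    using has_dual_basis_fin_gen[OF reg has_dual_basis_regular[OF B.ring_A]] by (simp add: fg_left_module_def)
  from B.ex_perfect_pairing[OF this] obtain V :: "('b, 'k univ) module" and pr n w v
    where V: "fg_left_module (opp B) V" "perfect_pairing k B (regular B) V pr n w v" by blast
  have "paired_modules k A B V (regular B) (\<lambda>y x. pr x y) n v w"
    using V(1) perfect_pairing_flip[OF V(2)] reg two_algebras_axioms
    by (simp add: paired_modules_def paired_modules_axioms_def right_module_tensor_def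
        right_module_tensor_axioms_def fg_left_module_def)
  then show ?thesis using V(1) by blast
qed

lemma perp_L_iff:
  assumes "fg_left_module L X" "chosen_resolution L X = (P, d)"
  shows "X \<in> perp L (regular L) \<longleftrightarrow> cohom_van L P d (regular L)"
  using L.Ext_trivial_iff[OF assms left_module_regular[OF ring_L]] assms(1) by (simp add: perp_def)

text \<open>Finite global dimension enters here: it provides the finite projective resolution of W
  that \<open>cohom_van_ind\<close> shifts along.\<close>

lemma cohom_van_ind_fg:
  fixes W :: "('b, 'k univ) module"
  assumes "fg_left_module L X" "chosen_resolution L X = (P, d)" "cohom_van L P d (regular L)"
    "gl_dim B < \<infinity>" "fg_left_module B W"
  shows "cohom_van L P d (ind W)"
proof -
  obtain e where "resolution L X P d e" using L.chosen_resolution[OF assms(1,2)] ..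
  note PD = resolutionD[OF this]
  obtain Q :: "nat \<Rightarrow> ('b, 'k univ) module" and \<delta> \<epsilon> n
    where Q: "resolution B W Q \<delta> \<epsilon>" "\<forall>i>n::nat. carrier (Q i) = {\<zero>\<^bsub>Q i\<^esub>}"
    using B.proj_dim_finite[OF assms(4,5)] by blast
  show ?thesis by (rule cohom_van_ind[OF PD(2,3,4,10) assms(3) Q])
qed

text \<open>For monic X both memberships are statements on one resolution P of X: vanishing with
  values in \<open>ind W\<close> for the dual W of every V, and vanishing with values in
  \<open>regular L\<close>.\<close>

lemma mon_in_perp:
  assumes "gl_dim B < \<infinity>"
  shows "mon_in k B A (perp A (regular A)) = mon k B A \<inter> perp L (regular L)"
proof (intro subset_antisym subsetI)
  fix X assume "X \<in> mon_in k B A (perp A (regular A))"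
  then have X: "X \<in> mon k B A" and XV: "\<And>V :: ('b, 'k univ) module. fg_right_module B V \<Longrightarrow>
      bimodule_tensor L (tensor_bimodule k A B V) X \<in> perp A (regular A)" by (auto simp: mon_in_def)
  have fg: "fg_left_module L X" using X by (simp add: mon_def)
  obtain P d where ch: "chosen_resolution L X = (P, d)" by (cases "chosen_resolution L X")
  \<comment> \<open>V is the dual of B, which makes the condition at this single V the vanishing of
    Ext into \<open>L\<close>.\<close>
  obtain V :: "('b, 'k univ) module" and pr n v w
    where V: "fg_right_module B V" "paired_modules k A B V (regular B) pr n v w"
    using ex_paired_regular by blast
  interpret paired_modules k A B V "regular B" pr n v w by (rule V(2))
  have "\<forall>i\<ge>1. trivial_group (Tor L Wb X i)" using X V(1) by (simp add: mon_def)
  then have "cohom_van L P d (ind (regular B))" using perp_C_iff[OF fg ch] XV[OF V(1)] by simp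
  then have "cohom_van L P d (regular L)" by (rule iffD1[OF cohom_van_ind_regular])
  then have "X \<in> perp L (regular L)" using perp_L_iff[OF fg ch] by simp
  then show "X \<in> mon k B A \<inter> perp L (regular L)" using X by simp
next
  fix X assume "X \<in> mon k B A \<inter> perp L (regular L)"
  then have X: "X \<in> mon k B A" "X \<in> perp L (regular L)" by auto
  have fg: "fg_left_module L X" using X(1) by (simp add: mon_def)
  obtain P d where ch: "chosen_resolution L X = (P, d)" by (cases "chosen_resolution L X")
  have van: "cohom_van L P d (regular L)" using X(2) perp_L_iff[OF fg ch] by simp
  have "bimodule_tensor L (tensor_bimodule k A B V) X \<in> perp A (regular A)"
    if V: "fg_right_module B V" for V :: "('b, 'k univ) module"
  proof -
    obtain W :: "('b, 'k univ) module" and pr n v w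
      where W: "fg_left_module B W" "paired_modules k A B V W pr n v w"
      using ex_paired_left[OF V] by blast
    interpret paired_modules k A B V W pr n v w by (rule W(2))
    have "\<forall>i\<ge>1. trivial_group (Tor L Wb X i)" using X(1) V by (simp add: mon_def)
    then show ?thesis using perp_C_iff[OF fg ch] cohom_van_ind_fg[OF fg ch van assms W(1)] by simp
  qed
  then show "X \<in> mon_in k B A (perp A (regular A))" using X(1) by (simp add: mon_in_def)
qed

text \<open>Together with \<open>mon_in_perp\<close> this gives the second claim. Monicity at V
  comes from vanishing at A \<otimes> W for the dual W of V, so vanishing at \<open>L\<close> is
  first spread to all W.\<close>

lemma perp_subset_mon:
  assumes "gl_dim B < \<infinity>" "inj_dim (opp A) (regular (opp A)) < \<infinity>"
  shows "perp L (regular L) \<subseteq> mon k B A"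
proof
  fix X assume X: "X \<in> perp L (regular L)"
  have fg: "fg_left_module L X" using X by (simp add: perp_def)
  obtain P d where ch: "chosen_resolution L X = (P, d)" by (cases "chosen_resolution L X")
  have van: "cohom_van L P d (regular L)" using X perp_L_iff[OF fg ch] by simp
  have "\<forall>i\<ge>1. trivial_group (Tor L (tensor_bimodule k A B V) X i)"
    if V: "fg_right_module B V" for V :: "('b, 'k univ) module"
  proof -
    obtain W :: "('b, 'k univ) module" and pr n v w
      where W: "fg_left_module B W" "paired_modules k A B V W pr n v w"
      using ex_paired_left[OF V] by blast
    interpret paired_modules k A B V W pr n v w by (rule W(2))
    show ?thesis by (rule Tor_trivial[OF fg ch cohom_van_ind_fg[OF fg ch van assms(1) W(1)] assms(2)])
  qed
  then show "X \<in> mon k B A" using fg by (simp add: mon_def)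
qed

end

theorem theorem1p1:
  fixes k :: "'k ring" and A :: "('k, 'a) module" and B :: "('k, 'b) module"
  assumes "fd_algebra k A" and "fd_algebra k B" and "gl_dim B < \<infinity>"
  shows "(mon_in k B A (perp A (regular A)) :: (('a \<times> 'b \<Rightarrow>\<^sub>0 int) set, 'x) module set) =
           mon k B A \<inter> perp (tensor_algebra k A B) (regular (tensor_algebra k A B)) \<and>
         (inj_dim (opp A) (regular (opp A)) < \<infinity> \<longrightarrow>
           (perp (tensor_algebra k A B) (regular (tensor_algebra k A B))
              :: (('a \<times> 'b \<Rightarrow>\<^sub>0 int) set, 'x) module set) =
           mon_in k B A (perp A (regular A)))"
proof -
  interpret two_algebras k A B
    using assms(1,2) by (simp add: two_algebras_def algebra_def)
  show ?thesis using mon_in_perp[OF assms(3)] perp_subset_mon[OF assms(3)] by blast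
qed

end
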